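(* Let $K,E\subseteq\mathbb{R}^n$ be convex bodies with nonempty interior, let $0\le i<j<n$ be integers, and suppose that $K$ belongs to the class $\mathcal{R}_{j-1}$ (with respect to $E$). Let $K_\lambda$ denote the parallel bodies of $K$ relative to $E$. Then the function $$\mathrm{I}_{i,j}(\lambda)=\frac{\mathrm{W}_j(K_\lambda;E)^{n-i}}{\mathrm{W}_i(K_\lambda;E)^{n-j}}$$ is monotonically decreasing on $(-\mathrm{r}(K;E),\infty)$. Moreover, if $E$ is smooth, the following are equivalent for all $-\mathrm{r}(K;E)<\lambda_0<\lambda_1<\infty$: (i) $\mathrm{I}_{i,j}(\lambda_0)=\mathrm{I}_{i,j}(\lambda_1)$; (ii) $K_{\lambda_0}$ is homothetic to $K_{\lambda_1}$; (iii) $K_{\lambda_1}$ is homothetic to an $(n-j)$-tangential body of $E$; (iv) $\mathrm{I}_{i,j}(\lambda)$ is constant on $(-\mathrm{r}(K;E),\lambda_1]$. If $E$ is smooth and $\lambda_1>0$, conditions (i)-(iv) are satisfied if and only if $K$ is homothetic to $E$ and, consequently, if and only if $\mathrm{I}_{i,j}(\lambda)=\mathrm{vol}(E)^{j-i}$ for all $\lambda\in(-\mathrm{r}(K;E),\infty)$.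
   Context: A convex body is a nonempty compact convex subset of $\mathbb{R}^n$; $\mathrm{vol}$ is $n$-dimensional Lebesgue measure; $h_K(u)=\sup\{\langle x,u\rangle:x\in K\}$ is the support function. The inradius of $K$ relative to $E$ is $\mathrm{r}(K;E)=\sup\{r\ge 0:\text{there is }x\in\mathbb{R}^n\text{ with }x+rE\subseteq K\}$. The parallel bodies of $K$ relative to $E$ are $K_\lambda=\{x\in\mathbb{R}^n: x+|\lambda|E\subseteq K\}$ for $-\mathrm{r}(K;E)\le\lambda\le 0$ and $K_\lambda=K+\lambda E$ (Minkowski sum) for $\lambda\ge 0$. The relative quermassintegrals $\mathrm{W}_i(K;E)$ are the coefficients in the relative Steiner formula $\mathrm{vol}(K+\lambda E)=\sum_{i=0}^n\binom{n}{i}\mathrm{W}_i(K;E)\lambda^i$, $\lambda\ge 0$. Write $\mathrm{W}_i(\lambda)=\mathrm{W}_i(K_\lambda;E)$. Class $\mathcal{R}_p$: for a fixed convex body $E$ with nonempty interior and an integer $0\le p\le n-1$, a convex body $K$ belongs to $\mathcal{R}_p$ if for all $0\le i\le p$ and all $-\mathrm{r}(K;E)\le\lambda<\infty$ the left and right derivatives exist and satisfy $\frac{\mathrm{d}^-}{\mathrm{d}\lambda}\mathrm{W}_i(\lambda)=\frac{\mathrm{d}^+}{\mathrm{d}\lambda}\mathrm{W}_i(\lambda)=(n-i)\mathrm{W}_{i+1}(\lambda)$, where the condition on the left derivative is dropped for $\lambda=-\mathrm{r}(K;E)$. A convex body is smooth if it has only one supporting hyperplane at every point of its boundary. Two convex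 bodies $K,L$ are homothetic if $L=\alpha K+x$ for some $\alpha>0$ and $x\in\mathbb{R}^n$. $p$-tangential bodies: for a convex body $L$ with nonempty interior and $p\in\{0,\dots,n-1\}$, a supporting hyperplane $\{x:\langle x,u\rangle=h_L(u)\}$ of $L$ is called $(n-p-1)$-extreme if its outer normal vector $u\in\mathbb{R}^n\setminus\{0\}$ cannot be represented as a sum of $n-p+1$ linearly independent outer normal vectors of $L$ at one and the same boundary point of $L$. If $E\subseteq L$, then $L$ is a $p$-tangential body of $E$ if each $(n-p-1)$-extreme supporting hyperplane of $L$ is a supporting hyperplane of $E$. "Monotonically decreasing" is meant in the weak sense (non-increasing). *)

theory Defs
  imports "HOL-Analysis.Analysis"
begin

definition convex_body :: "'a::euclidean_space set \<Rightarrow> bool" where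
  "convex_body K \<longleftrightarrow> K \<noteq> {} \<and> compact K \<and> convex K"

definition support_function :: "'a::euclidean_space set \<Rightarrow> 'a \<Rightarrow> real" where
  "support_function K u = (SUP x\<in>K. x \<bullet> u)"

definition homothetic :: "'a::euclidean_space set \<Rightarrow> 'a set \<Rightarrow> bool" where
  "homothetic K L \<longleftrightarrow> (\<exists>\<alpha>>0. \<exists>x. L = (\<lambda>y. \<alpha> *\<^sub>R y + x) ` K)"

definition inradius :: "'a::euclidean_space set \<Rightarrow> 'a set \<Rightarrow> real" where
  "inradius K E = Sup {r. 0 \<le> r \<and> (\<exists>x. (\<lambda>y. x + r *\<^sub>R y) ` E \<subseteq> K)}"

text \<open>Only meaningful for \<open>- inradius K E \<le> t\<close>. The \<open>+\<close> on sets is the Minkowski sum.\<close>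

definition parallel_body :: "'a::euclidean_space set \<Rightarrow> 'a set \<Rightarrow> real \<Rightarrow> 'a set" where
  "parallel_body K E t =
     (if t \<le> 0 then {x. (\<lambda>y. x + \<bar>t\<bar> *\<^sub>R y) ` E \<subseteq> K}
      else K + (*\<^sub>R) t ` E)"

text \<open>
  The coefficient family \<open>W\<close> of the relative Steiner formula, padded with zeros beyond the dimension.
  A family as required below is unique (lemma \<open>steiner_coefficients_unique\<close>) and, for convex bodies
  \<open>K\<close> and \<open>E\<close>, it exists by Minkowski's theorem on the volume of Minkowski sums, so the
  description operator is well defined there.
\<close>

definition steiner_coefficients ::
    "'a::euclidean_space set \<Rightarrow> 'a set \<Rightarrow> (nat \<Rightarrow> real) \<Rightarrow> bool" where
  "steiner_coefficients K E W \<longleftrightarrow>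
     (\<forall>t\<ge>0. measure lebesgue (K + (*\<^sub>R) t ` E) =
        (\<Sum>i=0..DIM('a). real (DIM('a) choose i) * W i * t ^ i)) \<and>
     (\<forall>i>DIM('a). W i = 0)"

definition quermassintegral :: "nat \<Rightarrow> 'a::euclidean_space set \<Rightarrow> 'a set \<Rightarrow> real" where
  "quermassintegral i K E = (THE W. steiner_coefficients K E W) i"

lemma steiner_coefficients_unique:
  fixes K E :: "'a::euclidean_space set"
  assumes V: "steiner_coefficients K E V" and W: "steiner_coefficients K E W"
  shows "V = W"
proof
  fix i
  let ?c = "\<lambda>i. real (DIM('a) choose i) * (V i - W i)"
  have "(\<Sum>i\<le>DIM('a). ?c i * x ^ i) = 0" if "x \<ge> 0" for x :: real
    using that V W
    by (simp add: steiner_coefficients_def atLeast0AtMost algebra_simps sum_subtractf)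
  then have "{0..} \<subseteq> {x::real. (\<Sum>i\<le>DIM('a). ?c i * x ^ i) = 0}"
    by auto
  then have "infinite {x::real. (\<Sum>i\<le>DIM('a). ?c i * x ^ i) = 0}"
    using infinite_Ici infinite_super by blast
  then have *: "\<forall>i\<le>DIM('a). ?c i = 0"
    using polyfun_finite_roots[of ?c "DIM('a)"] by auto
  show "V i = W i"
  proof (cases "i \<le> DIM('a)")
    case True
    then show ?thesis using * by force
  next
    case False
    then show ?thesis using V W by (simp add: steiner_coefficients_def)
  qed
qed

text \<open>
  The second conjunct below drops the left derivative at \<open>t = - inradius K E\<close>.
\<close>

definition class_R :: "nat \<Rightarrow> 'a::euclidean_space set \<Rightarrow> 'a set \<Rightarrow> bool" where
  "class_R p E K \<longleftrightarrow>
     convex_body E \<and> interior E \<noteq> {} \<and> p < DIM('a) \<and> convex_body K \<and>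
     (\<forall>i\<le>p. \<forall>t\<ge>- inradius K E.
        ((\<lambda>s. quermassintegral i (parallel_body K E s) E) has_real_derivative
           real (DIM('a) - i) * quermassintegral (i + 1) (parallel_body K E t) E) (at_right t) \<and>
        (t \<noteq> - inradius K E \<longrightarrow>
         ((\<lambda>s. quermassintegral i (parallel_body K E s) E) has_real_derivative
           real (DIM('a) - i) * quermassintegral (i + 1) (parallel_body K E t) E) (at_left t)))"

definition supporting_hyperplane :: "'a::euclidean_space set \<Rightarrow> 'a set \<Rightarrow> bool" where
  "supporting_hyperplane K H \<longleftrightarrow> (\<exists>u. u \<noteq> 0 \<and> H = {x. x \<bullet> u = support_function K u})"

definition smooth_body :: "'a::euclidean_space set \<Rightarrow> bool" where
  "smooth_body K \<longleftrightarrow> (\<forall>x\<in>frontier K. \<exists>!H. supporting_hyperplane K H \<and> x \<in> H)"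

definition outer_normals :: "'a::euclidean_space set \<Rightarrow> 'a \<Rightarrow> 'a set" where
  "outer_normals L x = {u. u \<noteq> 0 \<and> x \<bullet> u = support_function L u}"

text \<open>
  The hyperplane supporting \<open>L\<close> with outer normal vector \<open>u\<close> is \<open>r\<close>-extreme; with \<open>r = n - p - 1\<close>
  the number of summands is \<open>r + 2 = n - p + 1\<close>. Linearly independent vectors are distinct, so
  they may be collected in a set.
\<close>

definition extreme_normal :: "nat \<Rightarrow> 'a::euclidean_space set \<Rightarrow> 'a \<Rightarrow> bool" where
  "extreme_normal r L u \<longleftrightarrow> u \<noteq> 0 \<and>
     \<not> (\<exists>x\<in>frontier L. \<exists>S. S \<subseteq> outer_normals L x \<and> independent S \<and> card S = r + 2 \<and> u = \<Sum>S)"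

definition tangential_body :: "nat \<Rightarrow> 'a::euclidean_space set \<Rightarrow> 'a set \<Rightarrow> bool" where
  "tangential_body p E L \<longleftrightarrow>
     p < DIM('a) \<and> convex_body L \<and> interior L \<noteq> {} \<and> E \<subseteq> L \<and>
     (\<forall>u. extreme_normal (DIM('a) - p - 1) L u \<longrightarrow>
        supporting_hyperplane E {x. x \<bullet> u = support_function L u})"

definition I_quot :: "nat \<Rightarrow> nat \<Rightarrow> 'a::euclidean_space set \<Rightarrow> 'a set \<Rightarrow> real \<Rightarrow> real" where
  "I_quot i j K E t =
     quermassintegral j (parallel_body K E t) E ^ (DIM('a) - i) /
     quermassintegral i (parallel_body K E t) E ^ (DIM('a) - j)"

end

theory Submission
 imports Defs "HOL-Library.Function_Algebras"
begin

text \<open>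
 Set \<open>g\<^sub>k(t) = W\<^sub>k(K\<^sub>t)\<^bsup>1/(n-k)\<^esup>\<close>. The class condition \<open>W\<^sub>k' = (n - k) W\<^bsub>k+1\<^esub>\<close> gives \<open>I\<^bsub>k,k+1\<^esub> = (g\<^sub>k')\<^bsup>n-k\<^esup>\<close>, and \<open>g\<^sub>k\<close> is
 concave by the general Brunn-Minkowski inequality and the concavity of \<open>t \<mapsto> K\<^sub>t\<close>; \<open>I\<^bsub>i,j\<^esub>\<close> is a product
 of powers of such quotients.

 The general Brunn-Minkowski inequality follows from the Alexandrov-Fenchel inequality. The latter is proved for
 simple strongly isomorphic polytopes by a Bochner-type induction over the faces (in the manner of Shenfeld and
 van Handel), with the mixed volume form obtained from iterated differences of the volume, and then by approximation.

 Equality forces a difference of support functions into the kernel of the Alexandrov-Fenchel form. A smooth \<open>E\<close> can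
 be replaced there by an arbitrary body, because every body is to first order a summand of \<open>E\<close>; testing with
 simplices then yields homothety. If \<open>W\<^sub>0 = \<dots> = W\<^sub>j\<close> for \<open>E \<subseteq> L\<close>, the same replacement by bodies in a
 subspace shows that \<open>E\<close> and \<open>L\<close> share the required extreme supporting hyperplanes, since a body loses volume to first
 order wherever it is strictly indented. Conversely, the inner parallel bodies of a tangential body of \<open>E\<close> are
 homothetic to it.
\<close>

text \<open>Minkowski sums admit no subtraction of bodies, but differences of volumes always make
  sense. On polytopes with one common simple fan they equal a constant times the product of the
  steps, so multilinearity is read off there and survives limits.

  A continuation argument is forced by the Bochner inequality, which is the Alexandrov-Fenchel
  inequality on the facets: it excludes eigenvalues strictly between 0 and 1 but leaves open how
  many are at least 1. The other arguments are therefore deformed to equal bodies, where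
  log-concavity of face volumes decides, and both truth and failure of the claim are closed
  conditions along the way.

  In W_i a number i of slots is occupied by E, so equality in Brunn-Minkowski gives information
  against E only. The principle that frees these slots one by one is that a nonnegative additive
  functional of bodies vanishing at a smooth body vanishes at all bodies.

  For tangential bodies a single normal is isolated by adding to E and L a flat body of dimension
  below j: mixed volumes with j or more copies of it vanish, the others agree.\<close>

abbreviation vol :: "'a::euclidean_space set => real" where
 "vol \<equiv> measure lebesgue"

notation scaleR (infixr \<open>*R\<close> 75)

abbreviation dilate :: "real => 'a::real_vector set => 'a set" (infixr \<open>\<odot>\<close> 75) where
 "t \<odot> X \<equiv> (*R) t ` X"

section \<open>The Brunn-Minkowski inequality\<close>

text \<open>The indicators converge off the hyperplane \<open>x \<bullet> u = t\<close>, a null set,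
  so dominated convergence applies. Continuity feeds the intermediate value theorem when a set must
  be cut in a prescribed volume ratio.\<close>

lemma hyperplane_slice_continuous:
 fixes S :: "'a::euclidean_space set"
 assumes S: "S \<in> lmeasurable" and u: "u ~= 0"
 shows "continuous_on UNIV (%t. vol (S \<inter> {x. x \<bullet> u < t}))"
proof -
 have "isCont (%t. vol (S \<inter> {x. x \<bullet> u < t})) t" for t
  unfolding continuous_at_sequentially
 proof (intro allI impI)
  fix X assume X: "X \<longlonglongrightarrow> t"
  let ?A = "%t. S \<inter> {x. x \<bullet> u < t}"
  have meas: "{x. x \<bullet> u < s} \<in> sets lebesgue" for s
   using open_halfspace_component_lt open_halfspace_lt[of u s] by (simp add: inner_commute borel_open sets_completionI_sets)
  have A: "?A s \<in> lmeasurable" for s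
   by (intro fmeasurable_Int_fmeasurable S meas)
  have N: "negligible {x. x \<bullet> u = t}"
   using negligible_hyperplane[of u t] u by (simp add: inner_commute)
  have ind: "vol (?A s) = (\<integral>x. indicator (?A s) x \<partial>lebesgue)" for s
   by (simp add: A fmeasurableD)
  have "(%n. \<integral>x. indicat_real (?A (X n)) x \<partial>lebesgue) \<longlonglongrightarrow> (\<integral>x. indicat_real (?A t) x \<partial>lebesgue)"
  proof (rule integral_dominated_convergence[where w = "indicator S"])
   have "AE x in lebesgue. x \<notin> {x. x \<bullet> u = t}"
    using N negligible_iff_null_sets AE_not_in by blast
   thus "AE x in lebesgue. (%n. indicat_real (?A (X n)) x) \<longlonglongrightarrow> indicat_real (?A t) x"
   proof (rule AE_mp, intro AE_I2 impI)
    fix x assume "x \<notin> {x. x \<bullet> u = t}"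
    then consider "x \<bullet> u < t" | "x \<bullet> u > t" by force
    hence "\<forall>\<^sub>F n in sequentially. indicat_real (?A (X n)) x = indicat_real (?A t) x"
    proof cases
     case 1
     hence "\<forall>\<^sub>F n in sequentially. x \<bullet> u < X n"
      using X order_tendstoD(1) by blast
     thus ?thesis by eventually_elim (use 1 in \<open>auto simp: indicator_def\<close>)
    next
     case 2
     hence "\<forall>\<^sub>F n in sequentially. x \<bullet> u > X n"
      using X order_tendstoD(2) by blast
     thus ?thesis by eventually_elim (use 2 in \<open>auto simp: indicator_def\<close>)
    qed
    thus "(%n. indicat_real (?A (X n)) x) \<longlonglongrightarrow> indicat_real (?A t) x"
     by (rule tendsto_eventually)
   qed
   show "integrable lebesgue (indicat_real S)" using S by (simp add: lmeasurable_iff_integrable)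
   show "indicat_real (?A t) \<in> borel_measurable lebesgue" "!!n. indicat_real (?A (X n)) \<in> borel_measurable lebesgue"
    using A by (auto intro!: borel_measurable_indicator fmeasurableD)
   show "!!n. AE x in lebesgue. norm (indicat_real (?A (X n)) x) <= indicat_real S x"
    by (intro AE_I2) (auto simp: indicator_def)
  qed
  thus "((%t. vol (?A t)) \<circ> X) \<longlonglongrightarrow> vol (?A t)"
   unfolding o_def ind .
 qed
 thus ?thesis by (simp add: continuous_on_eq_continuous_at)
qed

lemma vol_mono: "X \<in> lmeasurable ==> Y \<in> lmeasurable ==> X \<subseteq> Y ==> vol X <= vol Y"
 by (simp add: fmeasurableD measure_mono_fmeasurable)

lemma vol_split_hyperplane:
 fixes S :: "'a::euclidean_space set"
 assumes S: "S \<in> lmeasurable" and u: "u ~= 0"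
 shows "vol S = vol (S \<inter> {x. x \<bullet> u < t}) + vol (S \<inter> {x. x \<bullet> u > t})"
proof -
 have meas: "{x. x \<bullet> u < t} \<in> sets lebesgue" "{x. x \<bullet> u > t} \<in> sets lebesgue"
  by (auto intro!: sets_completionI_sets borel_open open_Collect_less continuous_intros)
 have A: "S \<inter> {x. x \<bullet> u < t} \<in> lmeasurable" "S \<inter> {x. x \<bullet> u > t} \<in> lmeasurable"
  using fmeasurable_Int_fmeasurable[OF S] meas by blast+
 have N: "negligible {x. x \<bullet> u = t}"
  using negligible_hyperplane[of u t] u by (simp add: inner_commute)
 have "vol S = vol (S \<inter> {x. x \<bullet> u < t} \<union> S \<inter> {x. x \<bullet> u > t})"
 proof (rule sym, rule measure_negligible_symdiff)
  show "negligible (S - (S \<inter> {x. x \<bullet> u < t} \<union> S \<inter> {x. x \<bullet> u > t}) \<union> ((S \<inter> {x. x \<bullet> u < t} \<union> S \<inter> {x. x \<bullet> u > t}) - S))"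
   by (rule negligible_subset[OF N]) auto
 qed (use S in auto)
 also have "... = vol (S \<inter> {x. x \<bullet> u < t}) + vol (S \<inter> {x. x \<bullet> u > t})"
  using A by (intro measure_Un2[THEN trans]) (auto intro!: arg_cong[where f=vol])
 finally show ?thesis .
qed

text \<open>These are the sets of the Hadwiger-Ohmann proof. Open boxes make every Minkowski sum
  with them open, hence measurable; nonempty ones make every member contribute positive
  volume.\<close>

definition box_family :: "'a::euclidean_space set set => bool" where
 "box_family F \<longleftrightarrow> finite F & pairwise disjnt F & (\<forall>B\<in>F. B ~= {} & (\<exists>a b. B = box a b))"

lemma open_plus_left: "open (X::'a::real_normed_vector set) ==> open (X + Y)"
proof -
 assume "open X"
 moreover have "X + Y = (\<Union>y\<in>Y. (+) y ` X)"
  by (auto simp: set_plus_def image_iff) (metis add.commute)+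
 ultimately show ?thesis by (auto intro!: open_translation)
qed

lemma bounded_set_plus: "bounded (X::'a::real_normed_vector set) ==> bounded Y ==> bounded (X + Y)"
 unfolding bounded_iff set_plus_def by (auto, metis add_mono norm_triangle_ineq order_trans)

lemma box_family_union:
 assumes "box_family F" shows "open (\<Union>F)" "bounded (\<Union>F)"
proof -
 show "open (\<Union>F)" using assms unfolding box_family_def by (metis open_Union open_box)
 show "bounded (\<Union>F)" using assms unfolding box_family_def by (metis bounded_Union bounded_box)
qed

lemma box_family_cut:
 assumes F: "box_family F" and i: "(i::'a::euclidean_space) \<in> Basis"
 shows "box_family ((%B. B \<inter> {x. x \<bullet> i < t}) ` F - {{}})"
  "box_family ((%B. B \<inter> {x. x \<bullet> i > t}) ` F - {{}})"
proof -
 have 1: "\<exists>c d. box a b \<inter> {x. x \<bullet> i < t} = box c d" for a b :: 'a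
 proof (intro exI)
  show "box a b \<inter> {x. x \<bullet> i < t} = box a (\<Sum>j\<in>Basis. (if j = i then min t (b \<bullet> i) else b \<bullet> j) *R j)"
   using i by (auto simp: box_def split: if_splits)
 qed
 have 2: "\<exists>c d. box a b \<inter> {x. x \<bullet> i > t} = box c d" for a b :: 'a
 proof (intro exI)
  show "box a b \<inter> {x. x \<bullet> i > t} = box (\<Sum>j\<in>Basis. (if j = i then max t (a \<bullet> i) else a \<bullet> j) *R j) b"
   using i by (auto simp: box_def split: if_splits)
 qed
 show "box_family ((%B. B \<inter> {x. x \<bullet> i < t}) ` F - {{}})"
  unfolding box_family_def
 proof (intro conjI ballI)
  show "pairwise disjnt ((%B. B \<inter> {x. x \<bullet> i < t}) ` F - {{}})"
   using F unfolding box_family_def pairwise_def disjnt_def by fastforce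
 qed (use F 1 in \<open>auto simp: box_family_def\<close>)
 show "box_family ((%B. B \<inter> {x. x \<bullet> i > t}) ` F - {{}})"
  unfolding box_family_def
 proof (intro conjI ballI)
  show "pairwise disjnt ((%B. B \<inter> {x. x \<bullet> i > t}) ` F - {{}})"
   using F unfolding box_family_def pairwise_def disjnt_def by fastforce
 qed (use F 2 in \<open>auto simp: box_family_def\<close>)
qed

text \<open>Arithmetic-geometric mean in each coordinate: sides p and q contribute p + q \<ge> 2
  sqrt (p q), whence the factor 2^n. This multiplicative form is the one that yields log-concavity
  of slab volumes later.\<close>

lemma brunn_minkowski_box:
 fixes a b c d :: "'a::euclidean_space"
 assumes "box a b ~= {}" "box c d ~= {}"
 shows "vol (box a b + box c d) \<ge> 2 ^ DIM('a) * sqrt (vol (box a b) * vol (box c d))"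
proof -
 have ab: "a \<bullet> i < b \<bullet> i" "c \<bullet> i < d \<bullet> i" if "i \<in> Basis" for i
  using assms that by (auto simp: box_ne_empty)
 have sub: "box (a + c) (b + d) \<subseteq> box a b + box c d"
 proof
  fix x assume x: "x \<in> box (a + c) (b + d)"
  \<comment> \<open>\<open>l i\<close> is the relative position of \<open>x\<close> in the sum box;
    taking the same relative position in both boxes splits \<open>x\<close> into two
    summands.\<close>
  define l where "l i = (x \<bullet> i - (a + c) \<bullet> i) / ((b + d) \<bullet> i - (a + c) \<bullet> i)" for i
  define y where "y = (\<Sum>i\<in>Basis. (a \<bullet> i + l i * (b \<bullet> i - a \<bullet> i)) *R i)"
  have l: "0 < l i & l i < 1 & x \<bullet> i = (a + c) \<bullet> i + l i * ((b + d) \<bullet> i - (a + c) \<bullet> i)" if "i \<in> Basis" for i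
   using x that ab[OF that] by (auto simp: l_def box_def inner_add_left field_simps)
  have conv: "p < p + r * (q - p) & p + r * (q - p) < q" if "p < q" "0 < r" "r < 1" for p q r :: real
   using that mult_strict_right_mono[of r 1 "q - p"] by (auto simp: algebra_simps)
  have "y \<in> box a b"
   using l ab conv by (auto simp: y_def box_def)
  moreover have "x - y \<in> box c d"
  proof -
   have "(x - y) \<bullet> i = c \<bullet> i + l i * (d \<bullet> i - c \<bullet> i)" if "i \<in> Basis" for i
    using l[OF that] that by (simp add: y_def inner_diff_left inner_add_left right_diff_distrib distrib_left)
   thus ?thesis using l ab conv by (auto simp: box_def)
  qed
  ultimately show "x \<in> box a b + box c d"
   by (metis add.commute diff_add_cancel set_plus_intro)
 qed
 have sqrt_prod: "sqrt (prod f B) = (\<Prod>i\<in>B. sqrt (f i))" if "finite B" for f and B :: "'a set"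
  using that by induction (auto simp: real_sqrt_mult)
 have "2 ^ DIM('a) * sqrt (vol (box a b) * vol (box c d)) = (\<Prod>i\<in>Basis. 2 * sqrt ((b - a) \<bullet> i * ((d - c) \<bullet> i)))"
  using ab by (simp add: prod.distrib real_sqrt_mult sqrt_prod inner_diff_left less_imp_le)
 also have "... <= (\<Prod>i\<in>Basis. (b + d - (a + c)) \<bullet> i)"
 proof (rule prod_mono, safe)
  fix i :: 'a assume i: "i \<in> Basis"
  show "0 <= 2 * sqrt ((b - a) \<bullet> i * ((d - c) \<bullet> i))"
   using ab[OF i] by (simp add: inner_diff_left)
  show "2 * sqrt ((b - a) \<bullet> i * ((d - c) \<bullet> i)) <= (b + d - (a + c)) \<bullet> i"
   using ab[OF i] arith_geo_mean_sqrt[of "(b - a) \<bullet> i" "(d - c) \<bullet> i"] by (simp add: inner_diff_left inner_add_left)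
 qed
 also have "... = vol (box (a + c) (b + d))"
  using ab by (simp add: inner_add_left less_imp_le add_mono inner_diff_left)
 also have "... <= vol (box a b + box c d)"
  by (intro vol_mono sub lmeasurable_open bounded_set_plus open_plus_left) auto
 finally show ?thesis .
qed

text \<open>The lower pieces sum into one side of the hyperplane at \<open>s + t\<close> and the
  upper pieces into the other, so the volumes of the two sums add up. As both sets are cut in the
  same ratio \<open>q\<close>, the two bounds are \<open>q\<close> and \<open>1 - q\<close> times
  the bound for the whole.\<close>

lemma brunn_minkowski_split:
 fixes i :: "'a::euclidean_space"
 assumes X: "open X" "bounded X" and Y: "open Y" "bounded Y" and i: "i ~= 0"
  and pos: "vol X > 0" "vol Y > 0"
  and ratio: "vol (X \<inter> {x. x \<bullet> i < s}) / vol X = vol (Y \<inter> {x. x \<bullet> i < t}) / vol Y"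
  and m: "vol (X \<inter> {x. x \<bullet> i < s} + Y \<inter> {x. x \<bullet> i < t}) \<ge> c * sqrt (vol (X \<inter> {x. x \<bullet> i < s}) * vol (Y \<inter> {x. x \<bullet> i < t}))"
  and p: "vol (X \<inter> {x. x \<bullet> i > s} + Y \<inter> {x. x \<bullet> i > t}) \<ge> c * sqrt (vol (X \<inter> {x. x \<bullet> i > s}) * vol (Y \<inter> {x. x \<bullet> i > t}))"
 shows "vol (X + Y) \<ge> c * sqrt (vol X * vol Y)"
proof -
 define q where "q = vol (X \<inter> {x. x \<bullet> i < s}) / vol X"
 have oh: "open {x. x \<bullet> i < r}" "open {x. x \<bullet> i > r}" for r
  by (auto intro!: open_Collect_less continuous_intros)
 have lmX: "X \<in> lmeasurable" "Y \<in> lmeasurable" using X Y by (auto intro: lmeasurable_open)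
 have 1: "vol (X \<inter> {x. x \<bullet> i < s}) = q * vol X" "vol (Y \<inter> {x. x \<bullet> i < t}) = q * vol Y"
  using pos ratio by (simp_all add: q_def field_simps)
 have 2: "vol (X \<inter> {x. x \<bullet> i > s}) = (1 - q) * vol X" "vol (Y \<inter> {x. x \<bullet> i > t}) = (1 - q) * vol Y"
  using vol_split_hyperplane[OF lmX(1) i, of s] vol_split_hyperplane[OF lmX(2) i, of t] 1 by (simp_all add: algebra_simps)
 have th: "0 <= q" "q <= 1"
  using 1(1) 2(1) pos measure_nonneg[of lebesgue "X \<inter> {x. x \<bullet> i < s}"] measure_nonneg[of lebesgue "X \<inter> {x. x \<bullet> i > s}"]
  by (auto simp: zero_le_mult_iff)
 let ?M = "X \<inter> {x. x \<bullet> i < s} + Y \<inter> {x. x \<bullet> i < t}" and ?P = "X \<inter> {x. x \<bullet> i > s} + Y \<inter> {x. x \<bullet> i > t}"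
 have lm: "?M \<in> lmeasurable" "?P \<in> lmeasurable" "X + Y \<in> lmeasurable"
  using X Y oh by (auto intro!: lmeasurable_open bounded_set_plus open_plus_left)
 have sq: "sqrt (q * vol X * (q * vol Y)) = q * sqrt (vol X * vol Y)" if "0 <= q" for q
 proof -
  have "q * vol X * (q * vol Y) = (q * q) * (vol X * vol Y)" by (simp add: ac_simps)
  thus ?thesis using that by (simp add: real_sqrt_mult)
 qed
 have "c * sqrt (vol X * vol Y) = c * sqrt (q * vol X * (q * vol Y)) + c * sqrt ((1-q) * vol X * ((1-q) * vol Y))"
  using th by (simp add: sq) (simp add: algebra_simps)
 also have "... <= vol ?M + vol ?P" using m p 1 2 by simp
 also have "... = vol (?M \<union> ?P)"
 proof -
  have "?M \<inter> ?P = {}"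
  proof -
   have "x \<bullet> i < s + t" if "x \<in> ?M" for x
    using that by (force simp: set_plus_def inner_add_left)
   moreover have "x \<bullet> i > s + t" if "x \<in> ?P" for x
    using that by (force simp: set_plus_def inner_add_left)
   ultimately show ?thesis by force
  qed
  thus ?thesis using lm by (subst measure_Un3) auto
 qed
 also have "... <= vol (X + Y)"
  using lm by (intro vol_mono) (auto simp: set_plus_def)
 finally show ?thesis .
qed

lemma box_family_pos: assumes "box_family F" "F ~= {}" shows "vol (\<Union>F) > 0"
proof -
 obtain B where "B \<in> F" "B ~= {}" using assms by (auto simp: box_family_def)
 hence "\<Union>F ~= {}" by auto
 thus ?thesis using open_not_negligible[OF box_family_union(1)[OF assms(1)]]
  lmeasurable_open[OF box_family_union(2)[OF assms(1)] box_family_union(1)[OF assms(1)]]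
  by (metis completion.null_sets_outer measure_le_0_iff negligible_iff_measure not_le_imp_less)
qed

text \<open>Two disjoint boxes of \<open>F\<close> are separated by a coordinate hyperplane, so both
  halves of \<open>F\<close> have fewer boxes than \<open>F\<close>. Cutting \<open>G\<close> by a
  parallel hyperplane in the same volume ratio cannot increase its number of boxes, hence the total
  count drops and the two halves recombine.\<close>

lemma brunn_minkowski_box_family_step:
 fixes F G :: "'a::euclidean_space set set"
 assumes F: "box_family F" and G: "box_family G" "G ~= {}" and F2: "card F \<ge> 2"
  and IH: "!!F' G' :: 'a set set. card F' + card G' < card F + card G ==> box_family F' ==> box_family G' ==> F' ~= {} ==> G' ~= {} ==>
    vol (\<Union>F' + \<Union>G') \<ge> 2 ^ DIM('a) * sqrt (vol (\<Union>F') * vol (\<Union>G'))"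
 shows "vol (\<Union>F + \<Union>G) \<ge> 2 ^ DIM('a) * sqrt (vol (\<Union>F) * vol (\<Union>G))"
proof -
 have finF: "finite F" and finG: "finite G" using F G by (auto simp: box_family_def)
 obtain B1 B2 i t where B: "B1 \<in> F" "B2 \<in> F" and i: "i \<in> Basis"
  and t: "B1 \<subseteq> {x. x \<bullet> i < t}" "B2 \<subseteq> {x. x \<bullet> i > t}"
 proof -
  obtain B1 B2 where B: "B1 \<in> F" "B2 \<in> F" "B1 ~= B2"
   using F2 by (metis card_le_Suc0_iff_eq finF not_less_eq_eq numeral_2_eq_2)
  then obtain a b c d where ab: "B1 = box a b" "B2 = box c d" "B1 ~= {}" "B2 ~= {}"
   using F unfolding box_family_def by metis
  have "box a b \<inter> box c d = {}" using F B ab by (auto simp: box_family_def pairwise_def disjnt_def)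
  then obtain i where i: "i \<in> Basis" "b \<bullet> i <= c \<bullet> i \<or> d \<bullet> i <= a \<bullet> i"
   using ab unfolding disjoint_interval by (force simp: box_ne_empty)
  show ?thesis
  proof (cases "b \<bullet> i <= c \<bullet> i")
   case True
   thus ?thesis using that[of B1 B2 i "b \<bullet> i"] B i ab by (force simp: box_def)
  next
   case False
   thus ?thesis using that[of B2 B1 i "d \<bullet> i"] B i ab by (force simp: box_def)
  qed
 qed
 have i0: "i ~= 0" using i by auto
 let ?L = "%H t. (%B. B \<inter> {x. x \<bullet> i < t}) ` H - {{}}" and ?R = "%H t. (%B. B \<inter> {x. x \<bullet> i > t}) ` H - {{}}"
 have UL: "\<Union>(?L H t) = \<Union>H \<inter> {x. x \<bullet> i < t}" and UR: "\<Union>(?R H t) = \<Union>H \<inter> {x. x \<bullet> i > t}" for H t by auto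
 have card_le: "card (?L G r) <= card G" "card (?R G r) <= card G" for r
  using finG by (meson card_image_le card_mono Diff_subset finite_imageI order_trans)+
 have neB: "B1 ~= {}" "B2 ~= {}" using B F by (auto simp: box_family_def)
 have cardL: "card (?L F t) < card F"
 proof -
  have "B2 \<inter> {x. x \<bullet> i < t} = {}" using t by force
  hence "?L F t \<subseteq> (%B. B \<inter> {x. x \<bullet> i < t}) ` (F - {B2})" by auto
  hence "card (?L F t) <= card (F - {B2})"
   using finF by (meson card_image_le card_mono finite_Diff finite_imageI order_trans)
  thus ?thesis using B finF by (metis card_Diff1_less order_le_less_trans)
 qed
 have cardR: "card (?R F t) < card F"
 proof -
  have "B1 \<inter> {x. x \<bullet> i > t} = {}" using t by force
  hence "?R F t \<subseteq> (%B. B \<inter> {x. x \<bullet> i > t}) ` (F - {B1})" by auto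
  hence "card (?R F t) <= card (F - {B1})"
   using finF by (meson card_image_le card_mono finite_Diff finite_imageI order_trans)
  thus ?thesis using B finF by (metis card_Diff1_less order_le_less_trans)
 qed
 have "B1 \<in> ?L F t" "B2 \<in> ?R F t" using B t neB by (force simp: image_iff inf.absorb1)+
 hence neLR: "?L F t ~= {}" "?R F t ~= {}" by blast+
 have Fne: "F ~= {}" using B by auto
 have lm: "\<Union>F \<in> lmeasurable" "\<Union>G \<in> lmeasurable" using F G box_family_union by (auto intro: lmeasurable_open)
 have posF: "vol (\<Union>F) > 0" and posG: "vol (\<Union>G) > 0" using box_family_pos F G Fne by auto
 have posL: "vol (\<Union>F \<inter> {x. x \<bullet> i < t}) > 0" and posR: "vol (\<Union>F \<inter> {x. x \<bullet> i > t}) > 0"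
  using box_family_pos[OF box_family_cut(1)[OF F i] neLR(1)] box_family_pos[OF box_family_cut(2)[OF F i] neLR(2)] UL UR by metis+
 define q where "q = vol (\<Union>F \<inter> {x. x \<bullet> i < t}) / vol (\<Union>F)"
 have th: "0 < q" "q < 1"
  using posL posR posF vol_split_hyperplane[OF lm(1) i0, of t] by (auto simp: q_def)
 obtain R where R: "!!x. x \<in> \<Union>G ==> norm x <= R" using box_family_union(2)[OF G(1)] bounded_iff by metis
 have Ri: "- R <= x \<bullet> i & x \<bullet> i <= R" if "x \<in> \<Union>G" for x
  using R[OF that] Basis_le_norm[OF i, of x] by linarith
 have "\<exists>t'. vol (\<Union>G \<inter> {x. x \<bullet> i < t'}) = q * vol (\<Union>G)"
 proof -
  have "\<Union>G \<inter> {x. x \<bullet> i < - R} = {}" "\<Union>G \<inter> {x. x \<bullet> i < R + 1} = \<Union>G"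
   using Ri by force+
  moreover have "- R <= R + 1" using Ri G by (metis UnionI abs_ge_minus_self abs_le_D1 box_family_pos ex_in_conv less_numeral_extra(3) linorder_not_le measure_empty minus_le_iff order_less_le_trans order_trans posG less_add_one less_imp_le)
  moreover have "continuous_on {- R..R+1} (%t. vol (\<Union>G \<inter> {x. x \<bullet> i < t}))"
   using hyperplane_slice_continuous[OF lm(2) i0] continuous_on_subset by blast
  ultimately show ?thesis
   using IVT'[of "%t. vol (\<Union>G \<inter> {x. x \<bullet> i < t})" "- R" "q * vol (\<Union>G)" "R+1"] th posG by fastforce
 qed
 then obtain t' where t': "vol (\<Union>G \<inter> {x. x \<bullet> i < t'}) = q * vol (\<Union>G)" by blast
 have tR: "vol (\<Union>G \<inter> {x. x \<bullet> i > t'}) = (1 - q) * vol (\<Union>G)"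
  using t' vol_split_hyperplane[OF lm(2) i0, of t'] by (simp add: algebra_simps)
 have neG: "?L G t' ~= {}" "?R G t' ~= {}"
 proof -
  have "vol (\<Union>(?L G t')) > 0" "vol (\<Union>(?R G t')) > 0" unfolding UL UR using t' tR th posG by auto
  thus "?L G t' ~= {}" "?R G t' ~= {}" by (metis Union_empty less_irrefl measure_empty)+
 qed
 show ?thesis
 proof (rule brunn_minkowski_split[where i=i and s=t and t=t'])
  show "vol (\<Union>F \<inter> {x. x \<bullet> i < t}) / vol (\<Union>F) = vol (\<Union>G \<inter> {x. x \<bullet> i < t'}) / vol (\<Union>G)"
   using t' posG by (simp add: q_def)
  show "vol (\<Union>F \<inter> {x. x \<bullet> i < t} + \<Union>G \<inter> {x. x \<bullet> i < t'}) \<ge> 2 ^ DIM('a) * sqrt (vol (\<Union>F \<inter> {x. x \<bullet> i < t}) * vol (\<Union>G \<inter> {x. x \<bullet> i < t'}))"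
   unfolding UL[symmetric]
  proof (rule IH)
   show "card (?L F t) + card (?L G t') < card F + card G" using cardL card_le(1)[of t'] by linarith
  qed (use box_family_cut(1)[OF F i] box_family_cut(1)[OF G(1) i] neLR(1) neG(1) in blast)+
  show "vol (\<Union>F \<inter> {x. x \<bullet> i > t} + \<Union>G \<inter> {x. x \<bullet> i > t'}) \<ge> 2 ^ DIM('a) * sqrt (vol (\<Union>F \<inter> {x. x \<bullet> i > t}) * vol (\<Union>G \<inter> {x. x \<bullet> i > t'}))"
   unfolding UR[symmetric]
  proof (rule IH)
   show "card (?R F t) + card (?R G t') < card F + card G" using cardR card_le(2)[of t'] by linarith
  qed (use box_family_cut(2)[OF F i] box_family_cut(2)[OF G(1) i] neLR(2) neG(2) in blast)+
 qed (use F G box_family_union i0 posF posG in auto)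
qed

lemma brunn_minkowski_box_family:
 fixes F G :: "'a::euclidean_space set set"
 assumes "box_family F" "box_family G" "F ~= {}" "G ~= {}"
 shows "vol (\<Union>F + \<Union>G) \<ge> 2 ^ DIM('a) * sqrt (vol (\<Union>F) * vol (\<Union>G))"
 using assms
proof (induction "card F + card G" arbitrary: F G rule: less_induct)
 case less
 have fin: "finite F" "finite G" using less.prems by (auto simp: box_family_def)
 consider "card F \<ge> 2" | "card G \<ge> 2" | "card F = 1" "card G = 1"
  using less.prems fin by (metis One_nat_def card_0_eq le_less_Suc_eq not_less_eq_eq numeral_2_eq_2 le_SucE le_zero_eq nat_le_linear)
 thus ?case
 proof cases
  case 1
  thus ?thesis using brunn_minkowski_box_family_step[OF less.prems(1,2,4) 1] less.hyps by blast
 next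
  case 2
  have "vol (\<Union>G + \<Union>F) \<ge> 2 ^ DIM('a) * sqrt (vol (\<Union>G) * vol (\<Union>F))"
   using brunn_minkowski_box_family_step[OF less.prems(2,1,3) 2] less.hyps by (metis add.commute)
  thus ?thesis by (simp add: add.commute mult.commute)
 next
  case 3
  then obtain B C where "F = {B}" "G = {C}" by (meson card_1_singletonE)
  moreover from this obtain a b c d where "B = box a b" "C = box c d" "B ~= {}" "C ~= {}"
   using less.prems unfolding box_family_def by (metis singletonI)
  ultimately show ?thesis using brunn_minkowski_box[of a b c d] by simp
 qed
qed

text \<open>A finite cover by boxes is refined to a division; passing to the interiors of its cells
  makes them disjoint open boxes and removes only a null set.\<close>

lemma compact_inner_box_family:
 fixes K U :: "'a::euclidean_space set"
 assumes K: "compact K" "vol K > 0" and U: "open U" "K \<subseteq> U"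
 obtains F where "box_family F" "F ~= {}" "\<Union>F \<subseteq> U" "vol K <= vol (\<Union>F)"
proof -
 have "\<exists>a b. x \<in> box a b & cbox a b \<subseteq> U" if "x \<in> K" for x
  using open_contains_cbox U that by (metis subset_eq)
 then obtain a b where ab: "!!x. x \<in> K ==> x \<in> box (a x) (b x) & cbox (a x) (b x) \<subseteq> U" by metis
 obtain C where C: "C \<subseteq> K" "finite C" "K \<subseteq> (\<Union>x\<in>C. box (a x) (b x))"
 proof (rule compactE_image[OF K(1), of K "%x. box (a x) (b x)"])
  show "K \<subseteq> (\<Union>x\<in>K. box (a x) (b x))" using ab by blast
 qed auto
 obtain p where p: "p division_of (\<Union>((%x. cbox (a x) (b x)) ` C))"
  using elementary_unions_intervals[of "(%x. cbox (a x) (b x)) ` C"] C by blast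
 have Up: "\<Union>p = (\<Union>x\<in>C. cbox (a x) (b x))" using division_ofD(6)[OF p] by simp
 have KU: "K \<subseteq> \<Union>p" unfolding Up using C(3) box_subset_cbox by blast
 have pU: "\<Union>p \<subseteq> U" unfolding Up using ab C(1) by blast
 define F where "F = interior ` p - {{}}"
 have cb: "\<exists>a b. k = cbox a b" if "k \<in> p" for k using division_ofD(4)[OF p that] .
 have F: "box_family F"
  unfolding box_family_def F_def
 proof (intro conjI ballI)
  show "finite (interior ` p - {{}})" using division_ofD(1)[OF p] by auto
  show "pairwise disjnt (interior ` p - {{}})"
   using division_ofD(5)[OF p] by (auto simp: pairwise_def disjnt_def)
 qed (use cb in \<open>auto, metis interior_cbox\<close>)
 have lmp: "\<Union>p \<in> lmeasurable"
  using division_ofD(1)[OF p] cb by (intro fmeasurable.finite_Union) auto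
 have "vol (\<Union>p) <= vol (\<Union>F)"
 proof -
  have "negligible (\<Union>p - \<Union>F)"
  proof (rule negligible_subset)
   show "\<Union>p - \<Union>F \<subseteq> (\<Union>k\<in>p. frontier k)"
   proof
    fix x assume "x \<in> \<Union>p - \<Union>F"
    then obtain k where k: "k \<in> p" "x \<in> k" "x \<notin> interior k" by (auto simp: F_def)
    thus "x \<in> (\<Union>k\<in>p. frontier k)" using closure_subset by (fastforce simp: frontier_def)
   qed
   show "negligible (\<Union>k\<in>p. frontier k)"
    using division_ofD(1)[OF p] cb by (intro negligible_Union) (auto intro!: negligible_convex_frontier, metis convex_box(1))
  qed
  moreover have "\<Union>F \<subseteq> \<Union>p" unfolding F_def using interior_subset by blast
  ultimately have "vol (\<Union>F) = vol (\<Union>p)"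
   using lmp
   by (intro measure_negligible_symdiff) (auto simp: Diff_eq_empty_iff[THEN iffD2])
  thus ?thesis by simp
 qed
 moreover have "vol K <= vol (\<Union>p)"
  by (rule vol_mono[OF lmeasurable_compact[OF K(1)] lmp KU])
 ultimately have "vol K <= vol (\<Union>F)" by simp
 moreover from this K have "F ~= {}" by auto
 moreover have "\<Union>F \<subseteq> U" unfolding F_def using pU interior_subset by blast
 ultimately show ?thesis using that F by blast
qed

lemma compact_set_plus: "compact (X::'a::real_normed_vector set) ==> compact Y ==> compact (X + Y)"
 unfolding set_plus_image by (intro compact_continuous_image compact_Times) (auto intro!: continuous_intros simp: case_prod_unfold)

lemma vol_thicken:
 fixes A :: "'a::euclidean_space set"
 assumes A: "compact A" and e: "d > 0"
 obtains q where "q > 0" "vol (A + cball 0 q) < vol A + d"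
proof -
 have lmA: "A \<in> lmeasurable" using A by (rule lmeasurable_compact)
 obtain T where T: "open T" "A \<subseteq> T" "T - A \<in> lmeasurable" "emeasure lebesgue (T - A) < ennreal d"
  using sets_lebesgue_outer_open[OF fmeasurableD[OF lmA] e] by metis
 obtain q where eps: "q > 0" "(\<Union>x\<in>A. ball x q) \<subseteq> T"
  using compact_subset_open_imp_ball_epsilon_subset[OF A T(1,2)] by blast
 have sub: "A + cball 0 (q/2) \<subseteq> T"
 proof
  fix x assume "x \<in> A + cball 0 (q/2)"
  then obtain a b where "x = a + b" "a \<in> A" "norm b <= q/2" by (auto simp: set_plus_def)
  hence "x \<in> ball a q" using eps by (auto simp: dist_norm)
  thus "x \<in> T" using eps \<open>a \<in> A\<close> by blast
 qed
 have lmT: "T \<in> lmeasurable"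
  using fmeasurable.Un[OF lmA T(3)] T(2) by (metis Un_Diff_cancel Un_absorb1)
 have "vol (A + cball 0 (q/2)) <= vol T"
  by (intro vol_mono lmT sub lmeasurable_compact compact_set_plus A) auto
 also have "vol T = vol A + vol (T - A)"
  using measurable_measure_Diff[OF lmT fmeasurableD[OF lmA] T(2)] by simp
 also have "... < vol A + d"
  using T(3,4) e by (metis add_strict_left_mono emeasure_eq_measure2 ennreal_less_iff measure_nonneg)
 finally show ?thesis using that[of "q/2"] eps by simp
qed

text \<open>Box families of at least the volume of \<open>K\<close> and \<open>L\<close> sit inside
  thickenings by \<open>v / 2\<close>. Their sum stays in the thickening of \<open>K + L\<close> by
  \<open>v\<close>, which costs less than \<open>e\<close> in volume.\<close>

theorem brunn_minkowski_midpoint: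
 fixes K L :: "'a::euclidean_space set"
 assumes K: "compact K" "K ~= {}" and L: "compact L" "L ~= {}"
 shows "vol (K + L) \<ge> 2 ^ DIM('a) * sqrt (vol K * vol L)"
proof (cases "vol K = 0 \<or> vol L = 0")
 case True
 thus ?thesis by auto
next
 case False
 hence pos: "vol K > 0" "vol L > 0" by (simp_all add: zero_less_measure_iff)
 have "2 ^ DIM('a) * sqrt (vol K * vol L) <= vol (K + L) + e" if "e > 0" for e
 proof -
  obtain v where eps: "v > 0" "vol (K + L + cball 0 v) < vol (K + L) + e"
   using vol_thicken[OF compact_set_plus[OF K(1) L(1)] \<open>e > 0\<close>] .
  let ?b = "ball 0 (v/2) :: 'a set"
  have sub: "X \<subseteq> X + ?b" for X :: "'a set"
   using eps by (metis add.commute add_0 centre_in_ball half_gt_zero set_zero_plus2)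
  have op: "open (X + ?b)" for X :: "'a set" by (metis add.commute open_ball open_plus_left)
  obtain F where F: "box_family F" "F ~= {}" "\<Union>F \<subseteq> K + ?b" "vol K <= vol (\<Union>F)"
   using compact_inner_box_family[OF K(1) pos(1) op sub] .
  obtain G where G: "box_family G" "G ~= {}" "\<Union>G \<subseteq> L + ?b" "vol L <= vol (\<Union>G)"
   using compact_inner_box_family[OF L(1) pos(2) op sub] .
  have "\<Union>F + \<Union>G \<subseteq> (K + ?b) + (L + ?b)" using F G by (intro set_plus_mono2)
  also have "... \<subseteq> K + L + cball 0 v"
  proof
   fix x assume "x \<in> (K + ?b) + (L + ?b)"
   then obtain k l p q where x: "x = (k + p) + (l + q)" "k \<in> K" "l \<in> L" "p \<in> ?b" "q \<in> ?b"
    by (auto simp: set_plus_def)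
   have "x = k + l + (p + q)" using x by simp
   moreover have "p + q \<in> cball 0 v" using x norm_triangle_ineq[of p q] by simp
   ultimately show "x \<in> K + L + cball 0 v" using x by blast
  qed
  finally have "vol (\<Union>F + \<Union>G) <= vol (K + L + cball 0 v)"
   by (intro vol_mono[OF lmeasurable_open[OF bounded_set_plus open_plus_left] lmeasurable_compact[OF compact_set_plus[OF compact_set_plus]]]
     box_family_union F G K L compact_cball)
  moreover have "sqrt (vol K * vol L) <= sqrt (vol (\<Union>F) * vol (\<Union>G))"
   using F G pos by (intro real_sqrt_le_mono mult_mono) auto
  hence "2 ^ DIM('a) * sqrt (vol K * vol L) <= 2 ^ DIM('a) * sqrt (vol (\<Union>F) * vol (\<Union>G))"
   by simp
  ultimately show ?thesis using brunn_minkowski_box_family[OF F(1) G(1) F(2) G(2)] eps by linarith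
 qed
 thus ?thesis using field_le_epsilon by blast
qed

section \<open>Polytopes with a given simplicial normal fan\<close>

text \<open>A mixed difference that needs only a commutative monoid, so that it serves both for
  support numbers and for sets under Minkowski addition. On a homogeneous polynomial of degree n, n
  differences give n! times its polarization, whatever the base point.\<close>

primrec iterated_diff :: "'v::comm_monoid_add list => ('v => real) => 'v => real" where
 "iterated_diff [] f h = f h"
| "iterated_diff (c # cs) f h = iterated_diff cs f (h + c) - iterated_diff cs f h"

lemma iterated_diff_move: "iterated_diff (xs @ c # ys) f h = iterated_diff (c # xs @ ys) f h"
 by (induction xs arbitrary: h) (simp_all add: ac_simps)

lemma iterated_diff_perm: "mset xs = mset ys ==> iterated_diff xs f h = iterated_diff ys f h"
proof (induction xs arbitrary: ys h)
 case (Cons x xs)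
 then obtain us vs where ys: "ys = us @ x # vs"
  by (metis in_set_conv_decomp list.set_intros(1) mset_eq_setD)
 hence "mset xs = mset (us @ vs)" using Cons.prems by simp
 thus ?case using Cons.IH[of "us @ vs"] unfolding ys iterated_diff_move by simp
qed simp

lemma iterated_diff_add: "iterated_diff ((c + d) # cs) f h = iterated_diff (c # cs) f (h + d) + iterated_diff (d # cs) f h"
 by (simp add: ac_simps)

lemma iterated_diff_zero: "iterated_diff (0 # cs) f h = 0"
 by simp

lemma independent_span_UNIV:
 fixes S :: "'a::euclidean_space set"
 assumes "independent S" "card S = DIM('a)" shows "span S = UNIV"
 using assms by (metis dim_UNIV dim_eq_card_independent dim_eq_full dim_span)

lemma independent_interpolate:
 fixes S :: "'a::euclidean_space set"
 assumes "independent S" obtains x where "!!b. b \<in> S ==> b \<bullet> x = h b"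
proof -
 obtain g :: "'a => real" where g: "linear g" "\<forall>b\<in>S. g b = h b"
  using linear_independent_extend[OF assms] by blast
 have "b \<bullet> adjoint g 1 = g b" for b using adjoint_works[OF g(1), of b 1] by simp
 thus ?thesis using that g by metis
qed

lemma inner_eq_on_span:
 fixes S :: "'a::euclidean_space set"
 assumes "!!b. b \<in> S ==> b \<bullet> x = b \<bullet> y" "u \<in> span S" shows "u \<bullet> x = u \<bullet> y"
 using assms(2)
 by (induction rule: span_induct_alt) (simp_all add: assms(1) inner_add_left)

lemma inner_spanning_eq:
 fixes S :: "'a::euclidean_space set"
 assumes "independent S" "card S = DIM('a)" "!!b. b \<in> S ==> b \<bullet> x = b \<bullet> y" shows "x = y"
 using inner_eq_on_span[OF assms(3)] independent_span_UNIV[OF assms(1,2)] by (metis UNIV_I vector_eq_ldot)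

text \<open>Additivity with nonnegative values gives monotonicity. Trapping \<open>?N * s\<close>
  between the integers \<open>k\<close> and \<open>k + 1\<close> then confines \<open>g s\<close> to
  within \<open>g 1 / ?N\<close> of \<open>s * g 1\<close>.\<close>

lemma additive_nonneg_linear:
 fixes g :: "real => real"
 assumes add: "!!s t. 0 <= s ==> 0 <= t ==> g (s + t) = g s + g t" and nn: "!!s. 0 <= s ==> 0 <= g s" and s: "0 <= s"
 shows "g s = s * g 1"
proof -
 have mono: "g s <= g t" if "0 <= s" "s <= t" for s t
  using add[of s "t - s"] nn[of "t - s"] that by simp
 have nat: "g (real n * t) = real n * g t" if "0 <= t" for n t
 proof (induction n)
  case 0 thus ?case using add[of 0 0] by simp
 next
  case (Suc n) thus ?case using add[of "real n * t" t] that by (simp add: algebra_simps)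
 qed
 have "\<bar>g s - s * g 1\<bar> <= g 1 / real (Suc n)" for n
 proof -
  let ?N = "real (Suc n)"
  define k where "k = nat \<lfloor>?N * s\<rfloor>"
  have k: "real k <= ?N * s" "?N * s < real k + 1" using s by (auto simp: k_def)
  have "real k * g 1 = g (real k)" "?N * g s = g (?N * s)" "(real k + 1) * g 1 = g (real k + 1)"
   using nat[of 1 k] nat[OF s, of "Suc n"] nat[of 1 "Suc k"] by (simp_all add: add.commute)
  hence 1: "real k * g 1 <= ?N * g s" "?N * g s <= (real k + 1) * g 1"
   using mono[of "real k" "?N * s"] mono[of "?N * s" "real k + 1"] k s by auto
  have 2: "real k * g 1 <= ?N * s * g 1" "?N * s * g 1 <= (real k + 1) * g 1"
   using k nn[of 1] by (auto intro!: mult_right_mono)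
  have "\<bar>?N * g s - ?N * s * g 1\<bar> <= g 1" using 1 2 by (auto simp: algebra_simps abs_le_iff)
  moreover have "?N * g s - ?N * s * g 1 = ?N * (g s - s * g 1)" by (simp add: algebra_simps)
  ultimately have "?N * \<bar>g s - s * g 1\<bar> <= g 1" by (simp add: abs_mult)
  thus ?thesis by (simp add: field_simps)
 qed
 hence "\<bar>g s - s * g 1\<bar> <= 0"
  by (intro LIMSEQ_le_const[OF LIMSEQ_Suc[OF lim_const_over_n[of "g 1"]]]) auto
 thus ?thesis by simp
qed

text \<open>The dual basis of an independent \<open>S\<close>; it turns prescribed values
  \<open>b \<bullet> x\<close> into the explicit point \<open>vertex S h\<close>.\<close>

definition dual :: "'a::euclidean_space set => 'a => 'a" where
 "dual S b = (SOME d. \<forall>c\<in>S. c \<bullet> d = (if c = b then 1 else 0))"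

lemma dual_works:
 assumes "independent S" "c \<in> S" shows "c \<bullet> dual S b = (if c = b then 1 else 0)"
proof -
 obtain x where "!!c. c \<in> S ==> c \<bullet> x = (if c = b then 1 else 0)"
  using independent_interpolate[OF assms(1), of "%c. if c = b then 1 else 0"] by blast
 hence "\<exists>d. \<forall>c\<in>S. c \<bullet> d = (if c = b then 1 else 0)" by blast
 from someI_ex[OF this] have "\<forall>c\<in>S. c \<bullet> dual S b = (if c = b then 1 else 0)"
  unfolding dual_def .
 thus ?thesis using assms by auto
qed

definition polyh :: "'a::euclidean_space set => ('a => real) => 'a set" where
 "polyh A h = {x. \<forall>a\<in>A. a \<bullet> x <= h a}"

definition vertex :: "'a::euclidean_space set => ('a => real) => 'a" where
 "vertex S h = (\<Sum>b\<in>S. h b *R dual S b)"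

definition stepf :: "'a => real => 'a => real" where
 "stepf a s = (%b. if b = a then s else 0)"

definition supp_box :: "'a set => ('a => real) => real => ('a => real) set" where
 "supp_box A h r = {k. \<forall>a\<in>A. \<bar>k a - h a\<bar> <= r}"

lemma stepf_apply: "stepf a s b = (if b = a then s else 0)" by (simp add: stepf_def)

text \<open>
  A simplicial fan: the maximal cones are spanned by the sets in \<open>BB\<close>. Its chamber consists of the
  support numbers \<open>h\<close> for which \<open>polyh A h\<close> is a simple polytope with exactly this normal fan.
\<close>

locale simplicial_fan =
 fixes A :: "'a::euclidean_space set" and BB :: "'a set set"
 assumes finite_A: "finite A"
  and basis: "S \<in> BB ==> S \<subseteq> A & independent S & card S = DIM('a)"
  and complete: "\<exists>S\<in>BB. \<exists>l. (\<forall>b\<in>S. 0 <= l b) & u = (\<Sum>b\<in>S. l b *R b)"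
begin

abbreviation P where "P \<equiv> polyh A"

definition chamber :: "('a => real) set" where
 "chamber = {h. \<forall>S\<in>BB. \<forall>j\<in>A - S. j \<bullet> vertex S h < h j}"

text \<open>Weak inequalities let vertices coincide, which admits polytopes whose normal fan is
  coarser than the given one. A chamber vector added to such support numbers makes the polytope
  simple again.\<close>

definition closed_chamber :: "('a => real) set" where
 "closed_chamber = {h. \<forall>S\<in>BB. \<forall>j\<in>A - S. j \<bullet> vertex S h <= h j}"

text \<open>The cones of the fan, given by their generators. For \<open>h\<close> in the chamber
  these are the sets of facets of \<open>P h\<close> that have a common point.\<close>

definition faces :: "'a set set" where
 "faces = {I. \<exists>S\<in>BB. I \<subseteq> S}"

lemma BB_finite: "S \<in> BB ==> finite S"
 using basis finite_A finite_subset by blast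

lemma vertex_inner: "S \<in> BB ==> b \<in> S ==> b \<bullet> vertex S h = h b"
 using basis BB_finite by (simp add: vertex_def inner_sum_right dual_works if_distrib sum.delta cong: if_cong)

lemma vertex_eqI: "S \<in> BB ==> (!!b. b \<in> S ==> b \<bullet> x = h b) ==> x = vertex S h"
 using inner_spanning_eq[of S x "vertex S h"] basis vertex_inner by metis

lemma vertex_add: "vertex S (h + k) = vertex S h + vertex S k"
 by (simp add: vertex_def sum.distrib scaleR_left_distrib)

lemma vertex_scale: "vertex S (%a. t * h a) = t *R vertex S h"
 by (simp add: vertex_def scaleR_sum_right)

lemma BB_nonempty: "BB ~= {}"
 using complete by blast

lemma chamber_closed: "h \<in> chamber ==> h \<in> closed_chamber"
 by (auto simp: chamber_def closed_chamber_def less_imp_le)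

lemma chamber_add: "h \<in> chamber ==> k \<in> closed_chamber ==> h + k \<in> chamber"
 by (auto simp: chamber_def closed_chamber_def vertex_add inner_add_right intro!: add_less_le_mono)

lemma closed_chamber_add: "h \<in> closed_chamber ==> k \<in> closed_chamber ==> h + k \<in> closed_chamber"
 by (auto simp: closed_chamber_def vertex_add inner_add_right intro!: add_mono)

lemma closed_chamber_zero: "0 \<in> closed_chamber"
 by (auto simp: closed_chamber_def vertex_def)

lemma chamber_scale: "0 < t ==> h \<in> chamber ==> (%a. t * h a) \<in> chamber"
 by (auto simp: chamber_def vertex_scale)

lemma closed_chamber_scale: "0 <= t ==> h \<in> closed_chamber ==> (%a. t * h a) \<in> closed_chamber"
 by (auto simp: closed_chamber_def vertex_scale intro!: mult_left_mono)

lemma vertex_mem: "h \<in> closed_chamber ==> S \<in> BB ==> vertex S h \<in> P h"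
 using vertex_inner by (fastforce simp: closed_chamber_def polyh_def)

lemma polyh_cone_bound:
 assumes "S \<in> BB" "\<forall>b\<in>S. 0 <= l b" "x \<in> P h"
 shows "(\<Sum>b\<in>S. l b *R b) \<bullet> x <= (\<Sum>b\<in>S. l b *R b) \<bullet> vertex S h"
proof -
 have "(\<Sum>b\<in>S. l b *R b) \<bullet> x = (\<Sum>b\<in>S. l b * (b \<bullet> x))" by (simp add: inner_sum_left)
 also have "... <= (\<Sum>b\<in>S. l b * h b)"
  using assms basis by (intro sum_mono mult_left_mono) (auto simp: polyh_def)
 also have "... = (\<Sum>b\<in>S. l b *R b) \<bullet> vertex S h"
  using assms by (simp add: inner_sum_left vertex_inner)
 finally show ?thesis .
qed

lemma polyh_support: "\<exists>S\<in>BB. \<forall>h. \<forall>x\<in>P h. u \<bullet> x <= u \<bullet> vertex S h"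
proof -
 obtain S l where S: "S \<in> BB" "\<forall>b\<in>S. 0 <= l b" "u = (\<Sum>b\<in>S. l b *R b)" using complete[of u] by blast
 thus ?thesis using polyh_cone_bound[OF S(1,2)] by auto
qed

lemma closed_polyh: "closed (polyh C h)"
proof -
 have "polyh C h = (\<Inter>a\<in>C. {x. a \<bullet> x <= h a})" by (auto simp: polyh_def)
 thus ?thesis by (auto intro!: closed_halfspace_le)
qed

lemma compact_polyh: "compact (P h)"
proof -
 have "\<exists>B. \<forall>x\<in>P h. u \<bullet> x <= B" for u using polyh_support[of u] by blast
 then obtain B where B: "!!u x. x \<in> P h ==> u \<bullet> x <= B u" by metis
 have "norm x <= (\<Sum>i\<in>Basis. \<bar>B i\<bar> + \<bar>B (- i)\<bar>)" if x: "x \<in> P h" for x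
 proof -
  have "norm x <= (\<Sum>i\<in>Basis. \<bar>x \<bullet> i\<bar>)" by (rule norm_le_l1)
  also have "... <= (\<Sum>i\<in>Basis. \<bar>B i\<bar> + \<bar>B (- i)\<bar>)"
  proof (rule sum_mono)
   fix i :: 'a
   show "\<bar>x \<bullet> i\<bar> <= \<bar>B i\<bar> + \<bar>B (- i)\<bar>"
    using B[OF x, of i] B[OF x, of "- i"] by (simp add: inner_commute[of i])
  qed
  finally show ?thesis .
 qed
 hence "bounded (P h)" unfolding bounded_iff by blast
 thus ?thesis using closed_polyh compact_eq_bounded_closed by blast
qed

lemma convex_polyh: "convex (polyh C h)"
proof -
 have "polyh C h = (\<Inter>a\<in>C. {x. a \<bullet> x <= h a})" by (auto simp: polyh_def)
 thus ?thesis by (auto intro!: convex_INT convex_halfspace_le)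
qed

lemma body_polyh: "h \<in> closed_chamber ==> convex_body (P h)"
 using vertex_mem BB_nonempty compact_polyh convex_polyh unfolding convex_body_def by blast

text \<open>Every linear functional attains its maximum over \<open>P h\<close> at some
  \<open>vertex S h\<close>. A body containing all these vertices therefore cannot be separated from
  any point of \<open>P h\<close>.\<close>

lemma polyh_eq_of_support:
 assumes "compact K" "convex K" "K \<subseteq> P h" "!!S. S \<in> BB ==> vertex S h \<in> K"
 shows "K = P h"
proof (rule ccontr)
 assume "K ~= P h"
 then obtain x where x: "x \<in> P h" "x \<notin> K" using assms by blast
 obtain u c where u: "u \<bullet> x < c" "!!y. y \<in> K ==> c < u \<bullet> y"
  using separating_hyperplane_closed_point[OF assms(2) compact_imp_closed[OF assms(1)] x(2)] by metis
 obtain S where S: "S \<in> BB" "- u \<bullet> x <= - u \<bullet> vertex S h" using polyh_support[of "- u"] x(1) by blast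
 thus False using u assms(4)[of S] by force
qed

lemma polyh_plus:
 assumes "h \<in> closed_chamber" "k \<in> closed_chamber" shows "P (h + k) = P h + P k"
proof (rule sym, rule polyh_eq_of_support)
 show "compact (P h + P k)" "convex (P h + P k)"
  by (simp_all add: compact_set_plus compact_polyh convex_set_plus convex_polyh)
 show "P h + P k \<subseteq> P (h + k)"
  by (force simp: polyh_def set_plus_def inner_add_right intro: add_mono)
 show "vertex S (h + k) \<in> P h + P k" if "S \<in> BB" for S
  using that assms by (auto simp: vertex_add vertex_mem)
qed

lemma polyh_dilate:
 assumes "t > 0" shows "polyh C (%a. t * h a) = t \<odot> polyh C h"
proof (intro set_eqI iffI)
 fix x assume "x \<in> polyh C (%a. t * h a)"
 hence "inverse t *R x \<in> polyh C h" using assms by (auto simp: polyh_def field_simps)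
 thus "x \<in> t \<odot> polyh C h" using assms by (auto simp: image_iff intro!: bexI[of _ "inverse t *R x"])
qed (use assms in \<open>auto simp: polyh_def\<close>)

lemma polyh_zero: "P 0 = {0}"
proof (rule sym, rule polyh_eq_of_support)
 show "{0} \<subseteq> P 0" by (auto simp: polyh_def)
qed (auto simp: vertex_def)

text \<open>A point on all facets of \<open>T\<close> maximizes the sum of their normals over
  \<open>P h\<close>. At a vertex maximizing that sum all of \<open>T\<close> must be tight too, and
  in the open chamber the tight facets at \<open>vertex S h\<close> belong to
  \<open>S\<close>.\<close>

lemma tight_set_face:
 assumes h: "h \<in> chamber" and x: "x \<in> P h" and T: "T \<subseteq> A" "!!a. a \<in> T ==> a \<bullet> x = h a"
 shows "T \<in> faces"
proof -
 obtain S where S: "S \<in> BB" "\<forall>x\<in>P h. (\<Sum>a\<in>T. a) \<bullet> x <= (\<Sum>a\<in>T. a) \<bullet> vertex S h"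
  using polyh_support[of "\<Sum>a\<in>T. a"] by blast
 have finT: "finite T" using T finite_A finite_subset by blast
 have le: "a \<bullet> vertex S h <= h a" if "a \<in> T" for a
  using vertex_mem[OF chamber_closed[OF h] S(1)] that T by (auto simp: polyh_def)
 have "(\<Sum>a\<in>T. h a) <= (\<Sum>a\<in>T. a \<bullet> vertex S h)"
  using S(2) x T(2) by (force simp: inner_sum_left)
 hence "(\<Sum>a\<in>T. h a - a \<bullet> vertex S h) <= 0" by (simp add: sum_subtractf)
 hence "\<forall>a\<in>T. h a - a \<bullet> vertex S h = 0"
  using sum_nonneg_eq_0_iff[OF finT, of "%a. h a - a \<bullet> vertex S h"] sum_nonneg[of T "%a. h a - a \<bullet> vertex S h"] le by force
 hence "T \<subseteq> S" using h S(1) T(1) by (force simp: chamber_def)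
 thus ?thesis using S by (auto simp: faces_def)
qed

text \<open>Finitely many strict inequalities survive a small change of all support numbers:
  \<open>g\<close> is at most the least slack and \<open>C\<close> bounds the sensitivity of each
  inequality, so a change by \<open>g / (2 * C)\<close> uses at most half of the slack.\<close>

lemma chamber_box:
 assumes h: "h \<in> chamber" obtains r where "r > 0" "supp_box A h r \<subseteq> chamber"
proof -
 have BBfin: "finite BB" using basis finite_A by (meson Pow_iff finite_Pow_iff finite_subset subsetI)
 define C where "C = Max (insert 1 ((%(S, j). 1 + (\<Sum>b\<in>S. \<bar>j \<bullet> dual S b\<bar>)) ` (BB \<times> A)))"
 have C: "1 <= C" "S \<in> BB ==> j \<in> A ==> 1 + (\<Sum>b\<in>S. \<bar>j \<bullet> dual S b\<bar>) <= C" for S j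
  using BBfin finite_A unfolding C_def by (auto intro!: Max_ge)
 define g where "g = Min (insert 1 ((%(S, j). h j - j \<bullet> vertex S h) ` (SIGMA S:BB. A - S)))"
 have g: "0 < g" "S \<in> BB ==> j \<in> A - S ==> g <= h j - j \<bullet> vertex S h" for S j
  using BBfin finite_A h unfolding g_def chamber_def by (auto intro!: Min_le)
 show ?thesis
 proof (rule that[of "g / (2 * C)"])
  show "g / (2 * C) > 0" using g C by auto
  show "supp_box A h (g / (2 * C)) \<subseteq> chamber"
  proof
   fix k assume k: "k \<in> supp_box A h (g / (2 * C))"
   let ?r = "g / (2 * C)"
   show "k \<in> chamber" unfolding chamber_def
   proof (intro CollectI ballI)
    fix S j assume S: "S \<in> BB" and j: "j \<in> A - S"
    have "\<bar>j \<bullet> vertex S k - j \<bullet> vertex S h\<bar> = \<bar>\<Sum>b\<in>S. (k b - h b) * (j \<bullet> dual S b)\<bar>"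
     by (simp add: vertex_def inner_sum_right sum_subtractf left_diff_distrib)
    also have "... <= (\<Sum>b\<in>S. ?r * \<bar>j \<bullet> dual S b\<bar>)"
    proof (intro order_trans[OF sum_abs] sum_mono)
     fix b assume "b \<in> S"
     hence "\<bar>k b - h b\<bar> <= ?r" using k basis[OF S] by (auto simp: supp_box_def)
     thus "\<bar>(k b - h b) * (j \<bullet> dual S b)\<bar> <= ?r * \<bar>j \<bullet> dual S b\<bar>"
      unfolding abs_mult by (rule mult_right_mono) simp
    qed
    finally have "\<bar>j \<bullet> vertex S k - j \<bullet> vertex S h\<bar> + \<bar>k j - h j\<bar> <= ?r * (1 + (\<Sum>b\<in>S. \<bar>j \<bullet> dual S b\<bar>))"
     using k j by (simp add: supp_box_def sum_distrib_left algebra_simps) fastforce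
    also have "... <= ?r * C" using C(2)[OF S, of j] j g C(1) by (intro mult_left_mono) auto
    also have "... < g" using C g by simp
    finally show "j \<bullet> vertex S k < k j" using g(2)[OF S j] by linarith
   qed
  qed
 qed
qed

end

abbreviation steps :: "('a \<times> real) list => ('a => real) list" where
 "steps zs \<equiv> map (%(a, s). stepf a s) zs"

lemma iterated_diff_cons: "iterated_diff (c # cs) f h = iterated_diff cs (%k. f (k + c) - f k) h"
proof (induction cs arbitrary: h)
 case (Cons a cs)
 have "h + c + a = h + a + c" by (simp add: ac_simps)
 thus ?case using Cons[of "h + a"] Cons[of h] by simp
qed simp

lemma iterated_diff_append: "iterated_diff (xs @ ys) f h = iterated_diff xs (iterated_diff ys f) h"
 by (induction xs arbitrary: h) simp_all

lemma iterated_diff_shift: "iterated_diff cs (%k. f (k + c)) h = iterated_diff cs f (h + c)"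
 by (induction cs arbitrary: h) (simp_all add: ac_simps)

lemma iterated_diff_uminus: "iterated_diff cs (%k. - f k) h = - iterated_diff cs f h"
 by (induction cs arbitrary: h) simp_all

lemma iterated_diff_steps_zero:
 assumes "!!k. (!!a. \<bar>k a - h a\<bar> <= (\<Sum>z\<leftarrow>zs. \<bar>snd z\<bar>)) ==> g k = 0"
 shows "iterated_diff (steps zs) g h = 0"
 using assms
proof (induction zs arbitrary: h)
 case Nil
 thus ?case by simp
next
 case (Cons z zs)
 have 1: "iterated_diff (steps zs) g h = 0"
  by (rule Cons.IH, rule Cons.prems) (simp add: add_increasing)
 have 2: "iterated_diff (steps zs) g (h + stepf (fst z) (snd z)) = 0"
 proof (rule Cons.IH, rule Cons.prems)
  fix k a assume k: "!!a. \<bar>k a - (h + stepf (fst z) (snd z)) a\<bar> <= (\<Sum>z\<leftarrow>zs. \<bar>snd z\<bar>)"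
  show "\<bar>k a - h a\<bar> <= (\<Sum>z\<leftarrow>z # zs. \<bar>snd z\<bar>)"
   using k[of a] by (auto simp: stepf_apply split: if_splits)
 qed
 show ?case using 1 2 by (cases z) simp
qed

text \<open>A negative step is a positive step taken from the displaced base point, with the
  opposite sign. \<open>p\<close> collects these signs, and the product of the steps changes by the
  same \<open>p\<close>. This reduces everything to nonnegative steps, where differences are volumes
  of slabs.\<close>

lemma iterated_diff_signs:
 "\<exists>h' zs' p. map fst zs' = map fst zs & (\<forall>z\<in>set zs'. 0 <= snd z) & (\<forall>z\<in>set zs'. \<exists>w\<in>set zs. snd z = \<bar>snd w\<bar>) &
   (\<forall>a. \<bar>h' a - h a\<bar> <= (\<Sum>z\<leftarrow>zs. \<bar>snd z\<bar>)) &
   iterated_diff (steps zs) f h = p * iterated_diff (steps zs') f h' &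
   (\<Prod>z\<leftarrow>zs. snd z) = p * (\<Prod>z\<leftarrow>zs'. snd z) & p * p = (1::real)"
proof (induction zs arbitrary: f h)
 case Nil
 show ?case by (rule exI[of _ h], rule exI[of _ "[]"], rule exI[of _ 1]) simp
next
 case (Cons z zs)
 obtain a s where z: "z = (a, s)" by force
 show ?case
 proof (cases "s \<ge> 0")
  case True
  obtain h' zs' p where IH: "map fst zs' = map fst zs" "\<forall>z\<in>set zs'. 0 <= snd z" "\<forall>z\<in>set zs'. \<exists>w\<in>set zs. snd z = \<bar>snd w\<bar>"
   "\<forall>a. \<bar>h' a - h a\<bar> <= (\<Sum>z\<leftarrow>zs. \<bar>snd z\<bar>)"
   "iterated_diff (steps zs) (%k. f (k + stepf a s) - f k) h = p * iterated_diff (steps zs') (%k. f (k + stepf a s) - f k) h'"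
   "(\<Prod>z\<leftarrow>zs. snd z) = p * (\<Prod>z\<leftarrow>zs'. snd z)" "p * p = 1"
   using Cons.IH[of h "%k. f (k + stepf a s) - f k"] by blast
  show ?thesis
   by (rule exI[of _ h'], rule exI[of _ "(a, s) # zs'"], rule exI[of _ p])
    (use IH True z in \<open>auto simp: iterated_diff_cons simp del: iterated_diff.simps intro: order_trans[OF _ add_increasing]\<close>)
 next
  case False
  let ?g = "%k. f (k + stepf a (- s)) - f k"
  have eq: "f (k + stepf a s) - f k = - ?g (k + stepf a s)" for k
  proof -
   have "k + stepf a s + stepf a (- s) = k" by (auto simp: fun_eq_iff stepf_apply)
   thus ?thesis by (simp only: minus_diff_eq)
  qed
  obtain h' zs' p where IH: "map fst zs' = map fst zs" "\<forall>z\<in>set zs'. 0 <= snd z" "\<forall>z\<in>set zs'. \<exists>w\<in>set zs. snd z = \<bar>snd w\<bar>"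
   "\<forall>b. \<bar>h' b - (h + stepf a s) b\<bar> <= (\<Sum>z\<leftarrow>zs. \<bar>snd z\<bar>)"
   "iterated_diff (steps zs) ?g (h + stepf a s) = p * iterated_diff (steps zs') ?g h'"
   "(\<Prod>z\<leftarrow>zs. snd z) = p * (\<Prod>z\<leftarrow>zs'. snd z)" "p * p = 1"
   using Cons.IH[of "h + stepf a s" ?g] by blast
  have 1: "iterated_diff (steps (z # zs)) f h = - iterated_diff (steps zs) ?g (h + stepf a s)"
   unfolding z list.map prod.case iterated_diff_cons eq iterated_diff_uminus
   using iterated_diff_shift[where f="?g" and c="stepf a s" and cs="steps zs" and h=h] by (simp only:)
  have 2: "iterated_diff (steps ((a, - s) # zs')) f h' = iterated_diff (steps zs') ?g h'"
   unfolding list.map prod.case iterated_diff_cons ..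
  have 3: "\<bar>h' b - h b\<bar> <= (\<Sum>z\<leftarrow>z # zs. \<bar>snd z\<bar>)" for b
   using IH(4)[rule_format, of b] by (auto simp: z stepf_apply split: if_splits)
  have 4: "iterated_diff (steps (z # zs)) f h = - (p * iterated_diff (steps ((a, - s) # zs')) f h')"
   unfolding 1 2 IH(5) ..
  show ?thesis
   by (rule exI[of _ h'], rule exI[of _ "(a, - s) # zs'"], rule exI[of _ "- p"])
    (use IH(1,2,3,6,7) False 3 4 in \<open>auto simp: z simp del: iterated_diff.simps\<close>)
 qed
qed

lemma mset_map_fst_rearrange:
 "mset (map fst zs) = mset as ==> \<exists>zs'. mset zs' = mset zs & map fst zs' = as"
proof (induction as arbitrary: zs)
 case (Cons a as)
 hence "a \<in> set (map fst zs)" by (metis list.set_intros(1) mset_eq_setD)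
 then obtain z where "z \<in> set zs" and a: "fst z = a" by auto
 then obtain us vs where zs: "zs = us @ z # vs" by (metis in_set_conv_decomp)
 have "mset (map fst (us @ vs)) = mset as" using Cons.prems a unfolding zs by simp
 from Cons.IH[OF this] obtain zs' where "mset zs' = mset (us @ vs)" "map fst zs' = as" by blast
 thus ?case using a unfolding zs by (intro exI[of _ "z # zs'"]) simp
qed simp

lemma sum_list_fun_apply: "(sum_list fs) a = (\<Sum>f\<leftarrow>fs. f a)" for fs :: "('a => real) list"
 by (induction fs) auto

lemma sum_list_distinct_single:
 "distinct bs ==> (\<Sum>b\<leftarrow>bs. if a = b then t b else (0::real)) = (if a \<in> set bs then t a else 0)"
 by (induction bs) auto

text \<open>The path from \<open>h\<close> takes one coordinate step after another and never leaves
  the box given by the total step length, so a law for single steps, valid on that box, adds up to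
  one for a whole vector.\<close>

lemma step_telescope:
 assumes "!!b k. b \<in> set bs ==> (!!a. \<bar>k a - h a\<bar> <= (\<Sum>b\<leftarrow>bs. \<bar>t b\<bar>)) ==> f (k + stepf b (t b)) - f k = c b * t b"
 shows "f (h + (\<Sum>b\<leftarrow>bs. stepf b (t b))) - f h = (\<Sum>b\<leftarrow>bs. c b * t b)"
 using assms
proof (induction bs arbitrary: h)
 case Nil
 thus ?case by simp
next
 case (Cons b bs)
 have 1: "f (h + stepf b (t b)) - f h = c b * t b"
  by (rule Cons.prems) (auto intro!: add_nonneg_nonneg sum_list_nonneg)
 have 2: "f (h + stepf b (t b) + (\<Sum>b\<leftarrow>bs. stepf b (t b))) - f (h + stepf b (t b)) = (\<Sum>b\<leftarrow>bs. c b * t b)"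
 proof (rule Cons.IH, rule Cons.prems)
  fix b' k a assume k: "!!a. \<bar>k a - (h + stepf b (t b)) a\<bar> <= (\<Sum>b\<leftarrow>bs. \<bar>t b\<bar>)"
  show "\<bar>k a - h a\<bar> <= (\<Sum>b\<leftarrow>b # bs. \<bar>t b\<bar>)"
   using k[of a] by (auto simp: stepf_apply split: if_splits)
 qed auto
 show ?case using 1 2 by (simp add: add.assoc del: plus_fun_apply)
qed

section \<open>Volumes of parallelepipeds and of slabs beyond the facets of a polytope\<close>

definition cell :: "'a::euclidean_space set => ('a => real) => 'a set" where
 "cell S f = {x. \<forall>b\<in>S. 0 < b \<bullet> x & b \<bullet> x <= f b}"

lemma cell_lmeasurable:
 fixes S :: "'a::euclidean_space set"
 assumes S: "independent S" "card S = DIM('a)" shows "cell S f \<in> lmeasurable"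
proof -
 have fin: "finite S" using S by (meson independent_imp_finite)
 have "norm x <= (\<Sum>b\<in>S. \<bar>f b\<bar> * norm (dual S b))" if x: "x \<in> cell S f" for x
 proof -
  have "x = (\<Sum>b\<in>S. (b \<bullet> x) *R dual S b)"
   by (rule inner_spanning_eq[OF S]) (use fin S in \<open>simp add: inner_sum_right dual_works if_distrib cong: if_cong\<close>)
  hence "norm x <= (\<Sum>b\<in>S. norm ((b \<bullet> x) *R dual S b))" by (metis norm_sum)
  also have "... <= (\<Sum>b\<in>S. \<bar>f b\<bar> * norm (dual S b))"
   using x by (intro sum_mono) (auto simp: cell_def intro!: mult_right_mono)
  finally show ?thesis .
 qed
 hence "bounded (cell S f)" unfolding bounded_iff by blast
 moreover have "cell S f \<in> sets lebesgue"
 proof -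
  have "cell S f = {x. \<forall>b\<in>S. 0 < b \<bullet> x} \<inter> {x. \<forall>b\<in>S. b \<bullet> x <= f b}" by (auto simp: cell_def)
  moreover have "open (\<Inter>b\<in>S. {x. 0 < b \<bullet> x})" using fin by (intro open_INT) (auto simp: open_halfspace_gt)
  moreover have "closed (\<Inter>b\<in>S. {x. b \<bullet> x <= f b})" by (auto simp: closed_halfspace_le)
  moreover have "{x. \<forall>b\<in>S. 0 < b \<bullet> x} = (\<Inter>b\<in>S. {x. 0 < b \<bullet> x})" "{x. \<forall>b\<in>S. b \<bullet> x <= f b} = (\<Inter>b\<in>S. {x. b \<bullet> x <= f b})" by auto
  ultimately show ?thesis by (auto intro!: sets.Int sets_completionI_sets borel_open borel_closed)
 qed
 ultimately show ?thesis by (rule bounded_set_imp_lmeasurable)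
qed

text \<open>Cells are half-open, so a cell of side \<open>s + t\<close> is the disjoint union of one
  of side \<open>s\<close> and a translate of one of side \<open>t\<close>. The volume is thus
  additive and nonnegative in each side, hence proportional to it; the induction rescales the sides
  in \<open>T\<close> one after another.\<close>

lemma vol_cell:
 fixes S :: "'a::euclidean_space set"
 assumes S: "independent S" "card S = DIM('a)" and f: "!!b. b \<in> S ==> 0 <= f b"
 shows "vol (cell S f) = (\<Prod>b\<in>S. f b) * vol (cell S (%b. 1))"
proof -
 have fin: "finite S" using S by (meson independent_imp_finite)
 have "vol (cell S (%b. if b \<in> T then f b else 1)) = (\<Prod>b\<in>T. f b) * vol (cell S (%b. 1))" if "T \<subseteq> S" "finite T" for T
  using that(2,1)
 proof (induction T rule: finite_induct)
  case empty
  thus ?case by simp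
 next
  case (insert c T)
  let ?k = "%b. if b \<in> T then f b else 1"
  let ?g = "%s. vol (cell S (?k(c := s)))"
  have add: "?g (s + t) = ?g s + ?g t" if st: "0 <= s" "0 <= t" for s t
  proof -
   have d: "b \<bullet> dual S c = (if b = c then 1 else 0)" if "b \<in> S" for b using dual_works[OF S(1) that] .
   have "cell S (?k(c := s + t)) = cell S (?k(c := s)) \<union> (+) (s *R dual S c) ` cell S (?k(c := t))"
   proof (intro set_eqI iffI)
    fix x assume x: "x \<in> cell S (?k(c := s + t))"
    show "x \<in> cell S (?k(c := s)) \<union> (+) (s *R dual S c) ` cell S (?k(c := t))"
    proof (cases "c \<bullet> x <= s")
     case True
     thus ?thesis using x by (auto simp: cell_def split: if_splits)
    next
     case False
     hence "x - s *R dual S c \<in> cell S (?k(c := t))"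
      using x d by (auto simp: cell_def inner_diff_right split: if_splits)
     hence "s *R dual S c + (x - s *R dual S c) \<in> (+) (s *R dual S c) ` cell S (?k(c := t))" by blast
     thus ?thesis by simp
    qed
   next
    fix x assume "x \<in> cell S (?k(c := s)) \<union> (+) (s *R dual S c) ` cell S (?k(c := t))"
    thus "x \<in> cell S (?k(c := s + t))"
     using st d insert.prems by (auto simp: cell_def inner_add_right split: if_splits)
   qed
   moreover have "cell S (?k(c := s)) \<inter> (+) (s *R dual S c) ` cell S (?k(c := t)) = {}"
    using d[of c] insert.prems by (force simp: cell_def inner_add_right)
   ultimately show ?thesis
    using cell_lmeasurable[OF S] measurable_translation[OF cell_lmeasurable[OF S]]
    by (simp add: measure_Un3 measure_translation)
  qed
  have "?g (f c) = f c * ?g 1"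
   by (rule additive_nonneg_linear[OF add]) (use f insert.prems in auto)
  moreover have "(%b. if b \<in> insert c T then f b else 1) = ?k(c := f c)" "?k(c := 1) = ?k"
   using insert.hyps by (auto simp: fun_eq_iff)
  ultimately show ?case using insert by simp
 qed
 from this[of S] fin have "vol (cell S (%b. if b \<in> S then f b else 1)) = (\<Prod>b\<in>S. f b) * vol (cell S (%b. 1))" by simp
 moreover have "cell S (%b. if b \<in> S then f b else 1) = cell S f" by (auto simp: cell_def)
 ultimately show ?thesis by simp
qed

lemma vol_pos_of_open:
 fixes X :: "'a::euclidean_space set"
 assumes "X \<in> lmeasurable" "open U" "U ~= {}" "U \<subseteq> X" shows "vol X > 0"
proof -
 have "\<not> negligible X" using open_not_negligible[OF assms(2,3)] negligible_subset assms(4) by blast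
 thus ?thesis using assms(1) by (metis completion.null_sets_outer measure_le_0_iff negligible_iff_measure not_le_imp_less)
qed

lemma vol_cell_pos:
 fixes S :: "'a::euclidean_space set"
 assumes S: "independent S" "card S = DIM('a)" shows "0 < vol (cell S (%b. 1))"
proof (rule vol_pos_of_open[OF cell_lmeasurable[OF S]])
 have fin: "finite S" using S by (meson independent_imp_finite)
 have "open (\<Inter>b\<in>S. {x. 0 < b \<bullet> x} \<inter> {x. b \<bullet> x < 1})" using fin by (intro open_INT) (auto simp: open_halfspace_gt open_halfspace_lt)
 moreover have "(\<Inter>b\<in>S. {x. 0 < b \<bullet> x} \<inter> {x. b \<bullet> x < 1}) = {x. \<forall>b\<in>S. 0 < b \<bullet> x & b \<bullet> x < 1}" by auto
 ultimately show "open {x. \<forall>b\<in>S. 0 < b \<bullet> x & b \<bullet> x < 1}" by simp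
 have "(\<Sum>b\<in>S. (1/2) *R dual S b) \<in> {x. \<forall>b\<in>S. 0 < b \<bullet> x & b \<bullet> x < 1}"
  using fin S by (simp add: inner_sum_right dual_works if_distrib cong: if_cong)
 thus "{x. \<forall>b\<in>S. 0 < b \<bullet> x & b \<bullet> x < 1} ~= {}" by blast
qed (auto simp: cell_def)

context simplicial_fan
begin

definition pvol :: "('a => real) => real" where "pvol h = vol (P h)"

text \<open>The points of the enlarged polytope that lie beyond every listed facet. For distinct
  facets and nonnegative steps this is the set whose volume is the mixed difference, by repeated set
  difference.\<close>

definition slab :: "('a => real) => ('a \<times> real) list => 'a set" where
 "slab h zs = {x. (\<forall>a\<in>A. a \<bullet> x <= h a + (\<Sum>(b, s)\<leftarrow>zs. if a = b then s else 0)) & (\<forall>(a, s)\<in>set zs. h a < a \<bullet> x)}"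

lemma slab_lmeasurable: "slab h zs \<in> lmeasurable"
proof -
 have eq: "slab h zs = P (%a. h a + (\<Sum>(b, s)\<leftarrow>zs. if a = b then s else 0)) \<inter> (\<Inter>(a,s)\<in>set zs. {x. h a < a \<bullet> x})"
  by (auto simp: slab_def polyh_def)
 have "open (\<Inter>(a,s)\<in>set zs. {x. h a < a \<bullet> x})" by (intro open_INT) (auto simp: open_halfspace_gt)
 thus ?thesis unfolding eq
  by (intro fmeasurable_Int_fmeasurable lmeasurable_compact compact_polyh sets_completionI_sets) auto
qed

lemma slab_coeff_notin: "a \<notin> fst ` set zs ==> (\<Sum>(b, s)\<leftarrow>zs. if a = b then s else (0::real)) = 0"
 by (induction zs) auto

lemma slab_coeff_in: "distinct (map fst zs) ==> (a, s) \<in> set zs ==> (\<Sum>(b, s)\<leftarrow>zs. if a = b then s else (0::real)) = s"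
 by (induction zs) (force simp: slab_coeff_notin)+

lemma iterated_diff_slab:
 assumes "distinct (map fst zs)" "fst ` set zs \<subseteq> A" "\<forall>z\<in>set zs. 0 <= snd z"
 shows "iterated_diff (steps zs) pvol h = vol (slab h zs)"
 using assms
proof (induction zs arbitrary: h)
 case Nil
 thus ?case by (simp add: pvol_def slab_def polyh_def)
next
 case (Cons z zs)
 obtain a s where z: "z = (a, s)" by force
 have a: "a \<notin> fst ` set zs" "a \<in> A" "0 <= s" using Cons.prems by (auto simp: z)
 define f where "f b = (\<Sum>(c, t)\<leftarrow>zs. if b = c then t else (0::real))" for b
 have fa: "f a = 0" using slab_coeff_notin[OF a(1)] by (simp add: f_def)
 have ne: "b ~= a" if "(b, t) \<in> set zs" for b t using that a(1) by force
 have 1: "x \<in> slab (h + stepf a s) zs \<longleftrightarrow> (\<forall>b\<in>A. b \<bullet> x <= h b + (if b = a then s else 0) + f b) & (\<forall>(b, t)\<in>set zs. h b < b \<bullet> x)" for x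
  unfolding slab_def f_def[symmetric] using ne by (simp add: stepf_apply case_prod_unfold) fastforce
 have 2: "x \<in> slab h zs \<longleftrightarrow> (\<forall>b\<in>A. b \<bullet> x <= h b + f b) & (\<forall>(b, t)\<in>set zs. h b < b \<bullet> x)" for x
  unfolding slab_def f_def[symmetric] by simp
 have 3: "x \<in> slab h (z # zs) \<longleftrightarrow> (\<forall>b\<in>A. b \<bullet> x <= h b + (if b = a then s else 0) + f b) & h a < a \<bullet> x & (\<forall>(b, t)\<in>set zs. h b < b \<bullet> x)" for x
  unfolding slab_def z list.map list.set sum_list.Cons prod.case f_def[symmetric] by (auto simp: add.assoc)
 have sub: "slab h zs \<subseteq> slab (h + stepf a s) zs"
  unfolding subset_iff 1 2 using a(3) by force
 have eq: "slab (h + stepf a s) zs - slab h zs = slab h (z # zs)"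
 proof (intro set_eqI iffI)
  fix x assume "x \<in> slab (h + stepf a s) zs - slab h zs"
  hence x: "\<forall>b\<in>A. b \<bullet> x <= h b + (if b = a then s else 0) + f b" "\<forall>(b, t)\<in>set zs. h b < b \<bullet> x" "\<exists>b\<in>A. h b + f b < b \<bullet> x"
   unfolding Diff_iff 1 2 by force+
  then obtain b where "b \<in> A" "h b + f b < b \<bullet> x" by blast
  moreover from this have "b = a" using x(1) by (metis add.right_neutral linorder_not_less)
  ultimately show "x \<in> slab h (z # zs)" unfolding 3 using x fa by auto
 next
  fix x assume "x \<in> slab h (z # zs)"
  thus "x \<in> slab (h + stepf a s) zs - slab h zs"
   unfolding Diff_iff 1 2 3 using fa a(2) by force
 qed
 have "iterated_diff (steps (z # zs)) pvol h = vol (slab (h + stepf a s) zs) - vol (slab h zs)"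
  using Cons by (simp add: z)
 also have "... = vol (slab (h + stepf a s) zs - slab h zs)"
  using measurable_measure_Diff[OF slab_lmeasurable fmeasurableD[OF slab_lmeasurable] sub] by simp
 finally show ?case unfolding eq .
qed

text \<open>A point \<open>x\<close> of the slab becomes a common point of the listed facets once
  their support numbers are replaced by \<open>a \<bullet> x\<close>. This moves them by at most
  \<open>r\<close>, hence stays in the chamber, where only faces have common points.\<close>

lemma slab_empty:
 assumes box: "supp_box A h r \<subseteq> chamber" and zs: "distinct (map fst zs)" "fst ` set zs \<subseteq> A" "\<forall>z\<in>set zs. 0 <= snd z & snd z <= r"
  and r: "0 <= r" and J: "fst ` set zs \<notin> faces"
 shows "slab h zs = {}"
proof (rule ccontr)
 assume "slab h zs ~= {}"
 then obtain x where x: "x \<in> slab h zs" by blast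
 define k where "k = (%a. if a \<in> fst ` set zs then a \<bullet> x else h a)"
 have on: "h a < a \<bullet> x & a \<bullet> x <= h a + s" if "(a, s) \<in> set zs" for a s
 proof -
  have "a \<in> A" using that zs(2) by force
  thus ?thesis using x that slab_coeff_in[OF zs(1) that] unfolding slab_def by fastforce
 qed
 have off: "a \<bullet> x <= h a" if "a \<in> A" "a \<notin> fst ` set zs" for a
  using x that slab_coeff_notin[OF that(2)] by (force simp: slab_def)
 have "k \<in> supp_box A h r" using on zs r by (fastforce simp: supp_box_def k_def)
 hence "k \<in> chamber" using box by blast
 thus False using tight_set_face[of k x "fst ` set zs"] J zs off by (force simp: k_def polyh_def)
qed

text \<open>Each point of the parallelepiped at the vertex is itself the vertex of a polytope with
  nearby support numbers. These still lie in the chamber, so the inequalities of all other facets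
  hold automatically and the slab is the whole parallelepiped.\<close>

lemma slab_basis:
 assumes box: "supp_box A h r \<subseteq> chamber" and zs: "distinct (map fst zs)" "\<forall>z\<in>set zs. 0 <= snd z & snd z <= r"
  and r: "0 <= r" and S: "fst ` set zs \<in> BB"
 shows "vol (slab h zs) = (\<Prod>z\<leftarrow>zs. snd z) * vol (cell (fst ` set zs) (%b. 1))"
proof -
 let ?S = "fst ` set zs"
 define f where "f a = (\<Sum>(b, s)\<leftarrow>zs. if a = b then s else (0::real))" for a
 have f: "f a = s" if "(a, s) \<in> set zs" for a s using slab_coeff_in[OF zs(1) that] by (simp add: f_def)
 have f0: "f a = 0" if "a \<notin> ?S" for a using slab_coeff_notin[OF that] by (simp add: f_def)
 have bas: "?S \<subseteq> A" "independent ?S" "card ?S = DIM('a)" using basis[OF S] by auto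
 have "slab h zs = (+) (vertex ?S h) ` cell ?S f"
 proof (intro set_eqI iffI)
  fix x assume x: "x \<in> slab h zs"
  have "x - vertex ?S h \<in> cell ?S f"
   using x bas(1) vertex_inner[OF S] unfolding cell_def slab_def f_def[symmetric]
   by (auto simp: inner_diff_right) (smt (verit, best) f imageI fst_conv subsetD case_prodD)+
  hence "vertex ?S h + (x - vertex ?S h) \<in> (+) (vertex ?S h) ` cell ?S f" by blast
  thus "x \<in> (+) (vertex ?S h) ` cell ?S f" by simp
 next
  fix x assume "x \<in> (+) (vertex ?S h) ` cell ?S f"
  hence x: "h b < b \<bullet> x & b \<bullet> x <= h b + f b" if "b \<in> ?S" for b
   using vertex_inner[OF S that] that by (auto simp: cell_def inner_add_right)
  define k where "k = (%a. if a \<in> ?S then a \<bullet> x else h a)"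
  have "f b <= r" if "b \<in> ?S" for b using that f zs(2) by fastforce
  hence "k \<in> supp_box A h r" using x r by (fastforce simp: supp_box_def k_def)
  hence k: "k \<in> chamber" using box by blast
  have "x = vertex ?S k" by (rule vertex_eqI[OF S]) (simp add: k_def)
  hence "j \<bullet> x < h j" if "j \<in> A - ?S" for j using k S that by (auto simp: chamber_def k_def split: if_splits)
  thus "x \<in> slab h zs"
   using x f0 unfolding slab_def f_def[symmetric] by (force simp: less_imp_le)
 qed
 hence "vol (slab h zs) = vol (cell ?S f)" by (simp add: measure_translation)
 also have "... = (\<Prod>b\<in>?S. f b) * vol (cell ?S (%b. 1))"
  using zs(2) f by (intro vol_cell bas) force
 also have "(\<Prod>b\<in>?S. f b) = (\<Prod>b\<leftarrow>map fst zs. f b)" using prod.distinct_set_conv_list[OF zs(1), of f] by simp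
 also have "... = (\<Prod>z\<leftarrow>zs. snd z)" using f by (auto simp: o_def intro!: arg_cong[where f=prod_list])
 finally show ?thesis .
qed

text \<open>For n entries, \<open>m\<close> is the n-th mixed partial derivative of the volume as a
  polynomial in the support numbers. Steps are measured against the radius \<open>r\<close> of a box
  inside the chamber, which makes one \<open>\<delta>\<close> serve the entire chamber.\<close>

definition const_diff :: "'a list => real => bool" where
 "const_diff as m \<longleftrightarrow> (\<exists>\<delta>>0. \<forall>h r zs. map fst zs = as & 0 < r & supp_box A h r \<subseteq> chamber & (\<forall>z\<in>set zs. \<bar>snd z\<bar> <= \<delta> * r) -->
   iterated_diff (steps zs) pvol h = m * (\<Prod>z\<leftarrow>zs. snd z))"

lemma supp_box_subset: "(!!a. a \<in> A ==> \<bar>k a - h a\<bar> <= r - s) ==> supp_box A k s \<subseteq> supp_box A h r"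
 by (fastforce simp: supp_box_def)

lemma const_diff_perm:
 assumes "const_diff as m" "mset as = mset bs" shows "const_diff bs m"
proof -
 obtain \<delta> where d: "\<delta> > 0" "!!h r zs. map fst zs = as ==> 0 < r ==> supp_box A h r \<subseteq> chamber ==> \<forall>z\<in>set zs. \<bar>snd z\<bar> <= \<delta> * r ==>
   iterated_diff (steps zs) pvol h = m * (\<Prod>z\<leftarrow>zs. snd z)" using assms(1) unfolding const_diff_def by blast
 show ?thesis unfolding const_diff_def
 proof (intro exI[of _ \<delta>] conjI d(1) allI impI, elim conjE)
  fix h r zs assume zs: "map fst zs = bs" "0 < r" "supp_box A h r \<subseteq> chamber" "\<forall>z\<in>set zs. \<bar>snd z\<bar> <= \<delta> * r"
  obtain zs' where zs': "mset zs' = mset zs" "map fst zs' = as"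
   using mset_map_fst_rearrange[of zs as] zs(1) assms(2) by auto
  have "set zs' = set zs" using zs'(1) by (metis mset_eq_setD)
  hence "iterated_diff (steps zs') pvol h = m * (\<Prod>z\<leftarrow>zs'. snd z)" using d(2)[OF zs'(2) zs(2,3)] zs(4) by simp
  moreover have "iterated_diff (steps zs') pvol h = iterated_diff (steps zs) pvol h"
   by (rule iterated_diff_perm) (simp add: zs'(1))
  moreover have "(\<Prod>z\<leftarrow>zs'. snd z) = (\<Prod>z\<leftarrow>zs. snd z)"
   using zs'(1) by (metis mset_map prod_mset_prod_list)
  ultimately show "iterated_diff (steps zs) pvol h = m * (\<Prod>z\<leftarrow>zs. snd z)" by simp
 qed
qed

lemma const_diff_of_nonneg:
 assumes len: "length as > 0" and H: "!!h r zs. map fst zs = as ==> 0 < r ==> supp_box A h r \<subseteq> chamber ==> \<forall>z\<in>set zs. 0 <= snd z & snd z <= r / real (length as) ==>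
   iterated_diff (steps zs) pvol h = m * (\<Prod>z\<leftarrow>zs. snd z)"
 shows "const_diff as m"
 unfolding const_diff_def
\<comment> \<open>The factor 2 leaves room for reversing signs: this displaces the base point by at
  most \<open>r / 2\<close>, around which a box of radius \<open>r / 2\<close> remains.\<close>
proof (intro exI[of _ "1 / (2 * real (length as))"] conjI allI impI, goal_cases)
 case 1
 thus ?case using len by simp
next
 case (2 h r zs)
 hence zs: "map fst zs = as" "0 < r" "supp_box A h r \<subseteq> chamber" "\<forall>z\<in>set zs. \<bar>snd z\<bar> <= 1 / (2 * real (length as)) * r" by auto
 let ?n = "real (length as)"
 obtain h' zs' p where s: "map fst zs' = map fst zs" "\<forall>z\<in>set zs'. 0 <= snd z" "\<forall>z\<in>set zs'. \<exists>w\<in>set zs. snd z = \<bar>snd w\<bar>"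
   "\<forall>a. \<bar>h' a - h a\<bar> <= (\<Sum>z\<leftarrow>zs. \<bar>snd z\<bar>)"
   "iterated_diff (steps zs) pvol h = p * iterated_diff (steps zs') pvol h'"
   "(\<Prod>z\<leftarrow>zs. snd z) = p * (\<Prod>z\<leftarrow>zs'. snd z)" "p * p = 1"
  using iterated_diff_signs[of zs h pvol] by blast
 have "(\<Sum>z\<leftarrow>zs. \<bar>snd z\<bar>) <= (\<Sum>z\<leftarrow>zs. r / (2 * ?n))" using zs(4) by (intro sum_list_mono) auto
 also have "... = real (length zs) * (r / (2 * ?n))" by (simp only: sum_list_triv)
 also have "length zs = length as" using zs(1) by (metis length_map)
 also have "?n * (r / (2 * ?n)) = r / 2" using len by simp
 finally have sl: "(\<Sum>z\<leftarrow>zs. \<bar>snd z\<bar>) <= r / 2" .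
 have "supp_box A h' (r/2) \<subseteq> supp_box A h r"
 proof (rule supp_box_subset)
  fix a show "\<bar>h' a - h a\<bar> <= r - r/2" using s(4)[rule_format, of a] sl by linarith
 qed
 hence 2: "supp_box A h' (r/2) \<subseteq> chamber" using zs(3) by blast
 have "\<forall>z\<in>set zs'. 0 <= snd z & snd z <= r / 2 / ?n" using s(2,3) zs(4) by fastforce
 hence "iterated_diff (steps zs') pvol h' = m * (\<Prod>z\<leftarrow>zs'. snd z)" using H[OF _ _ 2] s(1) zs by simp
 thus ?case using s(5-7) by (metis mult.assoc mult.commute)
qed

lemma pvol_translate: "pvol (h + (%a. if a \<in> A then a \<bullet> v else 0)) = pvol h"
proof -
 have "P (h + (%a. if a \<in> A then a \<bullet> v else 0)) = (+) v ` P h"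
 proof (intro set_eqI iffI)
  fix x assume "x \<in> P (h + (%a. if a \<in> A then a \<bullet> v else 0))"
  hence "x - v \<in> P h" by (auto simp: polyh_def inner_diff_right)
  hence "v + (x - v) \<in> (+) v ` P h" by blast
  thus "x \<in> (+) v ` P h" by simp
 qed (auto simp: polyh_def inner_add_right)
 thus ?thesis by (simp add: pvol_def measure_translation)
qed

lemma iterated_diff_translate: "iterated_diff cs pvol (h + (%a. if a \<in> A then a \<bullet> v else 0)) = iterated_diff cs pvol h"
proof (induction cs arbitrary: h)
 case (Cons c cs)
 let ?t = "%a. if a \<in> A then a \<bullet> v else 0"
 have "h + ?t + c = h + c + ?t" by (simp only: ac_simps)
 thus ?case using Cons[of "h + c"] Cons[of h] by (simp only: iterated_diff.simps)
qed (simp add: pvol_translate)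

end

lemma set_plus_mono_translate: "x \<in> X ==> (+) x ` Y \<subseteq> X + Y" for x :: "'a::plus"
 by auto

lemma bodyD: "convex_body K ==> compact K" "convex_body K ==> convex K" "convex_body K ==> K ~= {}"
 by (simp_all add: convex_body_def)

lemma body_lmeasurable: "convex_body K ==> K \<in> lmeasurable"
 by (simp add: convex_body_def lmeasurable_compact)

lemma body_plus: "convex_body K ==> convex_body L ==> convex_body (K + L)"
 by (auto simp: convex_body_def compact_set_plus convex_set_plus)

lemma body_dilate: "convex_body K ==> convex_body (t \<odot> K)"
 by (auto simp: convex_body_def compact_scaling convex_scaling)

lemma body_singleton [simp]: "convex_body {x}"
 by (auto simp: convex_body_def)

lemma vol_plus_dilate_tendsto:
 fixes X Y :: "'a::euclidean_space set"
 assumes X: "convex_body X" and Y: "convex_body Y"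
 shows "((%t. vol (Y + t \<odot> X)) \<longlongrightarrow> vol Y) (at_right 0)"
proof (rule order_tendstoI)
 have mono: "vol Y <= vol (Y + t \<odot> X)" for t
 proof -
  obtain x where "x \<in> X" using X by (auto simp: convex_body_def)
  hence "(+) (t *R x) ` Y \<subseteq> t \<odot> X + Y" by (intro set_plus_mono_translate) auto
  hence "vol ((+) (t *R x) ` Y) <= vol (t \<odot> X + Y)"
   using X Y by (intro vol_mono measurable_translation body_lmeasurable body_plus body_dilate)
  thus ?thesis by (metis measure_translation add.commute)
 qed
 fix a assume "a < vol Y"
 hence "a < vol (Y + t \<odot> X)" for t using mono order_less_le_trans by blast
 thus "\<forall>\<^sub>F t in at_right 0. a < vol (Y + t \<odot> X)" by simp
next
 fix a assume a: "vol Y < a"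
 obtain e where e: "e > 0" "vol (Y + cball 0 e) < vol Y + (a - vol Y)"
  using vol_thicken[of Y "a - vol Y"] a Y by (auto simp: convex_body_def)
 obtain R where R: "R > 0" "!!x. x \<in> X ==> norm x <= R"
  using X compact_imp_bounded bounded_pos by (metis bodyD(1))
 have "vol (Y + t \<odot> X) < a" if t: "0 < t" "t < e / R" for t
 proof -
  have "t \<odot> X \<subseteq> cball 0 e"
  proof
   fix y assume "y \<in> t \<odot> X"
   then obtain x where "y = t *R x" "x \<in> X" by auto
   moreover from this have "t * norm x <= t * R" using R t by (intro mult_left_mono) auto
   moreover have "t * R < e" using t R by (simp add: field_simps)
   ultimately have "norm y <= e" using t by (simp only: norm_scaleR abs_of_pos)
   thus "y \<in> cball 0 e" by simp
  qed
  hence "vol (Y + t \<odot> X) <= vol (Y + cball 0 e)"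
   using X Y by (intro vol_mono set_plus_mono2 body_lmeasurable body_plus body_dilate)
    (auto simp: convex_body_def e less_imp_le[OF e(1)])
  thus ?thesis using e by simp
 qed
 thus "\<forall>\<^sub>F t in at_right 0. vol (Y + t \<odot> X) < a"
  using e R by (auto simp: eventually_at_right_field intro!: exI[of _ "e / R"])
qed

lemma iterated_diff_vol_tendsto:
 fixes X Y :: "'a::euclidean_space set"
 assumes X: "convex_body X" and "convex_body Y" "\<forall>K\<in>set Ks. convex_body K"
 shows "((%t. iterated_diff Ks vol (Y + t \<odot> X)) \<longlongrightarrow> iterated_diff Ks vol Y) (at_right 0)"
 using assms(2,3)
proof (induction Ks arbitrary: Y)
 case Nil
 thus ?case using vol_plus_dilate_tendsto[OF X] by simp
next
 case (Cons K Ks)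
 have "((%t. iterated_diff Ks vol (Y + K + t \<odot> X) - iterated_diff Ks vol (Y + t \<odot> X)) \<longlongrightarrow> iterated_diff Ks vol (Y + K) - iterated_diff Ks vol Y) (at_right 0)"
  using Cons by (intro tendsto_diff Cons.IH body_plus) auto
 moreover have "Y + K + t \<odot> X = Y + t \<odot> X + K" for t by (simp add: ac_simps)
 ultimately show ?case by simp
qed

context simplicial_fan
begin

lemma faces_independent: "J \<in> faces ==> independent J & J \<subseteq> A"
 unfolding faces_def using basis independent_mono by blast

text \<open>The differences in the distinct directions \<open>ds\<close> are volumes of empty slabs
  at every base point that the differences in the repeated directions \<open>rs\<close> can reach,
  so they vanish there identically.\<close>

lemma const_diff_not_face:
 assumes as: "set as \<subseteq> A" "set as \<notin> faces" shows "const_diff as 0"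
proof -
 have ne: "as ~= []" using as BB_nonempty by (auto simp: faces_def)
 obtain ds rs where dr: "distinct ds" "set ds = set as" "mset as = mset (rs @ ds)"
 proof -
  have "mset (remdups as) \<subseteq># mset as" by (rule mset_remdups_subset_eq)
  then obtain N where "mset as = mset (remdups as) + N" by (metis subset_mset.le_iff_add)
  moreover obtain rs where "mset rs = N" using ex_mset by blast
  ultimately show ?thesis using that[of "remdups as" rs] by simp
 qed
 have ds: "ds ~= []" using dr(2) ne by auto
 have "const_diff (rs @ ds) 0"
 proof (rule const_diff_of_nonneg)
  show "0 < length (rs @ ds)" using ds by simp
  fix h r zs
  let ?e = "r / real (length (rs @ ds))"
  assume zs: "map fst zs = rs @ ds" "0 < r" "supp_box A h r \<subseteq> chamber" "\<forall>z\<in>set zs. 0 <= snd z & snd z <= ?e"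
  define zr where "zr = take (length rs) zs"
  define zd where "zd = drop (length rs) zs"
  have z: "zs = zr @ zd" "map fst zr = rs" "map fst zd = ds"
   using zs(1) by (simp_all add: zr_def zd_def take_map[symmetric] drop_map[symmetric])
  have st: "fst ` set zd = set as" using dr(2) z(3) by (metis list.set_map)
  have dz: "distinct (map fst zd)" using z(3) dr(1) by simp
  have nn: "\<forall>z\<in>set zd. 0 <= snd z & snd z <= ?e" using zs(4) z(1) by auto
  have e: "0 <= ?e" using zs(2) by simp
  have "iterated_diff (steps zr) (iterated_diff (steps zd) pvol) h = 0"
  proof (rule iterated_diff_steps_zero)
   fix k assume k: "!!a. \<bar>k a - h a\<bar> <= (\<Sum>z\<leftarrow>zr. \<bar>snd z\<bar>)"
   have "(\<Sum>z\<leftarrow>zr. \<bar>snd z\<bar>) <= (\<Sum>z\<leftarrow>zr. ?e)" using zs(4) z(1) by (intro sum_list_mono) auto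
   also have "... = real (length rs) * ?e" unfolding sum_list_triv using z(2) by (metis length_map)
   also have "... <= r - ?e"
   proof -
    have "(real (length rs) + 1) * ?e <= real (length (rs @ ds)) * ?e"
     using ds zs(2) by (intro mult_right_mono) (cases ds; simp)+
    also have "... = r" using ds by (cases ds) simp_all
    finally show ?thesis unfolding distrib_right by linarith
   qed
   finally have "supp_box A k ?e \<subseteq> supp_box A h r" using k order_trans by (intro supp_box_subset) blast
   hence "slab k zd = {}"
    using slab_empty[OF _ dz _ nn e] zs(3) as unfolding st by blast
   thus "iterated_diff (steps zd) pvol k = 0"
    using iterated_diff_slab[OF dz] st as(1) nn by simp
  qed
  thus "iterated_diff (steps zs) pvol h = 0 * (\<Prod>z\<leftarrow>zs. snd z)"
   by (simp add: z(1) iterated_diff_append)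
 qed
 thus ?thesis using const_diff_perm dr(3) by simp
qed

lemma const_diff_basis:
 assumes as: "distinct as" "set as \<in> BB" shows "const_diff as (vol (cell (set as) (%b. 1)))"
proof (rule const_diff_of_nonneg)
 have len: "length as = DIM('a)" using basis[OF as(2)] as(1) by (simp add: distinct_card)
 thus l0: "0 < length as" by simp
 fix h r zs
 assume zs: "map fst zs = as" "0 < r" "supp_box A h r \<subseteq> chamber" "\<forall>z\<in>set zs. 0 <= snd z & snd z <= r / real (length as)"
 have st: "fst ` set zs = set as" unfolding zs(1)[symmetric] by simp
 have "r / real (length as) <= r" using zs(2) l0 by (simp add: field_simps Suc_le_eq)
 hence "\<forall>z\<in>set zs. 0 <= snd z & snd z <= r" using zs(4) by force
 hence "vol (slab h zs) = (\<Prod>z\<leftarrow>zs. snd z) * vol (cell (fst ` set zs) (%b. 1))"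
  using zs as st by (intro slab_basis[OF zs(3)]) auto
 moreover have "iterated_diff (steps zs) pvol h = vol (slab h zs)"
  using zs as st basis[OF as(2)] by (intro iterated_diff_slab) auto
 ultimately show "iterated_diff (steps zs) pvol h = vol (cell (set as) (%b. 1)) * (\<Prod>z\<leftarrow>zs. snd z)"
  using st by simp
qed

text \<open>Translation invariance eliminates a repeated direction. With
  \<open>a \<bullet> v = 1\<close> and \<open>v\<close> orthogonal to the other normals in
  \<open>rs\<close>, translation by \<open>s *R v\<close> moves facet \<open>a\<close> by
  \<open>s\<close>, keeps the rest of the face and moves the outer facets \<open>b\<close> by
  \<open>s * (b \<bullet> v)\<close>. The total change is zero, so the difference in direction
  \<open>a\<close> is minus the sum of those in the directions \<open>b\<close>.\<close>

lemma const_diff_step: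
 assumes rest: "set rs \<in> faces" "a \<in> set rs"
  and IH: "!!b. b \<in> A - set rs ==> const_diff (b # rs) (m b)"
 shows "\<exists>m. const_diff (a # rs) m"
proof -
 let ?J = "set rs"
 have J: "independent ?J" "?J \<subseteq> A" using faces_independent rest by auto
 obtain v where v: "!!b. b \<in> ?J ==> b \<bullet> v = (if b = a then 1 else 0)"
  using independent_interpolate[OF J(1), of "%b. if b = a then 1 else 0"] by blast
 obtain bs where bs: "set bs = A - ?J" "distinct bs" using finite_distinct_list finite_A by (metis finite_Diff)
 have "\<forall>b\<in>set bs. \<exists>\<delta>>0. \<forall>h r zs. map fst zs = b # rs & 0 < r & supp_box A h r \<subseteq> chamber & (\<forall>z\<in>set zs. \<bar>snd z\<bar> <= \<delta> * r) -->
   iterated_diff (steps zs) pvol h = m b * (\<Prod>z\<leftarrow>zs. snd z)"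
  using IH bs unfolding const_diff_def by auto
 then obtain d where d: "!!b. b \<in> set bs ==> d b > 0" "!!b h r zs. b \<in> set bs ==> map fst zs = b # rs ==> 0 < r ==> supp_box A h r \<subseteq> chamber ==> (\<forall>z\<in>set zs. \<bar>snd z\<bar> <= d b * r) ==>
   iterated_diff (steps zs) pvol h = m b * (\<Prod>z\<leftarrow>zs. snd z)" by metis
 define D where "D = Min (insert 1 (d ` set bs))"
 have D: "0 < D" "D <= 1" "!!b. b \<in> set bs ==> D <= d b" unfolding D_def using d(1) by auto
 define V where "V = (\<Sum>b\<leftarrow>bs. \<bar>b \<bullet> v\<bar>)"
 have V: "0 <= V" "!!b. b \<in> set bs ==> \<bar>b \<bullet> v\<bar> <= V"
  unfolding V_def by (auto intro!: sum_list_nonneg member_le_sum_list)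
 let ?\<delta> = "D / (2 * (1 + V))"
 have dpos: "0 < ?\<delta>" using D V by auto
 have "const_diff (a # rs) (- (\<Sum>b\<leftarrow>bs. m b * (b \<bullet> v)))"
  unfolding const_diff_def
 proof (intro exI[of _ ?\<delta>] conjI dpos allI impI, elim conjE)
  fix h r zs0 assume zs: "map fst zs0 = a # rs" "0 < r" "supp_box A h r \<subseteq> chamber" "\<forall>z\<in>set zs0. \<bar>snd z\<bar> <= ?\<delta> * r"
  obtain s zr where z: "zs0 = (a, s) # zr" "map fst zr = rs" using zs(1) by (cases zs0) auto
  define f where "f = iterated_diff (steps zr) pvol"
  let ?t = "%b. s * (b \<bullet> v)"
  let ?h = "h + stepf a s"
  have small: "\<bar>s\<bar> * (1 + V) <= D * r / 2"
   using zs(4) V by (simp add: z field_simps)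
  have sumt: "(\<Sum>b\<leftarrow>bs. \<bar>?t b\<bar>) = \<bar>s\<bar> * V" by (simp add: V_def abs_mult sum_list_const_mult)
  have Dr: "D * r <= r" using D zs(2) by simp
  have "f (?h + (\<Sum>b\<leftarrow>bs. stepf b (?t b))) - f ?h = (\<Sum>b\<leftarrow>bs. (m b * (\<Prod>z\<leftarrow>zr. snd z)) * ?t b)"
  proof (rule step_telescope)
   fix b k assume b: "b \<in> set bs" and k: "!!c. \<bar>k c - ?h c\<bar> <= (\<Sum>b\<leftarrow>bs. \<bar>?t b\<bar>)"
   have "supp_box A k (r/2) \<subseteq> supp_box A h r"
   proof (rule supp_box_subset)
    fix c
    have "\<bar>k c - h c\<bar> <= \<bar>k c - ?h c\<bar> + \<bar>s\<bar>" by (auto simp: stepf_apply)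
    also have "... <= \<bar>s\<bar> * (1 + V)" using k[of c] sumt by (simp add: algebra_simps)
    finally show "\<bar>k c - h c\<bar> <= r - r/2" using small Dr by linarith
   qed
   hence bx: "supp_box A k (r/2) \<subseteq> chamber" using zs(3) by blast
   have "\<forall>z\<in>set ((b, ?t b) # zr). \<bar>snd z\<bar> <= d b * (r / 2)"
   proof
    fix w assume "w \<in> set ((b, ?t b) # zr)"
    then consider "w = (b, ?t b)" | "w \<in> set zr" by auto
    hence "\<bar>snd w\<bar> <= D * (r / 2)"
    proof cases
     case 1
     have "\<bar>s\<bar> * \<bar>b \<bullet> v\<bar> <= \<bar>s\<bar> * (1 + V)" using V(2)[OF b] by (intro mult_left_mono) auto
     thus ?thesis using 1 small by (simp add: abs_mult)
    next
     case 2
     hence "\<bar>snd w\<bar> <= ?\<delta> * r" using zs(4) z(1) by auto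
     also have "... <= D / 2 * r" using D V zs(2) by (intro mult_right_mono divide_left_mono) auto
     finally show ?thesis by simp
    qed
    also have "... <= d b * (r / 2)" using D(3)[OF b] zs(2) by (intro mult_right_mono) auto
    finally show "\<bar>snd w\<bar> <= d b * (r / 2)" .
   qed
   hence "iterated_diff (steps ((b, ?t b) # zr)) pvol k = m b * (\<Prod>z\<leftarrow>(b, ?t b) # zr. snd z)"
    using b z(2) zs(2) bx by (intro d(2)) auto
   thus "f (k + stepf b (?t b)) - f k = (m b * (\<Prod>z\<leftarrow>zr. snd z)) * ?t b"
    by (simp add: f_def del: plus_fun_apply)
  qed
  also have "?h + (\<Sum>b\<leftarrow>bs. stepf b (?t b)) = h + (%c. if c \<in> A then c \<bullet> (s *R v) else 0)"
  proof (rule ext)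
   fix c
   have "(\<Sum>b\<leftarrow>bs. stepf b (?t b)) c = (if c \<in> set bs then ?t c else 0)"
    unfolding sum_list_fun_apply using sum_list_distinct_single[OF bs(2), of c ?t] by (simp add: o_def stepf_apply)
   thus "(?h + (\<Sum>b\<leftarrow>bs. stepf b (?t b))) c = (h + (%c. if c \<in> A then c \<bullet> (s *R v) else 0)) c"
    using bs J v[of c] rest by (auto simp: stepf_apply)
  qed
  also have "f (h + (%c. if c \<in> A then c \<bullet> (s *R v) else 0)) = f h"
   unfolding f_def by (rule iterated_diff_translate)
  finally have "f ?h - f h = - (\<Sum>b\<leftarrow>bs. (m b * (\<Prod>z\<leftarrow>zr. snd z)) * ?t b)" by linarith
  also have "(\<Sum>b\<leftarrow>bs. (m b * (\<Prod>z\<leftarrow>zr. snd z)) * ?t b) = (\<Sum>b\<leftarrow>bs. m b * (b \<bullet> v)) * (s * (\<Prod>z\<leftarrow>zr. snd z))"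
   by (subst sum_list_mult_const[symmetric]) (simp add: ac_simps)
  finally show "iterated_diff (steps zs0) pvol h = - (\<Sum>b\<leftarrow>bs. m b * (b \<bullet> v)) * (\<Prod>z\<leftarrow>zs0. snd z)"
   by (simp add: z f_def del: plus_fun_apply)
 qed
 thus ?thesis by blast
qed

text \<open>Induction on the number of distinct directions still missing: a repeated direction is
  traded for directions outside the set. The induction ends at non-faces, where the constant is 0,
  and at bases, where it is the volume of a cell.\<close>

lemma const_diff_exists:
 assumes "set as \<subseteq> A" "length as = DIM('a)" shows "\<exists>m. const_diff as m"
 using assms
proof (induction "DIM('a) - card (set as)" arbitrary: as rule: less_induct)
 case less
 consider "set as \<notin> faces" | "set as \<in> faces" "distinct as" | "set as \<in> faces" "\<not> distinct as" by blast
 thus ?case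
 proof cases
  case 1
  thus ?thesis using const_diff_not_face less by blast
 next
  case 2
  then obtain S where S: "S \<in> BB" "set as \<subseteq> S" by (auto simp: faces_def)
  have "card (set as) = card S" using 2 less basis[OF S(1)] by (simp add: distinct_card)
  hence "set as = S" using S BB_finite card_subset_eq by blast
  thus ?thesis using const_diff_basis 2 S by blast
 next
  case 3
  then obtain xs ys zs a where as: "as = xs @ [a] @ ys @ [a] @ zs" using not_distinct_decomp by blast
  let ?r = "xs @ ys @ a # zs"
  have ms: "mset (a # ?r) = mset as" and st: "set ?r = set as" using as by auto
  have "\<exists>m. const_diff (b # ?r) m" if b: "b \<in> A - set ?r" for b
  proof (rule less.hyps)
   have c: "card (set (b # ?r)) = Suc (card (set as))"
    using b unfolding list.set(2)[of b] st by (simp add: card_insert_disjoint)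
   have "card (set as) < length as" using 3 by (metis card_distinct card_length le_neq_implies_less)
   thus "DIM('a) - card (set (b # ?r)) < DIM('a) - card (set as)" unfolding c less.prems by linarith
   show "set (b # ?r) \<subseteq> A" using b st less.prems by auto
   show "length (b # ?r) = DIM('a)" using less.prems as by auto
  qed
  then obtain m where "!!b. b \<in> A - set ?r ==> const_diff (b # ?r) (m b)" by metis
  moreover have "set ?r \<in> faces" "a \<in> set ?r" using 3 st by auto
  ultimately obtain m where "const_diff (a # ?r) m" using const_diff_step by metis
  thus ?thesis using const_diff_perm ms by blast
 qed
qed

end

section \<open>The mixed volume form of a simplicial fan\<close>

locale simplicial_fan_nonempty = simplicial_fan +
 assumes chamber_nonempty: "chamber ~= {}"
begin

text \<open>These are the coefficients of n! times the mixed volume as a multilinear form in support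
  numbers.\<close>

definition mcoef :: "'a list => real" where
 "mcoef as = (if set as \<subseteq> A & length as = DIM('a) then SOME m. const_diff as m else 0)"

lemma const_diff_mcoef: "set as \<subseteq> A ==> length as = DIM('a) ==> const_diff as (mcoef as)"
 using someI_ex[OF const_diff_exists] by (simp add: mcoef_def)

lemma const_diff_unique:
 assumes "const_diff as m" "const_diff as m'" shows "m = m'"
proof -
 obtain h where h: "h \<in> chamber" using chamber_nonempty by blast
 obtain r where r: "r > 0" "supp_box A h r \<subseteq> chamber" using chamber_box[OF h] .
 obtain d where d: "d > 0" "!!h r zs. map fst zs = as ==> 0 < r ==> supp_box A h r \<subseteq> chamber ==> (\<forall>z\<in>set zs. \<bar>snd z\<bar> <= d * r) ==>
   iterated_diff (steps zs) pvol h = m * (\<Prod>z\<leftarrow>zs. snd z)" using assms(1) unfolding const_diff_def by blast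
 obtain d' where d': "d' > 0" "!!h r zs. map fst zs = as ==> 0 < r ==> supp_box A h r \<subseteq> chamber ==> (\<forall>z\<in>set zs. \<bar>snd z\<bar> <= d' * r) ==>
   iterated_diff (steps zs) pvol h = m' * (\<Prod>z\<leftarrow>zs. snd z)" using assms(2) unfolding const_diff_def by blast
 define zs where "zs = map (%a. (a, min d d' * r)) as"
 have f: "map fst zs = as" by (simp add: zs_def o_def)
 have sm: "\<forall>z\<in>set zs. \<bar>snd z\<bar> <= d * r" "\<forall>z\<in>set zs. \<bar>snd z\<bar> <= d' * r"
  using d(1) d'(1) r(1) by (auto simp: zs_def abs_mult)
 have "m * (\<Prod>z\<leftarrow>zs. snd z) = m' * (\<Prod>z\<leftarrow>zs. snd z)"
  using d(2)[OF f r sm(1)] d'(2)[OF f r sm(2)] by linarith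
 moreover have "(\<Prod>z\<leftarrow>zs. snd z) ~= 0"
  using d(1) d'(1) r(1) by (auto simp: zs_def o_def prod_list_zero_iff)
 ultimately show ?thesis by simp
qed

lemma mcoef_eqI: "const_diff as m ==> set as \<subseteq> A ==> length as = DIM('a) ==> mcoef as = m"
 using const_diff_unique const_diff_mcoef by blast

lemma mcoef_perm: "mset as = mset bs ==> mcoef as = mcoef bs"
 using const_diff_perm const_diff_mcoef mcoef_eqI mset_eq_setD mset_eq_length unfolding mcoef_def by metis

lemma mcoef_not_face: "set as \<notin> faces ==> mcoef as = 0"
 using mcoef_eqI const_diff_not_face mcoef_def by metis

lemma mcoef_pos: "distinct as ==> set as \<in> faces ==> length as = DIM('a) ==> 0 < mcoef as"
proof -
 assume as: "distinct as" "set as \<in> faces" "length as = DIM('a)"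
 then obtain S where S: "S \<in> BB" "set as \<subseteq> S" by (auto simp: faces_def)
 have "card (set as) = card S" using as basis[OF S(1)] by (simp add: distinct_card)
 hence eq: "set as = S" using S BB_finite card_subset_eq by blast
 hence "mcoef as = vol (cell S (%b. 1))" using mcoef_eqI const_diff_basis as S basis by metis
 thus ?thesis using vol_cell_pos[of S] basis[OF S(1)] by simp
qed

definition uniform_step :: "real => bool" where
 "uniform_step d \<longleftrightarrow> d > 0 & (\<forall>h r zs. length zs = DIM('a) --> fst ` set zs \<subseteq> A --> 0 < r --> supp_box A h r \<subseteq> chamber --> (\<forall>z\<in>set zs. \<bar>snd z\<bar> <= d * r) -->
   iterated_diff (steps zs) pvol h = mcoef (map fst zs) * (\<Prod>z\<leftarrow>zs. snd z))"

lemma uniform_diff: "\<exists>d. uniform_step d"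
proof -
 let ?L = "{as. set as \<subseteq> A & length as = DIM('a)}"
 have fin: "finite ?L" using finite_lists_length_eq[OF finite_A] .
 define C where "C as d \<longleftrightarrow> d > 0 & (\<forall>h r zs. map fst zs = as & 0 < r & supp_box A h r \<subseteq> chamber & (\<forall>z\<in>set zs. \<bar>snd z\<bar> <= d * r) -->
   iterated_diff (steps zs) pvol h = mcoef as * (\<Prod>z\<leftarrow>zs. snd z))" for as d
 have "\<forall>as\<in>?L. \<exists>d. C as d"
  using const_diff_mcoef unfolding const_diff_def C_def by simp
 then obtain dd where dd: "\<forall>as\<in>?L. C as (dd as)" by (rule bchoice[THEN exE])
 define d where "d = dd"
 have d: "as \<in> ?L ==> d as > 0" "as \<in> ?L ==> map fst zs = as ==> 0 < r ==> supp_box A h r \<subseteq> chamber ==> (\<forall>z\<in>set zs. \<bar>snd z\<bar> <= d as * r) ==>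
   iterated_diff (steps zs) pvol h = mcoef as * (\<Prod>z\<leftarrow>zs. snd z)" for as h r zs
  using dd d_def unfolding C_def by blast+
 define D where "D = Min (insert 1 (d ` ?L))"
 have D: "0 < D" "!!as. as \<in> ?L ==> D <= d as" unfolding D_def using d(1) fin by auto
 have "uniform_step D" unfolding uniform_step_def
 proof (intro conjI D(1) allI impI)
  fix h r zs assume zs: "length zs = DIM('a)" "fst ` set zs \<subseteq> A" "0 < r" "supp_box A h r \<subseteq> chamber" "\<forall>z\<in>set zs. \<bar>snd z\<bar> <= D * r"
  have L: "map fst zs \<in> ?L" using zs by auto
  have "D * r <= d (map fst zs) * r" using D(2)[OF L] zs(3) by (intro mult_right_mono) auto
  show "iterated_diff (steps zs) pvol h = mcoef (map fst zs) * (\<Prod>z\<leftarrow>zs. snd z)"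
  proof (rule d(2)[OF L refl zs(3,4)], intro ballI)
   fix z assume "z \<in> set zs"
   thus "\<bar>snd z\<bar> <= d (map fst zs) * r" using zs(5) \<open>D * r <= d (map fst zs) * r\<close> by fastforce
  qed
 qed
 thus ?thesis by blast
qed

text \<open>The slots not filled by \<open>ys\<close> are occupied by unit vectors of the facets in
  \<open>as\<close>. For a face with facets \<open>as\<close> this is the mixed volume form of the
  face up to a positive factor, which is what the induction over faces runs on.\<close>

primrec mform :: "('a => real) list => 'a list => real" where
 "mform [] as = mcoef as"
| "mform (y # ys) as = (\<Sum>a\<in>A. y a * mform ys (a # as))"

lemma mform_perm_index: "mset as = mset bs ==> mform ys as = mform ys bs"
proof (induction ys arbitrary: as bs)
 case Nil
 thus ?case by (simp add: mcoef_perm[OF Nil])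
next
 case (Cons y ys)
 have "mform ys (a # as) = mform ys (a # bs)" for a
 proof (rule Cons.IH)
  show "mset (a # as) = mset (a # bs)" using Cons.prems by simp
 qed
 note eq = this
 show ?case unfolding mform.simps eq ..
qed

lemma mform_swap: "mform (x # y # ys) as = mform (y # x # ys) as"
proof -
 have "mform ys (b # a # as) = mform ys (a # b # as)" for a b by (rule mform_perm_index) simp
 hence "mform (x # y # ys) as = (\<Sum>a\<in>A. \<Sum>b\<in>A. y b * (x a * mform ys (a # b # as)))"
  by (simp add: sum_distrib_left ac_simps)
 also have "... = (\<Sum>b\<in>A. \<Sum>a\<in>A. y b * (x a * mform ys (a # b # as)))" by (rule sum.swap)
 also have "... = mform (y # x # ys) as" by (simp add: sum_distrib_left ac_simps)
 finally show ?thesis .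
qed

lemma mform_move: "mform (xs @ c # ys) as = mform (c # xs @ ys) as"
proof (induction xs arbitrary: as)
 case (Cons x xs)
 have "mform ((x # xs) @ c # ys) as = (\<Sum>a\<in>A. x a * mform (c # xs @ ys) (a # as))" by (simp only: append_Cons mform.simps(2)[of x] Cons.IH)
 also have "... = mform (x # c # xs @ ys) as" by (simp only: mform.simps)
 also have "... = mform (c # x # xs @ ys) as" by (rule mform_swap)
 finally show ?case by simp
qed simp

lemma mform_perm: "mset xs = mset ys ==> mform xs as = mform ys as"
proof (induction xs arbitrary: ys as)
 case (Cons x xs)
 then obtain us vs where ys: "ys = us @ x # vs"
  by (metis in_set_conv_decomp list.set_intros(1) mset_eq_setD)
 hence "mset xs = mset (us @ vs)" using Cons.prems by simp
 thus ?case using Cons.IH[of "us @ vs"] unfolding ys mform_move by simp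
qed simp

lemma mform_add: "mform ((x + y) # ys) as = mform (x # ys) as + mform (y # ys) as"
 by (simp add: distrib_right sum.distrib)

lemma mform_scale: "mform ((%a. t * x a) # ys) as = t * mform (x # ys) as"
 by (simp add: sum_distrib_left mult.assoc)

lemma mform_step: "a \<in> A ==> mform (stepf a s # ys) as = s * mform ys (a # as)"
 using finite_A by (simp add: stepf_apply if_distrib[of "%x. x * _"] cong: if_cong)

lemma mform_sum: "mform (x # ys) as = (\<Sum>a\<in>A. x a * mform ys (a # as))"
 by simp

text \<open>Each vector of \<open>cs\<close> is resolved into its coordinate steps. Such a walk has
  length at most \<open>p\<close>, which is why the box must have radius \<open>p\<close> for each
  vector and one more \<open>p\<close> for the final steps.\<close>

lemma iterated_diff_small:
 assumes d: "uniform_step d"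
  and rho: "p > 0"
  and "!!c a. c \<in> set cs ==> \<bar>c a\<bar> <= d * p & real (card A) * \<bar>c a\<bar> <= p & (a \<notin> A --> c a = 0)"
  and "length cs + length zs = DIM('a)" "fst ` set zs \<subseteq> A" "\<forall>z\<in>set zs. \<bar>snd z\<bar> <= d * p"
  and "supp_box A h (p * (1 + real (length cs))) \<subseteq> chamber"
 shows "iterated_diff (cs @ steps zs) pvol h = (\<Prod>z\<leftarrow>zs. snd z) * mform cs (map fst zs)"
 using assms(3-)
proof (induction cs arbitrary: h zs)
 case Nil
 thus ?case using d rho by (simp add: uniform_step_def mult.commute)
next
 case (Cons c cs)
 obtain al where al: "set al = A" "distinct al" using finite_distinct_list finite_A by metis
 have c: "\<bar>c a\<bar> <= d * p" "real (card A) * \<bar>c a\<bar> <= p" "a \<notin> A ==> c a = 0" for a using Cons.prems(1)[of c a] by auto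
 have lenal: "length al = card A" using al by (metis distinct_card)
 have sm: "(\<Sum>b\<leftarrow>al. \<bar>c b\<bar>) <= p"
 proof (cases "al = []")
  case False
  hence cp: "real (card A) > 0" using lenal by (simp flip: lenal)
  have "(\<Sum>b\<leftarrow>al. \<bar>c b\<bar>) <= (\<Sum>b\<leftarrow>al. p / real (card A))"
   using c(2) cp by (intro sum_list_mono) (simp add: field_simps)
  also have "... = p" unfolding sum_list_triv lenal using cp by simp
  finally show ?thesis .
 qed (use rho in simp)
 let ?f = "iterated_diff (cs @ steps zs) pvol"
 have "?f (h + (\<Sum>b\<leftarrow>al. stepf b (c b))) - ?f h = (\<Sum>b\<leftarrow>al. ((\<Prod>z\<leftarrow>zs. snd z) * mform cs (b # map fst zs)) * c b)"
 proof (rule step_telescope)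
  fix b k assume b: "b \<in> set al" and k: "!!a. \<bar>k a - h a\<bar> <= (\<Sum>b\<leftarrow>al. \<bar>c b\<bar>)"
  have bx: "supp_box A k (p * (1 + real (length cs))) \<subseteq> supp_box A h (p * (1 + real (length (c # cs))))"
  proof (rule supp_box_subset)
   fix a show "\<bar>k a - h a\<bar> <= p * (1 + real (length (c # cs))) - p * (1 + real (length cs))"
    using k[of a] sm by (simp add: algebra_simps)
  qed
  have "iterated_diff (cs @ steps ((b, c b) # zs)) pvol k = (\<Prod>z\<leftarrow>(b, c b) # zs. snd z) * mform cs (map fst ((b, c b) # zs))"
  proof (rule Cons.IH)
   show "supp_box A k (p * (1 + real (length cs))) \<subseteq> chamber" using bx Cons.prems by blast
  qed (use Cons.prems c b al in auto)
  moreover have "iterated_diff (cs @ steps ((b, c b) # zs)) pvol k = ?f (k + stepf b (c b)) - ?f k"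
   by (simp add: iterated_diff_move del: plus_fun_apply)
  ultimately show "?f (k + stepf b (c b)) - ?f k = ((\<Prod>z\<leftarrow>zs. snd z) * mform cs (b # map fst zs)) * c b"
   by (simp add: ac_simps del: plus_fun_apply)
 qed
 also have "(\<Sum>b\<leftarrow>al. stepf b (c b)) = c"
 proof (rule ext)
  fix a
  show "(\<Sum>b\<leftarrow>al. stepf b (c b)) a = c a"
   unfolding sum_list_fun_apply using sum_list_distinct_single[OF al(2), of a c] c(3) al(1) by (simp add: o_def stepf_apply)
 qed
 also have "(\<Sum>b\<leftarrow>al. ((\<Prod>z\<leftarrow>zs. snd z) * mform cs (b # map fst zs)) * c b) = (\<Prod>z\<leftarrow>zs. snd z) * mform (c # cs) (map fst zs)"
  using al by (simp add: sum_list_distinct_conv_sum_set sum_distrib_left ac_simps)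
 finally show ?case by (simp only: append_Cons iterated_diff.simps)
qed

lemma iterated_diff_multiple:
 fixes f :: "('a => real) => real"
 shows "iterated_diff ((%a. real N * c a) # cs) f h = (\<Sum>i<N. iterated_diff (c # cs) f (h + (%a. real i * c a)))"
proof (induction N)
 case 0
 have "(%a. real 0 * c a) = 0" by (auto simp: fun_eq_iff)
 thus ?case by (simp only: iterated_diff_zero lessThan_0 sum.empty)
next
 case (Suc N)
 have "(%a. real (Suc N) * c a) = c + (%a. real N * c a)" by (auto simp: fun_eq_iff algebra_simps)
 thus ?case by (simp only: iterated_diff_add Suc sum.lessThan_Suc add.commute)
qed

lemma supp_box_plus: "supp_box A h R \<subseteq> chamber ==> c \<in> closed_chamber ==> supp_box A (h + c) R \<subseteq> chamber"
proof
 fix k assume bx: "supp_box A h R \<subseteq> chamber" "c \<in> closed_chamber" and k: "k \<in> supp_box A (h + c) R"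
 have "k - c \<in> supp_box A h R" using k by (auto simp: supp_box_def diff_diff_eq add.commute)
 hence "(k - c) + c \<in> chamber" using bx chamber_add by blast
 moreover have "(k - c) + c = k" by (auto simp: fun_eq_iff)
 ultimately show "k \<in> chamber" by simp
qed

definition supported :: "('a => real) set" where
 "supported = {c \<in> closed_chamber. \<forall>a. a \<notin> A --> c a = 0}"

text \<open>A vector of any size is cut into \<open>N\<close> equal pieces that meet the smallness
  conditions. The intermediate base points cause no trouble, because adding a vector of the closed
  chamber carries a box inside the chamber to another one.\<close>

lemma iterated_diff_pvol:
 assumes cs: "set cs \<subseteq> supported" "length cs = DIM('a)" and h: "h \<in> chamber"
 shows "iterated_diff cs pvol h = mform cs []"
proof -
 obtain R where R: "R > 0" "supp_box A h R \<subseteq> chamber" using chamber_box[OF h] .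
 obtain d where d: "uniform_step d" using uniform_diff by blast
 hence d0: "d > 0" by (simp add: uniform_step_def)
 define p where "p = R / (1 + DIM('a))"
 have rho: "p > 0" "p * (1 + DIM('a)) = R" using R(1) by (auto simp: p_def)
 define small where "small = {c :: 'a => real. \<forall>a. \<bar>c a\<bar> <= d * p & real (card A) * \<bar>c a\<bar> <= p}"
 have "iterated_diff (cs @ ds) pvol h = mform (cs @ ds) []"
  if "set ds \<subseteq> supported \<inter> small" "length cs + length ds = DIM('a)" "set cs \<subseteq> supported" "supp_box A h R \<subseteq> chamber" for cs ds h
  using that
 proof (induction cs arbitrary: ds h)
  case Nil
  let ?e = "[] :: ('a \<times> real) list"
  have "iterated_diff (ds @ steps ?e) pvol h = (\<Prod>z\<leftarrow>?e. snd z) * mform ds (map fst ?e)"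
   by (rule iterated_diff_small[OF d rho(1)]) (use Nil rho in \<open>auto simp: small_def supported_def\<close>)
  thus ?case by simp
 next
  case (Cons c cs)
  have c: "c \<in> closed_chamber" "!!a. a \<notin> A ==> c a = 0" using Cons.prems by (auto simp: supported_def)
  obtain B where B: "!!a. \<bar>c a\<bar> <= B" "B \<ge> 0"
  proof
   show "\<bar>c a\<bar> <= (\<Sum>a\<in>A. \<bar>c a\<bar>)" for a
    using c(2) member_le_sum[of a A "%a. \<bar>c a\<bar>"] finite_A sum_nonneg[of A "%a. \<bar>c a\<bar>"] by (cases "a \<in> A") auto
  qed (auto intro: sum_nonneg)
  obtain N :: nat where N: "real N > B / (d * p) + real (card A) * B / p" using reals_Archimedean2 by blast
  have pos: "d * p > 0" using d0 rho by simp
  have N0: "N > 0" using N B pos rho by (metis add_nonneg_nonneg divide_nonneg_pos mult_nonneg_nonneg of_nat_0_le_iff of_nat_0_less_iff order_le_less_trans)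
  have N1: "B <= real N * (d * p)" "real (card A) * B <= real N * p"
  proof -
   have "B / (d * p) \<ge> 0" "real (card A) * B / p \<ge> 0" using B(2) pos rho by auto
   hence "B / (d * p) <= real N" "real (card A) * B / p <= real N" using N by linarith+
   thus "B <= real N * (d * p)" "real (card A) * B <= real N * p" using pos rho by (simp_all add: field_simps)
  qed
  define c' where "c' = (%a. 1 / real N * c a)"
  have c': "c' \<in> supported" using closed_chamber_scale[OF _ c(1), of "1 / real N"] c by (auto simp: c'_def supported_def)
  have cc: "c = (%a. real N * c' a)" using N0 by (auto simp: c'_def)
  have "\<bar>c' a\<bar> <= d * p & real (card A) * \<bar>c' a\<bar> <= p" for a
  proof -
   have "\<bar>c a\<bar> <= real N * (d * p)" "real (card A) * \<bar>c a\<bar> <= real N * p"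
    using B(1)[of a] N1 mult_left_mono[OF B(1)[of a], of "real (card A)"] by auto
   thus ?thesis using N0 by (auto simp: c'_def abs_mult field_simps)
  qed
  hence c's: "c' \<in> small" by (auto simp: small_def)
  have each: "iterated_diff (c' # cs @ ds) pvol (h + (%a. real i * c' a)) = mform (c' # cs @ ds) []" for i
  proof -
   have "iterated_diff (cs @ c' # ds) pvol (h + (%a. real i * c' a)) = mform (cs @ c' # ds) []"
   proof (rule Cons.IH)
    show "supp_box A (h + (%a. real i * c' a)) R \<subseteq> chamber"
     using c' closed_chamber_scale[of "real i" c'] Cons.prems by (intro supp_box_plus) (auto simp: supported_def)
   qed (use Cons.prems c' c's in auto)
   thus ?thesis by (simp only: iterated_diff_move mform_move)
  qed
  have "iterated_diff (c # cs @ ds) pvol h = (\<Sum>i<N. iterated_diff (c' # cs @ ds) pvol (h + (%a. real i * c' a)))"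
   by (subst cc) (rule iterated_diff_multiple)
  also have "... = real N * mform (c' # cs @ ds) []" unfolding each by simp
  also have "... = mform (c # cs @ ds) []" unfolding mform_scale[symmetric] cc[symmetric] ..
  finally show ?case by simp
 qed
 from this[of "[]" cs h] show ?thesis using cs R by simp
qed

lemma iterated_diff_polyh:
 assumes "set cs \<subseteq> closed_chamber" "h \<in> closed_chamber"
 shows "iterated_diff (map P cs) vol (P h) = iterated_diff cs pvol h"
 using assms
proof (induction cs arbitrary: h)
 case Nil
 thus ?case by (simp add: pvol_def)
next
 case (Cons c cs)
 hence "P h + P c = P (h + c)" by (simp add: polyh_plus)
 thus ?case using Cons by (simp add: closed_chamber_add)
qed

text \<open>For base points in the chamber the value does not depend on the base point. A base point
  \<open>h\<close> of the closed chamber is the limit of \<open>h + t k\<close> with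
  \<open>k\<close> in the chamber, and volumes are continuous along this path.\<close>

theorem iterated_diff_vol_polyh:
 assumes cs: "set cs \<subseteq> supported" "length cs = DIM('a)" and h: "h \<in> closed_chamber"
 shows "iterated_diff (map P cs) vol (P h) = mform cs []"
proof -
 obtain k where k: "k \<in> chamber" using chamber_nonempty by blast
 have cc: "set cs \<subseteq> closed_chamber" using cs by (auto simp: supported_def)
 have "iterated_diff (map P cs) vol (P h + t \<odot> P k) = mform cs []" if t: "t > 0" for t
 proof -
  have tk: "(%a. t * k a) \<in> chamber" using chamber_scale k t by blast
  have hk: "h + (%a. t * k a) \<in> chamber" using chamber_add[OF tk h] by (simp add: add.commute)
  have "P h + t \<odot> P k = P (h + (%a. t * k a))"
   using polyh_plus[OF h chamber_closed[OF tk]] polyh_dilate[OF t] by metis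
  thus ?thesis using iterated_diff_polyh[OF cc chamber_closed[OF hk]] iterated_diff_pvol[OF cs hk] by simp
 qed
 hence "\<forall>\<^sub>F t in at_right 0. iterated_diff (map P cs) vol (P h + t \<odot> P k) = mform cs []"
  by (auto simp: eventually_at_right_field intro: exI[of _ 1])
 moreover have "((%t. iterated_diff (map P cs) vol (P h + t \<odot> P k)) \<longlongrightarrow> iterated_diff (map P cs) vol (P h)) (at_right 0)"
  using cc h chamber_closed[OF k] by (intro iterated_diff_vol_tendsto) (auto intro: body_polyh)
 ultimately have "((%t::real. mform cs []) \<longlongrightarrow> iterated_diff (map P cs) vol (P h)) (at_right 0)"
  by (rule Lim_transform_eventually[rotated])
 thus ?thesis by (simp add: tendsto_const_iff)
qed

text \<open>The difference along a translation vector vanishes because the volume is translation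
  invariant. The factor \<open>t\<close> shrinks the vector until \<open>iterated_diff_small\<close>
  applies.\<close>

lemma mcoef_translate:
 assumes "set as \<subseteq> A" "Suc (length as) = DIM('a)"
 shows "(\<Sum>a\<in>A. (a \<bullet> v) * mcoef (a # as)) = 0"
proof -
 obtain h where h: "h \<in> chamber" using chamber_nonempty by blast
 obtain R where R: "R > 0" "supp_box A h R \<subseteq> chamber" using chamber_box[OF h] .
 obtain d where d: "uniform_step d" using uniform_diff by blast
 hence d0: "d > 0" by (simp add: uniform_step_def)
 let ?p = "R / 2"
 define B where "B = (\<Sum>a\<in>A. \<bar>a \<bullet> v\<bar>)"
 have B: "0 <= B" "a \<in> A ==> \<bar>a \<bullet> v\<bar> <= B" for a
  unfolding B_def using finite_A by (auto intro: sum_nonneg member_le_sum[of a A "%a. \<bar>a \<bullet> v\<bar>"])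
 define t where "t = min (d * ?p) (?p / (1 + real (card A))) / (1 + B)"
 have t: "t > 0" using d0 R B by (auto simp: t_def)
 define c where "c = (%a. if a \<in> A then a \<bullet> (t *R v) else 0)"
 have cb: "\<bar>c a\<bar> <= min (d * ?p) (?p / (1 + real (card A)))" for a
 proof (cases "a \<in> A")
  case True
  have "\<bar>c a\<bar> <= t * (1 + B)" using True B(2)[OF True] t by (simp add: c_def abs_mult)
  also have "... = min (d * ?p) (?p / (1 + real (card A)))" using B by (simp add: t_def)
  finally show ?thesis .
 qed (use d0 R in \<open>auto simp: c_def\<close>)
 define zs where "zs = map (%a. (a, d * ?p)) as"
 have fz: "map fst zs = as" by (simp add: zs_def o_def)
 have "iterated_diff ([c] @ steps zs) pvol h = (\<Prod>z\<leftarrow>zs. snd z) * mform [c] (map fst zs)"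
 proof (rule iterated_diff_small[OF d])
  fix c' a assume "c' \<in> set [c]"
  hence c': "c' = c" by simp
  have "real (card A) * \<bar>c a\<bar> <= (1 + real (card A)) * (?p / (1 + real (card A)))" using cb[of a] by (intro mult_mono) auto
  also have "... = ?p" using nonzero_mult_div_cancel_left[of "1 + real (card A)" ?p] by (simp add: add_nonneg_eq_0_iff)
  finally show "\<bar>c' a\<bar> <= d * ?p & real (card A) * \<bar>c' a\<bar> <= ?p & (a \<notin> A --> c' a = 0)"
   using cb[of a] by (auto simp: c' c_def)
 qed (use assms R d0 in \<open>auto simp: zs_def\<close>)
 moreover have "iterated_diff ([c] @ steps zs) pvol h = 0"
  using iterated_diff_translate[of "steps zs" h "t *R v"] by (simp add: c_def del: plus_fun_apply)
 moreover have "(\<Prod>z\<leftarrow>zs. snd z) ~= 0" using d0 R by (auto simp: zs_def o_def prod_list_zero_iff)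
 ultimately have "mform [c] as = 0" by (simp add: fz)
 moreover have "mform [c] as = t * (\<Sum>a\<in>A. (a \<bullet> v) * mcoef (a # as))"
  by (simp add: c_def sum_distrib_left mult.assoc)
 ultimately show ?thesis using t by simp
qed

lemma mform_translate:
 assumes "set as \<subseteq> A" "Suc (length as + length ys) = DIM('a)"
 shows "mform ((%a. a \<bullet> v) # ys) as = 0"
 using assms
proof (induction ys arbitrary: as)
 case Nil
 thus ?case using mcoef_translate by simp
next
 case (Cons y ys)
 have "mform ((%a. a \<bullet> v) # y # ys) as = mform (y # (%a. a \<bullet> v) # ys) as" by (rule mform_swap)
 also have "... = (\<Sum>a\<in>A. y a * mform ((%a. a \<bullet> v) # ys) (a # as))" by (simp only: mform.simps)
 also have "... = 0" using Cons by (intro sum.neutral) simp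
 finally show ?case .
qed

end

section \<open>Hyperbolic quadratic forms\<close>

definition quad :: "'j set => ('j => 'j => real) => ('j => real) => ('j => real) => real" where
 "quad J G x z = (\<Sum>j\<in>J. \<Sum>k\<in>J. G j k * x j * z k)"

lemma quad_add_left: "quad J G (%j. x j + s * x' j) z = quad J G x z + s * quad J G x' z"
 by (simp add: quad_def algebra_simps sum.distrib sum_distrib_left)

lemma quad_add_right: "quad J G z (%j. x j + s * x' j) = quad J G z x + s * quad J G z x'"
 by (simp add: quad_def algebra_simps sum.distrib sum_distrib_left)

lemma quad_sym: "(!!j k. j \<in> J ==> k \<in> J ==> G j k = G k j) ==> quad J G x z = quad J G z x"
 unfolding quad_def by (subst sum.swap) (simp add: ac_simps)

lemma weighted_sum_square_add:
 fixes c x z :: "'j => real"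
 shows "(\<Sum>j\<in>J. c j * (x j + t * z j) * (x j + t * z j)) = (\<Sum>j\<in>J. c j * x j * x j) + 2 * t * (\<Sum>j\<in>J. c j * x j * z j) + t\<^sup>2 * (\<Sum>j\<in>J. c j * z j * z j)"
 by (simp add: algebra_simps sum.distrib sum_distrib_left power2_eq_square)

lemma weighted_sum_add:
 fixes c x z :: "'j => real"
 shows "(\<Sum>j\<in>J. c j * x j * (z j + s * y j)) = (\<Sum>j\<in>J. c j * x j * z j) + s * (\<Sum>j\<in>J. c j * x j * y j)"
 by (simp add: algebra_simps sum.distrib sum_distrib_left)

lemma compact_function_box:
 fixes S :: "'j => real set"
 assumes "!!j. compact (S j)" shows "compact {x. \<forall>j. x j \<in> S j}"
proof -
 have "compactin (product_topology (%j. euclidean) UNIV) (PiE UNIV S)"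
  using assms by (simp add: compactin_PiE)
 hence "compact (PiE UNIV S)"
  by (simp flip: compactin_euclidean_iff add: euclidean_product_topology)
 moreover have "PiE UNIV S = {x. \<forall>j. x j \<in> S j}" by (auto simp: PiE_def extensional_def)
 ultimately show ?thesis by simp
qed

text \<open>Vectors indexed by \<open>J\<close> are functions on the whole index type; fixing their
  values outside \<open>J\<close> makes the sphere a closed subset of a product of compact
  intervals, so Tychonoff's theorem applies.\<close>

lemma compact_quad_sphere:
 fixes J :: "'j set"
 defines "K \<equiv> {x :: 'j => real. (\<forall>j. j \<notin> J --> x j = 0) & (\<forall>j. \<bar>x j\<bar> <= 1) & (\<Sum>j\<in>J. (x j)\<^sup>2) = 1}"
 shows "compact K" "closed K"
proof -
 let ?S = "%j. if j \<in> J then {-1..1} else {0::real}"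
 have "closed {x :: 'j => real. (\<Sum>j\<in>J. (x j)\<^sup>2) = 1}"
  by (intro closed_Collect_eq continuous_intros continuous_on_product_coordinates)
 note cl = this
 have "compact ({x. \<forall>j. x j \<in> ?S j} \<inter> {x. (\<Sum>j\<in>J. (x j)\<^sup>2) = 1})"
  by (intro compact_Int_closed compact_function_box cl) auto
 moreover have "closed ({x. \<forall>j. x j \<in> ?S j} \<inter> {x. (\<Sum>j\<in>J. (x j)\<^sup>2) = 1})"
 proof (intro closed_Int cl)
  have "{x. \<forall>j. x j \<in> ?S j} = (\<Inter>j. (%x. x j) -` ?S j)" unfolding vimage_def by blast
  thus "closed {x. \<forall>j. x j \<in> ?S j}"
   by (simp only:, intro closed_INT ballI closed_vimage continuous_on_product_coordinates) auto
 qed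
 moreover have "{x. \<forall>j. x j \<in> ?S j} \<inter> {x. (\<Sum>j\<in>J. (x j)\<^sup>2) = 1} = {x. (\<forall>j. j \<notin> J --> x j = 0) & (\<forall>j. \<bar>x j\<bar> <= 1) & (\<Sum>j\<in>J. (x j)\<^sup>2) = 1}"
  by (intro set_eqI) (auto simp: abs_le_iff; metis minus_le_iff minus_zero zero_le_one)
 ultimately show "compact K" "closed K" by (simp_all add: K_def)
qed

text \<open>
  The operator \<open>x \<mapsto> (y j / w j) * (G x) j\<close> is self-adjoint for the weights \<open>w j / y j\<close> and, by the
  Bochner-type hypothesis, has no eigenvalue strictly between 0 and 1.
\<close>

lemma spectral_gap:
 fixes J :: "'j set" and G :: "'j => 'j => real"
 assumes fin: "finite J" and sym: "!!j k. j \<in> J ==> k \<in> J ==> G j k = G k j"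
  and y: "!!j. j \<in> J ==> 0 < y j" and w: "!!j. j \<in> J ==> 0 < (\<Sum>k\<in>J. G j k * y k)"
  and boch: "!!x. quad J G x x <= (\<Sum>j\<in>J. (y j / (\<Sum>k\<in>J. G j k * y k)) * (\<Sum>k\<in>J. G j k * x k)\<^sup>2)"
  and x0: "quad J G x0 y = 0" "quad J G x0 x0 > 0"
 shows "\<exists>x. (\<forall>j. j \<notin> J --> x j = 0) & (\<forall>j. \<bar>x j\<bar> <= 1) & (\<Sum>j\<in>J. (x j)\<^sup>2) = 1 & quad J G x y = 0 &
  (\<Sum>j\<in>J. ((\<Sum>k\<in>J. G j k * y k) / y j) * (x j)\<^sup>2) <= quad J G x x"
proof -
 define w where "w j = (\<Sum>k\<in>J. G j k * y k)" for j
 have wp: "!!j. j \<in> J ==> 0 < w j" using w by (simp add: w_def)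
 define N where "N x z = (\<Sum>j\<in>J. (w j / y j) * x j * z j)" for x z :: "'j => real"
 define D where "D = {x. (\<forall>j. j \<notin> J --> x j = 0) & (\<forall>j. \<bar>x j\<bar> <= 1) & (\<Sum>j\<in>J. (x j)\<^sup>2) = 1} \<inter> {x. quad J G x y = 0}"
 have "closed {x. quad J G x y = 0}"
  unfolding quad_def by (intro closed_Collect_eq continuous_intros continuous_on_product_coordinates)
 hence cD: "compact D" unfolding D_def by (intro compact_Int_closed compact_quad_sphere)
 have scale: "\<exists>x\<in>D. \<exists>s>0. \<forall>j\<in>J. x j = s * z j" if z: "quad J G z y = 0" "\<exists>j\<in>J. z j ~= 0" for z
 proof -
  define r where "r = sqrt (\<Sum>j\<in>J. (z j)\<^sup>2)"
  have r2: "(\<Sum>j\<in>J. (z j)\<^sup>2) > 0" using z fin by (metis (no_types, lifting) sum_pos2 zero_le_power2 zero_less_power2)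
  hence r: "r > 0" "r\<^sup>2 = (\<Sum>j\<in>J. (z j)\<^sup>2)" by (auto simp: r_def)
  define x where "x j = (if j \<in> J then z j / r else 0)" for j
  have s1: "(\<Sum>j\<in>J. (x j)\<^sup>2) = 1" using r(1) r2 unfolding x_def by (simp add: power_divide r(2)[symmetric] flip: sum_divide_distrib)
  have "\<bar>x j\<bar> <= 1" for j
  proof (cases "j \<in> J")
   case True
   hence "(x j)\<^sup>2 <= 1" using s1 fin member_le_sum[of j J "%j. (x j)\<^sup>2"] by simp
   thus ?thesis by (simp add: abs_square_le_1)
  qed (simp add: x_def)
  moreover have "quad J G x y = quad J G z y / r"
   by (simp add: quad_def x_def sum_divide_distrib)
  ultimately have "x \<in> D" using s1 z by (auto simp: D_def x_def)
  thus ?thesis using r by (intro bexI[of _ x] exI[of _ "1/r"]) (auto simp: x_def)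
 qed
 have quad_sc: "quad J G x x = s\<^sup>2 * quad J G z z" if "\<forall>j\<in>J. x j = s * z j" for x z s
  using that by (simp add: quad_def sum_distrib_left power2_eq_square ac_simps)
 have N_sc: "N x x = s\<^sup>2 * N z z" if "\<forall>j\<in>J. x j = s * z j" for x z s
  using that by (simp add: N_def sum_distrib_left power2_eq_square ac_simps)
 have Npos: "N x x > 0" if ne: "\<exists>j\<in>J. x j ~= 0" for x
 proof -
  obtain j where "j \<in> J" "x j ~= 0" using ne by blast
  moreover have nn: "0 <= (w k / y k) * x k * x k" if "k \<in> J" for k
   using wp[OF that] y[OF that] by (simp add: mult.assoc)
  moreover have "0 < x j * x j" using \<open>x j ~= 0\<close> by (auto simp: zero_less_mult_iff linorder_neq_iff)
  ultimately show ?thesis unfolding N_def using wp[of j] y[of j] fin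
   by (intro sum_pos2[of J j]) (auto simp: mult.assoc)
 qed
 have Dn: "\<exists>j\<in>J. x j ~= 0" if "x \<in> D" for x
 proof (rule ccontr)
  assume "\<not> ?thesis"
  hence "(\<Sum>j\<in>J. (x j)\<^sup>2) = 0" by simp
  thus False using that by (auto simp: D_def)
 qed
 have x0J: "\<exists>j\<in>J. x0 j ~= 0"
  using x0(2) unfolding quad_def by (metis (mono_tags, lifting) mult_eq_0_iff order_less_irrefl sum.neutral)
 have Dne: "D ~= {}" using scale[OF x0(1) x0J] by blast
 have "continuous_on D (%x. quad J G x x / N x x)"
  unfolding quad_def N_def
  by (intro continuous_intros continuous_on_product_coordinates[THEN continuous_on_subset])
   (use Npos Dn in \<open>force simp: N_def\<close>)+
 then obtain x where x: "x \<in> D" "!!z. z \<in> D ==> quad J G z z / N z z <= quad J G x x / N x x"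
  using continuous_attains_sup[OF cD Dne] by blast
 \<comment> \<open>\<open>m\<close> is the maximal Rayleigh quotient on the complement of
   \<open>y\<close>. Its maximizer is an eigenvector, and the Bochner hypothesis evaluated there
   reads \<open>m \<le> m\<^sup>2\<close>.\<close>
 define m where "m = quad J G x x / N x x"
 have Nx: "N x x > 0" using Npos Dn x by blast
 have qx: "quad J G x x = m * N x x" using Nx by (simp add: m_def)
 have le: "quad J G z z <= m * N z z" if zy: "quad J G z y = 0" for z
 proof (cases "\<exists>j\<in>J. z j ~= 0")
  case True
  then obtain x' s where x': "x' \<in> D" "s > 0" "\<forall>j\<in>J. x' j = s * z j" using scale[OF zy] by blast
  have "quad J G x' x' <= m * N x' x'"
   using x(2)[OF x'(1)] Npos[OF Dn[OF x'(1)]] by (simp add: m_def field_simps)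
  hence "s\<^sup>2 * quad J G z z <= s\<^sup>2 * (m * N z z)" using quad_sc[OF x'(3)] N_sc[OF x'(3)] by (simp add: ac_simps)
  thus ?thesis using x'(2) by simp
 next
  case False
  thus ?thesis by (simp add: quad_def N_def)
 qed
 have mpos: "m > 0"
  using le[OF x0(1)] x0(2) Npos[OF x0J] by (metis less_le_trans mult_pos_pos not_less zero_less_mult_pos2)
 have N_add: "N (%j. x j + t * z j) (%j. x j + t * z j) = N x x + 2 * t * N x z + t\<^sup>2 * N z z" for x z t
  unfolding N_def by (rule weighted_sum_square_add)
 have q_add: "quad J G (%j. x j + t * z j) (%j. x j + t * z j) = quad J G x x + 2 * t * quad J G x z + t\<^sup>2 * quad J G z z" for x z t
  using quad_sym[of J G z x] sym by (simp add: quad_add_left quad_add_right algebra_simps power2_eq_square)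
 have crit: "quad J G x z = m * N x z" if z: "quad J G z y = 0" for z
 proof -
  have ineq: "2 * t * (quad J G x z - m * N x z) + t\<^sup>2 * (quad J G z z - m * N z z) <= 0" for t
  proof -
   have "quad J G (%j. x j + t * z j) y = 0" using x(1) z by (simp add: quad_add_left D_def)
   from le[OF this] show ?thesis unfolding N_add q_add using qx by (simp add: algebra_simps)
  qed
  show ?thesis
  proof (rule ccontr)
   assume neq: "quad J G x z ~= m * N x z"
   define A where "A = quad J G x z - m * N x z"
   define B where "B = m * N z z - quad J G z z"
   have A: "A ~= 0" using neq by (simp add: A_def)
   have B: "B \<ge> 0" using le[OF z] by (simp add: B_def)
   have "2 * t * A <= t\<^sup>2 * B" for t using ineq[of t] by (simp add: A_def B_def algebra_simps)
   from this[of "A / (B + 1)"] have "2 * A\<^sup>2 / (B + 1) <= A\<^sup>2 * B / (B + 1)\<^sup>2" by (simp add: power2_eq_square)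
   moreover have "2 * A\<^sup>2 / (B + 1) = A\<^sup>2 * (2 * (B + 1)) / (B + 1)\<^sup>2"
   proof -
    have gen: "2 * p / c = p * (2 * c) / c\<^sup>2" if "c ~= 0" for p c :: real using that by (simp add: power2_eq_square)
    show ?thesis by (rule gen) (use B in simp)
   qed
   ultimately have "A\<^sup>2 * (2 * (B + 1)) <= A\<^sup>2 * B" using B by (simp add: divide_le_cancel)
   moreover have "0 < A\<^sup>2" using A by simp
   ultimately have "2 * (B + 1) <= B" using mult_le_cancel_left_pos by blast
   thus False using B by simp
  qed
 qed
 have Nxy: "N x y = quad J G x y"
 proof -
  have "N x y = (\<Sum>j\<in>J. w j * x j)" unfolding N_def using y by (intro sum.cong) (auto simp: less_imp_neq[THEN not_sym])
  also have "... = quad J G x y" by (simp add: w_def quad_def sum_distrib_left sum_distrib_right ac_simps)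
  finally show ?thesis .
 qed
 have qyy: "quad J G y y > 0"
 proof -
  have "quad J G y y = (\<Sum>j\<in>J. y j * w j)" by (simp add: quad_def w_def sum_distrib_left ac_simps)
  also have "... > 0" using x0J fin y wp by (intro sum_pos) auto
  finally show ?thesis .
 qed
 \<comment> \<open>The eigenvalue equation, so far tested on the complement of \<open>y\<close>,
   extends to all \<open>z\<close> because \<open>x\<close> is orthogonal to \<open>y\<close> in
   both forms.\<close>
 have crit': "quad J G x z = m * N x z" for z
 proof -
  define s where "s = - (quad J G z y / quad J G y y)"
  have "quad J G (%j. z j + s * y j) y = 0" unfolding quad_add_left s_def using qyy by simp
  from crit[OF this] have "quad J G x z + s * quad J G x y = m * (N x z + s * N x y)"
   unfolding quad_add_right N_def weighted_sum_add .
  thus ?thesis using x(1) Nxy by (simp add: D_def)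
 qed
 have row: "(\<Sum>k\<in>J. G j k * x k) = m * (w j / y j) * x j" if j: "j \<in> J" for j
 proof -
  let ?e = "%k. if k = j then 1 else (0::real)"
  have "quad J G x ?e = (\<Sum>k\<in>J. G k j * x k)"
   using fin j by (simp add: quad_def if_distrib cong: if_cong)
  also have "... = (\<Sum>k\<in>J. G j k * x k)" using sym j by (intro sum.cong) auto
  finally show ?thesis using crit'[of ?e] fin j by (simp add: N_def if_distrib cong: if_cong)
 qed
 have "quad J G x x <= (\<Sum>j\<in>J. (y j / w j) * (m * (w j / y j) * x j)\<^sup>2)"
  using boch[of x] row by (simp add: w_def)
 also have "... = m\<^sup>2 * N x x"
  unfolding N_def sum_distrib_left using y wp by (intro sum.cong refl) (simp add: power2_eq_square less_imp_neq[THEN not_sym])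
 finally have "m <= m\<^sup>2" using qx Nx by simp
 hence "1 <= m" using mpos by (simp add: power2_eq_square)
 hence "N x x <= quad J G x x" using qx Nx by simp
 moreover have "N x x = (\<Sum>j\<in>J. ((\<Sum>k\<in>J. G j k * y k) / y j) * (x j)\<^sup>2)"
  by (simp add: N_def w_def power2_eq_square mult.assoc)
 ultimately show ?thesis using x(1) by (intro exI[of _ x]) (simp add: D_def)
qed

text \<open>By \<open>spectral_gap\<close>, failure at \<open>t\<close> is witnessed by a unit
  vector orthogonal to \<open>y\<close> with Rayleigh quotient at least 1. Such pairs form the
  compact set \<open>Z\<close>, so failure is a closed condition on \<open>t\<close>, as is success.
  Connectedness of the unit interval carries success from 0 to 1.\<close>

lemma hyperbolic_continuation:
 fixes J :: "'j set" and G :: "real => 'j => 'j => real"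
 assumes fin: "finite J" and sym: "!!t j k. j \<in> J ==> k \<in> J ==> G t j k = G t k j"
  and cont: "!!j k. j \<in> J ==> k \<in> J ==> continuous_on {0..1} (%t. G t j k)"
  and y: "!!j. j \<in> J ==> 0 < y j" and w: "!!t j. t \<in> {0..1} ==> j \<in> J ==> 0 < (\<Sum>k\<in>J. G t j k * y k)"
  and boch: "!!t x. t \<in> {0..1} ==> quad J (G t) x x <= (\<Sum>j\<in>J. (y j / (\<Sum>k\<in>J. G t j k * y k)) * (\<Sum>k\<in>J. G t j k * x k)\<^sup>2)"
  and start: "!!x. quad J (G 0) x x * quad J (G 0) y y <= (quad J (G 0) x y)\<^sup>2"
 shows "quad J (G 1) x x * quad J (G 1) y y <= (quad J (G 1) x y)\<^sup>2"
proof -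
 define T where "T = {t \<in> {0..1}. \<forall>x. quad J (G t) x x * quad J (G t) y y <= (quad J (G t) x y)\<^sup>2}"
 let ?K = "{x :: 'j => real. (\<forall>j. j \<notin> J --> x j = 0) & (\<forall>j. \<bar>x j\<bar> <= 1) & (\<Sum>j\<in>J. (x j)\<^sup>2) = 1}"
 define N where "N t x = (\<Sum>j\<in>J. ((\<Sum>k\<in>J. G t j k * y k) / y j) * (x j)\<^sup>2)" for t and x :: "'j => real"
 define Z where "Z = {p \<in> {0..1} \<times> ?K. quad J (G (fst p)) (snd p) y = 0 & N (fst p) (snd p) <= quad J (G (fst p)) (snd p) (snd p)}"
 have cq: "continuous_on {0..1} (%t. quad J (G t) x z)" for x z
  unfolding quad_def by (intro continuous_intros cont)
 have "closed T"
 proof -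
  have "T = (\<Inter>x. {t \<in> {0..1}. quad J (G t) x x * quad J (G t) y y <= (quad J (G t) x y)\<^sup>2})" by (auto simp: T_def)
  moreover have "closed {t \<in> {0..1}. quad J (G t) x x * quad J (G t) y y <= (quad J (G t) x y)\<^sup>2}" for x
   by (intro continuous_on_closed_Collect_le continuous_intros cq)
  ultimately show ?thesis by auto
 qed
 have cont2: "continuous_on ({0..1} \<times> ?K) (%p. G (fst p) j k)" if "j \<in> J" "k \<in> J" for j k
  by (rule continuous_on_compose2[OF cont[OF that] continuous_on_fst[OF continuous_on_id]]) auto
 have cont3: "continuous_on S (%p :: real \<times> ('j => real). snd p j)" for S j
  by (rule continuous_on_product_then_coordinatewise[OF continuous_on_snd[OF continuous_on_id]])
 have "compact Z"
 proof -
  have 1: "continuous_on ({0..1} \<times> ?K) (%p. quad J (G (fst p)) (snd p) y)"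
   unfolding quad_def by (intro continuous_intros cont2 cont3)
  have 2: "continuous_on ({0..1} \<times> ?K) (%p. quad J (G (fst p)) (snd p) (snd p))"
   unfolding quad_def by (intro continuous_intros cont2 cont3)
  have yn: "y j ~= 0" if "j \<in> J" for j using y[OF that] by simp
  have 3: "continuous_on ({0..1} \<times> ?K) (%p. N (fst p) (snd p))"
   unfolding N_def by (intro continuous_intros cont2 cont3 ballI yn)
  have cK: "compact ({0..1::real} \<times> ?K)" "closed ({0..1::real} \<times> ?K)"
   by (intro compact_Times closed_Times compact_quad_sphere; simp)+
  have "Z = ({0..1} \<times> ?K) \<inter> {p \<in> {0..1} \<times> ?K. quad J (G (fst p)) (snd p) y = 0} \<inter> {p \<in> {0..1} \<times> ?K. N (fst p) (snd p) <= quad J (G (fst p)) (snd p) (snd p)}"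
   by (auto simp: Z_def)
  moreover have "compact ..."
   by (intro compact_Int_closed cK(1) continuous_closed_preimage_constant[OF 1 cK(2)]
     continuous_on_closed_Collect_le[OF 3 2 cK(2)])
  ultimately show ?thesis by simp
 qed
 hence cl: "closed (fst ` Z)" by (intro compact_imp_closed compact_continuous_image continuous_intros)
 show ?thesis
 proof (cases "J = {}")
  case True
  thus ?thesis by (simp add: quad_def)
 next
  case False
  have qyy: "quad J (G t) y y > 0" if t: "t \<in> {0..1}" for t
  proof -
   have "quad J (G t) y y = (\<Sum>j\<in>J. y j * (\<Sum>k\<in>J. G t j k * y k))" by (simp add: quad_def sum_distrib_left ac_simps)
   also have "... > 0" using False fin y w[OF t] by (intro sum_pos) auto
   finally show ?thesis .
  qed
  have cov: "{0..1} \<subseteq> T \<union> fst ` Z"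
  proof
   fix t :: real assume t: "t \<in> {0..1}"
   show "t \<in> T \<union> fst ` Z"
   proof (cases "t \<in> T")
    case False
    then obtain x where x: "(quad J (G t) x y)\<^sup>2 < quad J (G t) x x * quad J (G t) y y"
     using t by (auto simp: T_def not_le)
    define s where "s = - (quad J (G t) x y / quad J (G t) y y)"
    let ?x = "%j. x j + s * y j"
    have 1: "quad J (G t) ?x y = 0" unfolding quad_add_left s_def using qyy[OF t] by simp
    have "quad J (G t) ?x ?x = quad J (G t) x x + s * quad J (G t) y x"
     using 1 by (subst quad_add_right) (simp add: quad_add_left)
    also have "quad J (G t) y x = quad J (G t) x y" by (rule quad_sym) (rule sym)
    finally have e: "quad J (G t) ?x ?x = quad J (G t) x x + s * quad J (G t) x y" .
    have "quad J (G t) x x + s * quad J (G t) x y > 0"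
     using x qyy[OF t] by (simp add: s_def field_simps power2_eq_square)
    hence "quad J (G t) ?x ?x > 0" unfolding e .
    from spectral_gap[OF fin sym y w[OF t] boch[OF t] 1 this]
    obtain z where "z \<in> ?K" "quad J (G t) z y = 0" "N t z <= quad J (G t) z z" by (auto simp: N_def)
    hence "(t, z) \<in> Z" using t by (simp add: Z_def)
    thus ?thesis by force
   qed simp
  qed
  have dis: "T \<inter> fst ` Z = {}"
  proof (rule ccontr)
   assume "T \<inter> fst ` Z ~= {}"
   then obtain t x where tx: "t \<in> T" "(t, x) \<in> Z" by force
   hence t: "t \<in> {0..1}" by (simp add: T_def)
   have "\<exists>j\<in>J. x j ~= 0"
   proof (rule ccontr)
    assume "\<not> ?thesis"
    hence "(\<Sum>j\<in>J. (x j)\<^sup>2) = 0" by simp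
    thus False using tx by (auto simp: Z_def)
   qed
   then obtain j where j: "j \<in> J" "x j ~= 0" by blast
   have "N t x > 0" unfolding N_def
    using j fin y w[OF t] by (intro sum_pos2[of J j]) (auto intro!: mult_nonneg_nonneg divide_nonneg_nonneg simp: less_imp_le)
   hence "quad J (G t) x x * quad J (G t) y y > 0" using tx(2) qyy[OF t] by (auto simp: Z_def)
   moreover have "quad J (G t) x x * quad J (G t) y y <= (quad J (G t) x y)\<^sup>2" "quad J (G t) x y = 0"
    using tx(1) unfolding T_def by blast (use tx(2) in \<open>simp add: Z_def\<close>)
   ultimately show False by simp
  qed
  have "0 \<in> T" using start by (simp add: T_def)
  hence "1 \<in> T"
  proof -
   have "(1::real) \<in> {0..1}" "(0::real) \<in> {0..1}" by auto
   hence "fst ` Z \<inter> {0..1} = {}"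
    using connected_Icc[of 0 "1::real", unfolded connected_closed] \<open>closed T\<close> cl cov dis \<open>0 \<in> T\<close> by blast
   thus ?thesis using cov \<open>1 \<in> {0..1}\<close> by blast
  qed
  thus ?thesis by (simp add: T_def)
 qed
qed

section \<open>Positivity of the mixed volume form and the induction over faces\<close>

context simplicial_fan_nonempty
begin

lemma faces_subset: "I \<in> faces ==> J \<subseteq> I ==> J \<in> faces"
 unfolding faces_def by blast

lemma mform_not_face: "set as \<notin> faces ==> mform ys as = 0"
proof (induction ys arbitrary: as)
 case Nil
 thus ?case by (simp add: mcoef_not_face)
next
 case (Cons y ys)
 have "set (a # as) \<notin> faces" for a using Cons.prems faces_subset by (metis set_subset_Cons)
 thus ?case using Cons.IH by simp
qed

text \<open>A relative interior point of the face: from one of its vertices move along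
  \<open>d\<close>, which keeps the facets of \<open>I\<close> tight and leaves the remaining facets
  of \<open>S\<close>. The step \<open>g\<close> is short enough for the facets outside
  \<open>S\<close>, which have positive slack at the vertex.\<close>

lemma face_facet_offset:
 assumes h: "h \<in> chamber" and I: "I \<in> faces"
 obtains x where "!!i. i \<in> I ==> i \<bullet> x = h i" "!!j. j \<in> A - I ==> j \<bullet> x < h j"
proof -
 obtain S where S: "S \<in> BB" "I \<subseteq> S" using I by (auto simp: faces_def)
 obtain d where d: "!!b. b \<in> S ==> b \<bullet> d = (if b \<in> I then 0 else - 1)"
  using independent_interpolate[of S "%b. if b \<in> I then 0 else - 1"] basis[OF S(1)] by blast
 define g where "g = Min (insert 1 ((%j. (h j - j \<bullet> vertex S h) / (1 + \<bar>j \<bullet> d\<bar>)) ` (A - S)))"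
 have g: "0 < g" "!!j. j \<in> A - S ==> g <= (h j - j \<bullet> vertex S h) / (1 + \<bar>j \<bullet> d\<bar>)"
  unfolding g_def using finite_A h S(1) by (auto simp: chamber_def intro!: divide_pos_pos)
 show ?thesis
 proof (rule that[of "vertex S h + g *R d"])
  fix i assume "i \<in> I"
  thus "i \<bullet> (vertex S h + g *R d) = h i" using S d[of i] by (auto simp: inner_add_right vertex_inner)
 next
  fix j assume j: "j \<in> A - I"
  show "j \<bullet> (vertex S h + g *R d) < h j"
  proof (cases "j \<in> S")
   case True
   thus ?thesis using d[of j] j g(1) by (simp add: inner_add_right vertex_inner[OF S(1)])
  next
   case False
   hence "g * (1 + \<bar>j \<bullet> d\<bar>) <= h j - j \<bullet> vertex S h" using g(2)[of j] j by (simp add: pos_le_divide_eq)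
   hence "g + g * \<bar>j \<bullet> d\<bar> <= h j - j \<bullet> vertex S h" by (simp only: distrib_left mult_1_right)
   moreover have "g * (j \<bullet> d) <= g * \<bar>j \<bullet> d\<bar>" using g(1) by (intro mult_left_mono) auto
   ultimately show ?thesis unfolding inner_add_right inner_scaleR_right using g(1) by linarith
  qed
 qed
qed

lemma mform_shift:
 assumes "set as \<subseteq> A" "Suc (length as + length ys) = DIM('a)"
 shows "mform ((%a. x a - a \<bullet> v) # ys) as = mform (x # ys) as"
proof -
 have "(%a. x a - a \<bullet> v) = x + (%a. a \<bullet> (- v))" by (auto simp: fun_eq_iff)
 thus ?thesis using mform_translate[OF assms, of "- v"] by (simp only: mform_add)
qed

definition adjacent :: "'a set => 'a set" where
 "adjacent I = {j \<in> A - I. insert j I \<in> faces}"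

lemma adjacent_finite: "finite (adjacent I)" using finite_A by (simp add: adjacent_def)

lemma adjacent_nonempty: "I \<in> faces ==> card I < DIM('a) ==> adjacent I ~= {}"
proof -
 assume I: "I \<in> faces" "card I < DIM('a)"
 then obtain S where S: "S \<in> BB" "I \<subseteq> S" by (auto simp: faces_def)
 then obtain j where "j \<in> S - I" using I(2) basis[OF S(1)] by (metis Diff_eq_empty_iff all_not_in_conv less_irrefl subset_antisym)
 hence "j \<in> adjacent I" using S basis[OF S(1)] by (auto simp: adjacent_def faces_def)
 thus ?thesis by blast
qed

lemma mform_adjacent_sum:
 assumes "!!i. i \<in> set is ==> y i = 0"
 shows "mform (y # ys) is = (\<Sum>j\<in>adjacent (set is). y j * mform ys (j # is))"
proof -
 have "(\<Sum>j\<in>adjacent (set is). y j * mform ys (j # is)) = (\<Sum>a\<in>A. y a * mform ys (a # is))"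
 proof (rule sum.mono_neutral_left[OF finite_A])
  show "\<forall>a\<in>A - adjacent (set is). y a * mform ys (a # is) = 0"
   using assms mform_not_face[of "_ # is" ys] by (auto simp: adjacent_def)
 qed (auto simp: adjacent_def)
 thus ?thesis by simp
qed

text \<open>Moving the origin into the relative interior of the face makes the support numbers
  vanish on the face and positive off it. The form does not notice translations, so \<open>y\<close>
  may stand for \<open>h\<close>.\<close>

lemma normalized_support:
 assumes h: "h \<in> chamber" and I: "set is \<in> faces"
 obtains y where "!!i. i \<in> set is ==> y i = 0" "!!j. j \<in> A - set is ==> 0 < y j"
  "!!ys. Suc (length is + length ys) = DIM('a) ==> mform (h # ys) is = mform (y # ys) is"
  "!!ys j. j \<in> A ==> Suc (Suc (length is + length ys)) = DIM('a) ==> mform (h # ys) (j # is) = mform (y # ys) (j # is)"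
proof -
 obtain x where x: "!!i. i \<in> set is ==> i \<bullet> x = h i" "!!j. j \<in> A - set is ==> j \<bullet> x < h j"
  using face_facet_offset[OF h I] by blast
 show ?thesis
  using mform_shift[of "_ # is"] mform_shift[of "is"] faces_independent[OF I]
  by (intro that[of "%a. h a - a \<bullet> x"]) (auto simp: x simp del: mform.simps)
qed

text \<open>After this normalization the form is a sum, over the facets adjacent to the face, of
  positive multiples of forms on smaller faces.\<close>

lemma mform_pos:
 assumes "distinct is" "set is \<in> faces" "set cs \<subseteq> chamber" "length is + length cs = DIM('a)"
 shows "0 < mform cs is"
 using assms
proof (induction cs arbitrary: "is")
 case Nil
 thus ?case by (simp add: mcoef_pos)
next
 case (Cons c cs)
 have c: "c \<in> chamber" and I: "set is \<in> faces" using Cons.prems by auto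
 obtain y where y: "!!i. i \<in> set is ==> y i = 0" "!!j. j \<in> A - set is ==> 0 < y j"
  "!!ys. Suc (length is + length ys) = DIM('a) ==> mform (c # ys) is = mform (y # ys) is"
  "!!ys j. j \<in> A ==> Suc (Suc (length is + length ys)) = DIM('a) ==> mform (c # ys) (j # is) = mform (y # ys) (j # is)"
  using normalized_support[OF c I] by blast
 have "mform (c # cs) is = mform (y # cs) is" using y(3) Cons.prems by simp
 also have "... = (\<Sum>j\<in>adjacent (set is). y j * mform cs (j # is))" by (rule mform_adjacent_sum[OF y(1)])
 also have "... > 0"
 proof (rule sum_pos)
  show "adjacent (set is) ~= {}"
   using Cons.prems by (intro adjacent_nonempty) (auto simp: distinct_card)
  fix j assume j: "j \<in> adjacent (set is)"
  thus "0 < y j * mform cs (j # is)"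
   using Cons.prems y(2)[of j] Cons.IH[of "j # is"] by (auto simp: adjacent_def)
 qed (rule adjacent_finite)
 finally show ?case .
qed

lemma mform_continuous:
 assumes "!!c a. c \<in> set cs ==> a \<in> A ==> continuous_on T (%t. c t a)"
 shows "continuous_on T (%t. mform (map (%c. c t) cs) as)"
 using assms by (induction cs arbitrary: as) (auto intro!: continuous_intros)

lemma mform_diff: "mform ((%a. x a + s * z a) # ys) as = mform (x # ys) as + s * mform (z # ys) as"
 by (simp add: algebra_simps sum.distrib sum_distrib_left)

lemma mform_diff2: "mform (w # (%a. x a + s * z a) # ys) as = mform (w # x # ys) as + s * mform (w # z # ys) as"
 by (subst (1 2 3) mform_swap) (rule mform_diff)

text \<open>The vector \<open>x\<close> is arbitrary, not confined to the chamber. When the value at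
  \<open>c\<close> is positive, the condition says that the form is nonpositive on the complement of
  \<open>c\<close>.\<close>

definition hyperbolic_at :: "'a list => ('a => real) list => ('a => real) => bool" where
 "hyperbolic_at is cs c \<longleftrightarrow> (\<forall>x. mform (x # x # cs) is * mform (c # c # cs) is <= (mform (x # c # cs) is)\<^sup>2)"

text \<open>If \<open>x\<close> orthogonal to \<open>d\<close> had positive square, the plane
  spanned by \<open>x\<close> and \<open>d\<close> would be positive definite; yet it contains a
  vector \<open>z = x + r d\<close> orthogonal to \<open>c\<close>, whose square is
  nonpositive.\<close>

lemma hyperbolic_transfer:
 assumes H: "hyperbolic_at is cs c" and pos: "mform (c # c # cs) is > 0" "mform (d # d # cs) is > 0"
 shows "hyperbolic_at is cs d"
proof -
 define q where "q x z = mform (x # z # cs) is" for x z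
 have add: "q (%a. x a + s * x' a) z = q x z + s * q x' z" for x x' z s unfolding q_def by (rule mform_diff)
 have sym: "q x z = q z x" for x z unfolding q_def by (rule mform_swap)
 have qq: "q (%a. x a + s * z a) (%a. x a + s * z a) = q x x + 2 * s * q x z + s\<^sup>2 * q z z" for x z s
  using add sym by (simp add: algebra_simps power2_eq_square)
 have le: "q x x * q c c <= (q x c)\<^sup>2" for x using H by (simp add: hyperbolic_at_def q_def)
 have cc: "q c c > 0" and dd: "q d d > 0" using pos by (simp_all add: q_def)
 have dc: "q d c ~= 0" using le[of d] cc dd by (metis mult_pos_pos not_less power_zero_numeral)
 have "q x x * q d d <= (q x d)\<^sup>2" for x
 proof -
  define s where "s = - (q x d / q d d)"
  let ?x = "%a. x a + s * d a"
  have xd: "q ?x d = 0" unfolding add s_def using dd by simp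
  define r where "r = - (q ?x c / q d c)"
  let ?z = "%a. ?x a + r * d a"
  have "q ?z c = q ?x c + r * q d c" by (rule add)
  hence zc: "q ?z c = 0" using dc by (simp add: r_def)
  have "q ?z ?z = q ?x ?x + 2 * r * q ?x d + r\<^sup>2 * q d d" by (rule qq)
  hence "q ?z ?z = q ?x ?x + r\<^sup>2 * q d d" using xd by simp
  moreover have "q ?z ?z <= 0" using le[of ?z] zc cc by (simp add: mult_le_0_iff)
  moreover have "0 <= r\<^sup>2 * q d d" using dd by simp
  ultimately have "q ?x ?x <= 0" by linarith
  moreover have "q ?x ?x = q x x + 2 * s * q x d + s\<^sup>2 * q d d" by (rule qq)
  moreover have "q x x + 2 * s * q x d + s\<^sup>2 * q d d = q x x - (q x d)\<^sup>2 / q d d" using dd by (simp add: s_def power2_eq_square field_simps)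
  ultimately have "q x x <= (q x d)\<^sup>2 / q d d" by linarith
  thus ?thesis using dd by (simp add: pos_le_divide_eq)
 qed
 thus ?thesis by (simp add: hyperbolic_at_def q_def)
qed

text \<open>In the coordinates of the adjacent facets \<open>c\<close> becomes a positive vector
  \<open>y\<close>, and the induction hypothesis on each adjacent face, weighted by
  \<open>y j\<close> and summed, is precisely the Bochner inequality demanded by
  \<open>hyperbolic_continuation\<close>. For this the reference vector \<open>c\<close> must occur
  among the fixed arguments.\<close>

lemma hyperbolic_step:
 assumes I: "distinct is" "set is \<in> faces" and c: "c \<in> chamber" and cs: "set cs \<subseteq> chamber"
  and len: "length is + length cs + 3 = DIM('a)"
  and IH: "!!j cs'. j \<in> adjacent (set is) ==> length cs' = length cs ==> set cs' \<subseteq> chamber ==> hyperbolic_at (j # is) cs' c"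
  and start: "hyperbolic_at is (replicate (Suc (length cs)) c) c"
 shows "hyperbolic_at is (c # cs) c"
proof -
 let ?J = "adjacent (set is)"
 obtain y where y: "!!i. i \<in> set is ==> y i = 0" "!!j. j \<in> A - set is ==> 0 < y j"
  "!!ys. Suc (length is + length ys) = DIM('a) ==> mform (c # ys) is = mform (y # ys) is"
  "!!ys j. j \<in> A ==> Suc (Suc (length is + length ys)) = DIM('a) ==> mform (c # ys) (j # is) = mform (y # ys) (j # is)"
  using normalized_support[OF c I(2)] by blast
 \<comment> \<open>The deformation starts at copies of \<open>c\<close>, where \<open>start\<close>
   applies, and ends at \<open>cs\<close>. It remains in the chamber throughout, which keeps the row
   sums positive.\<close>
 define C where "C t = map (%d a. (1 - t) * c a + t * d a) cs" for t :: real
 have lenC: "length (C t) = length cs" for t by (simp add: C_def)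
 have Cch: "set (C t) \<subseteq> chamber" if t: "t \<in> {0..1}" for t
 proof
  fix e assume "e \<in> set (C t)"
  then obtain d where d: "d \<in> chamber" "e = (%a. (1 - t) * c a) + (%a. t * d a)" using cs by (auto simp: C_def fun_eq_iff)
  show "e \<in> chamber"
  proof (cases "t = 1")
   case True
   hence "e = d" using d by (auto simp: fun_eq_iff)
   thus ?thesis using d by simp
  next
   case False
   thus ?thesis unfolding d(2) using t c d(1)
    by (intro chamber_add chamber_scale closed_chamber_scale chamber_closed) auto
  qed
 qed
 define G where "G t j k = mform (c # C t) (j # k # is)" for t j k
 have adjA: "j \<in> A" "j \<notin> set is" if "j \<in> ?J" for j using that by (auto simp: adjacent_def)
 have ext: "(\<Sum>k\<in>?J. G t j k * x k) = mform (x # c # C t) (j # is)" if x: "!!k. k \<notin> ?J ==> x k = 0" for t j x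
 proof -
  have "mform (x # c # C t) (j # is) = (\<Sum>k\<in>A. x k * mform (c # C t) (k # j # is))" by (rule mform_sum)
  also have "... = (\<Sum>k\<in>?J. x k * mform (c # C t) (k # j # is))"
   using x by (intro sum.mono_neutral_right[OF finite_A]) (auto simp: adjacent_def)
  also have "... = (\<Sum>k\<in>?J. G t j k * x k)"
   by (intro sum.cong refl) (simp add: G_def mult.commute mform_perm_index[of "_ # j # is" "j # _ # is"] del: mform.simps)
  finally show ?thesis by simp
 qed
 have w: "(\<Sum>k\<in>?J. G t j k * y k) = mform (c # c # C t) (j # is)" if j: "j \<in> ?J" for t j
 proof -
  have "(\<Sum>k\<in>?J. G t j k * y k) = (\<Sum>k\<in>A. y k * mform (c # C t) (k # j # is))"
  proof (subst sum.mono_neutral_left[OF finite_A])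
   show "\<forall>i\<in>A - ?J. G t j i * y i = 0"
   proof
    fix i assume i: "i \<in> A - ?J"
    show "G t j i * y i = 0"
    proof (cases "i \<in> set is")
     case False
     hence "insert i (set is) \<notin> faces" using i by (auto simp: adjacent_def)
     hence "set (j # i # is) \<notin> faces" using faces_subset by (metis list.set(2) subset_insertI)
     thus ?thesis by (simp add: G_def mform_not_face del: mform.simps)
    qed (simp add: y(1))
   qed
  qed (auto simp: adjacent_def G_def mult.commute mform_perm_index[of "_ # j # is" "j # _ # is"] simp del: mform.simps intro!: sum.cong)
  also have "... = mform (y # c # C t) (j # is)" by (rule mform_sum[symmetric])
  also have "... = mform (c # c # C t) (j # is)" using adjA(1)[OF j] len lenC by (intro y(4)[symmetric]) auto
  finally show ?thesis .
 qed
 have wpos: "0 < mform (c # c # C t) (j # is)" if "j \<in> ?J" "t \<in> {0..1}" for t j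
  using that I c Cch len lenC by (intro mform_pos) (auto simp: adjacent_def)
 have quad_ext: "quad ?J (G t) x z = mform (x # z # c # C t) is"
  if "!!k. k \<notin> ?J ==> x k = 0" "!!k. k \<notin> ?J ==> z k = 0" for t x z
 proof -
  have "mform (x # z # c # C t) is = (\<Sum>j\<in>?J. x j * mform (z # c # C t) (j # is))"
   using that(1) by (intro mform_adjacent_sum) (auto simp: adjacent_def)
  also have "... = quad ?J (G t) x z"
   unfolding quad_def using ext[OF that(2)] by (intro sum.cong refl) (simp add: sum_distrib_left ac_simps flip: ext[OF that(2)] del: mform.simps)
  finally show ?thesis by simp
 qed
 have quad_y: "quad ?J (G t) x y = mform (x # c # c # C t) is" if "!!k. k \<notin> ?J ==> x k = 0" for t x
 proof -
  have "mform (x # c # c # C t) is = (\<Sum>j\<in>?J. x j * mform (c # c # C t) (j # is))"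
   using that(1) by (intro mform_adjacent_sum) (auto simp: adjacent_def)
  also have "... = quad ?J (G t) x y"
   unfolding quad_def by (intro sum.cong refl) (simp add: sum_distrib_left ac_simps flip: w del: mform.simps)
  finally show ?thesis by simp
 qed
 have quad_yy: "quad ?J (G t) y y = mform (c # c # c # C t) is" for t
 proof -
  have "mform (c # c # c # C t) is = mform (y # c # c # C t) is" using len lenC by (intro y(3)) auto
  also have "... = (\<Sum>j\<in>?J. y j * mform (c # c # C t) (j # is))"
   using y(1) by (intro mform_adjacent_sum) (auto simp: adjacent_def)
  also have "... = quad ?J (G t) y y"
   unfolding quad_def by (intro sum.cong refl) (simp add: sum_distrib_left ac_simps flip: w del: mform.simps)
  finally show ?thesis by simp
 qed
 define cut where "cut x = (%k. if k \<in> ?J then x k else (0::real))" for x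
 have quad_cut: "quad ?J g (cut x) (cut z) = quad ?J g x z" "quad ?J g (cut x) z = quad ?J g x z" for g x z
  by (simp_all add: quad_def cut_def)
 have cut0: "k \<notin> ?J ==> cut x k = 0" for k x by (simp add: cut_def)
 have key: "quad ?J (G 1) x x * quad ?J (G 1) y y <= (quad ?J (G 1) x y)\<^sup>2" for x
 proof (rule hyperbolic_continuation)
  show "finite ?J" by (rule adjacent_finite)
  show "G t j k = G t k j" for t j k unfolding G_def by (rule mform_perm_index) simp
  show "continuous_on {0..1} (%t. G t j k)" for j k
  proof -
   have "continuous_on {0..1} (%t. mform (map (%c. c t) ((%t. c) # map (%d t a. (1 - t) * c a + t * d a) cs)) (j # k # is))"
    by (rule mform_continuous) (auto intro!: continuous_intros)
   thus ?thesis by (simp add: G_def C_def o_def)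
  qed
  show "0 < y j" if "j \<in> ?J" for j using y(2) adjA[OF that] by blast
  show "0 < (\<Sum>k\<in>?J. G t j k * y k)" if "t \<in> {0..1}" "j \<in> ?J" for t j using w wpos that by simp
  show "quad ?J (G 0) x x * quad ?J (G 0) y y <= (quad ?J (G 0) x y)\<^sup>2" for x
  proof -
   have "C 0 = replicate (length cs) c" by (simp add: C_def map_replicate_const)
   hence "hyperbolic_at is (c # C 0) c" using start by simp
   hence "mform (cut x # cut x # c # C 0) is * mform (c # c # c # C 0) is <= (mform (cut x # c # c # C 0) is)\<^sup>2"
    unfolding hyperbolic_at_def by blast
   moreover have "mform (cut x # cut x # c # C 0) is = quad ?J (G 0) x x"
    using quad_ext[of "cut x" "cut x" 0, OF cut0 cut0] quad_cut by (simp del: mform.simps)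
   moreover have "mform (cut x # c # c # C 0) is = quad ?J (G 0) x y"
    using quad_y[of "cut x" 0, OF cut0] quad_cut by (simp del: mform.simps)
   ultimately show ?thesis by (simp only: quad_yy)
  qed
  show "quad ?J (G t) x x <= (\<Sum>j\<in>?J. (y j / (\<Sum>k\<in>?J. G t j k * y k)) * (\<Sum>k\<in>?J. G t j k * x k)\<^sup>2)" if t: "t \<in> {0..1}" for t x
  proof -
   let ?x = "cut x"
   have "quad ?J (G t) x x = mform (?x # ?x # c # C t) is"
    using quad_ext[of "cut x" "cut x" t, OF cut0 cut0] quad_cut by (simp del: mform.simps)
   also have "... = mform (c # ?x # ?x # C t) is" by (rule mform_perm) simp
   also have "... = mform (y # ?x # ?x # C t) is" using len lenC by (intro y(3)) auto
   also have "... = (\<Sum>j\<in>?J. y j * mform (?x # ?x # C t) (j # is))"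
    by (intro mform_adjacent_sum y(1))
   also have "... <= (\<Sum>j\<in>?J. (y j / (\<Sum>k\<in>?J. G t j k * y k)) * (\<Sum>k\<in>?J. G t j k * x k)\<^sup>2)"
   proof (rule sum_mono)
    fix j assume j: "j \<in> ?J"
    have "hyperbolic_at (j # is) (C t) c" using IH[OF j lenC Cch[OF t]] .
    hence 1: "mform (?x # ?x # C t) (j # is) * mform (c # c # C t) (j # is) <= (mform (?x # c # C t) (j # is))\<^sup>2"
     unfolding hyperbolic_at_def by blast
    have 2: "mform (?x # c # C t) (j # is) = (\<Sum>k\<in>?J. G t j k * x k)"
    proof -
     have "(\<Sum>k\<in>?J. G t j k * cut x k) = mform (cut x # c # C t) (j # is)" by (rule ext) (rule cut0)
     moreover have "(\<Sum>k\<in>?J. G t j k * cut x k) = (\<Sum>k\<in>?J. G t j k * x k)" by (intro sum.cong) (auto simp: cut_def)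
     ultimately show ?thesis by (simp only:)
    qed
    have "0 < y j" using y(2) adjA[OF j] by blast
    thus "y j * mform (?x # ?x # C t) (j # is) <= (y j / (\<Sum>k\<in>?J. G t j k * y k)) * (\<Sum>k\<in>?J. G t j k * x k)\<^sup>2"
     using 1 wpos[OF j t] unfolding 2 w[OF j] by (simp add: field_simps mult_left_mono del: mform.simps)
   qed
   finally show ?thesis .
  qed
 qed
 have C1: "C 1 = cs" by (simp add: C_def)
 show ?thesis unfolding hyperbolic_at_def
 proof
  fix x
  \<comment> \<open>An arbitrary \<open>x\<close> is translated to vanish on the face and then cut
    down to the adjacent facets; neither change affects the form.\<close>
  obtain v where v: "!!i. i \<in> set is ==> i \<bullet> v = x i"
   using independent_interpolate faces_independent[OF I(2)] by metis
  define x' where "x' = (%a. x a - a \<bullet> v)"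
  have sub: "set is \<subseteq> A" using faces_independent[OF I(2)] by blast
  have red: "mform (x # ys) is = mform (cut x' # ys) is" if "Suc (length is + length ys) = DIM('a)" for ys
  proof -
   have "mform (x # ys) is = mform (x' # ys) is" unfolding x'_def using mform_shift[OF sub that] by simp
   also have "... = (\<Sum>j\<in>?J. x' j * mform ys (j # is))" using v by (intro mform_adjacent_sum) (simp add: x'_def)
   also have "... = (\<Sum>j\<in>?J. cut x' j * mform ys (j # is))" by (simp add: cut_def)
   also have "... = mform (cut x' # ys) is" by (intro mform_adjacent_sum[symmetric]) (auto simp: cut_def adjacent_def)
   finally show ?thesis .
  qed
  have 1: "mform (x # x # c # cs) is = mform (cut x' # cut x' # c # cs) is"
   using red[of "x # c # cs"] red[of "cut x' # c # cs"] len mform_swap[of "cut x'" x "c # cs" "is"] by simp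
  have 2: "mform (x # c # c # cs) is = mform (cut x' # c # c # cs) is" using red[of "c # c # cs"] len by simp
  show "mform (x # x # c # cs) is * mform (c # c # c # cs) is <= (mform (x # c # c # cs) is)\<^sup>2"
  proof -
   have "quad ?J (G 1) (cut x') (cut x') = mform (cut x' # cut x' # c # C 1) is" by (rule quad_ext) (erule cut0)+
   moreover have "quad ?J (G 1) (cut x') y = mform (cut x' # c # c # C 1) is" by (rule quad_y) (erule cut0)
   ultimately show ?thesis using key[of "cut x'"] unfolding 1 2 C1 quad_yy by (simp only:)
  qed
 qed
qed

end

lemma iterated_diff_sum: "finite I ==> iterated_diff cs (%t. \<Sum>i\<in>I. c i * f i t) h = (\<Sum>i\<in>I. c i * iterated_diff cs (f i) h)"
 by (induction cs arbitrary: h) (simp_all add: sum_subtractf right_diff_distrib)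

lemma iterated_diff_power: "n <= m ==> iterated_diff (replicate m 1) (%t::real. t ^ n) x = (if m = n then fact n else 0)"
proof (induction m arbitrary: n)
 case (Suc m)
 have eq: "(t + 1) ^ n - t ^ n = (\<Sum>i<n. real (n choose i) * t ^ i)" for t :: real
  unfolding binomial_ring by (simp add: lessThan_Suc_atMost[symmetric])
 have "iterated_diff (replicate (Suc m) 1) (%t::real. t ^ n) x = (\<Sum>i<n. real (n choose i) * (if m = i then fact i else 0))"
  unfolding replicate_Suc iterated_diff_cons eq iterated_diff_sum[OF finite_lessThan] using Suc by (intro sum.cong) auto
 also have "... = (if m < n then real (n choose m) * fact m else 0)"
  by (simp add: if_distrib cong: if_cong)
 finally show ?case using Suc.prems by (auto simp: le_Suc_eq)
qed simp

lemma dilate_add: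
 assumes "convex K" "0 <= s" "0 <= t" shows "s \<odot> K + t \<odot> K = (s + t) \<odot> K"
proof (intro set_eqI iffI)
 fix z assume "z \<in> s \<odot> K + t \<odot> K"
 then obtain x y where z: "z = s *R x + t *R y" "x \<in> K" "y \<in> K" by (auto simp: set_plus_def)
 show "z \<in> (s + t) \<odot> K"
 proof (cases "s + t = 0")
  case True
  thus ?thesis using assms z by (auto simp: add_nonneg_eq_0_iff intro: image_eqI[of _ _ x])
 next
  case False
  have "(s / (s+t)) *R x + (t / (s+t)) *R y \<in> K"
   using assms z False by (intro convexD) (auto simp: add_divide_distrib[symmetric])
  moreover have "z = (s + t) *R ((s / (s+t)) *R x + (t / (s+t)) *R y)"
   using False by (simp add: z(1) scaleR_add_right)
  ultimately show ?thesis by blast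
 qed
qed (auto simp: scaleR_left_distrib)

lemma dilate_zero: "K ~= {} ==> 0 \<odot> K = {0}" by auto

lemma iterated_diff_vol_replicate:
 fixes K :: "'a::euclidean_space set"
 assumes K: "convex_body K" and t: "0 <= t"
 shows "iterated_diff (replicate m K) vol (t \<odot> K) = iterated_diff (replicate m 1) (%t. t ^ DIM('a)) t * vol K"
 using t
proof (induction m arbitrary: t)
 case 0
 thus ?case using measure_lebesgue_affine[of t 0 K] by simp
next
 case (Suc m)
 have "t \<odot> K + K = (t + 1) \<odot> K" using dilate_add[of K t 1] K Suc.prems by (simp add: convex_body_def)
 thus ?case using Suc.IH[of "t + 1"] Suc.IH[of t] Suc.prems by (simp add: left_diff_distrib)
qed

lemma iterated_diff_vol_self:
 fixes K :: "'a::euclidean_space set"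
 assumes K: "convex_body K"
 shows "iterated_diff (replicate (DIM('a)) K) vol {0} = fact (DIM('a)) * vol K"
 using iterated_diff_vol_replicate[OF K, of 0 "DIM('a)"]
 unfolding dilate_zero[OF bodyD(3)[OF K]] by (simp add: iterated_diff_power)

section \<open>Log-concavity of face volumes and the Alexandrov-Fenchel inequality\<close>

context simplicial_fan_nonempty
begin

text \<open>Brunn-Minkowski is stated for compact sets; this closed version of \<open>slab\<close>
  has the same volume when the facets form a face.\<close>

definition closed_slab :: "('a => real) => ('a \<times> real) list => 'a set" where
 "closed_slab h zs = {x. (\<forall>a\<in>A. a \<bullet> x <= h a + (\<Sum>(b, s)\<leftarrow>zs. if a = b then s else 0)) & (\<forall>(a, s)\<in>set zs. h a <= a \<bullet> x)}"

lemma compact_closed_slab: "compact (closed_slab h zs)"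
proof -
 have "closed_slab h zs = P (%a. h a + (\<Sum>(b, s)\<leftarrow>zs. if a = b then s else 0)) \<inter> (\<Inter>(a,s)\<in>set zs. {x. h a <= a \<bullet> x})"
  by (auto simp: closed_slab_def polyh_def)
 moreover have "closed (\<Inter>(a,s)\<in>set zs. {x. h a <= a \<bullet> x})" by (intro closed_INT) (auto simp: closed_halfspace_ge)
 ultimately show ?thesis by (simp only: compact_Int_closed[OF compact_polyh])
qed

lemma vol_closed_slab:
 assumes "fst ` set zs \<in> faces" shows "vol (closed_slab h zs) = vol (slab h zs)"
proof (rule measure_negligible_symdiff[OF slab_lmeasurable])
 have "negligible (\<Union>a\<in>fst ` set zs. {x. a \<bullet> x = h a})"
 proof (intro negligible_Union, safe)
  fix a s assume "(a, s) \<in> set zs"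
  hence "a \<in> fst ` set zs" by force
  hence "a ~= 0" using faces_independent[OF assms] dependent_zero by metis
  thus "negligible {x. fst (a, s) \<bullet> x = h (fst (a, s))}" using negligible_hyperplane by auto
 qed simp
 moreover have "slab h zs - closed_slab h zs \<union> (closed_slab h zs - slab h zs) \<subseteq> (\<Union>a\<in>fst ` set zs. {x. a \<bullet> x = h a})"
  unfolding slab_def closed_slab_def by force
 ultimately show "negligible (slab h zs - closed_slab h zs \<union> (closed_slab h zs - slab h zs))"
  using negligible_subset by blast
qed

definition midpt :: "('a => real) => ('a => real) => 'a => real" where
 "midpt h k = (%a. (h a + k a) / 2)"

text \<open>Half the sum of the slabs at \<open>h\<close> and \<open>k\<close> lies in the slab at
  their midpoint, because the defining inequalities are affine in the support numbers while the
  steps are the same for both.\<close>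

lemma slab_log_concave:
 assumes zs: "distinct (map fst zs)" "fst ` set zs \<in> faces" "\<forall>z\<in>set zs. 0 <= snd z"
 shows "iterated_diff (steps zs) pvol h * iterated_diff (steps zs) pvol k <= (iterated_diff (steps zs) pvol (midpt h k))\<^sup>2"
proof -
 let ?X = "closed_slab h zs" and ?Y = "closed_slab k zs" and ?Z = "closed_slab (midpt h k) zs"
 have A: "fst ` set zs \<subseteq> A" using faces_independent[OF zs(2)] by blast
 have eq: "iterated_diff (steps zs) pvol h = vol (closed_slab h zs)" for h
  using iterated_diff_slab[OF zs(1) A zs(3)] vol_closed_slab[OF zs(2)] by simp
 have "vol ?X * vol ?Y <= (vol ?Z)\<^sup>2"
 proof (cases "?X = {} \<or> ?Y = {}")
  case False
  have sub: "?X + ?Y \<subseteq> 2 \<odot> ?Z"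
  proof
   fix z assume "z \<in> ?X + ?Y"
   then obtain x y where z: "z = x + y" "x \<in> ?X" "y \<in> ?Y" by (auto simp: set_plus_def)
   have "(1/2) *R z \<in> ?Z"
    using z(2,3) unfolding closed_slab_def midpt_def z(1) by (fastforce simp: inner_add_right field_simps)
   hence "2 *R ((1/2) *R z) \<in> 2 \<odot> ?Z" by blast
   thus "z \<in> 2 \<odot> ?Z" by simp
  qed
  have "2 ^ DIM('a) * sqrt (vol ?X * vol ?Y) <= vol (?X + ?Y)"
   using False by (intro brunn_minkowski_midpoint compact_closed_slab) auto
  also have "... <= vol (2 \<odot> ?Z)"
   by (intro vol_mono sub lmeasurable_compact compact_set_plus compact_scaling compact_closed_slab)
  also have "... = 2 ^ DIM('a) * vol ?Z" using measure_lebesgue_affine[of 2 0 ?Z] by simp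
  finally have "sqrt (vol ?X * vol ?Y) <= vol ?Z" by simp
  thus ?thesis by (metis sqrt_le_D)
 qed auto
 thus ?thesis unfolding eq .
qed

lemma mform_replicate_derivative:
 "((%t. mform (replicate m (%a. h a + t * x a) @ ys) as) has_real_derivative
   real m * mform (x # replicate (m - 1) (%a. h a + t * x a) @ ys) as) (at t)"
proof (induction m arbitrary: ys)
 case 0
 thus ?case by simp
next
 case (Suc m)
 let ?u = "%t a. h a + t * x a"
 have split: "mform (replicate (Suc m) (?u t) @ ys) as = mform (replicate m (?u t) @ h # ys) as + t * mform (replicate m (?u t) @ x # ys) as" for t
  by (simp only: replicate_Suc append_Cons mform_diff mform_move)
 have "((%t. mform (replicate m (?u t) @ h # ys) as + t * mform (replicate m (?u t) @ x # ys) as) has_real_derivative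
   real m * mform (x # replicate (m - 1) (?u t) @ h # ys) as +
   (1 * mform (replicate m (?u t) @ x # ys) as + (real m * mform (x # replicate (m - 1) (?u t) @ x # ys) as) * t)) (at t)"
  by (intro DERIV_add DERIV_mult Suc.IH DERIV_ident)
 moreover have "real m * mform (x # replicate (m - 1) (?u t) @ h # ys) as + real m * mform (x # replicate (m - 1) (?u t) @ x # ys) as * t
   = real m * mform (x # replicate m (?u t) @ ys) as"
 proof (cases m)
  case (Suc k)
  have e: "mform (x # z # replicate k (?u t) @ ys) as = mform (x # replicate k (?u t) @ z # ys) as" for z
   by (rule mform_perm) simp
  have "mform (x # replicate m (?u t) @ ys) as = mform (x # h # replicate k (?u t) @ ys) as + t * mform (x # x # replicate k (?u t) @ ys) as"
   unfolding Suc replicate_Suc append_Cons by (rule mform_diff2)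
  thus ?thesis using Suc e by (simp add: algebra_simps del: mform.simps)
 qed simp
 ultimately show ?case unfolding split
  by (simp add: mform_move algebra_simps del: mform.simps)
qed

text \<open>The factorial is chosen so that the volume results for the empty face and that the
  derivative in direction \<open>a\<close> is \<open>face_poly (a # is)\<close>.\<close>

definition face_poly :: "'a list => ('a => real) => real" where
 "face_poly is h = mform (replicate (DIM('a) - length is) h) is / fact (DIM('a) - length is)"

lemma mform_restrict: "mform (map (%c a. if a \<in> A then c a else 0) cs) as = mform cs as"
 by (induction cs arbitrary: as) (auto intro!: sum.cong)

lemma face_poly_nil: assumes "h \<in> chamber" shows "face_poly [] h = pvol h"
proof -
 let ?n = "DIM('a)"
 let ?h = "%a. if a \<in> A then h a else 0"
 have vr: "vertex S ?h = vertex S h" if "S \<in> BB" for S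
  unfolding vertex_def using basis[OF that] by (intro sum.cong) auto
 have hc: "?h \<in> chamber" using assms vr by (auto simp: chamber_def)
 have hs: "?h \<in> supported" using hc chamber_closed by (auto simp: supported_def)
 have PK: "P ?h = P h" by (auto simp: polyh_def)
 have "mform (replicate ?n h) [] = mform (replicate ?n ?h) []"
  using mform_restrict[of "replicate ?n h"] by (simp only: map_replicate)
 also have "... = iterated_diff (map P (replicate ?n ?h)) vol (P 0)"
  using hs by (intro iterated_diff_vol_polyh[symmetric] closed_chamber_zero) auto
 also have "... = fact ?n * vol (P h)"
  using iterated_diff_vol_self[OF body_polyh[OF chamber_closed[OF hc]]] by (simp add: polyh_zero PK)
 finally show ?thesis by (simp add: face_poly_def pvol_def)
qed

lemma midpt_chamber: "h \<in> chamber ==> k \<in> chamber ==> midpt h k \<in> chamber"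
proof -
 assume "h \<in> chamber" "k \<in> chamber"
 hence "(%a. 1/2 * (h + k) a) \<in> chamber" by (intro chamber_scale chamber_add chamber_closed) auto
 thus ?thesis by (simp add: midpt_def)
qed

text \<open>
  Log-concavity of the volumes of slabs, differentiated once in each direction of \<open>is\<close>: every limit
  \<open>s \<rightarrow> 0\<close> trades a facet slab of width \<open>s\<close> for the facet itself.
\<close>

lemma face_poly_derivative:
 assumes a: "a \<in> A" and len: "length is < DIM('a)"
 shows "((%s. (face_poly is (h + stepf a s) - face_poly is h) / s) \<longlongrightarrow> face_poly (a # is) h) (at_right 0)"
proof -
 let ?m = "DIM('a) - length is"
 have m: "?m = Suc (DIM('a) - length (a # is))" using len by simp
 have st: "h + stepf a s = (%b. h b + s * stepf a 1 b)" for s by (auto simp: fun_eq_iff stepf_apply)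
 have "((%s. mform (replicate ?m (%b. h b + s * stepf a 1 b) @ []) is) has_real_derivative
   real ?m * mform (stepf a 1 # replicate (?m - 1) (%b. h b + 0 * stepf a 1 b) @ []) is) (at 0)"
  by (rule mform_replicate_derivative)
 hence "((%s. mform (replicate ?m (h + stepf a s)) is) has_real_derivative
   real ?m * mform (replicate (?m - 1) h) (a # is)) (at 0)"
  using mform_step[OF a, of 1] by (simp only: st append_Nil2 mult_zero_left add_0_right mult_1)
 hence "((%s. (mform (replicate ?m (h + stepf a s)) is - mform (replicate ?m (h + stepf a 0)) is) / s) \<longlongrightarrow> real ?m * mform (replicate (?m - 1) h) (a # is)) (at 0)"
  by (simp add: has_field_derivative_iff del: mform.simps plus_fun_apply)
 moreover have "h + stepf a 0 = h" by (auto simp: fun_eq_iff stepf_apply)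
 ultimately have "((%s. (mform (replicate ?m (h + stepf a s)) is - mform (replicate ?m h) is) / s) \<longlongrightarrow> real ?m * mform (replicate (?m - 1) h) (a # is)) (at_right 0)"
  by (auto intro: tendsto_mono[OF at_le] simp only: subset_UNIV)
 hence "((%s. (mform (replicate ?m (h + stepf a s)) is - mform (replicate ?m h) is) / s / fact ?m) \<longlongrightarrow> real ?m * mform (replicate (?m - 1) h) (a # is) / fact ?m) (at_right 0)"
  by (intro tendsto_divide tendsto_const) auto
 moreover have "real ?m * mform (replicate (?m - 1) h) (a # is) / fact ?m = face_poly (a # is) h"
  unfolding face_poly_def using m by (simp add: field_simps del: mform.simps)
 ultimately show ?thesis by (simp add: face_poly_def diff_divide_distrib mult.commute del: mform.simps plus_fun_apply)
qed

lemma face_poly_log_concave_slab: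
 assumes "distinct (map fst zs @ is)" "fst ` set zs \<union> set is \<in> faces" "\<forall>z\<in>set zs. 0 < snd z"
  and "supp_box A h R \<subseteq> chamber" "supp_box A k R \<subseteq> chamber" "supp_box A (midpt h k) R \<subseteq> chamber" "(\<Sum>z\<leftarrow>zs. \<bar>snd z\<bar>) < R"
 shows "iterated_diff (steps zs) (face_poly is) h * iterated_diff (steps zs) (face_poly is) k <= (iterated_diff (steps zs) (face_poly is) (midpt h k))\<^sup>2"
 using assms
proof (induction "is" arbitrary: zs)
 case Nil
 have R: "R > 0" using Nil.prems(7) sum_list_nonneg[of "map (%z. \<bar>snd z\<bar>) zs"] by fastforce
 have eq: "iterated_diff (steps zs) (face_poly []) h = iterated_diff (steps zs) pvol h" if "supp_box A h R \<subseteq> chamber" for h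
 proof -
  have "iterated_diff (steps zs) (%k. face_poly [] k - pvol k) h = 0"
  proof (rule iterated_diff_steps_zero)
   fix k assume "!!a. \<bar>k a - h a\<bar> <= (\<Sum>z\<leftarrow>zs. \<bar>snd z\<bar>)"
   hence "k \<in> supp_box A h R" using Nil.prems(7) by (auto simp: supp_box_def intro: order_trans less_imp_le)
   thus "face_poly [] k - pvol k = 0" using face_poly_nil that by auto
  qed
  moreover have "iterated_diff cs (%k. f k - g k) h = iterated_diff cs f h - iterated_diff cs g h" for cs f g and h :: "'a => real"
   by (induction cs arbitrary: h) simp_all
  ultimately show ?thesis by simp
 qed
 show ?case unfolding eq[OF Nil.prems(4)] eq[OF Nil.prems(5)] eq[OF Nil.prems(6)]
  using Nil.prems by (intro slab_log_concave) (auto simp: less_imp_le)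
next
 case (Cons a "is")
 let ?S = "%s h. iterated_diff (steps ((a, s) # zs)) (face_poly is) h"
 have aA: "a \<in> A" using Cons.prems(2) faces_independent by auto
 have len: "length is < DIM('a)"
 proof -
  obtain S where S: "S \<in> BB" "set (a # is) \<subseteq> S" using Cons.prems(2) by (auto simp: faces_def)
  have "card (set (a # is)) <= card S" using S BB_finite card_mono by blast
  thus ?thesis using basis[OF S(1)] Cons.prems(1) by (simp add: distinct_card)
 qed
 have lim: "((%s. ?S s h / s) \<longlongrightarrow> iterated_diff (steps zs) (face_poly (a # is)) h) (at_right 0)" for h
 proof -
  have div: "iterated_diff cs (%k. f k / s) h = iterated_diff cs f h / s" for cs f s and h :: "'a => real"
   by (induction cs arbitrary: h) (simp_all add: diff_divide_distrib)
  have lims: "((%s. iterated_diff cs (f s) h) \<longlongrightarrow> iterated_diff cs g h) (at_right 0)"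
   if "!!k. ((%s. f s k) \<longlongrightarrow> g k) (at_right 0)" for cs f g and h :: "'a => real"
   using that by (induction cs arbitrary: h) (auto intro: tendsto_diff)
  have "?S s h / s = iterated_diff (steps zs) (%k. (face_poly is (k + stepf a s) - face_poly is k) / s) h" for s
   unfolding list.map prod.case iterated_diff_cons div ..
  thus ?thesis using lims[OF face_poly_derivative[OF aA len]] by simp
 qed
 \<comment> \<open>The room that the existing slabs leave for one more slab of width
   \<open>s\<close> within the box of radius \<open>R\<close>.\<close>
 let ?e = "R - (\<Sum>z\<leftarrow>zs. \<bar>snd z\<bar>)"
 have ineq: "(?S s h / s) * (?S s k / s) <= (?S s (midpt h k) / s)\<^sup>2" if s: "0 < s" "s < ?e" for s
 proof -
  have "?S s h * ?S s k <= (?S s (midpt h k))\<^sup>2"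
   using Cons.prems s by (intro Cons.IH) auto
  thus ?thesis using s by (simp add: power_divide power2_eq_square divide_right_mono del: iterated_diff.simps)
 qed
 have "\<forall>\<^sub>F s in at_right 0. (?S s h / s) * (?S s k / s) <= (?S s (midpt h k) / s)\<^sup>2"
  unfolding eventually_at_right_field using ineq Cons.prems(7) by (intro exI[of _ ?e]) auto
 thus ?case
  by (rule tendsto_le[OF trivial_limit_at_right_real tendsto_power[OF lim] tendsto_mult[OF lim lim]])
qed

text \<open>If \<open>x\<close> were orthogonal to \<open>c\<close> with positive square, then along
  the line \<open>c + t x\<close> the function \<open>F\<close> would have a critical point at 0
  with positive second derivative. Then \<open>F t * F (- t)\<close> would exceed
  \<open>(F 0)\<^sup>2\<close> for small \<open>t\<close>, against log-concavity at the midpoint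
  \<open>c\<close>.\<close>

lemma hyperbolic_diagonal:
 assumes "is": "distinct is" "set is \<in> faces" and c: "c \<in> chamber" and len: "length is + m + 2 = DIM('a)"
 shows "hyperbolic_at is (replicate m c) c"
proof -
 let ?F = "%h. mform (replicate (m + 2) h) is"
 have DF: "DIM('a) - length is = m + 2" using len by simp
 have lc: "?F h * ?F k <= (?F (midpt h k))\<^sup>2" if hk: "h \<in> chamber" "k \<in> chamber" for h k
 proof -
  obtain R1 where R1: "R1 > 0" "supp_box A h R1 \<subseteq> chamber" using chamber_box[OF hk(1)] .
  obtain R2 where R2: "R2 > 0" "supp_box A k R2 \<subseteq> chamber" using chamber_box[OF hk(2)] .
  obtain R3 where R3: "R3 > 0" "supp_box A (midpt h k) R3 \<subseteq> chamber" using chamber_box[OF midpt_chamber[OF hk]] .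
  define R where "R = min R1 (min R2 R3)"
  have sub: "supp_box A h R \<subseteq> supp_box A h R'" if "R <= R'" for h R' using that by (fastforce simp: supp_box_def)
  have "R <= R1" "R <= R2" "R <= R3" "R > 0" using R1 R2 R3 by (auto simp: R_def)
  hence "iterated_diff (steps []) (face_poly is) h * iterated_diff (steps []) (face_poly is) k <= (iterated_diff (steps []) (face_poly is) (midpt h k))\<^sup>2"
   using sub[THEN subset_trans, OF _ R1(2)] sub[THEN subset_trans, OF _ R2(2)] sub[THEN subset_trans, OF _ R3(2)] "is"
   by (intro face_poly_log_concave_slab[where R=R]) auto
  hence "?F h / fact (m+2) * (?F k / fact (m+2)) <= (?F (midpt h k) / fact (m+2))\<^sup>2"
   by (simp only: list.map iterated_diff.simps face_poly_def DF)
  thus ?thesis by (simp add: power2_eq_square divide_le_cancel del: mform.simps fact_Suc)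
 qed
 have Fc: "?F c > 0" using "is" c len by (intro mform_pos) auto
 have b: "mform (x # x # replicate m c) is <= 0" if a: "mform (x # c # replicate m c) is = 0" for x
 proof (rule ccontr)
  assume "\<not> ?thesis"
  hence bp: "mform (x # x # replicate m c) is > 0" by simp
  let ?u = "%t a. c a + t * x a"
  define F where "F t = ?F (?u t)" for t
  define F' where "F' t = real (m + 2) * mform (x # replicate (m + 1) (?u t)) is" for t
  have u0: "?u 0 = c" by simp
  have dF: "(F has_real_derivative F' t) (at t)" for t
   unfolding F_def F'_def using mform_replicate_derivative[of "m + 2" c x "[]" "is" t] by (simp del: mform.simps)
  have "((%t. mform (replicate (m + 1) (?u t) @ [x]) is) has_real_derivative
    real (m + 1) * mform (x # replicate m (?u 0) @ [x]) is) (at 0)"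
   using mform_replicate_derivative[of "m + 1" c x "[x]" "is" 0] by (simp del: mform.simps)
  moreover have "mform (replicate (m + 1) (?u t) @ [x]) is = mform (x # replicate (m + 1) (?u t)) is" for t by (rule mform_perm) simp
  moreover have "mform (x # replicate m (?u 0) @ [x]) is = mform (x # x # replicate m c) is" unfolding u0 by (rule mform_perm) simp
  ultimately have dF': "(F' has_real_derivative real (m + 2) * (real (m + 1) * mform (x # x # replicate m c) is)) (at 0)"
   unfolding F'_def by (intro DERIV_cmult) (simp only:)
  have F'0: "F' 0 = 0" using a by (simp add: F'_def u0 del: mform.simps)
  have pos: "real (m + 2) * (real (m + 1) * mform (x # x # replicate m c) is) > 0" using bp by simp
  obtain d1 where d1: "d1 > 0" "!!t. 0 < t ==> t < d1 ==> F' t > 0"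
   using DERIV_pos_inc_right[OF dF' pos] F'0 by force
  obtain d2 where d2: "d2 > 0" "!!t. 0 < t ==> t < d2 ==> F' (- t) < 0"
   using DERIV_pos_inc_left[OF dF' pos] F'0 by force
  obtain R where R: "R > 0" "supp_box A c R \<subseteq> chamber" using chamber_box[OF c] .
  define X where "X = 1 + (\<Sum>a\<in>A. \<bar>x a\<bar>)"
  have X: "X > 0" "!!a. a \<in> A ==> \<bar>x a\<bar> <= X"
   unfolding X_def using finite_A member_le_sum[of _ A "%a. \<bar>x a\<bar>"] by (auto intro!: add_pos_nonneg sum_nonneg) force
  define t where "t = min (min d1 d2) (R / X) / 2"
  have "R / X > 0" using R X by simp
  moreover have "min (min a b) d / 2 > 0 & min (min a b) d / 2 < a & min (min a b) d / 2 < b & min (min a b) d / 2 <= d"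
   if "a > 0" "b > 0" "d > 0" for a b d :: real using that by (auto simp: min_def)
  ultimately have t: "0 < t" "t < d1" "t < d2" "t <= R / X" using d1(1) d2(1) unfolding t_def by blast+
  have ch: "?u s \<in> chamber" if "\<bar>s\<bar> = t" for s
  proof -
   have "\<bar>s * x a\<bar> <= R" if "a \<in> A" for a
   proof -
    have "\<bar>s * x a\<bar> <= R / X * X" unfolding abs_mult using t X(2)[OF that] \<open>\<bar>s\<bar> = t\<close> X(1) R(1) by (intro mult_mono) auto
    thus ?thesis using X(1) by simp
   qed
   thus ?thesis using R(2) by (auto simp: supp_box_def subset_iff)
  qed
  have "F 0 < F t"
  proof (rule DERIV_pos_imp_increasing_open[OF t(1)])
   show "\<exists>y. (F has_real_derivative y) (at s) & 0 < y" if "0 < s" "s < t" for s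
    using dF[of s] d1(2)[of s] that t(2) by (intro exI[of _ "F' s"]) simp
   show "continuous_on {0..t} F" using DERIV_isCont[OF dF] by (simp add: continuous_at_imp_continuous_on)
  qed
  moreover have "F 0 < F (- t)"
  proof -
   have "F (- 0) < F (- t)"
   proof (rule DERIV_pos_imp_increasing_open[OF t(1), of "%t. F (- t)"])
    fix s assume s: "0 < s" "s < t"
    have "((%t. F (- t)) has_real_derivative - F' (- s)) (at s)"
     using dF[of "- s"] DERIV_mirror[of F "F' (- s)" s] by blast
    moreover have "- F' (- s) > 0" using d2(2)[of s] s t by simp
    ultimately show "\<exists>y. ((%t. F (- t)) has_real_derivative y) (at s) & 0 < y" by blast
   next
    have "isCont (%t. F (- t)) s" for s
     using dF[of "- s"] DERIV_mirror[of F "F' (- s)" s] DERIV_isCont by blast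
    thus "continuous_on {0..t} (%t. F (- t))" by (simp add: continuous_at_imp_continuous_on)
   qed
   thus ?thesis by simp
  qed
  moreover have "F 0 > 0" using Fc by (simp only: F_def u0)
  ultimately have "F 0 * F 0 < F t * F (- t)" by (intro mult_strict_mono) auto
  moreover have "F t * F (- t) <= (F 0)\<^sup>2"
  proof -
   have "midpt (?u t) (?u (- t)) = ?u 0" by (auto simp: midpt_def)
   thus ?thesis using lc[OF ch[of t] ch[of "- t"]] t(1) by (simp add: F_def del: mform.simps)
  qed
  ultimately show False by (simp add: power2_eq_square)
 qed
 have cc: "mform (c # c # replicate m c) is = ?F c" by (simp only: replicate_Suc numeral_2_eq_2 add_Suc_right add_0_right)
 show ?thesis unfolding hyperbolic_at_def
 proof
  fix x
  let ?cs = "replicate m c"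
  define q where "q x z = mform (x # z # ?cs) is" for x z
  have add: "q (%a. x a + s * x' a) z = q x z + s * q x' z" for x x' z s unfolding q_def by (rule mform_diff)
  have sym: "q x z = q z x" for x z unfolding q_def by (rule mform_swap)
  have qq: "q (%a. x a + s * z a) (%a. x a + s * z a) = q x x + 2 * s * q x z + s\<^sup>2 * q z z" for x z s
   using add sym by (simp add: algebra_simps power2_eq_square)
  have qcc: "q c c > 0" using Fc cc by (simp only: q_def)
  define s where "s = - (q x c / q c c)"
  have "q (%a. x a + s * c a) c = 0" unfolding add s_def using qcc by simp
  hence "q (%a. x a + s * c a) (%a. x a + s * c a) <= 0" using b by (simp only: q_def)
  moreover have "q x x + 2 * s * q x c + s\<^sup>2 * q c c = q x x - (q x c)\<^sup>2 / q c c" using qcc by (simp add: s_def power2_eq_square field_simps)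
  ultimately have "q x x <= (q x c)\<^sup>2 / q c c" unfolding qq by linarith
  thus "mform (x # x # ?cs) is * mform (c # c # ?cs) is <= (mform (x # c # ?cs) is)\<^sup>2"
   using qcc unfolding q_def[symmetric] by (simp add: pos_le_divide_eq)
 qed
qed

text \<open>\<open>hyperbolic_step\<close> requires its reference vector among the fixed arguments.
  The head of \<open>cs\<close> is taken as reference, and \<open>hyperbolic_transfer\<close> passes
  to any other one. The list \<open>cs\<close> shortens as the face \<open>is\<close> grows.\<close>

theorem mform_alexandrov_fenchel:
 assumes "distinct is" "set is \<in> faces" "c \<in> chamber" "set cs \<subseteq> chamber" "length is + length cs + 2 = DIM('a)"
 shows "hyperbolic_at is cs c"
 using assms
proof (induction cs arbitrary: "is" c rule: length_induct)
 case (1 cs)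
 show ?case
 proof (cases cs)
  case Nil
  thus ?thesis using hyperbolic_diagonal[of "is" c 0] 1 by simp
 next
  case (Cons d ds)
  have d: "d \<in> chamber" "set ds \<subseteq> chamber" using 1 Cons by auto
  have "hyperbolic_at is (d # ds) d"
  proof (rule hyperbolic_step[OF 1(2,3) d])
   show "length is + length ds + 3 = DIM('a)" using 1 Cons by simp
   show "hyperbolic_at is (replicate (Suc (length ds)) d) d" using 1 Cons d by (intro hyperbolic_diagonal) auto
   fix j cs' assume j: "j \<in> adjacent (set is)" and cs': "length cs' = length ds" "set cs' \<subseteq> chamber"
   show "hyperbolic_at (j # is) cs' d"
    using 1 Cons j cs' d by (intro 1(1)[rule_format]) (auto simp: adjacent_def)
  qed
  moreover have "0 < mform (e # e # d # ds) is" if "e \<in> chamber" for e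
   using 1 Cons d that by (intro mform_pos) auto
  ultimately show ?thesis unfolding Cons using hyperbolic_transfer 1(4) d(1) by blast
 qed
qed

end

section \<open>Common normal fans of polytopes\<close>

lemma support_upper: "compact K ==> x \<in> K ==> x \<bullet> u <= support_function K u"
 unfolding support_function_def
 by (intro cSUP_upper) (auto intro!: compact_imp_bounded bounded_imp_bdd_above compact_continuous_image continuous_intros)

lemma support_max:
 assumes "compact K" "K ~= {}" obtains x where "x \<in> K" "x \<bullet> u = support_function K u"
proof -
 have "continuous_on K (%x. x \<bullet> u)" by (intro continuous_intros)
 then obtain x where x: "x \<in> K" "!!y. y \<in> K ==> y \<bullet> u <= x \<bullet> u"
  using continuous_attains_sup[OF assms] by blast
 moreover have "support_function K u <= x \<bullet> u" unfolding support_function_def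
  by (rule cSUP_least) (use assms x in auto)
 ultimately show ?thesis using support_upper[OF assms(1)] that by (metis order_antisym)
qed

lemma support_plus:
 assumes K: "compact K" "K ~= {}" and L: "compact L" "L ~= {}"
 shows "support_function (K + L) u = support_function K u + support_function L u"
proof (rule antisym)
 obtain z where z: "z \<in> K + L" "z \<bullet> u = support_function (K + L) u"
  using support_max[of "K + L" u] compact_set_plus[OF K(1) L(1)] K(2) L(2) by auto
 then obtain p q where "z = p + q" "p \<in> K" "q \<in> L" by (auto simp: set_plus_def)
 thus "support_function (K + L) u <= support_function K u + support_function L u"
  using z(2) support_upper[OF K(1), of p u] support_upper[OF L(1), of q u] by (simp add: inner_add_left)
 obtain x y where "x \<in> K" "x \<bullet> u = support_function K u" "y \<in> L" "y \<bullet> u = support_function L u"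
  using support_max K L by metis
 thus "support_function K u + support_function L u <= support_function (K + L) u"
  using support_upper[OF compact_set_plus[OF K(1) L(1)], of "x + y" u] by (auto simp: inner_add_left)
qed

lemma support_mono:
 assumes "compact K" "K ~= {}" "compact L" "K \<subseteq> L" shows "support_function K u <= support_function L u"
 using assms support_upper[of L _ u] support_max[of K u] by (metis subsetD)

definition supp_numbers :: "'a::euclidean_space set => 'a set => 'a => real" where
 "supp_numbers A K = (%a. if a \<in> A then support_function K a else 0)"

lemma polyh_move:
 fixes x :: "'a::euclidean_space"
 assumes "finite A" "x \<in> polyh A h" "!!a. a \<in> A ==> a \<bullet> x = h a ==> a \<bullet> d <= 0"
 obtains e where "e > 0" "x + e *R d \<in> polyh A h"
proof -
 define e where "e = Min (insert 1 ((%a. (h a - a \<bullet> x) / (1 + \<bar>a \<bullet> d\<bar>)) ` {a \<in> A. a \<bullet> x < h a}))"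
 have e: "0 < e" "!!a. a \<in> A ==> a \<bullet> x < h a ==> e <= (h a - a \<bullet> x) / (1 + \<bar>a \<bullet> d\<bar>)"
  unfolding e_def using assms(1) by (auto intro!: divide_pos_pos)
 have "a \<bullet> (x + e *R d) <= h a" if a: "a \<in> A" for a
 proof (cases "a \<bullet> x = h a")
  case True
  thus ?thesis using assms(3)[OF a] e(1) by (simp add: inner_add_right mult_nonneg_nonpos)
 next
  case False
  hence "a \<bullet> x < h a" using assms(2) a by (force simp: polyh_def)
  hence "e * (1 + \<bar>a \<bullet> d\<bar>) <= h a - a \<bullet> x" using e(2)[OF a] by (simp add: pos_le_divide_eq)
  hence "e + e * \<bar>a \<bullet> d\<bar> <= h a - a \<bullet> x" by (simp only: distrib_left mult_1_right)
  moreover have "e * (a \<bullet> d) <= e * \<bar>a \<bullet> d\<bar>" using e(1) by (intro mult_left_mono) auto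
  ultimately show ?thesis unfolding inner_add_right inner_scaleR_right using e(1) by linarith
 qed
 thus ?thesis using that[of e] e(1) by (simp add: polyh_def)
qed

text \<open>A functional attains its maximum at an extreme point. The tight normals there are
  independent by \<open>gen\<close>, and they span, since otherwise a segment through the point
  would fit. Their coefficients in \<open>u\<close> are nonnegative, since otherwise moving along
  minus a dual vector would increase \<open>u\<close>.\<close>

lemma polytope_vertex_cone:
 fixes h :: "'a::euclidean_space => real"
 assumes A: "finite A" and P: "compact (polyh A h)" "polyh A h ~= {}"
  and gen: "!!T x. T \<subseteq> A ==> (!!a. a \<in> T ==> a \<bullet> x = h a) ==> independent T"
 obtains S l where "S \<subseteq> A" "independent S" "card S = DIM('a)" "vertex S h \<in> polyh A h"
  "\<forall>b\<in>S. 0 <= l b" "u = (\<Sum>b\<in>S. l b *R b)"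
proof -
 let ?P = "polyh A h"
 have cvx: "convex ?P"
 proof -
  have "?P = (\<Inter>a\<in>A. {x. a \<bullet> x <= h a})" by (auto simp: polyh_def)
  thus ?thesis by (auto intro!: convex_INT convex_halfspace_le)
 qed
 define M where "M = support_function ?P u"
 have M: "x \<bullet> u <= M" if "x \<in> ?P" for x using support_upper[OF P(1) that] by (simp add: M_def)
 define F where "F = ?P \<inter> {x. u \<bullet> x = M}"
 obtain x0 where "x0 \<in> ?P" "x0 \<bullet> u = M" using support_max[OF P] M_def by metis
 hence "F ~= {}" by (auto simp: F_def inner_commute)
 moreover have "compact F" unfolding F_def by (intro compact_Int_closed P closed_hyperplane)
 moreover have face: "F face_of ?P" unfolding F_def
  by (rule face_of_Int_supporting_hyperplane_le[OF cvx]) (use M in \<open>simp add: inner_commute\<close>)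
 hence "convex F" by (simp add: face_of_imp_convex cvx)
 ultimately obtain x where x: "x extreme_point_of F" using extreme_point_exists_convex by blast
 hence xP: "x extreme_point_of ?P" using face extreme_point_of_face by blast
 have xin: "x \<in> ?P" and ux: "u \<bullet> x = M" using x by (auto simp: extreme_point_of_def F_def)
 define T where "T = {a \<in> A. a \<bullet> x = h a}"
 have T: "T \<subseteq> A" by (auto simp: T_def)
 hence "independent T" by (rule gen[where x = x]) (simp add: T_def)
 with T have T: "T \<subseteq> A" "independent T" by blast+
 have "card T = DIM('a)"
 proof (rule ccontr)
  assume "card T ~= DIM('a)"
  hence "dim (span T) < DIM('a)"
   using T(2) dim_eq_card_independent[OF T(2)] by (metis dim_span dim_subset_UNIV order_le_less)
  then obtain d where d: "d ~= 0" "!!y. y \<in> span T ==> orthogonal d y"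
   using orthogonal_to_subspace_exists[of T] by (metis dim_span)
  hence ort: "a \<bullet> d = 0" if "a \<in> T" for a using that by (metis orthogonal_def inner_commute span_base)
  obtain e1 where e1: "e1 > 0" "x + e1 *R d \<in> ?P"
   using polyh_move[OF A xin, of d] ort by (auto simp: T_def)
  obtain e2 where e2: "e2 > 0" "x + e2 *R (- d) \<in> ?P"
   using polyh_move[OF A xin, of "- d"] ort by (auto simp: T_def)
  have "x \<in> open_segment (x + e1 *R d) (x + e2 *R (- d))"
   unfolding in_segment
  proof (intro conjI exI)
   have s: "e1 *R d ~= - (e2 *R d)"
    using d(1) e1(1) e2(1) by (metis add_eq_0_iff add_pos_pos order_less_irrefl scaleR_eq_0_iff scaleR_left_distrib)
   thus "x + e1 *R d ~= x + e2 *R (- d)" by simp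
   show "0 < e1 / (e1 + e2)" "e1 / (e1 + e2) < 1" using e1 e2 by auto
   have "(1 - e1 / (e1 + e2)) * e1 = e1 / (e1 + e2) * e2" using e1 e2 by (simp add: field_simps)
   thus "x = (1 - e1 / (e1 + e2)) *R (x + e1 *R d) + (e1 / (e1 + e2)) *R (x + e2 *R (- d))"
    by (simp add: scaleR_diff_right scaleR_add_right scaleR_left_diff_distrib)
  qed
  thus False using xP e1(2) e2(2) by (auto simp: extreme_point_of_def)
 qed
 have vx: "vertex T h = x"
 proof (rule inner_spanning_eq[OF T(2) \<open>card T = DIM('a)\<close>])
  fix b assume b: "b \<in> T"
  have "finite T" using T A finite_subset by blast
  hence "b \<bullet> vertex T h = h b" using b T(2) by (simp add: vertex_def inner_sum_right dual_works if_distrib cong: if_cong)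
  thus "b \<bullet> vertex T h = b \<bullet> x" using b by (simp add: T_def)
 qed
 have finT: "finite T" using T A finite_subset by blast
 have ueq: "u = (\<Sum>b\<in>T. (u \<bullet> dual T b) *R b)"
 proof (rule vector_eq_ldot[THEN iffD1, rule_format])
  fix z
  have z: "z = (\<Sum>b\<in>T. (b \<bullet> z) *R dual T b)"
   by (rule inner_spanning_eq[OF T(2) \<open>card T = DIM('a)\<close>]) (use finT T(2) in \<open>simp add: inner_sum_right dual_works if_distrib cong: if_cong\<close>)
  have "z \<bullet> u = (\<Sum>b\<in>T. (b \<bullet> z) * (dual T b \<bullet> u))" by (subst z) (simp add: inner_sum_left)
  thus "z \<bullet> u = z \<bullet> (\<Sum>b\<in>T. (u \<bullet> dual T b) *R b)" by (simp add: inner_sum_right inner_commute mult.commute)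
 qed
 moreover have "0 <= u \<bullet> dual T b" if b: "b \<in> T" for b
 proof (rule ccontr)
  assume neg: "\<not> ?thesis"
  obtain e where e: "e > 0" "x + e *R (- dual T b) \<in> ?P"
  proof (rule polyh_move[OF A xin, of "- dual T b"])
   fix a assume "a \<in> A" "a \<bullet> x = h a"
   thus "a \<bullet> - dual T b <= 0" using dual_works[OF T(2), of a b] by (simp add: T_def)
  qed
  have "u \<bullet> (x + e *R (- dual T b)) = M - e * (u \<bullet> dual T b)" using ux by (simp add: inner_diff_right)
  moreover have "e * (u \<bullet> dual T b) < 0" using e(1) neg by (simp add: mult_pos_neg)
  ultimately show False using M[OF e(2)] by (simp add: inner_commute)
 qed
 ultimately show ?thesis using that[of T "%b. u \<bullet> dual T b"] T \<open>card T = DIM('a)\<close> vx xin by simp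
qed

text \<open>The right-hand sides are perturbed by distinct powers of \<open>q\<close>. A point on
  all hyperplanes of a dependent set \<open>T\<close> makes the coefficients of a linear relation
  satisfy a polynomial equation in \<open>q\<close>. Positive distinct exponents keep these
  coefficients apart from each other and from the constant term, so the polynomial is not zero and
  has finitely many roots.\<close>

lemma generic_perturbation:
 fixes A :: "'a::euclidean_space set"
 assumes A: "finite A" and k: "inj_on k A" "!!a. a \<in> A ==> 1 <= k a"
 shows "\<forall>\<^sub>F q in at_right 0. \<forall>T\<subseteq>A. \<forall>x. (\<forall>a\<in>T. a \<bullet> x = g a + q ^ k a) --> independent T"
proof -
 have "finite {q::real. \<exists>x. \<forall>a\<in>T. a \<bullet> x = g a + q ^ k a}" if T: "T \<subseteq> A" "dependent T" for T
 proof -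
  have finT: "finite T" using T A finite_subset by blast
  obtain c a0 where c: "(\<Sum>a\<in>T. c a *R a) = 0" "a0 \<in> T" "c a0 ~= 0"
   using T(2) finT dependent_finite by blast
  define n where "n = Max (k ` T)"
  define co where "co i = (if i = 0 then (\<Sum>a\<in>T. c a * g a) else (\<Sum>a\<in>{a\<in>T. k a = i}. c a))" for i
  have kn: "k a <= n" if "a \<in> T" for a using finT that by (simp add: n_def)
  have "(\<Sum>i\<le>n. co i * q ^ i) = (\<Sum>a\<in>T. c a * (g a + q ^ k a))" for q
  proof -
   have "(\<Sum>i\<le>n. co i * q ^ i) = co 0 + (\<Sum>i\<in>{1..n}. co i * q ^ i)"
    by (simp add: sum.atMost_shift atLeast0AtMost[symmetric] sum.atLeast_Suc_atMost)
   also have "(\<Sum>i\<in>{1..n}. co i * q ^ i) = (\<Sum>i\<in>{1..n}. \<Sum>a\<in>{a\<in>T. k a = i}. c a * q ^ k a)"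
    by (intro sum.cong refl) (simp add: co_def sum_distrib_right)
   also have "... = (\<Sum>a\<in>T. c a * q ^ k a)"
    using T k(2) kn finT by (intro sum.group) auto
   finally show ?thesis by (simp add: co_def sum.distrib distrib_left)
  qed
  moreover have "co (k a0) ~= 0"
  proof -
   have "{a\<in>T. k a = k a0} = {a0}" using c(2) T k(1) by (auto dest: inj_onD)
   thus ?thesis using k(2)[of a0] c T by (auto simp: co_def)
  qed
  ultimately have fin: "finite {q. (\<Sum>a\<in>T. c a * (g a + q ^ k a)) = 0}"
   using polyfun_finite_roots[of co n] kn[OF c(2)] by (metis (mono_tags, lifting) Collect_cong)
  have "(\<Sum>a\<in>T. c a * (g a + q ^ k a)) = 0" if "\<forall>a\<in>T. a \<bullet> x = g a + q ^ k a" for q x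
  proof -
   have "(\<Sum>a\<in>T. c a * (g a + q ^ k a)) = (\<Sum>a\<in>T. c a *R a) \<bullet> x" using that by (simp add: inner_sum_left)
   thus ?thesis by (simp add: c(1))
  qed
  thus ?thesis by (intro finite_subset[OF _ fin]) blast
 qed
 hence "finite (\<Union>T\<in>{T. T \<subseteq> A & dependent T}. {q::real. \<exists>x. \<forall>a\<in>T. a \<bullet> x = g a + q ^ k a})" (is "finite ?B")
  using A by (intro finite_UN_I) auto
 hence "open (- (?B - {0}))" by (intro open_Compl finite_imp_closed) simp
 hence "\<forall>\<^sub>F q in nhds 0. q \<in> - (?B - {0})" by (rule eventually_nhds_in_open) simp
 hence "\<forall>\<^sub>F q in at_right 0. q \<notin> ?B - {0}" unfolding eventually_at_filter by eventually_elim blast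
 moreover have "\<forall>\<^sub>F q::real in at_right 0. q > 0" by (simp add: eventually_at_right_less)
 ultimately show ?thesis by eventually_elim blast
qed

lemma polytope_sum_list: "\<forall>Q\<in>set Qs. polytope Q ==> polytope (sum_list Qs)"
proof (induction Qs)
 case (Cons Q Qs)
 then obtain V W where "finite V" "Q = convex hull V" "finite W" "sum_list Qs = convex hull W" by (auto simp: polytope_def)
 thus ?case by (auto simp: convex_hull_set_plus[symmetric] intro!: polytope_convex_hull finite_set_plus)
qed (simp add: polytope_sing)

text \<open>Normals of a halfspace representation of the Minkowski sum serve all summands. A generic
  perturbation of the right-hand sides makes the sum simple and defines the fan; letting the
  perturbation tend to 0 shows that each vertex basis still determines a point of the sum, and a
  vertex of the sum splits into vertices of the summands.\<close>

theorem polytopes_common_fan: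
 fixes Qs :: "'a::euclidean_space set list"
 assumes Qs: "\<forall>Q\<in>set Qs. polytope Q & Q ~= {}" and int: "interior (sum_list Qs) ~= {}"
 obtains A BB where "simplicial_fan_nonempty A BB"
  "!!Q. Q \<in> set Qs ==> supp_numbers A Q \<in> simplicial_fan_nonempty.supported A BB & polyh A (supp_numbers A Q) = Q"
proof -
 define Q where "Q = sum_list Qs"
 have Qpoly: "polytope Q" unfolding Q_def using Qs by (intro polytope_sum_list) auto
 have Q: "compact Q" "convex Q" "Q ~= {}"
  using polytope_imp_compact[OF Qpoly] polytope_imp_convex[OF Qpoly] int by (auto simp: Q_def)
 obtain F where F: "finite F" "Q = \<Inter>F" "!!h. h \<in> F ==> \<exists>a b. a ~= 0 & h = {x. a \<bullet> x <= b}"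
  using polytope_imp_polyhedron[OF Qpoly] unfolding polyhedron_def by metis
 obtain na nb where ab: "!!h. h \<in> F ==> na h ~= 0 & h = {x. na h \<bullet> x <= nb h}" using F(3) by metis
 define A where "A = na ` F"
 have A: "finite A" "0 \<notin> A" using F(1) ab by (auto simp: A_def)
 define g where "g = support_function Q"
 have Qeq: "polyh A g = Q"
 proof (intro set_eqI iffI)
  fix x assume x: "x \<in> polyh A g"
  have "x \<in> h" if h: "h \<in> F" for h
  proof -
   obtain y where y: "y \<in> Q" "y \<bullet> na h = g (na h)" using support_max[OF Q(1,3)] by (metis g_def)
   have "na h \<bullet> x <= g (na h)" using x h by (auto simp: polyh_def A_def)
   also have "... <= nb h"
   proof -
    have "y \<in> {x. na h \<bullet> x <= nb h}" using y(1) ab[OF h] h F(2) by blast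
    thus ?thesis using y(2) by (simp add: inner_commute)
   qed
   finally have "x \<in> {x. na h \<bullet> x <= nb h}" by simp
   thus ?thesis using ab[OF h] by blast
  qed
  thus "x \<in> Q" using F(2) by blast
 next
  fix x assume "x \<in> Q"
  thus "x \<in> polyh A g" unfolding polyh_def g_def using support_upper[OF Q(1), of x] by (simp add: inner_commute[of _ x])
 qed
 obtain c r where c: "r > 0" "cball c r \<subseteq> Q" using int by (metis Q_def ex_in_conv mem_interior_cball)
 define p where "p = Min (insert 1 ((%a. g a - a \<bullet> c) ` A))"
 have slack: "a \<bullet> c < g a" if "a \<in> A" for a
 proof -
  have a0: "a ~= 0" using A that by auto
  have "c + (r / norm a) *R a \<in> Q" using c a0 by (intro subsetD[OF c(2)]) (simp add: dist_norm)
  hence "(c + (r / norm a) *R a) \<bullet> a <= g a" using support_upper[OF Q(1)] by (simp add: g_def)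
  moreover have "(r / norm a) * (a \<bullet> a) > 0" using c a0 by simp
  ultimately show ?thesis unfolding inner_add_left inner_scaleR_left inner_commute[of a c] by linarith
 qed
 have rho: "p > 0" "!!a. a \<in> A ==> p <= g a - a \<bullet> c"
  unfolding p_def using A slack by auto
 obtain k :: "'a => nat" where k: "inj_on k A" "!!a. a \<in> A ==> 1 <= k a"
 proof -
  obtain f :: "'a => nat" where "inj_on f A" using finite_imp_inj_to_nat_seg[OF A(1)] by blast
  thus ?thesis using that[of "%a. Suc (f a)"] by (auto simp: inj_on_def)
 qed
 define G where "G q = (%a. g a + q ^ k a)" for q :: real
 have cpt: "compact (polyh A (G q))" "polyh A (G q) ~= {}" if th: "0 < q" "q < 1" for q
 proof -
  \<comment> \<open>Each facet has slack at least \<open>p\<close> at the centre \<open>c\<close>.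
    Enlarging about \<open>c\<close> by the factor \<open>1 + 1 / p\<close> therefore moves every
    facet outwards by at least 1, more than the perturbation does.\<close>
  let ?l = "1 + 1 / p"
  have l: "?l > 0" using rho(1) by (simp add: add_pos_pos)
  have "polyh A (G q) \<subseteq> (%y. (c - ?l *R c) + ?l *R y) ` Q"
  proof
   fix x assume x: "x \<in> polyh A (G q)"
   define y where "y = c + (1 / ?l) *R (x - c)"
   have "a \<bullet> y <= g a" if a: "a \<in> A" for a
   proof -
    have "a \<bullet> x <= g a + 1"
     using x a th power_le_one[of q "k a"] by (force simp: polyh_def G_def)
    moreover have "1 <= (1 / p) * (g a - a \<bullet> c)" using rho(1) rho(2)[OF a] by (simp add: field_simps)
    ultimately have "a \<bullet> (x - c) <= ?l * (g a - a \<bullet> c)" by (simp add: inner_diff_right distrib_right)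
    hence "(1 / ?l) * (a \<bullet> (x - c)) <= g a - a \<bullet> c" using l by (simp add: pos_divide_le_eq mult.commute)
    thus ?thesis by (simp add: y_def inner_add_right)
   qed
   hence "y \<in> Q" unfolding Qeq[symmetric] by (simp add: polyh_def)
   moreover have "x = (c - ?l *R c) + ?l *R y" using l by (simp add: y_def scaleR_add_right)
   ultimately show "x \<in> (%y. (c - ?l *R c) + ?l *R y) ` Q" by blast
  qed
  moreover have "bounded ((%y. (c - ?l *R c) + ?l *R y) ` Q)"
   by (intro compact_imp_bounded compact_continuous_image continuous_intros Q)
  ultimately have "bounded (polyh A (G q))" using bounded_subset by blast
  moreover have "closed (polyh A (G q))"
  proof -
   have "polyh A (G q) = (\<Inter>a\<in>A. {x. a \<bullet> x <= G q a})" by (auto simp: polyh_def)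
   thus ?thesis by (auto intro!: closed_halfspace_le)
  qed
  ultimately show "compact (polyh A (G q))" using compact_eq_bounded_closed by blast
  have "c \<in> polyh A (G q)" using slack th by (fastforce simp: polyh_def G_def less_imp_le add_increasing2)
  thus "polyh A (G q) ~= {}" by blast
 qed
 define B where "B q = {S. S \<subseteq> A & independent S & card S = DIM('a) & vertex S (G q) \<in> polyh A (G q)}" for q
 define good where "good q \<longleftrightarrow> 0 < q & q < 1 & (\<forall>T\<subseteq>A. \<forall>x. (\<forall>a\<in>T. a \<bullet> x = G q a) --> independent T)" for q
 have evgood: "\<forall>\<^sub>F q in at_right 0. good q"
 proof -
  have "\<forall>\<^sub>F q::real in at_right 0. 0 < q & q < 1"
   by (auto simp: eventually_at_right_field intro: exI[of _ 1])
  moreover have "\<forall>\<^sub>F q in at_right 0. \<forall>T\<subseteq>A. \<forall>x. (\<forall>a\<in>T. a \<bullet> x = g a + q ^ k a) --> independent T"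
   by (rule generic_perturbation[OF A(1) k])
  ultimately show ?thesis by eventually_elim (simp add: good_def G_def)
 qed
 \<comment> \<open>Pigeonhole: there are finitely many candidate sets of bases, so one of them
   occurs for arbitrarily small perturbations. This is what permits the limit later on.\<close>
 have "\<exists>BB. \<exists>\<^sub>F q in at_right 0. good q & B q = BB"
 proof (rule ccontr)
  assume "\<not> ?thesis"
  hence "\<forall>BB\<in>Pow (Pow A). \<forall>\<^sub>F q in at_right 0. \<not> (good q & B q = BB)" by (simp add: not_frequently)
  hence "\<forall>\<^sub>F q in at_right 0. \<forall>BB\<in>Pow (Pow A). \<not> (good q & B q = BB)"
   using A(1) by (intro eventually_ball_finite) auto
  with evgood have "\<forall>\<^sub>F q::real in at_right 0. False"
  proof eventually_elim
   case (elim q)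
   have "B q \<in> Pow (Pow A)" by (auto simp: B_def)
   thus ?case using elim by blast
  qed
  thus False by simp
 qed
 then obtain BB where BB: "\<exists>\<^sub>F q in at_right 0. good q & B q = BB" by blast
 from frequently_ex[OF this] obtain q where th: "good q" "B q = BB" by blast
 have basis: "S \<subseteq> A & independent S & card S = DIM('a)" if "S \<in> BB" for S using that th(2) by (auto simp: B_def)
 interpret fan: simplicial_fan A BB
 proof
  fix u
  have t01: "0 < q" "q < 1" using th(1) by (auto simp: good_def)
  have gen: "independent T" if "T \<subseteq> A" "!!a. a \<in> T ==> a \<bullet> x = G q a" for T x
   using th(1) that unfolding good_def by blast
  obtain S l where "S \<subseteq> A" "independent S" "card S = DIM('a)" "vertex S (G q) \<in> polyh A (G q)"
   "\<forall>b\<in>S. 0 <= l b" "u = (\<Sum>b\<in>S. l b *R b)"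
   by (rule polytope_vertex_cone[OF A(1) cpt(1)[OF t01] cpt(2)[OF t01] gen])
  thus "\<exists>S\<in>BB. \<exists>l. (\<forall>b\<in>S. 0 <= l b) & u = (\<Sum>b\<in>S. l b *R b)" using th(2) by (auto simp: B_def)
 qed (use A basis in auto)
 have Gch: "G q \<in> fan.chamber" unfolding fan.chamber_def
 proof (intro CollectI ballI)
  fix S j assume S: "S \<in> BB" and j: "j \<in> A - S"
  have "j \<bullet> vertex S (G q) <= G q j" using S th(2) j by (auto simp: B_def polyh_def)
  moreover have "j \<bullet> vertex S (G q) ~= G q j"
  proof
   assume "j \<bullet> vertex S (G q) = G q j"
   hence "independent (insert j S)"
    using th(1) fan.vertex_inner[OF S] j basis[OF S] unfolding good_def by (metis DiffD1 insert_iff insert_subset)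
   moreover have "card (insert j S) = Suc (DIM('a))" using j basis[OF S] fan.BB_finite[OF S] by simp
   ultimately show False using independent_bound[of "insert j S"] by simp
  qed
  ultimately show "j \<bullet> vertex S (G q) < G q j" by simp
 qed
 interpret fan: simplicial_fan_nonempty A BB by unfold_locales (use Gch in blast)
 have vQ: "vertex S g \<in> Q" if S: "S \<in> BB" for S
 proof -
  have "j \<bullet> vertex S g <= g j" if j: "j \<in> A" for j
  proof (rule ccontr)
   assume "\<not> ?thesis"
   hence gt: "0 < j \<bullet> vertex S g - g j" by simp
   have kpos: "b \<in> A ==> k b > 0" for b using k(2)[of b] by linarith
   have "((%q. j \<bullet> vertex S (G q) - G q j) \<longlongrightarrow> j \<bullet> vertex S (%a. g a + 0 ^ k a) - (g j + 0 ^ k j)) (at_right 0)"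
    unfolding vertex_def G_def by (intro tendsto_intros)
   moreover have "vertex S (%a. g a + 0 ^ k a) = vertex S g"
    unfolding vertex_def
   proof (rule sum.cong[OF refl])
    fix b assume "b \<in> S"
    hence "k b > 0" using basis[OF S] kpos by blast
    thus "(g b + 0 ^ k b) *R dual S b = g b *R dual S b" by simp
   qed
   ultimately have "((%q. j \<bullet> vertex S (G q) - G q j) \<longlongrightarrow> j \<bullet> vertex S g - g j) (at_right 0)"
    using kpos[OF j] by (simp add: power_0_left)
   hence "\<forall>\<^sub>F q in at_right 0. 0 < j \<bullet> vertex S (G q) - G q j" using gt order_tendstoD(1) by blast
   with BB have "\<exists>\<^sub>F q in at_right 0. (good q & B q = BB) & 0 < j \<bullet> vertex S (G q) - G q j"
    by (rule frequently_eventually_frequently)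
   from frequently_ex[OF this] obtain q' where "B q' = BB" "0 < j \<bullet> vertex S (G q') - G q' j" by blast
   thus False using S j by (auto simp: B_def polyh_def)
  qed
  thus ?thesis unfolding Qeq[symmetric] by (simp add: polyh_def)
 qed
 have "supp_numbers A K \<in> fan.supported & polyh A (supp_numbers A K) = K" if K: "K \<in> set Qs" for K
 proof -
  obtain us vs where uv: "Qs = us @ K # vs" using K by (metis in_set_conv_decomp)
  define R where "R = sum_list (us @ vs)"
  have QKR: "Q = K + R" by (simp add: Q_def R_def uv ac_simps)
  have Kp: "polytope K" "K ~= {}" using Qs K by auto
  have Rp: "polytope R" unfolding R_def using Qs uv by (intro polytope_sum_list) auto
  have Rne: "R ~= {}" using Q(3) QKR by auto
  have cK: "compact K" and cR: "compact R" using Kp Rp polytope_imp_compact by auto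
  have vK: "vertex S (supp_numbers A K) \<in> K" if S: "S \<in> BB" for S
  proof -
   \<comment> \<open>The support functions of \<open>K\<close> and \<open>R\<close> add up to that
     of the sum, so equality for the sum on the normals in \<open>S\<close> forces equality for both
     summands.\<close>
   obtain x y where xy: "vertex S g = x + y" "x \<in> K" "y \<in> R" using vQ[OF S] QKR by (auto simp: set_plus_def)
   have "b \<bullet> x = supp_numbers A K b" if b: "b \<in> S" for b
   proof -
    have "b \<bullet> x + b \<bullet> y = support_function K b + support_function R b"
     using fan.vertex_inner[OF S b, of g] support_plus[OF cK Kp(2) cR Rne] xy(1) by (simp add: g_def QKR inner_add_right)
    moreover have "b \<bullet> x <= support_function K b" "b \<bullet> y <= support_function R b"
     using support_upper[OF cK xy(2)] support_upper[OF cR xy(3)] by (simp_all add: inner_commute)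
    ultimately show ?thesis using b basis[OF S] by (auto simp: supp_numbers_def)
   qed
   thus ?thesis using fan.vertex_eqI[OF S] xy(2) by metis
  qed
  have "supp_numbers A K \<in> fan.closed_chamber" unfolding fan.closed_chamber_def
   using support_upper[OF cK vK] by (auto simp: supp_numbers_def inner_commute)
  moreover have "K = polyh A (supp_numbers A K)"
   using cK polytope_imp_convex[OF Kp(1)] support_upper[OF cK] vK
   by (intro fan.polyh_eq_of_support) (auto simp: polyh_def supp_numbers_def inner_commute)
  ultimately show ?thesis by (auto simp: fan.supported_def supp_numbers_def)
 qed
 thus ?thesis using that[of A BB] fan.simplicial_fan_nonempty_axioms by blast
qed

section \<open>Mixed volumes of convex bodies\<close>

text \<open>The base \<open>{0}\<close> is a choice of convenience for the definition; additivity in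
  each argument rests on the independence of the base point, which is first visible on polytopes
  with a common fan.\<close>

definition mixvol :: "'a::euclidean_space set list => real" where
 "mixvol Ks = iterated_diff Ks vol {0} / fact (length Ks)"

context simplicial_fan_nonempty
begin

lemma iterated_diff_vol_mform:
 assumes "!!K. K \<in> set (X # Ks) ==> supp_numbers A K \<in> supported & P (supp_numbers A K) = K" "length Ks = DIM('a)"
 shows "iterated_diff Ks vol X = mform (map (supp_numbers A) Ks) []"
proof -
 have "map P (map (supp_numbers A) Ks) = Ks" using assms by (simp add: map_idI)
 moreover have "P (supp_numbers A X) = X" using assms by simp
 moreover have "iterated_diff (map P (map (supp_numbers A) Ks)) vol (P (supp_numbers A X)) = mform (map (supp_numbers A) Ks) []"
 proof (rule iterated_diff_vol_polyh)
  show "set (map (supp_numbers A) Ks) \<subseteq> supported" using assms(1) by auto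
  show "supp_numbers A X \<in> closed_chamber" using assms(1)[of X] by (simp add: supported_def)
 qed (use assms(2) in simp)
 ultimately show ?thesis by simp
qed

lemma mixvol_mform:
 assumes "!!K. K \<in> set Ks ==> supp_numbers A K \<in> supported & P (supp_numbers A K) = K" "length Ks = DIM('a)"
 shows "mixvol Ks = mform (map (supp_numbers A) Ks) [] / fact (DIM('a))"
proof -
 have "map P (map (supp_numbers A) Ks) = Ks" using assms by (simp add: map_idI)
 moreover have "iterated_diff (map P (map (supp_numbers A) Ks)) vol (P 0) = mform (map (supp_numbers A) Ks) []"
  using assms by (intro iterated_diff_vol_polyh closed_chamber_zero) auto
 ultimately show ?thesis using assms(2) by (simp add: mixvol_def polyh_zero)
qed

lemma chamber_perturbation:
 "k \<in> chamber ==> 0 < t ==> c \<in> closed_chamber ==> (%a. t * k a + c a) \<in> chamber"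
 using chamber_add[OF chamber_scale[of t k], of c] by (simp add: plus_fun_def)

lemma closed_limit:
 fixes F G :: "real => real"
 assumes "!!t. 0 < t ==> F t <= G t" "continuous_on UNIV F" "continuous_on UNIV G" shows "F 0 <= G 0"
proof (rule tendsto_le[OF trivial_limit_at_right_real])
 show "(G \<longlongrightarrow> G 0) (at_right 0)" "(F \<longlongrightarrow> F 0) (at_right 0)"
  using assms(2,3) by (auto simp: continuous_on_eq_continuous_at isCont_def intro: tendsto_mono[OF at_le])
 show "\<forall>\<^sub>F t in at_right 0. F t <= G t" using assms(1) eventually_at_right_less by (rule eventually_mono[rotated])
qed

lemma mform_nonneg_closed:
 assumes "set cs \<subseteq> closed_chamber" "Suc (length cs) = DIM('a)"
 shows "0 <= mform cs [a]"
proof (cases "{a} \<in> faces")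
 case True
 obtain k where k: "k \<in> chamber" using chamber_nonempty by blast
 define H where "H t c = (%a. t * k a + c a)" for t c
 have H: "!!t c. 0 < t ==> c \<in> closed_chamber ==> H t c \<in> chamber" "!!c. H 0 c = c" "!!c b. continuous_on UNIV (%t. H t c b)"
  using chamber_perturbation[OF k] by (auto simp: H_def intro!: continuous_intros)
 have "0 <= mform (map (%d. d 0) (map (%c t. H t c) cs)) [a]"
 proof (rule closed_limit[where F = "%t. 0"])
  show "0 <= mform (map (%d. d t) (map (%c t. H t c) cs)) [a]" if "0 < t" for t
   using assms True H(1)[OF that] by (intro less_imp_le[OF mform_pos]) auto
  show "continuous_on UNIV (%t. mform (map (%d. d t) (map (%c t. H t c) cs)) [a])"
   using H(3) by (intro mform_continuous) auto
 qed auto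
 thus ?thesis by (simp add: H(2) o_def)
next
 case False
 thus ?thesis by (simp add: mform_not_face)
qed

lemma mform_mono_closed:
 assumes "set cs \<subseteq> closed_chamber" "Suc (length cs) = DIM('a)" "!!a. a \<in> A ==> x a <= y a"
 shows "mform (x # cs) [] <= mform (y # cs) []"
 using assms mform_nonneg_closed by (simp add: sum_mono mult_right_mono)

lemma alexandrov_fenchel_closed:
 assumes "c \<in> closed_chamber" "set cs \<subseteq> closed_chamber" "length cs + 2 = DIM('a)"
 shows "mform (x # x # cs) [] * mform (c # c # cs) [] <= (mform (x # c # cs) [])\<^sup>2"
proof -
 obtain k where k: "k \<in> chamber" using chamber_nonempty by blast
 define H where "H t c = (%a. t * k a + c a)" for t c
 have H: "!!t c. 0 < t ==> c \<in> closed_chamber ==> H t c \<in> chamber" "!!c. H 0 c = c" "!!c b. continuous_on UNIV (%t. H t c b)"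
  using chamber_perturbation[OF k] by (auto simp: H_def intro!: continuous_intros)
 let ?m = "%ds t. mform (map (%d. d t) ds) []"
 let ?c = "%t. H t c" and ?x = "%t::real. x" and ?cs = "map (%c t. H t c) cs"
 have "?m (?x # ?x # ?cs) 0 * ?m (?c # ?c # ?cs) 0 <= (?m (?x # ?c # ?cs) 0)\<^sup>2"
 proof (rule closed_limit)
  show "?m (?x # ?x # ?cs) t * ?m (?c # ?c # ?cs) t <= (?m (?x # ?c # ?cs) t)\<^sup>2" if "0 < t" for t
  proof -
   have "hyperbolic_at [] (map (%d. d t) ?cs) (H t c)"
    using assms H(1)[OF that] BB_nonempty by (intro mform_alexandrov_fenchel) (auto simp: faces_def)
   thus ?thesis by (simp add: hyperbolic_at_def del: mform.simps)
  qed
  show "continuous_on UNIV (%t. ?m (?x # ?x # ?cs) t * ?m (?c # ?c # ?cs) t)"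
   using H(3) by (intro continuous_intros mform_continuous) auto
  show "continuous_on UNIV (%t. (?m (?x # ?c # ?cs) t)\<^sup>2)"
   using H(3) by (intro continuous_intros mform_continuous) auto
 qed
 thus ?thesis by (simp add: H(2) o_def del: mform.simps)
qed

end

lemma interior_plus_nonempty:
 fixes K :: "'a::euclidean_space set"
 assumes "interior K ~= {}" "L ~= {}" shows "interior (K + L) ~= {}"
proof -
 have "open (interior K + L)" by (rule open_plus_left) simp
 moreover have "interior K + L \<subseteq> K + L" using interior_subset by (intro set_plus_mono2) auto
 ultimately have "interior K + L \<subseteq> interior (K + L)" by (rule interior_maximal[rotated])
 thus ?thesis using assms by (auto simp: set_plus_def)
qed

lemma sum_list_nonempty: "\<forall>Q\<in>set Qs. Q ~= {} ==> sum_list Qs ~= ({} :: 'a::comm_monoid_add set)"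
 by (induction Qs) auto

text \<open>A cube is added to the list so that the Minkowski sum acquires interior points, as
  \<open>polytopes_common_fan\<close> demands.\<close>

lemma polytopes_fan:
 fixes Qs :: "'a::euclidean_space set list"
 assumes "\<forall>Q\<in>set Qs. polytope Q & Q ~= {}"
 obtains A BB where "simplicial_fan_nonempty A BB"
  "!!Q. Q \<in> set Qs ==> supp_numbers A Q \<in> simplicial_fan_nonempty.supported A BB & polyh A (supp_numbers A Q) = Q"
proof -
 let ?C = "cbox 0 One :: 'a set"
 have C: "polytope ?C" "interior ?C ~= {}" by (auto simp: polytope_interval interior_cbox box_ne_empty)
 hence Cne: "?C ~= {}" by (metis interior_empty)
 have "interior (sum_list (?C # Qs)) ~= {}"
  using interior_plus_nonempty[OF C(2) sum_list_nonempty] assms by simp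
 moreover have "\<forall>Q\<in>set (?C # Qs). polytope Q & Q ~= {}" using assms C(1) Cne by auto
 ultimately obtain A BB where "simplicial_fan_nonempty A BB"
  "!!Q. Q \<in> set (?C # Qs) ==> supp_numbers A Q \<in> simplicial_fan_nonempty.supported A BB & polyh A (supp_numbers A Q) = Q"
  using polytopes_common_fan[of "?C # Qs"] by blast
 thus ?thesis using that by simp
qed

lemma polytope_iterated_diff_base:
 fixes Ks :: "'a::euclidean_space set list"
 assumes "\<forall>Q\<in>set (X # Y # Ks). polytope Q & Q ~= {}" "length Ks = DIM('a)"
 shows "iterated_diff Ks vol X = iterated_diff Ks vol Y"
proof -
 obtain A BB where f: "simplicial_fan_nonempty A BB"
  "!!Q. Q \<in> set (X # Y # Ks) ==> supp_numbers A Q \<in> simplicial_fan_nonempty.supported A BB & polyh A (supp_numbers A Q) = Q"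
  using polytopes_fan[OF assms(1)] by blast
 interpret simplicial_fan_nonempty A BB by fact
 have "iterated_diff Ks vol X = mform (map (supp_numbers A) Ks) []"
  by (rule iterated_diff_vol_mform) (use f(2) assms(2) in auto)
 moreover have "iterated_diff Ks vol Y = mform (map (supp_numbers A) Ks) []"
  by (rule iterated_diff_vol_mform) (use f(2) assms(2) in auto)
 ultimately show ?thesis by simp
qed

lemma polytope_mixvol_mono:
 fixes Ks :: "'a::euclidean_space set list"
 assumes "\<forall>Q\<in>set (K # L # Ks). polytope Q & Q ~= {}" "Suc (length Ks) = DIM('a)" "K \<subseteq> L"
 shows "mixvol (K # Ks) <= mixvol (L # Ks)"
proof -
 obtain A BB where f: "simplicial_fan_nonempty A BB"
  "!!Q. Q \<in> set (K # L # Ks) ==> supp_numbers A Q \<in> simplicial_fan_nonempty.supported A BB & polyh A (supp_numbers A Q) = Q"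
  using polytopes_fan[OF assms(1)] by blast
 interpret simplicial_fan_nonempty A BB by fact
 have "supp_numbers A K a <= supp_numbers A L a" for a
  using assms support_mono[of K L a] polytope_imp_compact by (auto simp: supp_numbers_def)
 hence "mform (supp_numbers A K # map (supp_numbers A) Ks) [] <= mform (supp_numbers A L # map (supp_numbers A) Ks) []"
  using f(2) assms(2) by (intro mform_mono_closed) (auto simp: supported_def)
 moreover have "mixvol (K # Ks) = mform (map (supp_numbers A) (K # Ks)) [] / fact (DIM('a))"
  by (rule mixvol_mform) (use f(2) assms(2) in auto)
 moreover have "mixvol (L # Ks) = mform (map (supp_numbers A) (L # Ks)) [] / fact (DIM('a))"
  by (rule mixvol_mform) (use f(2) assms(2) in auto)
 ultimately show ?thesis by (simp add: divide_right_mono del: mform.simps)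
qed

text \<open>The form is evaluated at the difference of the support numbers of \<open>K\<close> and
  \<open>L\<close>, which is not the support function of a body. The expansion by bilinearity
  expresses this through bodies only and thus passes to limits.\<close>

lemma polytope_alexandrov_fenchel:
 fixes Ks :: "'a::euclidean_space set list"
 assumes "\<forall>Q\<in>set (K # L # M # Ks). polytope Q & Q ~= {}" "length Ks + 2 = DIM('a)"
 shows "(mixvol (K # K # Ks) - 2 * mixvol (K # L # Ks) + mixvol (L # L # Ks)) * mixvol (M # M # Ks)
  <= (mixvol (K # M # Ks) - mixvol (L # M # Ks))\<^sup>2"
proof -
 obtain A BB where f: "simplicial_fan_nonempty A BB"
  "!!Q. Q \<in> set (K # L # M # Ks) ==> supp_numbers A Q \<in> simplicial_fan_nonempty.supported A BB & polyh A (supp_numbers A Q) = Q"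
  using polytopes_fan[OF assms(1)] by blast
 interpret simplicial_fan_nonempty A BB by fact
 define q where "q x z = mform (x # z # map (supp_numbers A) Ks) []" for x z
 let ?k = "supp_numbers A K" and ?l = "supp_numbers A L" and ?m = "supp_numbers A M"
 have mv: "mixvol (X # Y # Ks) = q (supp_numbers A X) (supp_numbers A Y) / fact (DIM('a))" if "X \<in> {K, L, M}" "Y \<in> {K, L, M}" for X Y
  unfolding q_def list.map(2)[symmetric] by (rule mixvol_mform) (use f(2) assms(2) that in auto)
 let ?x = "%a. ?k a + (-1) * ?l a"
 have lin: "q (%a. x a + s * z a) w = q x w + s * q z w" for x s z w unfolding q_def by (rule mform_diff)
 have sym: "q x z = q z x" for x z unfolding q_def by (rule mform_swap)
 have qxx: "q ?x ?x = q ?k ?k - 2 * q ?k ?l + q ?l ?l"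
  using lin[of ?k "-1" ?l ?x] lin[of ?k "-1" ?l ?k] lin[of ?k "-1" ?l ?l] sym[of ?k ?x] sym[of ?l ?x] sym[of ?l ?k] by linarith
 have qxm: "q ?x ?m = q ?k ?m - q ?l ?m" using lin[of ?k "-1" ?l ?m] by simp
 have "q ?x ?x * q ?m ?m <= (q ?x ?m)\<^sup>2"
  unfolding q_def using f(2) assms(2) by (intro alexandrov_fenchel_closed) (auto simp: supported_def)
 hence "(q ?k ?k - 2 * q ?k ?l + q ?l ?l) * q ?m ?m / (fact (DIM('a)))\<^sup>2 <= (q ?k ?m - q ?l ?m)\<^sup>2 / (fact (DIM('a)))\<^sup>2"
  unfolding qxx qxm by (intro divide_right_mono) auto
 thus ?thesis using mv by (simp add: power2_eq_square diff_divide_distrib add_divide_distrib algebra_simps)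
qed

section \<open>Approximation of convex bodies by polytopes from outside\<close>

definition approximates :: "(nat => 'a::euclidean_space set) => 'a set => bool" where
 "approximates Q K \<longleftrightarrow> convex_body K & (\<forall>m. convex_body (Q m)) &
   (\<exists>c\<ge>0. \<forall>m. K \<subseteq> Q m & Q m \<subseteq> K + cball 0 (c / real (Suc m)))"

lemma approximates_const: "convex_body K ==> approximates (%m. K) K"
 unfolding approximates_def by (intro conjI allI exI[of _ 0]) auto

lemma cball_plus: "0 <= r ==> 0 <= s ==> cball 0 r + cball 0 s \<subseteq> (cball 0 (r + s) :: 'a::real_normed_vector set)"
 by (auto simp: set_plus_def intro!: order_trans[OF norm_triangle_ineq] add_mono)

lemma approximates_plus: "approximates Q K ==> approximates R L ==> approximates (%m. Q m + R m) (K + L)"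
proof -
 assume "approximates Q K" "approximates R L"
 then obtain c d where cd: "c \<ge> 0" "d \<ge> 0" "!!m. K \<subseteq> Q m & Q m \<subseteq> K + cball 0 (c / real (Suc m))" "!!m. L \<subseteq> R m & R m \<subseteq> L + cball 0 (d / real (Suc m))"
  and b: "convex_body K" "convex_body L" "!!m. convex_body (Q m)" "!!m. convex_body (R m)"
  unfolding approximates_def by blast
 have "Q m + R m \<subseteq> K + L + cball 0 ((c + d) / real (Suc m))" for m
 proof -
  have "Q m + R m \<subseteq> (K + cball 0 (c / real (Suc m))) + (L + cball 0 (d / real (Suc m)))"
   using cd by (intro set_plus_mono2) auto
  also have "... = K + L + (cball 0 (c / real (Suc m)) + cball 0 (d / real (Suc m)))" by (simp only: ac_simps)
  also have "... \<subseteq> K + L + cball 0 ((c + d) / real (Suc m))"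
   unfolding add_divide_distrib using cd by (intro set_plus_mono2 cball_plus) auto
  finally show ?thesis .
 qed
 moreover have "K + L \<subseteq> Q m + R m" for m using cd by (intro set_plus_mono2) auto
 ultimately show ?thesis unfolding approximates_def using cd(1,2) b
  by (intro conjI allI body_plus exI[of _ "c + d"]) auto
qed

lemma approximates_vol: "approximates Q K ==> (%m. vol (Q m)) \<longlonglongrightarrow> vol K"
proof -
 assume "approximates Q K"
 then obtain c where c: "c \<ge> 0" "!!m. K \<subseteq> Q m & Q m \<subseteq> K + cball 0 (c / real (Suc m))"
  and b: "convex_body K" "!!m. convex_body (Q m)" unfolding approximates_def by blast
 show ?thesis
 proof (rule order_tendstoI)
  fix a assume "a < vol K"
  thus "\<forall>\<^sub>F m in sequentially. a < vol (Q m)"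
   using vol_mono[OF body_lmeasurable[OF b(1)] body_lmeasurable[OF b(2)]] c(2) less_le_trans by (auto intro!: always_eventually) blast
 next
  fix a assume a: "vol K < a"
  obtain e where e: "e > 0" "vol (K + cball 0 e) < vol K + (a - vol K)"
   using vol_thicken[of K "a - vol K"] a b(1) by (auto simp: convex_body_def)
  have "(%m. c / real (Suc m)) \<longlonglongrightarrow> 0" by (rule LIMSEQ_Suc[OF lim_const_over_n])
  hence "\<forall>\<^sub>F m in sequentially. c / real (Suc m) < e" using e(1) order_tendstoD(2) by blast
  thus "\<forall>\<^sub>F m in sequentially. vol (Q m) < a"
  proof eventually_elim
   case (elim m)
   have "Q m \<subseteq> K + cball 0 e" using c(2)[of m] elim by (meson order_trans set_plus_mono2 order_refl subset_cball less_imp_le)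
   moreover have "convex_body (K + cball 0 e)" using b(1) e(1) by (intro body_plus) (auto simp: convex_body_def less_imp_le)
   ultimately have "vol (Q m) <= vol (K + cball 0 e)" using b by (intro vol_mono body_lmeasurable)
   thus ?case using e(2) by linarith
  qed
 qed
qed

lemma approximates_iterated_diff:
 assumes "approximates Q X" "list_all2 approximates Qs Ks"
 shows "(%m. iterated_diff (map (%Q. Q m) Qs) vol (Q m)) \<longlonglongrightarrow> iterated_diff Ks vol X"
 using assms(2,1)
proof (induction arbitrary: Q X rule: list_all2_induct)
 case Nil
 thus ?case by (simp add: approximates_vol)
next
 case (Cons R Rs K Ks)
 thus ?case using Cons.IH[OF approximates_plus[OF Cons.prems Cons.hyps(1)]] Cons.IH[OF Cons.prems] by (auto intro!: tendsto_diff)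
qed

lemma approximates_mixvol:
 assumes "list_all2 approximates Qs Ks"
 shows "(%m. mixvol (map (%Q. Q m) Qs)) \<longlonglongrightarrow> mixvol Ks"
proof -
 have "(%m. iterated_diff (map (%Q. Q m) Qs) vol {0}) \<longlonglongrightarrow> iterated_diff Ks vol {0}"
  using approximates_iterated_diff[OF approximates_const[OF body_singleton[of 0]] assms] .
 thus ?thesis unfolding mixvol_def length_map list_all2_lengthD[OF assms] by (intro tendsto_divide tendsto_const) auto
qed

lemma polytope_between:
 fixes K :: "'a::euclidean_space set"
 assumes K: "convex_body K" and e: "e > 0"
 obtains Q where "polytope Q" "K \<subseteq> Q" "Q \<subseteq> K + cball 0 e"
proof -
 have "\<exists>a b. x \<in> box a b & cbox a b \<subseteq> ball x e" for x :: 'a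
 proof -
  have "x \<in> ball x e" using e by simp
  thus ?thesis by (meson open_contains_cbox open_ball)
 qed
 then obtain a b where ab: "!!x::'a. x \<in> box (a x) (b x) & cbox (a x) (b x) \<subseteq> ball x e" by metis
 obtain C where C: "C \<subseteq> K" "finite C" "K \<subseteq> (\<Union>x\<in>C. box (a x) (b x))"
 proof (rule compactE_image[of K K "%x. box (a x) (b x)"])
  show "compact K" using K by (simp add: convex_body_def)
  show "K \<subseteq> (\<Union>x\<in>K. box (a x) (b x))" using ab by blast
 qed auto
 have "\<exists>V. finite V & cbox (a x) (b x) = convex hull V" for x
  using polytope_interval[of "a x" "b x"] by (auto simp: polytope_def)
 then obtain V where V: "!!x. finite (V x)" "!!x. cbox (a x) (b x) = convex hull (V x)" by metis
 define Q where "Q = convex hull (\<Union>x\<in>C. V x)"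
 have "cbox (a x) (b x) \<subseteq> Q" if "x \<in> C" for x unfolding V(2) Q_def using that by (intro hull_mono) blast
 hence "K \<subseteq> Q" using C(3) box_subset_cbox by blast
 moreover have "Q \<subseteq> K + cball 0 e" unfolding Q_def
 proof (rule hull_minimal)
  show "convex (K + cball 0 e)" using K by (intro convex_set_plus) (auto simp: convex_body_def)
  show "(\<Union>x\<in>C. V x) \<subseteq> K + cball 0 e"
  proof clarify
   fix x v assume x: "x \<in> C" "v \<in> V x"
   hence "v \<in> ball x e" using ab V(2) hull_subset by (metis subset_iff)
   hence "x + (v - x) \<in> K + cball 0 e" using x C(1) by (intro set_plus_intro) (auto simp: dist_norm norm_minus_commute)
   thus "v \<in> K + cball 0 e" by simp
  qed
 qed
 ultimately show ?thesis using that[of Q] C(2) V(1) by (auto simp: Q_def intro!: polytope_convex_hull)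
qed

lemma polytope_convex_body: "polytope Q ==> Q ~= {} ==> convex_body Q"
 by (simp add: convex_body_def polytope_imp_compact polytope_imp_convex)

text \<open>The parameter \<open>c\<close> buys a margin for nested bodies: approximating the
  smaller body with \<open>c = 0\<close> and the larger with \<open>c = 1\<close> keeps the
  approximating polytopes nested, as \<open>mixvol_mono\<close> requires.\<close>

lemma polytope_approximation:
 fixes K :: "'a::euclidean_space set"
 assumes "convex_body K" "0 <= c"
 shows "\<exists>Q. approximates Q K & (\<forall>m. polytope (Q m) & Q m ~= {} & K + cball 0 (c / real (Suc m)) \<subseteq> Q m & Q m \<subseteq> K + cball 0 ((c + 1) / real (Suc m)))"
proof -
 have b: "convex_body (K + cball 0 (c / real (Suc m)))" for m
 proof (rule body_plus[OF assms(1)])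
  have "0 <= c / real (Suc m)" using assms(2) by simp
  thus "convex_body (cball 0 (c / real (Suc m)) :: 'a set)" by (simp add: convex_body_def)
 qed
 have "\<exists>Q. polytope Q & K + cball 0 (c / real (Suc m)) \<subseteq> Q & Q \<subseteq> K + cball 0 (c / real (Suc m)) + cball 0 (1 / real (Suc m))" for m
  using polytope_between[OF b[of m], of "1 / real (Suc m)"] by (metis of_nat_0_less_iff zero_less_Suc zero_less_divide_1_iff)
 then obtain Q where Q: "!!m. polytope (Q m)" "!!m. K + cball 0 (c / real (Suc m)) \<subseteq> Q m" "!!m. Q m \<subseteq> K + cball 0 (c / real (Suc m)) + cball 0 (1 / real (Suc m))" by metis
 have 1: "Q m \<subseteq> K + cball 0 ((c + 1) / real (Suc m))" for m
 proof -
  have "K + cball 0 (c / real (Suc m)) + cball 0 (1 / real (Suc m)) \<subseteq> K + cball 0 ((c + 1) / real (Suc m))"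
   unfolding add.assoc add_divide_distrib using assms(2) by (intro set_plus_mono2 cball_plus) auto
  thus ?thesis using Q(3) by blast
 qed
 have 2: "K \<subseteq> Q m" for m
 proof -
  have "K \<subseteq> cball 0 (c / real (Suc m)) + K" using assms(2) by (intro set_zero_plus2) auto
  thus ?thesis using Q(2)[of m] by (simp add: add.commute)
 qed
 have "Q m ~= {}" for m using 2[of m] assms(1) by (auto simp: convex_body_def)
 moreover from this have "convex_body (Q m)" for m using Q(1) polytope_convex_body by blast
 hence "approximates Q K" unfolding approximates_def
  using assms 1 2 by (intro conjI exI[of _ "c + 1"]) auto
 ultimately show ?thesis using Q 1 by blast
qed

lemma polytope_approximation_list:
 assumes "\<forall>K\<in>set Ks. convex_body K"
 obtains Qs where "list_all2 approximates Qs Ks" "!!Q m. Q \<in> set Qs ==> polytope (Q m) & Q m ~= {}"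
proof -
 have "\<exists>Qs. list_all2 approximates Qs Ks & (\<forall>Q\<in>set Qs. \<forall>m. polytope (Q m) & Q m ~= {})"
  using assms
 proof (induction Ks)
  case (Cons K Ks)
  have "convex_body K" using Cons.prems by simp
  from polytope_approximation[OF this, of 0] obtain Q where "approximates Q K" "\<forall>m. polytope (Q m) & Q m ~= {}" by blast
  moreover obtain Qs where "list_all2 approximates Qs Ks" "\<forall>Q\<in>set Qs. \<forall>m. polytope (Q m) & Q m ~= {}" using Cons by auto
  ultimately show ?case by (intro exI[of _ "Q # Qs"]) auto
 qed simp
 thus ?thesis using that by blast
qed

theorem iterated_diff_base:
 fixes Ks :: "'a::euclidean_space set list"
 assumes "\<forall>K\<in>set (X # Ks). convex_body K" "length Ks = DIM('a)"
 shows "iterated_diff Ks vol X = fact (DIM('a)) * mixvol Ks"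
proof -
 have b: "\<forall>K\<in>set (X # {0} # Ks). convex_body K" using assms by simp
 obtain Qs where Q: "list_all2 approximates Qs (X # {0} # Ks)" "!!Q m. Q \<in> set Qs ==> polytope (Q m) & Q m ~= {}"
  using polytope_approximation_list[OF b] by blast
 then obtain R Z Rs where Qs: "Qs = R # Z # Rs" "approximates R X" "approximates Z {0}" "list_all2 approximates Rs Ks"
  by (auto simp: list_all2_Cons2)
 have "iterated_diff (map (%Q. Q m) Rs) vol (R m) = iterated_diff (map (%Q. Q m) Rs) vol (Z m)" for m
  using Q(2) assms(2) list_all2_lengthD[OF Qs(4)] Qs(1) by (intro polytope_iterated_diff_base) auto
 hence "iterated_diff Ks vol X = iterated_diff Ks vol {0}"
  using approximates_iterated_diff[OF Qs(2,4)] approximates_iterated_diff[OF Qs(3,4)] LIMSEQ_unique by simp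
 thus ?thesis by (simp add: mixvol_def assms(2))
qed

theorem mixvol_mono:
 fixes Ks :: "'a::euclidean_space set list"
 assumes "\<forall>K\<in>set (K # L # Ks). convex_body K" "Suc (length Ks) = DIM('a)" "K \<subseteq> L"
 shows "mixvol (K # Ks) <= mixvol (L # Ks)"
proof -
 have b: "convex_body K" "convex_body L" using assms(1) by auto
 from polytope_approximation[OF b(1), of 0] obtain Q where "approximates Q K" "\<forall>m. polytope (Q m) & Q m ~= {}" "\<forall>m. Q m \<subseteq> K + cball 0 ((0 + 1) / real (Suc m))" by blast
 note Q = this[rule_format]
 from polytope_approximation[OF b(2), of 1] obtain R where "approximates R L" "\<forall>m. polytope (R m) & R m ~= {}" "\<forall>m. L + cball 0 (1 / real (Suc m)) \<subseteq> R m" by auto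
 note R = this[rule_format]
 obtain Rs where Rs: "list_all2 approximates Rs Ks" "!!Q m. Q \<in> set Rs ==> polytope (Q m) & Q m ~= {}"
  using polytope_approximation_list[of Ks] assms(1) by auto
 have "Q m \<subseteq> R m" for m
 proof -
  have "K + cball 0 (1 / real (Suc m)) \<subseteq> L + cball 0 (1 / real (Suc m))" using assms(3) by (intro set_plus_mono2) auto
  thus ?thesis using Q(3)[of m] R(3)[of m] by simp
 qed
 hence "mixvol (map (%Q. Q m) (Q # Rs)) <= mixvol (map (%Q. Q m) (R # Rs))" for m
  using Q R Rs assms(2) list_all2_lengthD[OF Rs(1)] unfolding list.map by (intro polytope_mixvol_mono) auto
 thus ?thesis
  using Q(1) R(1) Rs(1) by (intro LIMSEQ_le[OF approximates_mixvol[of "Q # Rs"] approximates_mixvol[of "R # Rs"]]) auto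
qed

theorem alexandrov_fenchel:
 fixes Ks :: "'a::euclidean_space set list"
 assumes "\<forall>Q\<in>set (K # L # M # Ks). convex_body Q" "length Ks + 2 = DIM('a)"
 shows "(mixvol (K # K # Ks) - 2 * mixvol (K # L # Ks) + mixvol (L # L # Ks)) * mixvol (M # M # Ks)
  <= (mixvol (K # M # Ks) - mixvol (L # M # Ks))\<^sup>2"
proof -
 obtain Qs where Q: "list_all2 approximates Qs (K # L # M # Ks)" "!!Q m. Q \<in> set Qs ==> polytope (Q m) & Q m ~= {}"
  using polytope_approximation_list[OF assms(1)] by blast
 then obtain k l n Rs where Qs: "Qs = k # l # n # Rs" "approximates k K" "approximates l L" "approximates n M" "list_all2 approximates Rs Ks"
  by (auto simp: list_all2_Cons2)
 let ?m = "%X Y m. mixvol (map (%Q. Q m) (X # Y # Rs))"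
 have lim: "(?m x y) \<longlonglongrightarrow> mixvol (X # Y # Ks)" if "approximates x X" "approximates y Y" for x y X Y
  using approximates_mixvol[of "x # y # Rs" "X # Y # Ks"] that Qs(5) by simp
 show ?thesis
 proof (rule LIMSEQ_le)
  show "(%m. (?m k k m - 2 * ?m k l m + ?m l l m) * ?m n n m) \<longlonglongrightarrow> (mixvol (K # K # Ks) - 2 * mixvol (K # L # Ks) + mixvol (L # L # Ks)) * mixvol (M # M # Ks)"
   using Qs by (intro tendsto_intros lim)
  show "(%m. (?m k n m - ?m l n m)\<^sup>2) \<longlonglongrightarrow> (mixvol (K # M # Ks) - mixvol (L # M # Ks))\<^sup>2"
   using Qs by (intro tendsto_intros lim)
  have "(?m k k m - 2 * ?m k l m + ?m l l m) * ?m n n m <= (?m k n m - ?m l n m)\<^sup>2" for m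
   unfolding list.map using Q(2) Qs(1) assms(2) list_all2_lengthD[OF Qs(5)] by (intro polytope_alexandrov_fenchel) auto
  thus "\<exists>N. \<forall>m\<ge>N. (?m k k m - 2 * ?m k l m + ?m l l m) * ?m n n m <= (?m k n m - ?m l n m)\<^sup>2" by blast
 qed
qed

lemma mixvol_perm: "mset Ks = mset Ls ==> mixvol Ks = mixvol Ls"
 unfolding mixvol_def by (metis iterated_diff_perm mset_eq_length)

text \<open>A difference along \<open>K + L\<close> is one along \<open>K\<close> from the base
  moved by \<open>L\<close> plus one along \<open>L\<close>; independence of the base removes the
  displacement.\<close>

theorem mixvol_add:
 fixes Ks :: "'a::euclidean_space set list"
 assumes "\<forall>K\<in>set (K # L # Ks). convex_body K" "Suc (length Ks) = DIM('a)"
 shows "mixvol ((K + L) # Ks) = mixvol (K # Ks) + mixvol (L # Ks)"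
proof -
 have "iterated_diff ((K + L) # Ks) vol {0} = iterated_diff (K # Ks) vol ({0} + L) + iterated_diff (L # Ks) vol {0}"
  by (rule iterated_diff_add)
 also have "... = fact (DIM('a)) * mixvol (K # Ks) + fact (DIM('a)) * mixvol (L # Ks)"
  using assms by (subst (1 2) iterated_diff_base) auto
 finally show ?thesis using assms(2) by (simp add: mixvol_def[of "(K + L) # Ks"] add_divide_distrib del: iterated_diff.simps)
qed

lemma mixvol_zero: "mixvol ({0} # Ks) = 0"
 by (simp add: mixvol_def)

lemma iterated_diff_singleton:
 fixes Ks :: "'a::euclidean_space set list"
 shows "iterated_diff Ks vol {x} = iterated_diff Ks vol {0}"
proof -
 have "iterated_diff Ks vol (X + {x}) = iterated_diff Ks vol X" for X :: "'a set"
 proof (induction Ks arbitrary: X)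
  case Nil
  have "X + {x} = (+) x ` X" by (auto simp: set_plus_def add.commute)
  thus ?case by (simp add: measure_translation)
 next
  case (Cons L Ls)
  have "X + {x} + L = X + L + {x}" by (simp add: ac_simps)
  thus ?case using Cons[of "X + L"] Cons[of X] by simp
 qed
 from this[of "{0}"] show ?thesis by simp
qed

lemma mixvol_nonneg:
 fixes Ks :: "'a::euclidean_space set list"
 assumes "\<forall>K\<in>set Ks. convex_body K" "length Ks = DIM('a)" shows "0 <= mixvol Ks"
proof -
 obtain K Ls where Ks: "Ks = K # Ls" using assms(2) by (cases Ks) auto
 obtain x where x: "x \<in> K" using assms Ks by (auto simp: convex_body_def)
 have "mixvol ({x} # Ls) = 0" using iterated_diff_singleton[of Ls x] by (simp add: mixvol_def)
 moreover have "mixvol ({x} # Ls) <= mixvol (K # Ls)" using assms x unfolding Ks by (intro mixvol_mono) auto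
 ultimately show ?thesis by (simp add: Ks)
qed

text \<open>Dilates of a convex body add up like their factors, so the mixed volume is additive and
  nonnegative in \<open>t\<close>, hence linear.\<close>

theorem mixvol_dilate:
 fixes Ks :: "'a::euclidean_space set list"
 assumes "\<forall>K\<in>set (K # Ks). convex_body K" "Suc (length Ks) = DIM('a)" "0 <= t"
 shows "mixvol (t \<odot> K # Ks) = t * mixvol (K # Ks)"
proof -
 have "mixvol (t \<odot> K # Ks) = t * mixvol (1 \<odot> K # Ks)"
 proof (rule additive_nonneg_linear[where g = "%t. mixvol (t \<odot> K # Ks)"])
  fix s t :: real assume st: "0 <= s" "0 <= t"
  have "convex K" using assms by (simp add: convex_body_def)
  thus "mixvol ((s + t) \<odot> K # Ks) = mixvol (s \<odot> K # Ks) + mixvol (t \<odot> K # Ks)"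
   using assms st by (subst dilate_add[symmetric]) (auto intro!: mixvol_add body_dilate)
 next
  fix s :: real show "0 <= mixvol (s \<odot> K # Ks)" using assms by (intro mixvol_nonneg) (auto intro: body_dilate)
 qed fact
 thus ?thesis by simp
qed

lemma mixvol_self: "convex_body (K :: 'a::euclidean_space set) ==> mixvol (replicate (DIM('a)) K) = vol K"
 using iterated_diff_vol_self[of K] by (simp add: mixvol_def)

section \<open>Quermassintegrals and the general Brunn-Minkowski inequality\<close>

abbreviation bodies :: "'a::euclidean_space set list => bool" where
 "bodies Ks \<equiv> (\<forall>K\<in>set Ks. convex_body K)"

lemma binomial_split_sum:
 "(\<Sum>i\<le>m. real (m choose i) * a i) + (\<Sum>i\<le>m. real (m choose i) * a (Suc i)) = (\<Sum>i\<le>Suc m. real (Suc m choose i) * a i)"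
proof -
 have "(\<Sum>i\<le>Suc m. real (Suc m choose i) * a i) = a 0 + (\<Sum>i\<le>m. real (m choose i) * a (Suc i)) + (\<Sum>i\<le>m. real (m choose Suc i) * a (Suc i))"
  by (simp only: sum.atMost_Suc_shift) (simp add: distrib_right sum.distrib)
 moreover have "a 0 + (\<Sum>i\<le>m. real (m choose Suc i) * a (Suc i)) = (\<Sum>i\<le>Suc m. real (m choose i) * a i)"
  by (simp only: sum.atMost_Suc_shift) simp
 moreover have "(\<Sum>i\<le>Suc m. real (m choose i) * a i) = (\<Sum>i\<le>m. real (m choose i) * a i)" by simp
 ultimately show ?thesis by simp
qed

lemma mixvol_replicate_add:
 fixes K L :: "'a::euclidean_space set"
 assumes "bodies (K # L # Ls)" "m + length Ls = DIM('a)"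
 shows "mixvol (replicate m (K + L) @ Ls) = (\<Sum>i\<le>m. real (m choose i) * mixvol (replicate (m - i) K @ replicate i L @ Ls))"
 using assms
proof (induction m arbitrary: Ls)
 case (Suc m)
 define a where "a i = mixvol (replicate (Suc m - i) K @ replicate i L @ Ls)" for i
 have "mixvol (replicate (Suc m) (K + L) @ Ls) = mixvol (K # replicate m (K + L) @ Ls) + mixvol (L # replicate m (K + L) @ Ls)"
  unfolding replicate_Suc append_Cons by (rule mixvol_add) (use Suc.prems in \<open>auto intro: body_plus\<close>)
 also have "mixvol (K # replicate m (K + L) @ Ls) = mixvol (replicate m (K + L) @ K # Ls)" by (rule mixvol_perm) simp
 also have "... = (\<Sum>i\<le>m. real (m choose i) * mixvol (replicate (m - i) K @ replicate i L @ K # Ls))"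
  using Suc.prems by (intro Suc.IH) auto
 also have "... = (\<Sum>i\<le>m. real (m choose i) * a i)"
  unfolding a_def by (intro sum.cong refl arg_cong2[where f="(*)"] mixvol_perm) (simp add: Suc_diff_le)
 also have "mixvol (L # replicate m (K + L) @ Ls) = mixvol (replicate m (K + L) @ L # Ls)" by (rule mixvol_perm) simp
 also have "... = (\<Sum>i\<le>m. real (m choose i) * mixvol (replicate (m - i) K @ replicate i L @ L # Ls))"
  using Suc.prems by (intro Suc.IH) auto
 also have "... = (\<Sum>i\<le>m. real (m choose i) * a (Suc i))"
  unfolding a_def by (intro sum.cong refl arg_cong2[where f="(*)"] mixvol_perm) simp
 finally show ?case unfolding binomial_split_sum by (simp add: a_def)
qed simp

lemma mixvol_replicate_dilate:
 fixes K :: "'a::euclidean_space set"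
 assumes "bodies (K # Ls)" "m + length Ls = DIM('a)" "0 <= t"
 shows "mixvol (replicate m (t \<odot> K) @ Ls) = t ^ m * mixvol (replicate m K @ Ls)"
 using assms(1,2)
proof (induction m arbitrary: Ls)
 case (Suc m)
 have "mixvol (replicate (Suc m) (t \<odot> K) @ Ls) = t * mixvol (K # replicate m (t \<odot> K) @ Ls)"
  unfolding replicate_Suc append_Cons by (rule mixvol_dilate) (use Suc.prems assms(3) in \<open>auto intro: body_dilate\<close>)
 also have "mixvol (K # replicate m (t \<odot> K) @ Ls) = mixvol (replicate m (t \<odot> K) @ K # Ls)" by (rule mixvol_perm) simp
 also have "... = t ^ m * mixvol (replicate m K @ K # Ls)" using Suc.prems by (intro Suc.IH) auto
 also have "mixvol (replicate m K @ K # Ls) = mixvol (replicate (Suc m) K @ Ls)" by (rule mixvol_perm) simp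
 finally show ?case by simp
qed simp

definition qm :: "nat => 'a::euclidean_space set => 'a set => real" where
 "qm i K E = mixvol (replicate (DIM('a) - i) K @ replicate i E)"

lemma steiner_coefficients_qm:
 fixes K E :: "'a::euclidean_space set"
 assumes "convex_body K" "convex_body E"
 shows "steiner_coefficients K E (%i. if i <= DIM('a) then qm i K E else 0)"
 unfolding steiner_coefficients_def
proof (intro conjI allI impI)
 fix t :: real assume t: "0 <= t"
 let ?n = "DIM('a)"
 have "vol (K + t \<odot> E) = mixvol (replicate ?n (K + t \<odot> E) @ [])"
  using assms by (simp add: mixvol_self body_plus body_dilate)
 also have "... = (\<Sum>i\<le>?n. real (?n choose i) * mixvol (replicate (?n - i) K @ replicate i (t \<odot> E) @ []))"
  using assms by (intro mixvol_replicate_add) (auto intro: body_dilate)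
 also have "... = (\<Sum>i=0..?n. real (?n choose i) * (if i <= ?n then qm i K E else 0) * t ^ i)"
  unfolding atLeast0AtMost
 proof (rule sum.cong[OF refl])
  fix i assume i: "i \<in> {..?n}"
  have "mixvol (replicate (?n - i) K @ replicate i (t \<odot> E) @ []) = mixvol (replicate i (t \<odot> E) @ replicate (?n - i) K)" by (rule mixvol_perm) simp
  also have "... = t ^ i * mixvol (replicate i E @ replicate (?n - i) K)" using assms t i by (intro mixvol_replicate_dilate) auto
  also have "mixvol (replicate i E @ replicate (?n - i) K) = qm i K E" unfolding qm_def by (rule mixvol_perm) simp
  finally show "real (?n choose i) * mixvol (replicate (?n - i) K @ replicate i (t \<odot> E) @ []) = real (?n choose i) * (if i <= ?n then qm i K E else 0) * t ^ i"
   using i by simp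
 qed
 finally show "vol (K + t \<odot> E) = (\<Sum>i=0..?n. real (?n choose i) * (if i <= ?n then qm i K E else 0) * t ^ i)" .
qed simp

lemma quermassintegral_eq:
 fixes K E :: "'a::euclidean_space set"
 assumes "convex_body K" "convex_body E" "i <= DIM('a)"
 shows "quermassintegral i K E = qm i K E"
proof -
 have "(THE W. steiner_coefficients K E W) = (%i. if i <= DIM('a) then qm i K E else 0)"
  using steiner_coefficients_qm[OF assms(1,2)] steiner_coefficients_unique by (blast intro: the_equality)
 thus ?thesis using assms(3) by (simp add: quermassintegral_def)
qed

lemma mixvol_translate:
 fixes K :: "'a::euclidean_space set"
 assumes "bodies (K # Ks)" "Suc (length Ks) = DIM('a)"
 shows "mixvol ((+) x ` K # Ks) = mixvol (K # Ks)"
proof -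
 have eq: "(+) x ` K = {x} + K" by (auto simp: set_plus_def)
 have "iterated_diff Ks vol {x} = iterated_diff Ks vol {0}" by (rule iterated_diff_singleton)
 hence "mixvol ({x} # Ks) = 0" by (simp add: mixvol_def)
 thus ?thesis unfolding eq using assms by (simp add: mixvol_add)
qed

lemma mixvol_mono_list:
 fixes Ks Ls :: "'a::euclidean_space set list"
 assumes "list_all2 (\<subseteq>) Ks Ls" "bodies Ks" "bodies Ls" "bodies Rs" "length Ks + length Rs = DIM('a)"
 shows "mixvol (Ks @ Rs) <= mixvol (Ls @ Rs)"
 using assms
proof (induction arbitrary: Rs rule: list_all2_induct)
 case (Cons K Ks L Ls)
 have "mixvol ((K # Ks) @ Rs) <= mixvol ((L # Ks) @ Rs)"
  unfolding append_Cons by (rule mixvol_mono) (use Cons in auto)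
 also have "... = mixvol (Ks @ L # Rs)" by (rule mixvol_perm) simp
 also have "... <= mixvol (Ls @ L # Rs)" using Cons by (intro Cons.IH) auto
 also have "... = mixvol ((L # Ls) @ Rs)" by (rule mixvol_perm) simp
 finally show ?case .
qed simp

text \<open>Monotonicity and translation invariance replace each body by a ball it contains. The
  smallest of these balls, put into all slots, leaves its own positive volume as a lower
  bound.\<close>

lemma mixvol_pos:
 fixes Ks :: "'a::euclidean_space set list"
 assumes "bodies Ks" "\<forall>K\<in>set Ks. interior K ~= {}" "length Ks = DIM('a)" shows "0 < mixvol Ks"
proof -
 have "0 < mixvol (Ks @ Rs)" if "bodies Ks" "\<forall>K\<in>set Ks. interior K ~= {}" "length Ks + length Rs = DIM('a)" "\<forall>R\<in>set Rs. \<exists>r>0. R = cball 0 r" for Rs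
  using that
 proof (induction Ks arbitrary: Rs)
  case Nil
  obtain r where r: "r > 0" "\<forall>R\<in>set Rs. cball 0 r \<subseteq> R"
  proof -
   have "\<exists>r>0. \<forall>R\<in>set Rs. cball 0 r \<subseteq> R" using Nil(4)
   proof (induction Rs)
    case (Cons R Rs)
    then obtain r s where "r > 0" "\<forall>R\<in>set Rs. cball 0 r \<subseteq> R" "s > 0" "R = cball 0 s" by auto
    moreover have "cball (0::'a) (min r s) \<subseteq> cball 0 r" by auto
    ultimately show ?case by (intro exI[of _ "min r s"]) fastforce
   qed (auto intro: exI[of _ 1])
   thus ?thesis using that by blast
  qed
  have cb: "convex_body (cball 0 r :: 'a set)" using r(1) by (simp add: convex_body_def)
  have "0 < vol (cball 0 r :: 'a set)" by (rule vol_pos_of_open[OF lmeasurable_cball open_ball _ ball_subset_cball]) (use r in auto)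
  also have "... = mixvol (replicate (length Rs) (cball 0 r :: 'a set) @ [])" using cb Nil(3) by (simp add: mixvol_self)
  also have "... <= mixvol (Rs @ [])"
   using r Nil cb by (intro mixvol_mono_list) (auto simp: list_all2_conv_all_nth convex_body_def)
  finally show ?case by simp
 next
  case (Cons K Ks)
  obtain c r where c: "r > 0" "cball c r \<subseteq> K" using Cons.prems(2) by (metis ex_in_conv list.set_intros(1) mem_interior_cball)
  have cb: "convex_body (cball 0 r :: 'a set)" using c(1) by (simp add: convex_body_def)
  have cc: "cball c r = (+) c ` cball 0 r" by simp
  have "convex_body (cball 0 r :: 'a set)" if "r > 0" for r using that by (simp add: convex_body_def)
  hence "bodies Rs" using Cons.prems(4) by metis
  hence len: "Suc (length (Ks @ Rs)) = DIM('a)" and bR: "bodies (Ks @ Rs)" and bK: "convex_body K"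
   using Cons.prems(1,3) by auto
  have "0 < mixvol (Ks @ cball 0 r # Rs)" using Cons c(1) by (intro Cons.IH) auto
  also have "... = mixvol (cball 0 r # Ks @ Rs)" by (rule mixvol_perm) simp
  also have "... = mixvol ((+) c ` cball 0 r # Ks @ Rs)" using cb bR len by (intro mixvol_translate[symmetric]) auto
  also have "... <= mixvol (K # Ks @ Rs)" using c bR len bK unfolding cc[symmetric]
   by (intro mixvol_mono) (auto simp: convex_body_def)
  finally show ?case by simp
 qed
 from this[of "[]"] show ?thesis using assms by simp
qed

lemma mixvol_swap: "mixvol (K # L # Ks) = mixvol (L # K # Ks)"
 by (rule mixvol_perm) simp

lemma small_quadratic_zero:
 fixes a b c :: real
 assumes "!!s. 2 * s * a + s\<^sup>2 * b <= s\<^sup>2 * c" shows "a = 0"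
proof (rule ccontr)
 assume a: "a ~= 0"
 define m where "m = \<bar>c - b\<bar> + 1"
 have m: "m > 0" "c - b < m" by (auto simp: m_def)
 have "2 * (a / m) * a <= (a / m)\<^sup>2 * (c - b)" using assms[of "a / m"] by (simp add: right_diff_distrib)
 also have "... < (a / m)\<^sup>2 * m" using a m by (intro mult_strict_left_mono) auto
 also have "... = (a / m) * a" using m by (simp add: power2_eq_square)
 finally have "(a / m) * a < 0" by linarith
 moreover have "(a / m) * a = a\<^sup>2 / m" by (simp add: power2_eq_square)
 ultimately show False using m by (simp add: divide_less_0_iff)
qed

text \<open>The difference \<open>K - L\<close> of support functions plays the role of an isotropic vector orthogonal to \<open>M\<close>.\<close>

lemma alexandrov_fenchel_kernel:
 fixes Ks :: "'a::euclidean_space set list"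
 assumes b: "bodies (K # L # M # D # Ks)" and len: "length Ks + 2 = DIM('a)"
  and pos: "0 < mixvol (M # M # Ks)"
  and orth: "mixvol (K # M # Ks) = mixvol (L # M # Ks)"
  and iso: "mixvol (K # K # Ks) - 2 * mixvol (K # L # Ks) + mixvol (L # L # Ks) = 0"
 shows "mixvol (K # D # Ks) = mixvol (L # D # Ks)"
proof -
 let ?q = "%X Y. mixvol (X # Y # Ks)"
 have sq: "(?q X X - 2 * ?q X Y + ?q Y Y) * ?q M M <= (?q X M - ?q Y M)\<^sup>2" if "convex_body X" "convex_body Y" for X Y
  using alexandrov_fenchel[of X Y M Ks] b len that by auto
 have lin: "?q (X + s \<odot> D) Y = ?q X Y + s * ?q D Y" if "convex_body X" "convex_body Y" "0 <= s" for X Y s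
  using b len that by (simp add: mixvol_add mixvol_dilate body_dilate)
 have bd: "convex_body (X + s \<odot> D)" if "convex_body X" for X s using that b by (intro body_plus body_dilate) auto
 define a where "a = (?q K D - ?q L D) * ?q M M"
 have main: "2 * s * ((?q X D - ?q Y D) * ?q M M) + s\<^sup>2 * (?q D D * ?q M M) <= s\<^sup>2 * (?q D M)\<^sup>2"
  if s: "0 <= s" and X: "convex_body X" "convex_body Y" "?q X X - 2 * ?q X Y + ?q Y Y = 0" "?q X M = ?q Y M" for X Y s
 proof -
  let ?X = "X + s \<odot> D"
  have 1: "?q ?X ?X = ?q X X + 2 * s * ?q X D + s\<^sup>2 * ?q D D"
   using lin[OF X(1) bd[OF X(1)] s] lin[OF X(1) X(1) s] lin[OF X(1) _ s, of D] b mixvol_swap[of X ?X Ks] mixvol_swap[of D ?X Ks] mixvol_swap[of D X Ks]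
   by (simp add: algebra_simps power2_eq_square)
  have 2: "?q ?X Y = ?q X Y + s * ?q Y D" using lin[OF X(1,2) s] mixvol_swap[of D Y Ks] by simp
  have 3: "?q ?X M = ?q X M + s * ?q D M" using lin[OF X(1) _ s, of M] b by simp
  have "?q ?X ?X - 2 * ?q ?X Y + ?q Y Y = 2 * s * (?q X D - ?q Y D) + s\<^sup>2 * ?q D D"
   unfolding 1 2 using X(3) by (simp add: algebra_simps)
  hence "(2 * s * (?q X D - ?q Y D) + s\<^sup>2 * ?q D D) * ?q M M <= (s * ?q D M)\<^sup>2"
   using sq[OF bd[OF X(1), of s] X(2)] unfolding 3 X(4) by simp
  thus ?thesis by (simp add: algebra_simps power_mult_distrib)
 qed
 \<comment> \<open>Only nonnegative multiples of \<open>D\<close> can be added to a body, so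
   negative \<open>s\<close> is covered by exchanging the roles of \<open>K\<close> and
   \<open>L\<close>.\<close>
 have "2 * s * a + s\<^sup>2 * (?q D D * ?q M M) <= s\<^sup>2 * (?q D M)\<^sup>2" for s
 proof (cases "0 <= s")
  case True
  thus ?thesis using main[OF True, of K L] b iso orth by (simp add: a_def)
 next
  case False
  have "?q L L - 2 * ?q L K + ?q K K = 0" using iso mixvol_swap[of L K Ks] by simp
  thus ?thesis using main[of "- s" L K] b orth False by (simp add: a_def algebra_simps)
 qed
 hence "a = 0" by (rule small_quadratic_zero)
 thus ?thesis using pos by (simp add: a_def)
qed

text \<open>The Alexandrov-Fenchel inequality for the difference of \<open>K\<close> and
  \<open>{0}\<close>, all of whose terms with \<open>{0}\<close> vanish.\<close>

lemma log_concave_step: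
 fixes K L :: "'a::euclidean_space set"
 assumes b: "bodies (K # L # Ls)" and len: "m + length Ls = DIM('a)" and i: "Suc (Suc i) <= m"
 defines "V \<equiv> %i. mixvol (replicate (m - i) K @ replicate i L @ Ls)"
 shows "V i * V (Suc (Suc i)) <= (V (Suc i))\<^sup>2"
proof -
 obtain p where p: "m = p + i + 2" using i by (metis add.commute add_2_eq_Suc le_Suc_ex add.assoc)
 let ?C = "replicate p K @ replicate i L @ Ls"
 have e: "V i = mixvol (K # K # ?C)" "V (Suc i) = mixvol (K # L # ?C)" "V (Suc (Suc i)) = mixvol (L # L # ?C)"
  unfolding V_def p by (rule mixvol_perm; simp)+
 have b0: "bodies ({0} # K # L # ?C)" using b by auto
 have "(mixvol (K # K # ?C) - 2 * mixvol (K # {0} # ?C) + mixvol ({0} # {0} # ?C)) * mixvol (L # L # ?C) <= (mixvol (K # L # ?C) - mixvol ({0} # L # ?C))\<^sup>2"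
  by (rule alexandrov_fenchel) (use b0 len p in auto)
 moreover have "mixvol (K # {0} # ?C) = 0" using mixvol_swap[of K "{0}" ?C] mixvol_zero by simp
 ultimately show ?thesis unfolding e by (simp add: mixvol_zero)
qed

lemma log_concave_ratio_mono:
 fixes V :: "nat => real"
 assumes pos: "!!i. i <= m ==> 0 < V i" and lc: "!!i. Suc (Suc i) <= m ==> V i * V (Suc (Suc i)) <= (V (Suc i))\<^sup>2"
  and ij: "i <= j" "Suc j <= m"
 shows "V (Suc j) / V j <= V (Suc i) / V i"
 using ij
proof (induction j rule: dec_induct)
 case (step j)
 have "V (Suc (Suc j)) / V (Suc j) <= V (Suc j) / V j"
  using lc[of j] pos[of j] pos[of "Suc j"] step.prems by (simp add: divide_simps power2_eq_square mult.commute)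
 also have "... <= V (Suc i) / V i" using step by simp
 finally show ?case .
qed simp

text \<open>Ratios of successive terms decrease, so with \<open>r = V i / V (i - 1)\<close> both
  \<open>V 0 * r ^ i \<le> V i\<close> and \<open>V m \<le> V i * r ^ (m - i)\<close> hold.
  Eliminating \<open>r\<close> bounds \<open>V i ^ m\<close> from below; \<open>a\<close> and
  \<open>b\<close> stand for the m-th roots of the end terms.\<close>

lemma log_concave_chord:
 fixes V :: "nat => real"
 assumes pos: "!!i. i <= m ==> 0 < V i" and lc: "!!i. Suc (Suc i) <= m ==> V i * V (Suc (Suc i)) <= (V (Suc i))\<^sup>2"
  and ab: "0 < a" "0 < b" "a ^ m = V 0" "b ^ m = V m" and i: "i <= m"
 shows "a ^ (m - i) * b ^ i <= V i"
proof (cases "i = 0")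
 case False
 define r where "r = V i / V (i - 1)"
 have r: "r > 0" using pos[of i] pos[of "i - 1"] i by (simp add: r_def)
 have up: "V i \<ge> V j * r ^ (i - j)" if "j <= i" for j
  using that
 proof (induction j rule: inc_induct)
  case (step j)
  have "V j * r <= V (Suc j)"
   using log_concave_ratio_mono[where V = V and m = m, OF pos lc, of j "i - 1"] step i pos[of j] False by (simp add: r_def pos_le_divide_eq mult.commute)
  hence "V j * r * r ^ (i - Suc j) <= V (Suc j) * r ^ (i - Suc j)" using r by (intro mult_right_mono) auto
  also have "... <= V i" using step by simp
  finally show ?case using step by (simp add: mult.assoc flip: power_Suc) (simp add: Suc_diff_Suc)
 qed simp
 have dn: "V j <= V i * r ^ (j - i)" if "i <= j" "j <= m" for j
  using that
 proof (induction j rule: dec_induct)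
  case (step j)
  have "V (Suc j) / V j <= r"
   using log_concave_ratio_mono[where V = V and m = m, OF pos lc, of "i - 1" j] step False by (simp add: r_def)
  hence "V (Suc j) <= V j * r" using pos[of j] step by (simp add: pos_divide_le_eq mult.commute)
  also have "... <= V i * r ^ (j - i) * r" using step r by (intro mult_right_mono) auto
  finally show ?case using step by (simp add: Suc_diff_le ac_simps)
 qed simp
 have 1: "V 0 * r ^ i <= V i" using up[of 0] by simp
 have 2: "V m <= V i * r ^ (m - i)" using dn[of m] i by simp
 have "(a ^ (m - i) * b ^ i) ^ m = V 0 ^ (m - i) * V m ^ i"
  unfolding ab(3,4)[symmetric] by (simp add: power_mult_distrib mult.commute flip: power_mult)
 also have "... <= V 0 ^ (m - i) * (V i * r ^ (m - i)) ^ i"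
  using 2 pos[of m] pos[of 0] by (intro mult_left_mono power_mono) (auto simp: less_imp_le)
 also have "... = (V 0 * r ^ i) ^ (m - i) * V i ^ i" by (simp add: power_mult_distrib mult.commute flip: power_mult)
 also have "... <= V i ^ (m - i) * V i ^ i"
  using 1 r pos[of 0] pos[of i] i by (intro mult_right_mono power_mono) (auto simp: less_imp_le)
 also have "... = V i ^ m" using i by (simp flip: power_add)
 finally show ?thesis using power_le_imp_le_base[of "a ^ (m - i) * b ^ i" "m - 1" "V i"] pos[OF i] False i by (simp add: less_imp_le)
qed (use ab in simp)

context
 fixes K L :: "'a::euclidean_space set" and Ls m a b
 assumes bod: "bodies (K # L # Ls)" and int: "\<forall>X\<in>set (K # L # Ls). interior X ~= {}" and len: "m + length Ls = DIM('a)"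
  and ab: "0 < a" "0 < b" "a ^ m = mixvol (replicate m K @ Ls)" "b ^ m = mixvol (replicate m L @ Ls)"
begin

lemma mixed_chord:
 assumes "i <= m" shows "a ^ (m - i) * b ^ i <= mixvol (replicate (m - i) K @ replicate i L @ Ls)"
proof (rule log_concave_chord[where V = "%i. mixvol (replicate (m - i) K @ replicate i L @ Ls)"])
 show "0 < mixvol (replicate (m - i) K @ replicate i L @ Ls)" if "i <= m" for i
  using bod int len that by (intro mixvol_pos) auto
 show "mixvol (replicate (m - i) K @ replicate i L @ Ls) * mixvol (replicate (m - Suc (Suc i)) K @ replicate (Suc (Suc i)) L @ Ls)
  <= (mixvol (replicate (m - Suc i) K @ replicate (Suc i) L @ Ls))\<^sup>2" if "Suc (Suc i) <= m" for i
  using log_concave_step[OF bod len that] .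
qed (use ab assms in auto)

lemma binomial_two: "(a + b) ^ m = (\<Sum>i\<le>m. real (m choose i) * (a ^ (m - i) * b ^ i))"
 using binomial_ring[of b a m] by (simp add: add.commute mult.commute mult.left_commute)

theorem general_brunn_minkowski: "(a + b) ^ m <= mixvol (replicate m (K + L) @ Ls)"
 unfolding mixvol_replicate_add[OF bod len] binomial_two
 by (intro sum_mono mult_left_mono mixed_chord) auto

text \<open>Brunn-Minkowski compares two binomial expansions term by term, so equality of the sums
  forces equality in every term.\<close>

lemma general_brunn_minkowski_equality:
 assumes eq: "mixvol (replicate m (K + L) @ Ls) = (a + b) ^ m" and i: "i <= m"
 shows "mixvol (replicate (m - i) K @ replicate i L @ Ls) = a ^ (m - i) * b ^ i"
proof -
 let ?d = "%i. real (m choose i) * mixvol (replicate (m - i) K @ replicate i L @ Ls) - real (m choose i) * (a ^ (m - i) * b ^ i)"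
 have "(\<Sum>i\<le>m. ?d i) = 0" using eq unfolding mixvol_replicate_add[OF bod len] binomial_two by (simp add: sum_subtractf)
 moreover have "0 <= ?d i" if "i <= m" for i using mixed_chord[OF that] by (simp add: mult_left_mono)
 ultimately have "?d i = 0" using i by (subst (asm) sum_nonneg_eq_0_iff) auto
 thus ?thesis using i by simp
qed

end

section \<open>Smooth bodies\<close>

lemma closed_limit_nonneg:
 fixes a b :: real
 assumes H: "!!e. 0 < e ==> 0 <= a + e * b" shows "0 <= a"
proof (rule ccontr)
 assume a: "\<not> 0 <= a"
 define e where "e = - a / (2 * (\<bar>b\<bar> + 1))"
 have e: "e > 0" using a by (simp add: e_def divide_neg_pos)
 have "e * b <= e * (\<bar>b\<bar> + 1)" using e by (intro mult_left_mono) auto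
 also have "... = - a / 2" by (simp add: e_def field_simps)
 finally show False using H[OF e] a by simp
qed

lemma cball_dilate: "0 <= e ==> cball 0 e = e \<odot> (cball 0 1 :: 'a::euclidean_space set)"
proof (cases "e = 0")
 case False
 assume "0 <= e"
 with False have e: "e > 0" by simp
 show ?thesis
 proof (intro set_eqI iffI)
  fix x :: 'a assume "x \<in> cball 0 e"
  hence "(1 / e) *R x \<in> cball 0 1" using e by simp
  hence "e *R ((1 / e) *R x) \<in> e \<odot> cball 0 1" by blast
  thus "x \<in> e \<odot> cball 0 1" using e by simp
 qed (use e in \<open>auto simp: mult_left_le\<close>)
next
 case True
 have "(0::'a) \<in> cball 0 1" by simp
 hence "(%x. 0 *R x) ` cball 0 1 = {0::'a}" by fastforce
 thus ?thesis using True by simp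
qed

lemma body_cball [simp]: "0 <= r ==> convex_body (cball (c::'a::euclidean_space) r)"
 by (simp add: convex_body_def)

lemma support_hyperplane_frontier:
 fixes E :: "'a::euclidean_space set"
 assumes "compact E" "y \<in> E" "u ~= 0" "y \<bullet> u = support_function E u" shows "y \<in> frontier E"
proof -
 have "y \<notin> interior E"
 proof
  assume "y \<in> interior E"
  then obtain r where r: "r > 0" "cball y r \<subseteq> E" by (meson mem_interior_cball)
  have "y + (r / norm u) *R u \<in> E" using r assms(3) by (intro subsetD[OF r(2)]) (simp add: dist_norm)
  hence "(y + (r / norm u) *R u) \<bullet> u <= y \<bullet> u" using support_upper[OF assms(1)] assms(4) by simp
  moreover have "(r / norm u) * (u \<bullet> u) > 0" using r assms(3) by simp
  ultimately show False unfolding inner_add_left inner_scaleR_left by linarith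
 qed
 thus ?thesis using assms(1,2) by (simp add: frontier_def compact_imp_closed)
qed

lemma support_le: "convex_body K ==> (!!x. x \<in> K ==> x \<bullet> u <= c) ==> support_function K u <= c"
 using support_max[of K u] by (metis bodyD(1,3))

lemma support_attained: "convex_body K ==> \<exists>x\<in>K. x \<bullet> u = support_function K u"
 using support_max[of K u] by (metis convex_body_def)

lemma separating_support:
 fixes K :: "'a::euclidean_space set"
 assumes K: "convex_body K" and z: "z \<notin> K"
 shows "\<exists>w. norm w = 1 & support_function K w < z \<bullet> w"
proof -
 obtain a b where ab: "a \<bullet> z < b" "\<forall>x\<in>K. b < a \<bullet> x"
  using separating_hyperplane_closed_point[of K z] K z by (auto simp: convex_body_def compact_imp_closed)
 obtain x where x: "x \<in> K" "x \<bullet> (- (1 / norm a) *R a) = support_function K (- (1 / norm a) *R a)"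
  using support_attained[OF K] by blast
 have "a ~= 0" using ab x by auto
 have "a \<bullet> z < a \<bullet> x" using ab x by force
 hence "(1 / norm a) * (z \<bullet> a) < (1 / norm a) * (x \<bullet> a)" using \<open>a ~= 0\<close> by (intro mult_strict_left_mono) (auto simp: inner_commute)
 thus ?thesis using x(2) \<open>a ~= 0\<close> by (intro exI[of _ "- (1 / norm a) *R a"]) simp
qed

lemma support_scale:
 assumes "convex_body K" "0 <= c" shows "support_function K (c *R u) = c * support_function K u"
proof (rule antisym)
 show "support_function K (c *R u) <= c * support_function K u"
  using assms support_upper[of K] by (intro support_le) (auto simp: convex_body_def intro: mult_left_mono)
 obtain x where "x \<in> K" "x \<bullet> u = support_function K u" using support_attained[OF assms(1)] by blast
 thus "c * support_function K u <= support_function K (c *R u)"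
  using support_upper[of K x "c *R u"] assms by (simp add: convex_body_def)
qed

lemma support_add_le:
 assumes "convex_body K" shows "support_function K (u + v) <= support_function K u + support_function K v"
 using assms support_upper[of K] by (intro support_le) (auto simp: convex_body_def inner_add_right intro: add_mono)

lemma support_continuous:
 assumes K: "convex_body K" shows "continuous_on S (support_function K)"
proof -
 have "convex_on UNIV (support_function K)"
 proof (rule convex_onI)
  fix t :: real and x y assume t: "0 < t" "t < 1"
  show "support_function K ((1 - t) *R x + t *R y) <= (1 - t) * support_function K x + t * support_function K y"
   using support_add_le[OF K, of "(1 - t) *R x" "t *R y"] t by (simp add: support_scale[OF K])
 qed simp
 thus ?thesis using convex_on_continuous[OF open_UNIV] continuous_on_subset by blast
qed

lemma support_gt_interior:
 assumes K: "convex_body K" and x: "x \<in> interior K" and w: "w ~= 0" shows "x \<bullet> w < support_function K w"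
proof -
 have "x \<in> K" using x interior_subset by blast
 hence "x \<bullet> w <= support_function K w" using K by (intro support_upper) (auto simp: convex_body_def)
 moreover have "x \<bullet> w ~= support_function K w"
  using support_hyperplane_frontier[of K x w] K x w interior_subset by (auto simp: frontier_def convex_body_def)
 ultimately show ?thesis by simp
qed

lemma vol_dilate: "convex_body (A :: 'a::euclidean_space set) ==> 0 <= t ==> vol (t \<odot> A) = t ^ DIM('a) * vol A"
 using mixvol_replicate_dilate[of A "[]" "DIM('a)" t] mixvol_self[of A] mixvol_self[of "t \<odot> A"] by (simp add: body_dilate)

lemma interior_of_vol_pos: "convex_body A ==> 0 < vol A ==> interior A ~= {}"
 using negligible_convex_interior[of A] negligible_imp_measure0[of A] by (auto simp: convex_body_def)

lemma vol_pos_of_interior: "convex_body A ==> interior A ~= {} ==> 0 < vol A"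
 by (meson body_lmeasurable interior_subset open_interior vol_pos_of_open)

lemma body_eqI:
 fixes A B :: "'a::euclidean_space set"
 assumes A: "convex_body A" and B: "convex_body B" and h: "!!w. support_function A w = support_function B w" shows "A = B"
proof -
 have "X \<subseteq> Y" if X: "convex_body X" and Y: "convex_body Y" and h: "!!w. support_function X w = support_function Y w" for X Y :: "'a set"
 proof
  fix x assume x: "x \<in> X"
  show "x \<in> Y"
  proof (rule ccontr)
   assume "x \<notin> Y"
   then obtain w where "support_function Y w < x \<bullet> w" using separating_support[OF Y] by blast
   thus False using support_upper[OF bodyD(1)[OF X] x, of w] h[of w] by simp
  qed
 qed
 thus ?thesis using A B h by (metis subset_antisym)
qed

lemma affine_image: "(%y. a *R y + x) ` K = (+) x ` (a \<odot> K)"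
 by (simp add: image_image add.commute)

lemma translate_eq_plus: "(+) x ` K = {x} + K"
 by (auto simp: set_plus_def)

lemma body_affine: "convex_body K ==> convex_body ((+) x ` (a \<odot> K))"
 unfolding translate_eq_plus by (intro body_plus body_dilate) auto

lemma support_affine:
 assumes K: "convex_body K" and a: "0 <= a" shows "support_function ((+) x ` (a \<odot> K)) w = x \<bullet> w + a * support_function K w"
proof (rule antisym)
 have c: "compact K" using K by (simp add: convex_body_def)
 show "support_function ((+) x ` (a \<odot> K)) w <= x \<bullet> w + a * support_function K w"
  using support_upper[OF c] a by (intro support_le body_affine K) (auto simp: inner_add_left mult_left_mono)
 obtain k where k: "k \<in> K" "k \<bullet> w = support_function K w" using support_attained[OF K] by blast
 hence "x + a *R k \<in> (+) x ` (a \<odot> K)" by blast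
 from support_upper[OF bodyD(1)[OF body_affine[OF K]] this, of w] k
 show "x \<bullet> w + a * support_function K w <= support_function ((+) x ` (a \<odot> K)) w" by (simp add: inner_add_left)
qed

text \<open>Coinciding supporting hyperplanes only make the normals proportional; an interior point
  of \<open>E\<close>, strictly on the inner side of both, makes the factor positive.\<close>

lemma smooth_unique_normal:
 fixes E :: "'a::euclidean_space set"
 assumes E: "smooth_body E" "convex_body E" "interior E ~= {}" and y: "y \<in> E"
  and u: "norm u = 1" "y \<bullet> u = support_function E u" and v: "v ~= 0" "y \<bullet> v = support_function E v"
 shows "\<exists>c>0. v = c *R u"
proof -
 have cE: "compact E" using E by (simp add: convex_body_def)
 have u0: "u ~= 0" using u by auto
 let ?H = "%u. {x. x \<bullet> u = support_function E u}"
 have "y \<in> frontier E" using support_hyperplane_frontier[OF cE y v] .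
 moreover have "supporting_hyperplane E (?H u) & y \<in> ?H u" "supporting_hyperplane E (?H v) & y \<in> ?H v"
  using u u0 v by (auto simp: supporting_hyperplane_def)
 ultimately have H: "?H u = ?H v" using E(1) unfolding smooth_body_def by blast
 define d where "d = v - (v \<bullet> u) *R u"
 have uu: "u \<bullet> u = 1" using u(1) by (simp add: norm_eq_1)
 have du: "d \<bullet> u = 0" by (simp add: d_def inner_diff_left uu)
 hence "y + d \<in> ?H u" using u by (simp add: inner_add_left)
 hence "y + d \<in> ?H v" using H by blast
 hence "d \<bullet> v = 0" using v by (simp add: inner_add_left)
 hence "d \<bullet> d = 0" using du by (subst (2) d_def) (simp add: inner_diff_right)
 hence veq: "v = (v \<bullet> u) *R u" by (simp add: d_def)
 obtain p r where p: "r > 0" "cball p r \<subseteq> E" using E(3) by (metis ex_in_conv mem_interior_cball)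
 have strict: "p \<bullet> w < support_function E w" if "w ~= 0" for w
 proof -
  have "p + (r / norm w) *R w \<in> E" using p that by (intro subsetD[OF p(2)]) (simp add: dist_norm)
  hence "(p + (r / norm w) *R w) \<bullet> w <= support_function E w" by (rule support_upper[OF cE])
  moreover have "(r / norm w) * (w \<bullet> w) > 0" using p that by simp
  ultimately show ?thesis unfolding inner_add_left inner_scaleR_left by linarith
 qed
 have "(p - y) \<bullet> u < 0" "(p - y) \<bullet> v < 0" using strict[OF u0] strict[OF v(1)] u v by (simp_all add: inner_diff_left)
 moreover have "(p - y) \<bullet> v = (v \<bullet> u) * ((p - y) \<bullet> u)" by (subst veq) simp
 ultimately have "v \<bullet> u > 0" by (metis mult_less_0_iff not_less_iff_gr_or_eq)
 thus ?thesis using veq by blast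
qed

definition erosion :: "'a::euclidean_space set => real => 'a set => 'a set" where
 "erosion E t D = {x. \<forall>d\<in>D. x + t *R d \<in> E}"

lemma erosion_compact_convex:
 assumes "convex_body E" "D ~= {}" shows "compact (erosion E t D)" "convex (erosion E t D)"
proof -
 have eq: "erosion E t D = (\<Inter>d\<in>D. (%x. x - t *R d) ` E)"
  unfolding erosion_def by (auto simp: image_iff) (metis add_diff_cancel diff_add_cancel)+
 obtain d where "d \<in> D" using assms by blast
 hence "erosion E t D = (%x. x - t *R d) ` E \<inter> (\<Inter>d\<in>D. (%x. x - t *R d) ` E)" unfolding eq by blast
 moreover have "compact ((%x. x - t *R d) ` E)" for d using assms by (intro compact_continuous_image continuous_intros) (simp add: convex_body_def)
 ultimately show "compact (erosion E t D)" by (metis compact_Int_closed closed_INT compact_imp_closed)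
 show "convex (erosion E t D)" unfolding eq using assms by (intro convex_INT convex_translation_subtract) (simp add: convex_body_def)
qed

lemma erosion_plus: "erosion E t D + t \<odot> D \<subseteq> E"
 by (auto simp: erosion_def set_plus_def)

text \<open>Up to an error of order \<open>t * e\<close>, every body \<open>D\<close> is a summand of a smooth body at the scale \<open>t\<close>.\<close>

lemma smooth_erosion:
 fixes E D :: "'a::euclidean_space set"
 assumes E: "smooth_body E" "convex_body E" "interior E ~= {}" and D: "convex_body D" and eta: "e > 0"
 shows "\<exists>t>0. convex_body (erosion E t D) & E \<subseteq> erosion E t D + t \<odot> D + cball 0 (t * e)"
proof -
 let ?h = "support_function E"
 obtain B where B: "B > 0" "!!d. d \<in> D ==> norm d <= B"
  using compact_imp_bounded[OF bodyD(1)[OF D]] bounded_pos by metis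
 define C where "C = 2 * B + e"
 have C: "0 < C" using B eta by (simp add: C_def)
 \<comment> \<open>Support points \<open>y\<close> in direction \<open>u\<close>, paired with
   directions \<open>w\<close> at a definite distance from \<open>u\<close>. By smoothness
   \<open>y\<close> misses the supporting hyperplane of every such \<open>w\<close>, and compactness
   turns this into a uniform gap \<open>m\<close>. \<open>C\<close> bounds the vectors
   \<open>d' - d - e u\<close> that occur below.\<close>
 define X where "X = (E \<times> sphere 0 1 \<times> sphere 0 1) \<inter> {q. fst q \<bullet> fst (snd q) = ?h (fst (snd q)) & e / C <= norm (snd (snd q) - fst (snd q))}"
 have cont: "continuous_on UNIV (%q :: 'a \<times> 'a \<times> 'a. ?h (fst (snd q)))" "continuous_on UNIV (%q :: 'a \<times> 'a \<times> 'a. ?h (snd (snd q)))"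
  by (intro continuous_on_compose2[OF support_continuous[OF E(2), of UNIV]] continuous_intros; simp)+
 have cX: "compact X" unfolding X_def
  by (intro compact_Int_closed compact_Times bodyD(1)[OF E(2)] compact_sphere closed_Collect_conj closed_Collect_eq closed_Collect_le continuous_intros cont)
 have gap: "0 < ?h w - y \<bullet> w" if "(y, u, w) \<in> X" for y u w
 proof -
  have q: "y \<in> E" "norm u = 1" "norm w = 1" "y \<bullet> u = ?h u" "e / C <= norm (w - u)" using that by (auto simp: X_def)
  have "y \<bullet> w ~= ?h w"
  proof
   assume "y \<bullet> w = ?h w"
   then obtain c where "c > 0" "w = c *R u" using smooth_unique_normal[OF E q(1,2,4), of w] q(3) by fastforce
   hence "w = u" using q(2,3) by simp
   thus False using q(5) eta C by (simp add: divide_le_0_iff)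
  qed
  thus ?thesis using support_upper[OF bodyD(1)[OF E(2)] q(1), of w] by simp
 qed
 have "\<exists>m>0. \<forall>q\<in>X. m <= ?h (snd (snd q)) - fst q \<bullet> snd (snd q)"
 proof (cases "X = {}")
  case False
  have "continuous_on X (%q. ?h (snd (snd q)) - fst q \<bullet> snd (snd q))"
   by (intro continuous_intros continuous_on_subset[OF cont(2)]) auto
  then obtain q where q: "q \<in> X" "\<forall>q'\<in>X. ?h (snd (snd q)) - fst q \<bullet> snd (snd q) <= ?h (snd (snd q')) - fst q' \<bullet> snd (snd q')"
   using continuous_attains_inf[OF cX False] by blast
  thus ?thesis using gap[of "fst q" "fst (snd q)" "snd (snd q)"]
   by (intro exI[of _ "?h (snd (snd q)) - fst q \<bullet> snd (snd q)"]) simp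
 qed (auto intro: exI[of _ 1])
 then obtain m where m: "m > 0" "!!y u w. (y, u, w) \<in> X ==> m <= ?h w - y \<bullet> w" by fastforce
 define t where "t = m / (C + 1)"
 have t: "0 < t" "t * C < m" using m(1) C by (auto simp: t_def pos_divide_less_eq)
 have key: "\<exists>x d. x \<in> erosion E t D & d \<in> D & (x + t *R d + (t * e) *R u) \<bullet> u = ?h u" if u: "norm u = 1" for u
 proof -
  obtain y where y: "y \<in> E" "y \<bullet> u = ?h u" using support_attained[OF E(2)] by blast
  obtain d where d: "d \<in> D" "d \<bullet> u = support_function D u" using support_attained[OF D] by blast
  \<comment> \<open>The support point is pulled back by \<open>t d\<close> and a little further
    along \<open>u\<close>. Against normals close to \<open>u\<close> this extra term keeps
    \<open>x + t D\<close> in \<open>E\<close>; against all others the gap \<open>m\<close> exceeds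
    the displacement.\<close>
  define x where "x = y - t *R d - (t * e) *R u"
  have "x + t *R d' \<in> E" if d': "d' \<in> D" for d'
  proof (rule ccontr)
   assume "x + t *R d' \<notin> E"
   then obtain w where w: "norm w = 1" "?h w < (x + t *R d') \<bullet> w" using separating_support[OF E(2)] by blast
   define v where "v = d' - d - e *R u"
   have xv: "x + t *R d' = y + t *R v" by (simp add: x_def v_def algebra_simps)
   have "norm v <= norm (d' - d) + norm (e *R u)" unfolding v_def by (rule norm_triangle_ineq4)
   hence v: "norm v <= C" using norm_triangle_ineq4[of d' d] B(2)[OF d'] B(2)[OF d(1)] u eta by (simp add: C_def)
   have vw: "?h w - y \<bullet> w < t * (v \<bullet> w)" using w(2) unfolding xv by (simp add: inner_add_left)
   moreover have "t * (v \<bullet> w) <= t * C" using norm_cauchy_schwarz[of v w] w(1) v t by (intro mult_left_mono) auto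
   ultimately have "\<not> m <= ?h w - y \<bullet> w" using t by linarith
   hence "(y, u, w) \<notin> X" using m(2) by blast
   hence "norm (w - u) < e / C" using y u w(1) by (auto simp: X_def)
   hence "C * norm (w - u) < e" using C by (simp add: pos_less_divide_eq mult.commute)
   moreover have "v \<bullet> (w - u) <= C * norm (w - u)" using norm_cauchy_schwarz[of v "w - u"] mult_right_mono[OF v norm_ge_zero[of "w - u"]] by linarith
   moreover have "v \<bullet> u <= - e" using support_upper[OF bodyD(1)[OF D] d', of u] d(2) u by (simp add: v_def inner_diff_left norm_eq_1)
   ultimately have "v \<bullet> w < 0" by (simp add: inner_diff_right)
   hence "t * (v \<bullet> w) < 0" using t by (simp add: mult_pos_neg)
   thus False using vw support_upper[OF bodyD(1)[OF E(2)] y(1), of w] by linarith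
  qed
  hence "x \<in> erosion E t D" by (simp add: erosion_def)
  moreover have "x + t *R d + (t * e) *R u = y" by (simp add: x_def)
  ultimately show ?thesis using d(1) y(2) by auto
 qed
 obtain b :: 'a where "norm b = 1" using SOME_Basis norm_Basis by blast
 hence "erosion E t D ~= {}" using key by blast
 hence cb: "convex_body (erosion E t D)" using erosion_compact_convex[OF E(2) bodyD(3)[OF D]] by (simp add: convex_body_def)
 let ?S = "erosion E t D + t \<odot> D + cball 0 (t * e)"
 have cS: "convex_body ?S" using cb D t eta by (intro body_plus body_dilate) auto
 have "z \<in> ?S" if z: "z \<in> E" for z
 proof (rule ccontr)
  assume "z \<notin> ?S"
  then obtain u where u: "norm u = 1" "support_function ?S u < z \<bullet> u" using separating_support[OF cS] by blast
  obtain x d where xd: "x \<in> erosion E t D" "d \<in> D" "(x + t *R d + (t * e) *R u) \<bullet> u = ?h u" using key[OF u(1)] by blast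
  have "x + t *R d + (t * e) *R u \<in> ?S" using xd u t eta by (intro set_plus_intro) auto
  from support_upper[OF bodyD(1)[OF cS] this, of u] show False
   using xd(3) u(2) support_upper[OF bodyD(1)[OF E(2)] z, of u] by linarith
 qed
 thus ?thesis using t(1) cb by blast
qed

text \<open>By \<open>smooth_erosion\<close>, \<open>E\<close> exceeds the sum of a body and
  \<open>t D\<close> by an error of order \<open>t * d\<close> only. Hence \<open>t * f D\<close> is
  at most \<open>f E = 0\<close> plus \<open>c * t * d\<close>; dividing by \<open>t\<close> and
  letting \<open>d\<close> tend to 0 leaves nothing.\<close>

lemma smooth_functional_zero:
 fixes E D :: "'a::euclidean_space set" and f :: "'a set => real"
 assumes E: "smooth_body E" "convex_body E" "interior E ~= {}" and D: "convex_body D"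
  and add: "!!X Y. convex_body X ==> convex_body Y ==> f (X + Y) = f X + f Y"
  and dil: "!!t X. convex_body X ==> 0 <= t ==> f (t \<odot> X) = t * f X"
  and nonneg: "!!X. convex_body X ==> 0 <= f X"
  and bound: "!!X Y e. convex_body X ==> convex_body Y ==> 0 <= e ==> X \<subseteq> Y ==> Y \<subseteq> X + cball 0 e ==> f X - c * e <= f Y"
  and zero: "f E = 0"
 shows "f D = 0"
proof -
 have "f D <= c * d" if eta: "d > 0" for d
 proof -
  obtain t where t: "t > 0" "convex_body (erosion E t D)" "E \<subseteq> erosion E t D + t \<odot> D + cball 0 (t * d)"
   using smooth_erosion[OF E D eta] by blast
  have "f (erosion E t D + t \<odot> D) - c * (t * d) <= f E"
   by (rule bound[OF body_plus[OF t(2) body_dilate[OF D]] E(2) _ erosion_plus t(3)]) (use t eta in simp)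
  moreover have "f (erosion E t D + t \<odot> D) = f (erosion E t D) + t * f D"
   using t D by (simp add: add dil body_dilate)
  ultimately have "t * f D <= t * (c * d)" using zero nonneg[OF t(2)] by (simp add: mult.left_commute)
  thus ?thesis using t(1) by simp
 qed
 hence "0 <= - f D + e * c" if "e > 0" for e using that by (simp add: mult.commute[of e])
 hence "0 <= - f D" by (rule closed_limit_nonneg)
 thus ?thesis using nonneg[OF D] by simp
qed

lemma mixvol_third_difference:
 fixes Cs :: "'a::euclidean_space set list"
 assumes "bodies (A # B # X # Y # Cs)" "length Cs + 3 = DIM('a)" "0 <= e" "X \<subseteq> Y" "Y \<subseteq> X + cball 0 e"
 shows "mixvol (A # B # X # Cs) <= mixvol (A # B # Y # Cs)" "mixvol (A # B # Y # Cs) <= mixvol (A # B # X # Cs) + e * mixvol (A # B # cball 0 1 # Cs)"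
proof -
 have p: "mixvol (A # B # X # Cs) = mixvol (X # A # B # Cs)" for X by (rule mixvol_perm) simp
 show "mixvol (A # B # X # Cs) <= mixvol (A # B # Y # Cs)"
  unfolding p[of X] p[of Y] using assms by (intro mixvol_mono) auto
 have "mixvol (Y # A # B # Cs) <= mixvol ((X + e \<odot> cball 0 1) # A # B # Cs)"
  using assms by (intro mixvol_mono) (auto simp: cball_dilate[symmetric] intro!: body_plus)
 also have "... = mixvol (X # A # B # Cs) + e * mixvol (cball 0 1 # A # B # Cs)"
  using assms by (simp add: mixvol_add mixvol_dilate body_dilate)
 finally show "mixvol (A # B # Y # Cs) <= mixvol (A # B # X # Cs) + e * mixvol (A # B # cball 0 1 # Cs)"
  unfolding p .
qed

text \<open>As a function of one slot \<open>X\<close>, minus the square of the difference of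
  \<open>K\<close> and \<open>L\<close> is additive. It is nonnegative by Alexandrov-Fenchel, since
  the difference is orthogonal to \<open>E\<close>, and it vanishes for \<open>X = E\<close>. So it
  vanishes for \<open>D\<close>, and an isotropic vector orthogonal to \<open>E\<close> lies in the
  kernel of the form with \<open>D\<close> in the slot.\<close>

lemma smooth_kernel_replace:
 fixes E :: "'a::euclidean_space set"
 assumes E: "smooth_body E" "convex_body E" "interior E ~= {}"
  and b: "bodies (K # L # Cs)" "\<forall>C\<in>set Cs. interior C ~= {}" and len: "length Cs + 3 = DIM('a)"
  and ker: "!!F. convex_body F ==> mixvol (K # F # E # Cs) = mixvol (L # F # E # Cs)"
  and D: "convex_body D" "interior D ~= {}" and F: "convex_body F"
 shows "mixvol (K # F # D # Cs) = mixvol (L # F # D # Cs)"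
proof -
 define f where "f X = - (mixvol (K # K # X # Cs) - 2 * mixvol (K # L # X # Cs) + mixvol (L # L # X # Cs))" for X
 define q where "q A B X = mixvol (X # A # B # Cs)" for A B X
 have p: "mixvol (A # B # X # Cs) = q A B X" for A B X unfolding q_def by (rule mixvol_perm) simp
 have pa: "q A B (X + Y) = q A B X + q A B Y" "0 <= t ==> q A B (t \<odot> X) = t * q A B X"
  if "convex_body A" "convex_body B" "convex_body X" "convex_body Y" for A B X Y t
  unfolding q_def using b len that by (simp_all add: mixvol_add mixvol_dilate)
 have add: "f (X + Y) = f X + f Y" if "convex_body X" "convex_body Y" for X Y
  unfolding f_def p using b that by (simp add: pa)
 have dil: "f (t \<odot> X) = t * f X" if "convex_body X" "0 <= t" for t X
  unfolding f_def p using b that pa(2)[of _ _ X X] by (simp add: algebra_simps)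
 have orth: "mixvol (K # E # X # Cs) = mixvol (L # E # X # Cs)" if "convex_body X" for X
 proof -
  have "mixvol (Z # E # X # Cs) = mixvol (Z # X # E # Cs)" for Z by (rule mixvol_perm) simp
  thus ?thesis using ker[OF that] by simp
 qed
 have pos: "0 < mixvol (E # E # X # Cs)" if "convex_body X" "interior X ~= {}" for X
  using E b len that by (intro mixvol_pos) auto
 have nn1: "0 <= f X" if X: "convex_body X" "interior X ~= {}" for X
 proof -
  have "(mixvol (K # K # X # Cs) - 2 * mixvol (K # L # X # Cs) + mixvol (L # L # X # Cs)) * mixvol (E # E # X # Cs)
   <= (mixvol (K # E # X # Cs) - mixvol (L # E # X # Cs))\<^sup>2"
   using b E X len by (intro alexandrov_fenchel) auto
  thus ?thesis using orth[OF X(1)] pos[OF X] by (simp add: f_def mult_le_0_iff)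
 qed
 \<comment> \<open>Bodies without interior are reached by adding a small ball and letting it
   shrink.\<close>
 have nonneg: "0 <= f X" if X: "convex_body X" for X
 proof -
  let ?B = "cball 0 1 :: 'a set"
  have "0 <= f X + e * f ?B" if e: "e > 0" for e
  proof -
   have "interior (e \<odot> ?B + X) ~= {}" using e X by (intro interior_plus_nonempty) (auto simp: cball_dilate[symmetric] convex_body_def)
   hence "0 <= f (X + e \<odot> ?B)" using X by (intro nn1 body_plus body_dilate) (auto simp: add.commute)
   thus ?thesis using X e by (simp add: add dil body_dilate)
  qed
  thus ?thesis
   using closed_limit_nonneg[of "f X" "f ?B"] by blast
 qed
 have bound: "f X - (mixvol (K # K # cball 0 1 # Cs) + mixvol (L # L # cball 0 1 # Cs)) * e <= f Y"
  if "convex_body X" "convex_body Y" "0 <= e" "X \<subseteq> Y" "Y \<subseteq> X + cball 0 e" for X Y e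
  using mixvol_third_difference[of K K X Y Cs e] mixvol_third_difference[of L L X Y Cs e] mixvol_third_difference[of K L X Y Cs e] b len that
  by (simp add: f_def algebra_simps)
 have "f E = 0" using ker[of K] ker[of L] b mixvol_swap[of L K "E # Cs"] by (simp add: f_def)
 hence "f D = 0" using smooth_functional_zero[OF E D(1) add dil nonneg bound] by blast
 thus ?thesis
  using alexandrov_fenchel_kernel[of K L E F "D # Cs"] b E D F len pos[OF D] orth[OF D(1)] by (simp add: f_def)
qed

section \<open>Equality in the general Brunn-Minkowski inequality\<close>

text \<open>When all mixed volumes of \<open>K\<close> and \<open>L\<close> with \<open>E\<close> agree, \<open>K - L\<close> lies in the kernel of the Alexandrov-Fenchel form. Each
  application of the kernel lemma frees one more argument, until all of them are arbitrary.\<close>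

lemma mixvol_kernel_propagate:
 fixes K L :: "'a::euclidean_space set"
 assumes K: "convex_body K" "interior K ~= {}" and L: "convex_body L" "interior L ~= {}"
  and Es: "bodies Es" "\<forall>C\<in>set Es. interior C ~= {}"
  and v: "!!p r. p + r + length Es = DIM('a) ==> mixvol (replicate p K @ replicate r L @ Es) = v"
  and Fs: "bodies Fs" "\<forall>C\<in>set (tl Fs). interior C ~= {}" and len: "Suc (p + r + length Fs + length Es) = DIM('a)"
 shows "mixvol (K # Fs @ replicate p K @ replicate r L @ Es) = mixvol (L # Fs @ replicate p K @ replicate r L @ Es)"
 using Fs len
proof (induction Fs arbitrary: p r)
 case Nil
 have "mixvol (L # replicate p K @ replicate r L @ Es) = mixvol (replicate p K @ replicate (Suc r) L @ Es)" by (rule mixvol_perm) simp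
 thus ?case using v[of "Suc p" r] v[of p "Suc r"] Nil by simp
next
 case (Cons F Fs)
 let ?C = "Fs @ replicate p K @ replicate r L @ Es"
 have int: "\<forall>C\<in>set Fs. interior C ~= {}" and b: "bodies Fs" "convex_body F" using Cons.prems by auto
 hence int': "\<forall>C\<in>set (tl Fs). interior C ~= {}" by (cases Fs) auto
 have pm: "mixvol (Z # Fs @ replicate (Suc p) K @ replicate r L @ Es) = mixvol (Z # K # ?C)"
  "mixvol (Z # Fs @ replicate p K @ replicate (Suc r) L @ Es) = mixvol (Z # L # ?C)" for Z by (rule mixvol_perm, simp)+
 have KK: "mixvol (K # K # ?C) = mixvol (L # K # ?C)" and KL: "mixvol (K # L # ?C) = mixvol (L # L # ?C)"
  using Cons.IH[OF b(1) int', of "Suc p" r] Cons.IH[OF b(1) int', of p "Suc r"] Cons.prems unfolding pm by simp_all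
 have "mixvol (K # F # ?C) = mixvol (L # F # ?C)"
 proof (rule alexandrov_fenchel_kernel[where M = K])
  show "0 < mixvol (K # K # ?C)" using K L Es b int Cons.prems by (intro mixvol_pos) auto
  show "mixvol (K # K # ?C) - 2 * mixvol (K # L # ?C) + mixvol (L # L # ?C) = 0" using KK KL mixvol_swap[of L K ?C] by simp
 qed (use K L Es b KK Cons.prems in auto)
 thus ?case by simp
qed

text \<open>Downward induction on the number \<open>d\<close> of copies of \<open>E\<close> that
  remain; each step trades one of them for an arbitrary body with interior. The head of
  \<open>Fs\<close> is the free argument of the kernel statement and may be any body.\<close>

lemma equal_mixed_volumes:
 fixes K L E :: "'a::euclidean_space set"
 assumes E: "smooth_body E" "convex_body E" "interior E ~= {}" and K: "convex_body K" "interior K ~= {}"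
  and L: "convex_body L" "interior L ~= {}" and i: "i + 2 <= DIM('a)"
  and v: "!!p r. p + r + i = DIM('a) ==> mixvol (replicate p K @ replicate r L @ replicate i E) = v"
  and Fs: "bodies Fs" "\<forall>C\<in>set (tl Fs). interior C ~= {}" "Suc (length Fs + d) = DIM('a)" and d: "d <= i"
 shows "mixvol (K # Fs @ replicate d E) = mixvol (L # Fs @ replicate d E)"
 using d Fs
proof (induction d arbitrary: Fs rule: inc_induct)
 case base
 thus ?case using mixvol_kernel_propagate[OF K L, of "replicate i E" v Fs 0 0] E v by simp
next
 case (step d)
 obtain F D Cs where Fs: "Fs = F # D # Cs" using step i by (cases Fs; cases "tl Fs") auto
 have p: "mixvol (Z # (F # Cs) @ replicate (Suc d) E) = mixvol (Z # F # E # Cs @ replicate d E)" for Z F by (rule mixvol_perm) simp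
 have ker: "mixvol (K # F # E # Cs @ replicate d E) = mixvol (L # F # E # Cs @ replicate d E)" if "convex_body F" for F
  using step.IH[of "F # Cs"] step.prems that unfolding p Fs by simp
 have "mixvol (K # F # D # Cs @ replicate d E) = mixvol (L # F # D # Cs @ replicate d E)"
  by (rule smooth_kernel_replace[OF E]) (use E K L step.prems[unfolded Fs] ker in auto)
 thus ?case unfolding Fs by simp
qed

section \<open>Mixed volumes with simplices, which sample support functions at finitely many
  normals\<close>

lemma strip_vol:
 fixes S :: "'a::euclidean_space set"
 assumes S: "independent S" "card S = DIM('a)" "a \<in> S" "a' \<in> S" "a ~= a'" and M: "0 <= M"
 shows "\<exists>c\<ge>0. \<forall>t\<ge>0. \<forall>l. \<exists>Q\<in>lmeasurable. vol Q <= c * t\<^sup>2 &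
  {z. l a - t < a \<bullet> z & l a' - t < a' \<bullet> z & (\<forall>s\<in>S. l s - M < s \<bullet> z & s \<bullet> z <= l s)} \<subseteq> Q"
proof -
 have fin: "finite S" using S(1) by (rule independent_imp_finite)
 define c where "c = M ^ card (S - {a, a'}) * vol (cell S (%b. 1))"
 have "\<exists>Q\<in>lmeasurable. vol Q <= c * t\<^sup>2 & {z. l a - t < a \<bullet> z & l a' - t < a' \<bullet> z & (\<forall>s\<in>S. l s - M < s \<bullet> z & s \<bullet> z <= l s)} \<subseteq> Q"
  if t: "0 <= t" for t l
 proof -
  \<comment> \<open>The set fits into a parallelepiped with two sides \<open>t\<close> and all the
    others \<open>M\<close>, whence the order \<open>t\<^sup>2\<close>. The offset \<open>l\<close>
    only translates it, so \<open>c\<close> does not depend on \<open>l\<close>.\<close>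
  define f where "f s = (if s = a \<or> s = a' then t else M)" for s
  obtain p where p: "!!s. s \<in> S ==> s \<bullet> p = l s - f s" using independent_interpolate[OF S(1), of "%s. l s - f s"] by blast
  have "vol ((+) p ` cell S f) = (\<Prod>s\<in>S. f s) * vol (cell S (%b. 1))"
   unfolding measure_translation using t M by (intro vol_cell S) (auto simp: f_def)
  also have "(\<Prod>s\<in>S. f s) = f a * (f a' * (\<Prod>s\<in>S - {a, a'}. f s))"
   using fin S by (simp add: prod.remove[of S a] prod.remove[of "S - {a}" a'] insert_commute Diff_insert2[symmetric])
  also have "(\<Prod>s\<in>S - {a, a'}. f s) = M ^ card (S - {a, a'})" by (subst prod.cong[OF refl, of _ _ "%_. M"]) (auto simp: f_def)
  finally have "vol ((+) p ` cell S f) = f a * f a' * c" by (simp add: c_def mult_ac)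
  hence "vol ((+) p ` cell S f) = c * t\<^sup>2" by (simp add: f_def[of a] f_def[of a'] power2_eq_square)
  moreover have "z \<in> (+) p ` cell S f" if z: "l a - t < a \<bullet> z & l a' - t < a' \<bullet> z & (\<forall>s\<in>S. l s - M < s \<bullet> z & s \<bullet> z <= l s)" for z
  proof -
   have "z - p \<in> cell S f" using z p by (auto simp: cell_def f_def inner_diff_right)
   hence "p + (z - p) \<in> (+) p ` cell S f" by blast
   thus ?thesis by simp
  qed
  ultimately show ?thesis using measurable_translation[OF cell_lmeasurable[OF S(1,2)]] by (intro bexI[of _ "(+) p ` cell S f"]) auto
 qed
 thus ?thesis using M by (intro exI[of _ c]) (auto simp: c_def)
qed

text \<open>If \<open>X\<close> touches all facets of the polytope \<open>T\<close>, a point of \<open>(1 + t) T\<close> outside \<open>T + t X\<close> is within distance \<open>O(t)\<close> of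
  two facets, so that the volumes of these bodies differ by \<open>O(t\<^sup>2)\<close> only.\<close>

lemma vol_le_mixvol_touching:
 fixes T X :: "'a::euclidean_space set" and b :: "'a => real"
 assumes N: "finite N" and T: "convex_body T" "T = {x. \<forall>a\<in>N. a \<bullet> x <= b a}" and X: "convex_body X" "X \<subseteq> T"
  and touch: "!!a. a \<in> N ==> \<exists>x\<in>X. a \<bullet> x = b a"
  and ext: "!!a a'. a \<in> N ==> a' \<in> N ==> a ~= a' ==> \<exists>S\<subseteq>N. a \<in> S & a' \<in> S & independent S & card S = DIM('a)"
  and ne: "N ~= {}"
 shows "vol T <= mixvol (X # replicate (DIM('a) - 1) T)"
proof -
 let ?n = "DIM('a)"
 obtain R where R: "R > 0" "!!x. x \<in> T ==> norm x <= R" using compact_imp_bounded[OF bodyD(1)[OF T(1)]] bounded_pos by metis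
 \<comment> \<open>\<open>m\<close> strictly exceeds \<open>\<bar>a \<bullet> x\<bar>\<close> on
   \<open>T\<close> and every \<open>\<bar>b a\<bar>\<close>; the window \<open>5 * m\<close> and
   the strip width \<open>2 * m * t\<close> are calibrated by it.\<close>
 define m where "m = R * (1 + (\<Sum>a\<in>N. norm a))"
 have m: "0 < m" using R by (simp add: m_def add_pos_nonneg sum_nonneg)
 have am: "\<bar>a \<bullet> x\<bar> < m" if "a \<in> N" "x \<in> T" for a x
 proof -
  have "\<bar>a \<bullet> x\<bar> <= norm a * R" using Cauchy_Schwarz_ineq2[of a x] mult_left_mono[OF R(2)[OF that(2)] norm_ge_zero[of a]] by linarith
  also have "... < (1 + (\<Sum>a\<in>N. norm a)) * R" using member_le_sum[OF that(1), of norm] N R(1) by (intro mult_strict_right_mono) auto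
  finally show ?thesis by (simp add: m_def mult.commute)
 qed
 have bm: "\<bar>b a\<bar> < m" if "a \<in> N" for a using touch[OF that] am[OF that] X(2) by force
 define PP where "PP = {q \<in> N \<times> N. fst q ~= snd q}"
 have finP: "finite PP" using N by (simp add: PP_def)
 define U where "U l t q = {z. l (fst q) - t < fst q \<bullet> z & l (snd q) - t < snd q \<bullet> z & (\<forall>s\<in>N. l s - 5 * m < s \<bullet> z & s \<bullet> z <= l s)}" for l t q
 have "\<forall>q\<in>PP. \<exists>c. 0 <= c & (\<forall>t\<ge>0. \<forall>l. \<exists>Q\<in>lmeasurable. vol Q <= c * t\<^sup>2 & U l t q \<subseteq> Q)"
 proof
  fix q assume "q \<in> PP"
  hence q: "fst q \<in> N" "snd q \<in> N" "fst q ~= snd q" by (auto simp: PP_def)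
  from ext[OF q] obtain S where S: "S \<subseteq> N" "fst q \<in> S" "snd q \<in> S" "independent S" "card S = ?n" by blast
  have "U l t q \<subseteq> {z. l (fst q) - t < fst q \<bullet> z & l (snd q) - t < snd q \<bullet> z & (\<forall>s\<in>S. l s - 5 * m < s \<bullet> z & s \<bullet> z <= l s)}" for l t
   using S(1) by (auto simp: U_def)
  note sub = this
  have "0 <= 5 * m" using m by simp
  from strip_vol[OF S(4,5,2,3) q(3) this] obtain c where c: "0 <= c" and Q: "\<forall>t\<ge>0. \<forall>l. \<exists>Q\<in>lmeasurable. vol Q <= c * t\<^sup>2 &
   {z. l (fst q) - t < fst q \<bullet> z & l (snd q) - t < snd q \<bullet> z & (\<forall>s\<in>S. l s - 5 * m < s \<bullet> z & s \<bullet> z <= l s)} \<subseteq> Q" by (elim exE conjE)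
  show "\<exists>c. 0 <= c & (\<forall>t\<ge>0. \<forall>l. \<exists>Q\<in>lmeasurable. vol Q <= c * t\<^sup>2 & U l t q \<subseteq> Q)"
  proof (intro exI[of _ c] conjI c allI impI)
   fix t :: real and l assume "0 <= t"
   with Q obtain Q where "Q \<in> lmeasurable" "vol Q <= c * t\<^sup>2"
    "{z. l (fst q) - t < fst q \<bullet> z & l (snd q) - t < snd q \<bullet> z & (\<forall>s\<in>S. l s - 5 * m < s \<bullet> z & s \<bullet> z <= l s)} \<subseteq> Q" by meson
   thus "\<exists>Q\<in>lmeasurable. vol Q <= c * t\<^sup>2 & U l t q \<subseteq> Q" using subset_trans[OF sub] by blast
  qed
 qed
 then obtain c where c: "!!q. q \<in> PP ==> 0 <= c q" "!!q t l. q \<in> PP ==> 0 <= t ==> \<exists>Q\<in>lmeasurable. vol Q <= c q * t\<^sup>2 & U l t q \<subseteq> Q"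
  unfolding bchoice_iff by blast
 define G where "G = (\<Sum>k=0..?n. real (?n choose k) * qm k T X)"
 define H where "H = G + (\<Sum>q\<in>PP. c q * (2 * m)\<^sup>2)"
 have q0: "0 <= real (?n choose k) * qm k T X" if "k \<in> {0..?n}" for k unfolding qm_def using T X that by (intro mult_nonneg_nonneg mixvol_nonneg) auto
 have H: "0 <= H" unfolding H_def G_def using q0 c(1) by (intro add_nonneg_nonneg sum_nonneg) auto
 have main: "real ?n * vol T <= real ?n * qm 1 T X + t * H" if t: "0 < t" "t <= 1" for t
 proof -
  have "\<forall>q\<in>PP. \<exists>Q. Q \<in> lmeasurable & vol Q <= c q * (2 * m * t)\<^sup>2 & U (%a. (1 + t) * b a) (2 * m * t) q \<subseteq> Q"
  proof
   fix q assume "q \<in> PP"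
   from c(2)[OF this, of "2 * m * t" "%a. (1 + t) * b a"] t m show "\<exists>Q. Q \<in> lmeasurable & vol Q <= c q * (2 * m * t)\<^sup>2 & U (%a. (1 + t) * b a) (2 * m * t) q \<subseteq> Q" by auto
  qed
  then obtain Q where Q: "!!q. q \<in> PP ==> Q q \<in> lmeasurable" "!!q. q \<in> PP ==> vol (Q q) <= c q * (2 * m * t)\<^sup>2"
   "!!q. q \<in> PP ==> U (%a. (1 + t) * b a) (2 * m * t) q \<subseteq> Q q" unfolding bchoice_iff by blast
  have sub: "(1 + t) \<odot> T \<subseteq> (T + t \<odot> X) \<union> (\<Union>q\<in>PP. Q q)"
  proof
   fix z assume "z \<in> (1 + t) \<odot> T"
   then obtain y where y: "z = (1 + t) *R y" "y \<in> T" by blast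
   show "z \<in> (T + t \<odot> X) \<union> (\<Union>q\<in>PP. Q q)"
   proof (rule ccontr)
    assume no: "z \<notin> (T + t \<odot> X) \<union> (\<Union>q\<in>PP. Q q)"
    have box: "(1 + t) * b s - 5 * m < s \<bullet> z & s \<bullet> z <= (1 + t) * b s" if s: "s \<in> N" for s
    proof -
     have ys: "s \<bullet> y <= b s" "- m < s \<bullet> y" "b s < m" using y(2) T(2) am[OF s y(2)] bm[OF s] s by auto
     have "(1 + t) * (s \<bullet> y) <= (1 + t) * b s" "(1 + t) * (- m) <= (1 + t) * (s \<bullet> y)" "(1 + t) * b s <= (1 + t) * m"
      using ys t by (intro mult_left_mono; simp)+
     moreover have "(1 + t) * m <= 2 * m" using t m by (intro mult_right_mono) auto
     ultimately show ?thesis using m unfolding y(1) inner_scaleR_right by linarith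
    qed
    \<comment> \<open>Subtracting \<open>t x\<close>, with \<open>x\<close> touching facet
      \<open>a\<close>, restores the inequality of \<open>a\<close>. As the result is still outside
      \<open>T\<close>, a different facet is violated. Applied twice, this produces two distinct
      facets close to \<open>z\<close>.\<close>
    have near: "\<exists>a'\<in>N. a' ~= a & (1 + t) * b a' - 2 * m * t < a' \<bullet> z" if a: "a \<in> N" for a
    proof -
     obtain x where x: "x \<in> X" "a \<bullet> x = b a" using touch[OF a] by blast
     have "z - t *R x \<notin> T"
     proof
      assume "z - t *R x \<in> T"
      hence "(z - t *R x) + t *R x \<in> T + t \<odot> X" using x by blast
      thus False using no by simp
     qed
     then obtain a' where a': "a' \<in> N" "b a' < a' \<bullet> z - t * (a' \<bullet> x)" unfolding T(2) by (auto simp: not_le inner_diff_right)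
     have "a' ~= a" using a' x(2) box[OF a] by (auto simp: algebra_simps)
     moreover have "t * (b a' - a' \<bullet> x) < t * (2 * m)" using am[OF a'(1), of x] bm[OF a'(1)] x(1) X(2) t by (intro mult_strict_left_mono) auto
     ultimately show ?thesis using a' by (intro bexI[of _ a']) (auto simp: algebra_simps)
    qed
    obtain a0 where "a0 \<in> N" using ne by blast
    from near[OF this] obtain a where a: "a \<in> N" "(1 + t) * b a - 2 * m * t < a \<bullet> z" by blast
    from near[OF a(1)] obtain a' where a': "a' \<in> N" "a' ~= a" "(1 + t) * b a' - 2 * m * t < a' \<bullet> z" by blast
    have PP: "(a, a') \<in> PP" using a a' by (simp add: PP_def)
    moreover have "z \<in> U (%a. (1 + t) * b a) (2 * m * t) (a, a')" using a a' box by (simp add: U_def)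
    ultimately have "z \<in> Q (a, a')" using Q(3) by blast
    thus False using no PP by blast
   qed
  qed
  have lm: "T + t \<odot> X \<in> lmeasurable" "(\<Union>q\<in>PP. Q q) \<in> lmeasurable" "(1 + t) \<odot> T \<in> lmeasurable"
   by (intro body_lmeasurable body_plus body_dilate T X, intro fmeasurable.finite_UN finP Q, assumption)
    (intro body_lmeasurable body_dilate T)
  have "vol ((1 + t) \<odot> T) <= vol (T + t \<odot> X) + vol (\<Union>q\<in>PP. Q q)"
   using vol_mono[OF lm(3) fmeasurable.Un[OF lm(1,2)] sub] measure_Un_le[of "T + t \<odot> X" lebesgue "\<Union>q\<in>PP. Q q"] lm by (auto simp: fmeasurableD)
  also have "vol (\<Union>q\<in>PP. Q q) <= (\<Sum>q\<in>PP. vol (Q q))" using Q(1) finP by (intro measure_UNION_le) (auto simp: fmeasurableD)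
  also have "... <= (\<Sum>q\<in>PP. c q * (2 * m)\<^sup>2 * t\<^sup>2)" using Q(2) by (intro sum_mono) (auto simp: power_mult_distrib mult.assoc)
  also have "... = (\<Sum>q\<in>PP. c q * (2 * m)\<^sup>2) * t\<^sup>2" by (rule sum_distrib_right[symmetric])
  also have "vol (T + t \<odot> X) <= vol T + real ?n * qm 1 T X * t + G * t\<^sup>2"
  proof -
   let ?e = "%k. (if k = 0 then vol T else 0) + (if k = 1 then real ?n * qm 1 T X * t else 0)"
   have qm0: "qm 0 T X = vol T" using mixvol_self[OF T(1)] by (simp add: qm_def)
   have "vol (T + t \<odot> X) = (\<Sum>k=0..?n. real (?n choose k) * qm k T X * t ^ k)"
    using steiner_coefficients_qm[OF T(1) X(1)] t by (simp add: steiner_coefficients_def)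
   also have "... <= (\<Sum>k=0..?n. ?e k + real (?n choose k) * qm k T X * t\<^sup>2)"
   proof (rule sum_mono)
    fix k assume k: "k \<in> {0..?n}"
    consider "k = 0" | "k = 1" | "2 <= k" by linarith
    thus "real (?n choose k) * qm k T X * t ^ k <= ?e k + real (?n choose k) * qm k T X * t\<^sup>2"
    proof cases
     case 3
     thus ?thesis using q0[OF k] t by (auto intro!: mult_left_mono power_decreasing)
    qed (use q0[OF k] qm0 in auto)
   qed
   also have "... = vol T + real ?n * qm 1 T X * t + G * t\<^sup>2" by (simp add: sum.distrib G_def sum_distrib_right Suc_leI)
   finally show ?thesis .
  qed
  finally have "vol ((1 + t) \<odot> T) <= vol T + real ?n * qm 1 T X * t + H * t\<^sup>2" by (simp add: H_def algebra_simps)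
  moreover have "(1 + real ?n * t) * vol T <= (1 + t) ^ ?n * vol T" using Bernoulli_inequality[of t ?n] t by (intro mult_right_mono) auto
  moreover have "vol ((1 + t) \<odot> T) = (1 + t) ^ ?n * vol T" using t by (intro vol_dilate T(1)) simp
  ultimately have "(1 + real ?n * t) * vol T <= vol T + real ?n * qm 1 T X * t + H * t\<^sup>2" by linarith
  hence "t * (real ?n * vol T) <= t * (real ?n * qm 1 T X + t * H)" by (simp add: algebra_simps power2_eq_square)
  thus ?thesis using t by simp
 qed
 have "0 <= real ?n * (qm 1 T X - vol T) + t * H" if t: "0 < t" for t
 proof (cases "t <= 1")
  case False
  have "1 * H <= t * H" using False H by (intro mult_right_mono) auto
  thus ?thesis using main[of 1] by (simp add: algebra_simps)
 qed (use main[of t] t in \<open>simp add: algebra_simps\<close>)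
 hence "0 <= real ?n * (qm 1 T X - vol T)" by (rule closed_limit_nonneg)
 hence "vol T <= qm 1 T X" by (simp add: zero_le_mult_iff)
 moreover have "qm 1 T X = mixvol (X # replicate (?n - 1) T)" unfolding qm_def by (rule mixvol_perm) simp
 ultimately show ?thesis by simp
qed

text \<open>\<open>T\<close> is the simplex with outer normals \<open>B\<close> and minus their sum.
  The simplex of the same shape circumscribed about \<open>X\<close> is a translate of a dilate of
  \<open>T\<close> touched by \<open>X\<close> on every facet, so by
  \<open>vol_le_mixvol_touching\<close> and monotonicity the mixed volume is that of the
  circumscribed simplex. Only n + 1 support values enter.\<close>

lemma simplex_mixvol:
 fixes B :: "'a::euclidean_space set"
 assumes B: "independent B" "card B = DIM('a)" and n: "2 <= DIM('a)"
 shows "\<exists>T. convex_body T & interior T ~= {} & (\<forall>X. convex_body X & interior X ~= {} -->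
  mixvol (X # replicate (DIM('a) - 1) T) = (support_function X (- \<Sum>B) + (\<Sum>b\<in>B. support_function X b)) * vol T)"
proof -
 let ?n = "DIM('a)"
 define a0 where "a0 = - \<Sum>B"
 define d where "d a = (if a = a0 then 1 else 0 :: real)" for a
 define T where "T = {x. \<forall>a\<in>insert a0 B. a \<bullet> x <= d a}"
 have fin: "finite B" using B(1) by (rule independent_imp_finite)
 have a0span: "a0 \<notin> span (B - {c})" if c: "c \<in> B" for c
 proof
  assume "a0 \<in> span (B - {c})"
  hence "- (a0 + \<Sum>(B - {c})) \<in> span (B - {c})" by (rule span_neg[OF span_add[OF _ span_sum[OF span_base]]])
  moreover have "- (a0 + \<Sum>(B - {c})) = c" using c fin by (simp add: a0_def sum.remove)
  ultimately show False using B(1) c by (auto simp: dependent_def)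
 qed
 have other: "\<exists>c\<in>B. c ~= b" for b
 proof (rule ccontr)
  assume "\<not> ?thesis"
  hence "B \<subseteq> {b}" by auto
  thus False using card_mono[of "{b}" B] B(2) n by simp
 qed
 have a0B: "a0 \<notin> B" using other[of a0] a0span span_base by (metis Diff_iff singletonD)
 have d: "d a0 = 1" "b \<in> B ==> d b = 0" for b using a0B by (auto simp: d_def)
 have Tx: "x \<in> T \<longleftrightarrow> (\<forall>b\<in>B. b \<bullet> x <= 0) & a0 \<bullet> x <= 1" for x using d by (auto simp: T_def)
 have a0x: "a0 \<bullet> x = - (\<Sum>b\<in>B. b \<bullet> x)" for x by (simp add: a0_def inner_sum_left)
 obtain q where q: "!!b. b \<in> B ==> b \<bullet> q = - 1 / (2 * real ?n)" using independent_interpolate[OF B(1), of "%_. - 1 / (2 * real ?n)"] by blast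
 have "a0 \<bullet> q = 1 / 2" using q B(2) by (simp add: a0x)
 hence "q \<in> (\<Inter>b\<in>B. {x. b \<bullet> x < 0}) \<inter> {x. a0 \<bullet> x < 1}" using q by auto
 moreover have "open ((\<Inter>b\<in>B. {x. b \<bullet> x < 0}) \<inter> {x. a0 \<bullet> x < 1})" using fin by (intro open_Int open_INT) (auto simp: open_halfspace_lt)
 moreover have "(\<Inter>b\<in>B. {x. b \<bullet> x < 0}) \<inter> {x. a0 \<bullet> x < 1} \<subseteq> T" by (auto simp: Tx less_imp_le)
 ultimately have qT: "q \<in> interior T" using interior_maximal by blast
 have "T = (\<Inter>a\<in>insert a0 B. {x. a \<bullet> x <= d a})" by (auto simp: T_def)
 moreover have "closed (\<Inter>a\<in>insert a0 B. {x. a \<bullet> x <= d a})" by (intro closed_INT ballI closed_halfspace_le)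
 moreover have "convex (\<Inter>a\<in>insert a0 B. {x. a \<bullet> x <= d a})" by (intro convex_INT convex_halfspace_le)
 ultimately have "closed T" "convex T" by metis+
 moreover have "bounded T"
 proof (rule boundedI)
  fix x assume x: "x \<in> T"
  have "\<bar>b \<bullet> x\<bar> <= 1" if "b \<in> B" for b
  proof -
   have "(\<Sum>b\<in>B - {b}. b \<bullet> x) <= 0" using x by (intro sum_nonpos) (auto simp: Tx)
   thus ?thesis using x that fin by (auto simp: Tx a0x sum.remove[of B b])
  qed
  moreover have "x = (\<Sum>b\<in>B. (b \<bullet> x) *R dual B b)"
  proof (rule inner_spanning_eq[OF B])
   fix b assume b: "b \<in> B"
   have "b \<bullet> (\<Sum>b\<in>B. (b \<bullet> x) *R dual B b) = (\<Sum>c\<in>B. if b = c then b \<bullet> x else 0)"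
    unfolding inner_sum_right using dual_works[OF B(1) b] by (intro sum.cong) auto
   thus "b \<bullet> x = b \<bullet> (\<Sum>b\<in>B. (b \<bullet> x) *R dual B b)" using fin b by simp
  qed
  ultimately show "norm x <= (\<Sum>b\<in>B. norm (dual B b))"
   by (metis (no_types, lifting) sum_norm_le norm_scaleR mult_left_le_one_le abs_ge_zero norm_ge_zero)
 qed
 ultimately have T: "convex_body T" "interior T ~= {}" using qT interior_subset by (auto simp: convex_body_def compact_eq_bounded_closed)
 have ext: "\<exists>S\<subseteq>insert a0 B. a \<in> S & a' \<in> S & independent S & card S = ?n" if a: "a \<in> insert a0 B" "a' \<in> insert a0 B" "a ~= a'" for a a'
 proof (cases "a0 \<in> {a, a'}")
  case False
  thus ?thesis using a B by (intro exI[of _ B]) auto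
 next
  case True
  obtain c where c: "c \<in> B" "c ~= a" "c ~= a'" using True other[of a] other[of a'] a0B by auto
  have "independent (insert a0 (B - {c}))" by (rule independent_insertI[OF a0span[OF c(1)] independent_mono[OF B(1)]]) auto
  moreover have "card (insert a0 (B - {c})) = ?n" using c(1) fin a0B B(2) n by (simp add: card_Diff_singleton)
  ultimately show ?thesis using a c by (intro exI[of _ "insert a0 (B - {c})"]) auto
 qed
 have "mixvol (X # replicate (?n - 1) T) = (support_function X a0 + (\<Sum>b\<in>B. support_function X b)) * vol T" if X: "convex_body X" "interior X ~= {}" for X
 proof -
  let ?h = "support_function X"
  \<comment> \<open>\<open>c\<close> is the vertex of the circumscribed simplex on the facets in
    \<open>B\<close>, and \<open>s\<close> is its ratio to \<open>T\<close>. Moving \<open>c\<close>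
    to the origin and scaling by \<open>1 / s\<close> fits the body into \<open>T\<close>.\<close>
  obtain c where c: "!!b. b \<in> B ==> b \<bullet> c = ?h b" using independent_interpolate[OF B(1), of ?h] by blast
  define s where "s = ?h a0 + (\<Sum>b\<in>B. ?h b)"
  obtain p where p: "p \<in> interior X" using X by blast
  have "a0 ~= 0" "!!b. b \<in> B ==> b ~= 0" using a0span other[of 0] span_zero B(1) dependent_zero by metis+
  hence "p \<bullet> a0 < ?h a0" "!!b. b \<in> B ==> p \<bullet> b < ?h b" using support_gt_interior[OF X(1) p] by auto
  hence "p \<bullet> a0 + (\<Sum>b\<in>B. p \<bullet> b) < s" unfolding s_def by (intro add_less_le_mono sum_mono) (auto simp: less_imp_le)
  hence s: "0 < s" using a0x[of p] by (simp add: inner_commute)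
  define Y where "Y = (+) (- (1 / s) *R c) ` ((1 / s) \<odot> X)"
  have Y: "convex_body Y" unfolding Y_def by (rule body_affine[OF X(1)])
  have hY: "support_function Y w = (?h w - c \<bullet> w) / s" for w
   unfolding Y_def by (subst support_affine[OF X(1)]) (use s in \<open>auto simp: field_simps\<close>)
  have "c \<bullet> a0 = - (\<Sum>b\<in>B. ?h b)" using a0x[of c] c by (simp add: inner_commute)
  hence hN: "support_function Y a = d a" if "a \<in> insert a0 B" for a using that s c d by (auto simp: hY s_def inner_commute)
  have YT: "Y \<subseteq> T" unfolding T_def using support_upper[OF bodyD(1)[OF Y]] hN by (auto simp: inner_commute) (metis inner_commute insertI1 insertI2)+
  have "vol T <= mixvol (Y # replicate (?n - 1) T)"
  proof (rule vol_le_mixvol_touching[OF _ T(1) T_def Y YT _ ext])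
   show "\<exists>x\<in>Y. a \<bullet> x = d a" if "a \<in> insert a0 B" for a using support_attained[OF Y, of a] hN[OF that] by (metis inner_commute)
  qed (use fin in auto)
  moreover have "mixvol (Y # replicate (?n - 1) T) <= mixvol (T # replicate (?n - 1) T)" using YT Y T by (intro mixvol_mono) auto
  moreover have "mixvol (T # replicate (?n - 1) T) = vol T" using mixvol_self[OF T(1)] by (simp flip: replicate_Suc)
  moreover have "mixvol (Y # replicate (?n - 1) T) = (1 / s) * mixvol (X # replicate (?n - 1) T)"
   unfolding Y_def using X T s by (subst mixvol_translate, simp_all add: body_dilate) (subst mixvol_dilate, auto)
  ultimately have "(1 / s) * mixvol (X # replicate (?n - 1) T) = vol T" by linarith
  thus ?thesis using s by (simp add: s_def[symmetric] field_simps)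
 qed
 thus ?thesis using T unfolding a0_def by blast
qed

text \<open>Simplices as test bodies give \<open>q (- \<Sum>B) + (\<Sum>b\<in>B. q b) = 0\<close>
  for every basis, where \<open>q\<close> is the difference of the support functions. On scaled
  coordinate bases this relation, with positive homogeneity and continuity, makes \<open>q\<close>
  linear, which means a translation.\<close>

lemma equal_mixed_volumes_translate:
 fixes K L E :: "'a::euclidean_space set"
 assumes E: "smooth_body E" "convex_body E" "interior E ~= {}" and K: "convex_body K" "interior K ~= {}"
  and L: "convex_body L" "interior L ~= {}" and i: "i + 2 <= DIM('a)"
  and v: "!!p r. p + r + i = DIM('a) ==> mixvol (replicate p K @ replicate r L @ replicate i E) = v"
 shows "\<exists>p. L = (+) p ` K"
proof -
 let ?n = "DIM('a)"
 define q where "q w = support_function L w - support_function K w" for w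
 have scale: "q (c *R w) = c * q w" if "0 <= c" for c w using that K L by (simp add: q_def support_scale algebra_simps)
 have cont: "continuous_on UNIV q" unfolding q_def using K L by (intro continuous_intros support_continuous)
 have basis: "q (- \<Sum>B) + (\<Sum>b\<in>B. q b) = 0" if B: "independent B" "card B = ?n" for B
 proof -
  obtain T where T: "convex_body T" "interior T ~= {}" "!!X. convex_body X ==> interior X ~= {} ==>
   mixvol (X # replicate (?n - 1) T) = (support_function X (- \<Sum>B) + (\<Sum>b\<in>B. support_function X b)) * vol T"
   using simplex_mixvol[OF B] i by auto
  have "mixvol (K # replicate (?n - 1) T @ replicate 0 E) = mixvol (L # replicate (?n - 1) T @ replicate 0 E)"
   by (rule equal_mixed_volumes[OF E K L i v]) (use T in auto)
  hence "(support_function K (- \<Sum>B) + (\<Sum>b\<in>B. support_function K b)) * vol T = (support_function L (- \<Sum>B) + (\<Sum>b\<in>B. support_function L b)) * vol T"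
   using T(3)[OF K] T(3)[OF L] by simp
  thus ?thesis using vol_pos_of_interior[OF T(1,2)] by (simp add: q_def sum_subtractf)
 qed
 have coord: "q (- (\<Sum>b\<in>Basis. y b *R b)) + (\<Sum>b\<in>Basis. q (y b *R b)) = 0" if y: "!!b. b \<in> Basis ==> y b ~= 0" for y :: "'a => real"
 proof -
  let ?B = "(%b. y b *R b) ` Basis"
  have inj: "inj_on (%b. y b *R b) Basis"
  proof (rule inj_onI)
   fix b b' :: 'a assume b: "b \<in> Basis" "b' \<in> Basis" "y b *R b = y b' *R b'"
   hence "y b * (b \<bullet> b) = y b' * (b' \<bullet> b)" by (metis inner_scaleR_left)
   thus "b = b'" using b(1,2) y[OF b(1)] by (cases "b = b'") (auto simp: inner_Basis)
  qed
  have "independent ?B" using y by (intro pairwise_orthogonal_independent) (auto simp: pairwise_def orthogonal_def inner_Basis)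
  hence "q (- \<Sum>?B) + (\<Sum>b\<in>?B. q b) = 0" using card_image[OF inj] by (intro basis) auto
  thus ?thesis by (simp add: sum.reindex[OF inj] o_def)
 qed
 have lim: "f 0 = 0" if "continuous_on UNIV f" "!!t. 0 < t ==> t < e ==> f t = (0 :: real)" "0 < e" for f :: "real => real" and e
 proof -
  have "(f \<longlongrightarrow> f 0) (at_right 0)" using that(1) by (simp add: continuous_on_def) (meson tendsto_within_subset UNIV_I subset_UNIV)
  moreover have "\<forall>\<^sub>F t in at_right 0. f t = 0" using that(2,3) by (auto simp: eventually_at_right_field intro: exI[of _ e])
  ultimately show ?thesis by (metis tendsto_eventually tendsto_unique trivial_limit_at_right_real)
 qed
 have odd: "q (- b) = - q b" if b: "b \<in> Basis" for b
 proof -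
  \<comment> \<open>Letting all basis vectors but \<open>b\<close> shrink to 0 reduces the relation
    to \<open>q (- b) + q b = 0\<close>.\<close>
  let ?y = "%t c. if c = b then 1 else t"
  let ?f = "%t. q (- (\<Sum>c\<in>Basis. ?y t c *R c)) + (\<Sum>c\<in>Basis. q (?y t c *R c))"
  have cf: "continuous_on UNIV ?f"
  proof -
   have "continuous_on UNIV (%t. ?y t c)" for c by (cases "c = b") (simp_all add: continuous_on_id)
   thus ?thesis by (intro continuous_intros continuous_on_compose2[OF cont]) auto
  qed
  have "?f t = 0" if "0 < t" "t < 1" for t using that by (intro coord) auto
  from lim[OF cf this] have "?f 0 = 0" by simp
  moreover have "q 0 = 0" using scale[of 0 0] by simp
  ultimately show ?thesis using b by (simp add: if_distrib[of "%c. c *R _"] if_distrib[of q] sum.delta cong: if_cong)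
 qed
 have sc: "q (c *R b) = c * q b" if b: "b \<in> Basis" for b c
  using scale[of c b] scale[of "- c" "- b"] odd[OF b] by (cases "0 <= c") auto
 define p where "p = (\<Sum>b\<in>Basis. q b *R b)"
 have lin: "q w = p \<bullet> w" for w
 proof -
  have gen: "q x = p \<bullet> x" if x: "!!b. b \<in> Basis ==> x \<bullet> b ~= 0" for x
  proof -
   have "q (- (\<Sum>b\<in>Basis. (- (x \<bullet> b)) *R b)) + (\<Sum>b\<in>Basis. q ((- (x \<bullet> b)) *R b)) = 0" using x by (intro coord) auto
   moreover have "- (\<Sum>b\<in>Basis. (- (x \<bullet> b)) *R b) = x" by (simp add: sum_negf euclidean_representation)
   moreover have "(\<Sum>b\<in>Basis. q ((- (x \<bullet> b)) *R b)) = (\<Sum>b\<in>Basis. - (x \<bullet> b) * q b)" by (intro sum.cong refl sc)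
   moreover have "(\<Sum>b\<in>Basis. - (x \<bullet> b) * q b) = - (p \<bullet> x)"
    by (simp add: p_def inner_sum_left sum_negf inner_commute[of x] mult.commute)
   ultimately show ?thesis by simp
  qed
  let ?one = "\<Sum>b\<in>Basis. b :: 'a"
  let ?f = "%t. q (w + t *R ?one) - p \<bullet> (w + t *R ?one)"
  \<comment> \<open>Vectors with a zero coordinate are not covered by \<open>gen\<close>. Adding
    \<open>t\<close> to all coordinates avoids zeros as long as \<open>t\<close> is below every
    nonzero \<open>\<bar>w \<bullet> b\<bar>\<close>.\<close>
  define e where "e = Min (insert 1 ((%b. \<bar>w \<bullet> b\<bar>) ` {b \<in> Basis. w \<bullet> b ~= 0}))"
  have e: "0 < e" "!!b. b \<in> Basis ==> w \<bullet> b ~= 0 ==> e <= \<bar>w \<bullet> b\<bar>" unfolding e_def by (auto intro: Min_le)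
  have zero: "?f t = 0" if t: "0 < t" "t < e" for t
  proof -
   have "(w + t *R ?one) \<bullet> b ~= 0" if b: "b \<in> Basis" for b
   proof -
    have "(w + t *R ?one) \<bullet> b = w \<bullet> b + t" using b by (simp add: inner_add_left inner_sum_left inner_Basis)
    thus ?thesis using e(2)[OF b] t by (cases "w \<bullet> b = 0") auto
   qed
   thus ?thesis using gen[of "w + t *R ?one"] by simp
  qed
  have "continuous_on UNIV ?f" by (intro continuous_intros continuous_on_compose2[OF cont]) auto
  from lim[OF this zero e(1)] show ?thesis by simp
 qed
 have "L = (+) p ` (1 \<odot> K)"
  by (rule body_eqI[OF L(1) body_affine[OF K(1)]]) (use lin support_affine[OF K(1), of 1 p] in \<open>simp add: q_def algebra_simps\<close>)
 thus ?thesis by auto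
qed

text \<open>Scaling \<open>K\<close> by \<open>b\<close> and \<open>L\<close> by \<open>a\<close>
  turns all the mixed volumes on the chord into the single value \<open>a ^ ?m * b ^ ?m\<close>, so
  the scaled bodies are translates.\<close>

lemma equality_homothetic:
 fixes K L E :: "'a::euclidean_space set"
 assumes E: "smooth_body E" "convex_body E" "interior E ~= {}" and K: "convex_body K" "interior K ~= {}"
  and L: "convex_body L" "interior L ~= {}" and i: "i + 2 <= DIM('a)" and ab: "0 < a" "0 < b"
  and v: "!!k. k <= DIM('a) - i ==> mixvol (replicate (DIM('a) - i - k) K @ replicate k L @ replicate i E) = a ^ (DIM('a) - i - k) * b ^ k"
 shows "homothetic K L"
proof -
 let ?m = "DIM('a) - i"
 have int: "interior (t \<odot> C) ~= {}" if "0 < t" "convex_body C" "interior C ~= {}" for t and C :: "'a set"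
  using that by (intro interior_of_vol_pos body_dilate) (auto simp: vol_dilate vol_pos_of_interior)
 have "\<exists>p. a \<odot> L = (+) p ` (b \<odot> K)"
 proof (rule equal_mixed_volumes_translate[OF E _ _ _ _ i])
  fix q k assume "q + k + i = DIM('a)"
  hence k: "k <= ?m" "q = ?m - k" by auto
  have "mixvol (replicate (?m - k) (b \<odot> K) @ replicate k (a \<odot> L) @ replicate i E)
   = b ^ (?m - k) * mixvol (replicate (?m - k) K @ replicate k (a \<odot> L) @ replicate i E)"
   using K L E k(1) i ab by (intro mixvol_replicate_dilate) (auto intro: body_dilate)
  also have "mixvol (replicate (?m - k) K @ replicate k (a \<odot> L) @ replicate i E) = mixvol (replicate k (a \<odot> L) @ replicate (?m - k) K @ replicate i E)"
   by (rule mixvol_perm) simp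
  also have "... = a ^ k * mixvol (replicate k L @ replicate (?m - k) K @ replicate i E)"
   using K L E k(1) i ab by (intro mixvol_replicate_dilate) auto
  also have "mixvol (replicate k L @ replicate (?m - k) K @ replicate i E) = a ^ (?m - k) * b ^ k"
   unfolding v[OF k(1), symmetric] by (rule mixvol_perm) simp
  finally show "mixvol (replicate q (b \<odot> K) @ replicate k (a \<odot> L) @ replicate i E) = a ^ ?m * b ^ ?m"
   using power_add[of a k "?m - k"] power_add[of b k "?m - k"] le_add_diff_inverse[OF k(1)] by (simp add: mult_ac k(2))
 qed (use K L ab int in \<open>auto intro: body_dilate\<close>)
 then obtain p where p: "a \<odot> L = (+) p ` (b \<odot> K)" by blast
 have "L = (1 / a) \<odot> (a \<odot> L)" using ab by (simp add: image_image)
 also have "... = (%y. (b / a) *R y + (1 / a) *R p) ` K" unfolding p using ab by (simp add: image_image scaleR_add_right add.commute)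
 finally show ?thesis unfolding homothetic_def using ab by (metis divide_pos_pos)
qed

section \<open>First-order volume loss near a frontier point, and mixed volumes of flat
  bodies\<close>

lemma body_frontier: "convex_body K ==> y \<in> frontier K ==> y \<in> K"
 by (metis compact_imp_closed bodyD(1) frontier_subset_closed subsetD)

lemma frontier_outward:
 fixes K :: "'a::euclidean_space set"
 assumes K: "convex_body K" and o': "o' \<in> interior K" and y: "y \<in> frontier K" and t: "0 < t"
 shows "y + t *R (y - o') \<notin> K"
proof
 let ?x = "y + t *R (y - o')"
 assume "?x \<in> K"
 hence "?x - (t / (1 + t)) *R (?x - o') \<in> interior K"
  using K o' t closure_subset[of K] by (intro mem_interior_closure_convex_shrink) (auto simp: convex_body_def)
 moreover have "?x - (t / (1 + t)) *R (?x - o') = y"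
 proof -
  have "?x - o' = (1 + t) *R (y - o')" by (simp add: algebra_simps)
  thus ?thesis using t by simp
 qed
 ultimately show False using y by (simp add: frontier_def)
qed

text \<open>If \<open>B\<close> lies strictly inside \<open>A\<close> in all normal directions at \<open>y\<close>, then passing from \<open>A\<close> to \<open>(1 - t) A + t B\<close> removes a
  layer of thickness proportional to \<open>t\<close> near \<open>y\<close>: its translates by multiples of that thickness cover a fixed ball.\<close>

lemma volume_loss:
 fixes A B :: "'a::euclidean_space set"
 assumes A: "convex_body A" "interior A ~= {}" and B: "convex_body B" "B \<subseteq> A" and y: "y \<in> frontier A"
  and strict: "!!w. w ~= 0 ==> y \<bullet> w = support_function A w ==> support_function B w < support_function A w"
 shows "mixvol (replicate (DIM('a) - 1) A @ [B]) ~= vol A"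
proof
 assume eq: "mixvol (replicate (DIM('a) - 1) A @ [B]) = vol A"
 let ?n = "DIM('a)" and ?h = "support_function"
 define C where "C t = (1 - t) \<odot> A + t \<odot> B" for t
 have cA: "compact A" "convex A" using A by (simp_all add: convex_body_def)
 have volA: "0 < vol A" using A by (simp add: vol_pos_of_interior)
 have cC: "convex_body (C t)" for t unfolding C_def using A B by (intro body_plus body_dilate)
 have CA: "C t \<subseteq> A" if "0 <= t" "t <= 1" for t
  using B(2) that convexD_alt[OF cA(2)] by (auto simp: C_def set_plus_def)
 \<comment> \<open>The two leading terms of the expansion of \<open>vol (C t)\<close> suffice: with
   \<open>m = ?n - 1\<close> they give \<open>(1 - t) ^ m * (1 + m t)\<close> times the volume of
   \<open>A\<close>, and Bernoulli's inequality shows that the loss is at most quadratic in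
   \<open>t\<close>.\<close>
 have volC: "(1 - (real ?n - 1)\<^sup>2 * t\<^sup>2) * vol A <= vol (C t)" if t: "0 <= t" "t <= 1" for t
 proof -
  let ?f = "%i. real (?n choose i) * mixvol (replicate (?n - i) ((1 - t) \<odot> A) @ replicate i (t \<odot> B))"
  obtain m where m: "?n = Suc m" using DIM_positive[where 'a='a] gr0_implies_Suc by blast
  have cb: "convex_body ((1 - t) \<odot> A)" "convex_body (t \<odot> B)" using A B by (simp_all add: body_dilate)
  have "mixvol (replicate (?n - 1) ((1 - t) \<odot> A) @ [t \<odot> B]) = (1 - t) ^ m * mixvol (replicate m A @ [t \<odot> B])"
   using A cb t m by (simp add: mixvol_replicate_dilate)
  also have "mixvol (replicate m A @ [t \<odot> B]) = t * vol A"
  proof -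
   have "mixvol (replicate m A @ [X]) = mixvol (X # replicate m A)" for X by (rule mixvol_perm) simp
   thus ?thesis using eq A B t m mixvol_dilate[of B "replicate m A" t] by simp
  qed
  finally have f1: "?f 1 = real ?n * ((1 - t) ^ m * (t * vol A))" by simp
  have "vol (C t) = (\<Sum>i\<le>?n. ?f i)"
   using mixvol_replicate_add[of "(1 - t) \<odot> A" "t \<odot> B" "[]" ?n] mixvol_self[OF cC] cb by (simp add: C_def)
  also have "... \<ge> (\<Sum>i\<in>{0, 1}. ?f i)" using m cb by (intro sum_mono2 mult_nonneg_nonneg mixvol_nonneg) auto
  finally have "?f 0 + ?f 1 <= vol (C t)" by simp
  hence "(1 - t) ^ ?n * vol A + real ?n * ((1 - t) ^ m * (t * vol A)) <= vol (C t)"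
   unfolding f1 using mixvol_self[OF cb(1)] A t by (simp add: vol_dilate)
  moreover have "(1 - t) ^ ?n * vol A + real ?n * ((1 - t) ^ m * (t * vol A)) = (1 - t) ^ m * (1 + real m * t) * vol A"
   by (simp add: m algebra_simps)
  moreover have "(1 - real m * t) * (1 + real m * t) * vol A <= (1 - t) ^ m * (1 + real m * t) * vol A"
   using Bernoulli_inequality[of "- t" m] t volA by (intro mult_right_mono) auto
  moreover have "(1 - (real ?n - 1)\<^sup>2 * t\<^sup>2) * vol A = (1 - real m * t) * (1 + real m * t) * vol A" by (simp add: m power2_eq_square algebra_simps)
  ultimately show ?thesis by linarith
 qed
 obtain o' where o': "o' \<in> interior A" using A by blast
 have yA: "y \<in> A" using A y by (simp add: body_frontier)
 have yo: "y ~= o'" using y o' by (auto simp: frontier_def)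
 \<comment> \<open>In each direction either \<open>B\<close> is indented or \<open>y\<close> is not
   a support point; compactness of the sphere yields a common amount
   \<open>\<delta>\<close>.\<close>
 have "\<exists>\<delta>>0. \<forall>w\<in>sphere 0 1. \<delta> <= max (?h A w - ?h B w) (?h A w - y \<bullet> w)"
 proof -
  have "continuous_on (sphere 0 1) (%w. max (?h A w - ?h B w) (?h A w - y \<bullet> w))"
   using A B by (intro continuous_intros support_continuous)
  moreover have "sphere (0::'a) 1 ~= {}" by simp
  ultimately obtain w0 where w0: "w0 \<in> sphere 0 1" "\<forall>w\<in>sphere 0 1. max (?h A w0 - ?h B w0) (?h A w0 - y \<bullet> w0) <= max (?h A w - ?h B w) (?h A w - y \<bullet> w)"
   using continuous_attains_inf[OF compact_sphere] by blast
  have "w0 ~= 0" using w0(1) by auto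
  hence "0 < max (?h A w0 - ?h B w0) (?h A w0 - y \<bullet> w0)"
   using strict[of w0] support_upper[OF cA(1) yA, of w0] by (cases "y \<bullet> w0 = ?h A w0") auto
  thus ?thesis using w0(2) by blast
 qed
 then obtain \<delta> where \<delta>: "\<delta> > 0" "!!w. norm w = 1 ==> \<delta> <= ?h A w - ?h B w \<or> \<delta> <= ?h A w - y \<bullet> w"
  by (auto simp: le_max_iff_disj)
 define v where "v = (1 / norm (y - o')) *R (y - o')"
 have v: "norm v = 1" using yo by (simp add: v_def)
 \<comment> \<open>Near \<open>y\<close>, the body \<open>C t\<close> stays away from the boundary
   of \<open>A\<close> by at least \<open>t * \<delta>\<close> in direction \<open>v\<close>:
   normals seen from \<open>y\<close> are handled by the indentation of \<open>B\<close>, the others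
   by the distance of \<open>y\<close> from their hyperplanes.\<close>
 have layer: "x + (t * \<delta>) *R v \<in> A" if t: "0 <= t" "t <= 1/2" and x: "x \<in> C t" "norm (x - y) <= \<delta> / 2" for x t
 proof (rule ccontr)
  assume "x + (t * \<delta>) *R v \<notin> A"
  then obtain w where w: "norm w = 1" "?h A w < (x + (t * \<delta>) *R v) \<bullet> w" using separating_support[OF A(1)] by blast
  have "v \<bullet> w <= 1" using norm_cauchy_schwarz[of v w] v w by simp
  hence "(t * \<delta>) * (v \<bullet> w) <= (t * \<delta>) * 1" using t \<delta> by (intro mult_left_mono) auto
  hence lt: "?h A w < x \<bullet> w + t * \<delta>" using w(2) by (simp add: inner_add_left)
  from \<delta>(2)[OF w(1)] show False
  proof
   assume d: "\<delta> <= ?h A w - ?h B w"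
   obtain a b where ab: "x = (1 - t) *R a + t *R b" "a \<in> A" "b \<in> B" using x(1) by (auto simp: C_def set_plus_def)
   have "x \<bullet> w = (1 - t) * (a \<bullet> w) + t * (b \<bullet> w)" by (simp add: ab inner_add_left)
   also have "... <= (1 - t) * ?h A w + t * (?h A w - \<delta>)"
    using support_upper[OF cA(1) ab(2), of w] support_upper[of B b w] B ab d t by (intro add_mono mult_left_mono) (auto simp: convex_body_def)
   finally show False using lt by (simp add: algebra_simps)
  next
   assume d: "\<delta> <= ?h A w - y \<bullet> w"
   have "(x - y) \<bullet> w <= \<delta> / 2" using norm_cauchy_schwarz[of "x - y" w] w(1) x(2) by simp
   moreover have "t * \<delta> <= 1/2 * \<delta>" using t \<delta> by (intro mult_right_mono) auto
   ultimately show False using lt d by (simp add: inner_diff_left)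
  qed
 qed
 define q where "q = min (\<delta> / 8) (norm (y - o') / 2)"
 have q: "0 < q" "q <= \<delta> / 8" "q < norm (y - o')" using \<delta>(1) yo by (auto simp: q_def min_less_iff_disj)
 have "y - q *R v \<in> interior A"
 proof -
  have "y - (q / norm (y - o')) *R (y - o') \<in> interior A"
   using cA(2) o' yA q closure_subset yo by (intro mem_interior_closure_convex_shrink) auto
  thus ?thesis by (simp add: v_def)
 qed
 then obtain r1 where r1: "r1 > 0" "ball (y - q *R v) r1 \<subseteq> A" using mem_interior by blast
 have "y + q *R v \<notin> A" using frontier_outward[OF A(1) o' y, of "q / norm (y - o')"] q yo by (simp add: v_def)
 hence "y + q *R v \<in> - A" "open (- A)" using cA compact_imp_closed by auto
 then obtain r2 where r2: "r2 > 0" "ball (y + q *R v) r2 \<subseteq> - A" by (meson openE)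
 define r where "r = min (\<delta> / 8) (min r1 r2)"
 have r: "0 < r" "r <= \<delta> / 8" "r <= r1" "r <= r2" using r1 r2 \<delta> by (auto simp: r_def)
 define Z where "Z = ball (y - q *R v) r"
 have volZ: "0 < vol Z" using r by (intro vol_pos_of_open[of Z Z]) (auto simp: Z_def)
 \<comment> \<open>Marching from \<open>z\<close> in direction \<open>v\<close> with stride
   \<open>t * \<delta>\<close>, the last point inside \<open>A\<close> lies near \<open>y\<close>
   and by \<open>layer\<close> cannot belong to \<open>C t\<close>. The march is shorter than
   \<open>2 * q\<close>, which is at most \<open>\<delta> / 4\<close>, hence the bound on the number
   of strides.\<close>
 have cover: "\<exists>k. real k * (4 * t) <= 1 & z + (real k * (t * \<delta>)) *R v \<in> A - C t" if z: "z \<in> Z" and t: "0 < t" "t <= 1/2" for z t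
 proof -
  define s where "s = t * \<delta>"
  have s: "0 < s" "s <= \<delta> / 2" using t \<delta> by (auto simp: s_def)
  have zA: "z \<in> A" using z r r1 by (auto simp: Z_def)
  have zT: "z + (2 * q) *R v \<notin> A"
  proof -
   have "(2 * q) *R v = q *R v + q *R v" by (simp flip: scaleR_add_left)
   hence "dist (y + q *R v) (z + (2 * q) *R v) = dist (y - q *R v) z" by (simp add: dist_norm algebra_simps)
   hence "z + (2 * q) *R v \<in> ball (y + q *R v) r2" using z r by (simp add: Z_def)
   thus ?thesis using r2 by blast
  qed
  have out: "z + a *R v \<notin> A" if "2 * q <= a" for a
  proof
   assume a: "z + a *R v \<in> A"
   have "(1 - 2 * q / a) *R z + (2 * q / a) *R (z + a *R v) \<in> A" using zA a q that by (intro convexD_alt[OF cA(2)]) auto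
   moreover have "(1 - 2 * q / a) *R z + (2 * q / a) *R (z + a *R v) = z + (2 * q) *R v" using q that by (simp add: algebra_simps)
   ultimately show False using zT by simp
  qed
  define l where "l = (LEAST k. z + (real k * s) *R v \<notin> A)"
  obtain N :: nat where "2 * q / s <= real N" using real_arch_simple by blast
  hence "z + (real N * s) *R v \<notin> A" using out s by (simp add: field_simps)
  hence l: "z + (real l * s) *R v \<notin> A" unfolding l_def by (rule LeastI)
  then obtain k where k: "l = Suc k" using zA by (cases l) auto
  have "k < (LEAST k. z + (real k * s) *R v \<notin> A)" using k by (simp add: l_def)
  hence kA: "z + (real k * s) *R v \<in> A" using not_less_Least by blast
  hence ks: "real k * s < 2 * q" using out[of "real k * s"] by argo
  let ?x = "z + (real k * s) *R v"
  have "norm (?x - y) <= \<delta> / 2"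
  proof -
   have "?x - y = (z - (y - q *R v)) + (real k * s - q) *R v" by (simp add: algebra_simps)
   also have "norm ... <= norm (z - (y - q *R v)) + norm ((real k * s - q) *R v)" by (rule norm_triangle_ineq)
   also have "... <= r + q" using z ks v s q by (intro add_mono) (auto simp: Z_def dist_norm norm_minus_commute abs_le_iff intro: less_imp_le)
   finally show ?thesis using r q by simp
  qed
  moreover have "?x + (t * \<delta>) *R v \<notin> A" using l by (simp add: k s_def algebra_simps)
  ultimately have "?x \<notin> C t" using layer[of t ?x] t by auto
  moreover have "real k * (4 * t) * \<delta> = 4 * (real k * s)" by (simp add: s_def)
  hence "real k * (4 * t) * \<delta> <= 1 * \<delta>" using ks q by linarith
  hence "real k * (4 * t) <= 1" using \<delta> by simp
  ultimately show ?thesis using kA by (auto simp: s_def)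
 qed
 \<comment> \<open>A number of translates of \<open>A - C t\<close> of order \<open>1 / t\<close>
   covers the fixed ball \<open>Z\<close>, so the loss is at least linear in \<open>t\<close>. This
   contradicts the quadratic bound.\<close>
 have loss: "vol Z * t <= vol A - vol (C t)" if t: "0 < t" "t <= 1/2" for t
 proof -
  let ?G = "A - C t"
  have lmG: "?G \<in> lmeasurable" using A cC by (intro fmeasurable.Diff) (auto intro: body_lmeasurable)
  define N where "N = nat \<lfloor>1 / (4 * t)\<rfloor>"
  let ?T = "%k. (+) (- (real k * (t * \<delta>)) *R v) ` ?G"
  have lmT: "?T k \<in> lmeasurable" for k by (rule measurable_translation[OF lmG])
  have "Z \<subseteq> (\<Union>k\<in>{..N}. ?T k)"
  proof
   fix z assume "z \<in> Z"
   from cover[OF this t] obtain k where k: "real k * (4 * t) <= 1" "z + (real k * (t * \<delta>)) *R v \<in> ?G" by blast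
   have "k <= N" using k(1) t by (simp add: N_def le_nat_floor field_simps)
   moreover have "z \<in> ?T k" using k(2) by (auto simp: image_iff intro!: bexI[of _ "z + (real k * (t * \<delta>)) *R v"])
   ultimately show "z \<in> (\<Union>k\<in>{..N}. ?T k)" by blast
  qed
  hence "vol Z <= vol (\<Union>k\<in>{..N}. ?T k)"
   using lmT by (intro vol_mono fmeasurable.finite_UN) (auto simp: Z_def)
  also have "... <= (\<Sum>k\<in>{..N}. vol (?T k))"
   using lmT by (intro measure_UNION_le) (auto intro: fmeasurableD)
  also have "... = (real N + 1) * vol ?G" by (simp only: measure_translation) simp
  finally have "vol Z * t <= (real N + 1) * t * vol ?G" using t by (simp add: mult.commute mult.left_commute)
  also have "(real N + 1) * t <= 1"
  proof -
   have "real N <= 1 / (4 * t)" using t by (simp add: N_def)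
   hence "real N * t <= 1 / (4 * t) * t" using t by (intro mult_right_mono) auto
   thus ?thesis using t by (simp add: algebra_simps)
  qed
  hence "(real N + 1) * t * vol ?G <= 1 * vol ?G" by (intro mult_right_mono) auto
  also have "vol ?G = vol A - vol (C t)" using A cC CA t by (intro measurable_measure_Diff body_lmeasurable fmeasurableD) auto
  finally show ?thesis by simp
 qed
 define c where "c = (real ?n - 1)\<^sup>2 * vol A"
 have "0 <= - vol Z + e * (c + 2 * vol Z)" if e: "e > 0" for e
 proof (cases "e <= 1/2")
  case True
  have "vol Z * e <= c * e * e" using loss[OF e True] volC[of e] e True by (simp add: c_def power2_eq_square algebra_simps)
  hence "vol Z <= c * e" using e by simp
  moreover have "0 <= e * (2 * vol Z)" using e by simp
  ultimately show ?thesis unfolding distrib_left by (simp add: mult.commute)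
 next
  case False
  have "1/2 * (2 * vol Z) <= e * (c + 2 * vol Z)" using False volZ volA by (intro mult_mono) (auto simp: c_def)
  thus ?thesis by simp
 qed
 hence "0 <= - vol Z" by (rule closed_limit_nonneg)
 thus False using volZ by simp
qed

text \<open>The volume of \<open>cball 0 R\<close> plus \<open>t Q\<close> grows at most like
  \<open>t ^ dim W\<close>, while this mixed volume is, up to a binomial, its coefficient of
  \<open>t ^ k\<close> with \<open>k\<close> larger than \<open>dim W\<close>.\<close>

lemma flat_mixvol_zero:
 fixes Q B :: "'a::euclidean_space set"
 assumes W: "subspace W" "dim W < k" and Q: "convex_body Q" "Q \<subseteq> W \<inter> cball 0 1" and k: "k <= DIM('a)" and R: "0 < R"
 shows "mixvol (replicate (DIM('a) - k) (cball 0 R) @ replicate k Q) = 0"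
proof -
 let ?n = "DIM('a)" and ?d = "dim W" and ?B = "cball (0::'a) R"
 obtain S where S: "S \<subseteq> W" "pairwise orthogonal S" "!!x. x \<in> S ==> norm x = 1" "independent S" "card S = ?d" "span S = W"
  by (rule orthonormal_basis_subspace[OF W(1)]) blast
 let ?V = "{y. \<forall>x\<in>W. orthogonal x y}"
 have V: "subspace ?V" "dim ?V + ?d = ?n"
  using dim_subspace_orthogonal_to_vectors[OF W(1) subspace_UNIV subset_UNIV] by (simp_all add: subspace_orthogonal_to_vectors)
 obtain U where U: "U \<subseteq> ?V" "pairwise orthogonal U" "!!x. x \<in> U ==> norm x = 1" "card U = dim ?V"
  by (rule orthonormal_basis_subspace[OF V(1)]) blast
 let ?S = "S \<union> U"
 have orth: "orthogonal a b" if "a \<in> S" "b \<in> U" for a b using that S(1) U(1) by blast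
 have po: "pairwise orthogonal ?S" unfolding pairwise_def
 proof (intro ballI impI)
  fix x y assume xy: "x \<in> ?S" "y \<in> ?S" "x ~= y"
  show "orthogonal x y" using xy S(2) U(2) orth[of x y] orth[of y x] by (auto simp: pairwise_def orthogonal_def inner_commute)
 qed
 have n1: "!!x. x \<in> ?S ==> norm x = 1" using S(3) U(3) by blast
 have ind: "independent ?S" using n1 po by (intro pairwise_orthogonal_independent) force+
 have fin: "finite ?S" using ind by (rule independent_imp_finite)
 have "S \<inter> U = {}" using orth n1 by (auto simp: orthogonal_def) (metis norm_eq_1 zero_neq_one)
 hence card: "card ?S = ?n" using fin S(5) U(4) V(2) by (simp add: card_Un_disjoint)
 define c where "c = (4 * (R + 1)) ^ ?n * vol (cell ?S (%b. 1))"
 have bound: "vol (?B + t \<odot> Q) <= c * t ^ ?d" if t: "t \<ge> 1" for t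
 proof -
  define f where "f b = (if b \<in> S then 4 * (R + 1) * t else 4 * (R + 1) * 1)" for b
  define p where "p = (\<Sum>b\<in>?S. (f b / 2) *R b)"
  have pb: "b \<bullet> p = f b / 2" if "b \<in> ?S" for b
  proof -
   have "b \<bullet> p = (\<Sum>a\<in>?S. if a = b then f b / 2 else 0)" unfolding p_def inner_sum_right
    using that po n1 by (intro sum.cong refl) (auto simp: pairwise_def orthogonal_def norm_eq_1)
   thus ?thesis using fin that by simp
  qed
  have "(+) p ` (?B + t \<odot> Q) \<subseteq> cell ?S f"
  proof
   fix x assume "x \<in> (+) p ` (?B + t \<odot> Q)"
   then obtain a q where x: "x = p + (a + t *R q)" "norm a <= R" "q \<in> Q" by (auto simp: set_plus_def)
   have q: "q \<in> span S" "norm q <= 1" using x Q S(6) by auto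
   show "x \<in> cell ?S f" unfolding cell_def
   proof (intro CollectI ballI)
    fix b assume b: "b \<in> ?S"
    have ba: "\<bar>b \<bullet> a\<bar> <= R" using Cauchy_Schwarz_ineq2[of b a] n1[OF b] x by simp
    have bq: "\<bar>b \<bullet> (t *R q)\<bar> < (if b \<in> S then (R + 1) * t else 1)"
    proof (cases "b \<in> S")
     case True
     have "\<bar>b \<bullet> q\<bar> <= 1" using Cauchy_Schwarz_ineq2[of b q] n1[OF b] q by simp
     hence "t * \<bar>b \<bullet> q\<bar> <= t * 1" using t by (intro mult_left_mono) auto
     moreover have "0 < R * t" using R t by simp
     ultimately have "t * \<bar>b \<bullet> q\<bar> < (R + 1) * t" unfolding distrib_right by linarith
     thus ?thesis using True t by (simp add: abs_mult)
    next
     case False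
     hence "orthogonal b s" if "s \<in> S" for s using b that orth orthogonal_commute by blast
     hence "orthogonal b q" by (intro orthogonal_to_span[OF q(1)])
     thus ?thesis using False by (simp add: orthogonal_def)
    qed
    have "R <= R * t" using mult_left_mono[OF t, of R] R by simp
    have "\<bar>b \<bullet> a + b \<bullet> (t *R q)\<bar> <= \<bar>b \<bullet> a\<bar> + \<bar>b \<bullet> (t *R q)\<bar>" by (rule abs_triangle_ineq)
    hence "\<bar>b \<bullet> a + b \<bullet> (t *R q)\<bar> < R + (if b \<in> S then (R + 1) * t else 1)" using ba bq by linarith
    also have "... <= f b / 2"
    proof (cases "b \<in> S")
     case True
     hence "f b / 2 = 2 * (R * t) + 2 * t" "(R + 1) * t = R * t + t" by (simp_all add: f_def algebra_simps)
     thus ?thesis unfolding if_P[OF True] using \<open>R <= R * t\<close> t R by linarith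
    qed (use R in \<open>simp add: f_def\<close>)
    finally have "\<bar>b \<bullet> a + b \<bullet> (t *R q)\<bar> < f b / 2" .
    thus "0 < b \<bullet> x & b \<bullet> x <= f b" using pb[OF b] unfolding x(1) inner_add_right by linarith
   qed
  qed
  moreover have "?B + t \<odot> Q \<in> lmeasurable" using Q R by (intro body_lmeasurable body_plus body_dilate) auto
  ultimately have "vol (?B + t \<odot> Q) <= vol (cell ?S f)"
   using vol_mono[OF measurable_translation cell_lmeasurable[OF ind card]] by (metis measure_translation)
  also have "... = (\<Prod>b\<in>?S. f b) * vol (cell ?S (%b. 1))" using t R by (intro vol_cell ind card) (auto simp: f_def)
  also have "(\<Prod>b\<in>?S. f b) = (\<Prod>b\<in>?S. 4 * (R + 1)) * (\<Prod>b\<in>?S. if b \<in> S then t else 1)"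
   unfolding prod.distrib[symmetric] by (rule prod.cong) (auto simp: f_def)
  also have "(\<Prod>b\<in>?S. if b \<in> S then t else 1) = t ^ ?d" using fin S(5) by (simp add: prod.If_cases Int_absorb1)
  finally show ?thesis by (simp add: card c_def mult_ac del: distrib_left_numeral)
 qed
 have Bb: "convex_body ?B" using R by simp
 let ?w = "qm k ?B Q"
 have w0: "0 <= qm i ?B Q" if "i <= ?n" for i unfolding qm_def using that Bb Q by (intro mixvol_nonneg) auto
 have le: "?w * t <= c" if t: "t \<ge> 1" for t
 proof -
  have "vol (?B + t \<odot> Q) = (\<Sum>i=0..?n. real (?n choose i) * qm i ?B Q * t ^ i)"
   using steiner_coefficients_qm[OF Bb Q(1)] t by (simp add: steiner_coefficients_def)
  also have "... \<ge> (\<Sum>i\<in>{k}. real (?n choose i) * qm i ?B Q * t ^ i)" using k t w0 by (intro sum_mono2) auto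
  finally have "real (?n choose k) * ?w * t ^ k <= vol (?B + t \<odot> Q)" by simp
  moreover have "1 * ?w * t ^ Suc ?d <= real (?n choose k) * ?w * t ^ k"
   using W(2) k t w0 by (intro mult_mono power_increasing) (auto simp: Suc_le_eq zero_less_binomial)
  ultimately have "?w * t * t ^ ?d <= c * t ^ ?d" using bound[OF t] by (simp add: mult.assoc)
  thus ?thesis using t by simp
 qed
 have "?w <= 0"
 proof (rule ccontr)
  assume w: "\<not> ?w <= 0"
  have "?w * (\<bar>c\<bar> / ?w + 1) <= c" using w by (intro le) simp
  moreover have "?w * (\<bar>c\<bar> / ?w + 1) = \<bar>c\<bar> + ?w" using w by (simp add: field_simps)
  ultimately show False using w by simp
 qed
 thus ?thesis using w0[OF k] by (simp add: qm_def)
qed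

section \<open>Tangential bodies\<close>

text \<open>A cross-section of the normal cone at \<open>y\<close>. With \<open>p\<close> interior
  and \<open>y\<close> on the frontier it is a compact convex base of the cone, so that extreme rays
  become extreme points.\<close>

definition normal_base :: "'a::euclidean_space set => 'a => 'a => 'a set" where
 "normal_base A y p = {w. y \<bullet> w = support_function A w & w \<bullet> (y - p) = 1}"

text \<open>The normal cone including 0, unlike \<open>outer_normals\<close>, so that it is closed
  under nonnegative combinations.\<close>

abbreviation normals :: "'a::euclidean_space set => 'a => 'a set" where
 "normals A y \<equiv> {w. y \<bullet> w = support_function A w}"

lemma support_zero [simp]: "convex_body A ==> support_function A 0 = 0"
 using support_attained[of A 0] by auto

context
 fixes A :: "'a::euclidean_space set" and y p :: 'a
 assumes A: "convex_body A" and y: "y \<in> frontier A" and p: "p \<in> interior A"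
begin

lemma normals_scale: "w \<in> normals A y ==> 0 <= c ==> c *R w \<in> normals A y"
 using A by (simp add: support_scale)

lemma normals_add:
 assumes "w \<in> normals A y" "w' \<in> normals A y" shows "w + w' \<in> normals A y"
proof -
 have "y \<bullet> (w + w') <= support_function A (w + w')" by (rule support_upper[OF bodyD(1)[OF A] body_frontier[OF A y]])
 thus ?thesis using support_add_le[OF A, of w w'] assms by (simp add: inner_add_right)
qed

lemma normals_pos: "w \<in> normals A y ==> w ~= 0 ==> 0 < w \<bullet> (y - p)"
 using support_gt_interior[OF A p, of w] unfolding inner_diff_right inner_commute[of w] by simp

lemma normals_normalize: "w \<in> normals A y ==> w ~= 0 ==> (1 / (w \<bullet> (y - p))) *R w \<in> normal_base A y p"
 using normals_scale[of w "1 / (w \<bullet> (y - p))"] normals_pos[of w] by (simp add: normal_base_def)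

lemma normal_base_compact_convex: "compact (normal_base A y p)" "convex (normal_base A y p)" "normal_base A y p ~= {}"
proof -
 obtain r where r: "r > 0" "cball p r \<subseteq> A" using p by (auto simp: mem_interior_cball)
 have "closed (normal_base A y p)" unfolding normal_base_def
  by (intro closed_Collect_conj closed_Collect_eq continuous_intros support_continuous A)
 moreover have "norm w <= 1 / r" if "w \<in> normal_base A y p" for w
 proof -
  have w: "y \<bullet> w = support_function A w" "w \<bullet> (y - p) = 1" "w ~= 0" using that by (auto simp: normal_base_def)
  have "p + (r / norm w) *R w \<in> A" using r w by (intro subsetD[OF r(2)]) (simp add: dist_norm)
  hence "(p + (r / norm w) *R w) \<bullet> w <= y \<bullet> w" unfolding w(1) using A by (intro support_upper) (auto simp: convex_body_def)
  moreover have "(r / norm w) * (w \<bullet> w) = r * norm w" using w by (simp add: dot_square_norm power2_eq_square)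
  ultimately have "p \<bullet> w + r * norm w <= y \<bullet> w" by (simp add: inner_add_left)
  hence "r * norm w <= 1" using w(2) by (simp add: inner_diff_right inner_commute)
  thus ?thesis using r by (simp add: field_simps)
 qed
 ultimately show "compact (normal_base A y p)" by (meson bounded_iff compact_eq_bounded_closed)
 show "convex (normal_base A y p)"
 proof (rule convexI)
  fix w w' and s t :: real assume a: "w \<in> normal_base A y p" "w' \<in> normal_base A y p" "0 <= s" "0 <= t" "s + t = 1"
  have "s *R w + t *R w' \<in> normals A y" using a by (intro normals_add normals_scale) (auto simp: normal_base_def)
  thus "s *R w + t *R w' \<in> normal_base A y p" using a by (simp add: normal_base_def inner_add_left)
 qed
 have yA: "y \<in> A" using A y by (rule body_frontier)
 have "interior A ~= {}" using p by blast
 hence "rel_interior A = interior A" by (rule rel_interior_nonempty_interior)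
 then obtain a where a: "a ~= 0" "!!z. z \<in> A ==> a \<bullet> y <= a \<bullet> z"
  using supporting_hyperplane_rel_boundary[OF bodyD(2)[OF A] yA] y by (metis DiffE frontier_def)
 have "support_function A (- a) <= y \<bullet> - a" using a(2) by (intro support_le[OF A]) (simp add: inner_commute)
 hence "- a \<in> normals A y" using support_upper[of A y "- a"] A yA by (simp add: convex_body_def)
 from normals_normalize[OF this] show "normal_base A y p ~= {}" using a(1) by auto
qed

end

context
 fixes A B :: "'a::euclidean_space set" and p :: 'a
 assumes A: "convex_body A" and B: "convex_body B" and p: "p \<in> interior A"
  and reg: "!!y. y \<in> frontier A ==> \<exists>w. w ~= 0 & y \<bullet> w = support_function A w & support_function B w = support_function A w"
begin

text \<open>The segment from \<open>p\<close> to \<open>z\<close> leaves \<open>A\<close> at a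
  frontier point; the common normal that \<open>reg\<close> provides there increases along the
  segment and so separates \<open>z\<close>.\<close>

lemma common_support_separation:
 assumes z: "z \<notin> A"
 shows "\<exists>w. norm w = 1 & support_function B w = support_function A w & support_function A w < z \<bullet> w"
proof -
 have "z - p ~= 0" using z p interior_subset by auto
 then obtain d where d: "0 < d" "p + d *R (z - p) \<in> frontier A" "!!e. 0 <= e ==> e < d ==> p + e *R (z - p) \<in> interior A"
  using ray_to_frontier[of A p "z - p"] A p by (metis compact_imp_bounded convex_body_def)
 let ?y = "p + d *R (z - p)"
 have "\<not> 1 < d" using d(3)[of 1] z interior_subset by auto
 moreover have "d ~= 1" using body_frontier[OF A d(2)] z by auto
 ultimately have d1: "d < 1" by simp
 obtain w where w: "w ~= 0" "?y \<bullet> w = support_function A w" "support_function B w = support_function A w" using reg[OF d(2)] by blast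
 have "p \<bullet> w < ?y \<bullet> w" using support_gt_interior[OF A p w(1)] w(2) by simp
 hence "0 < d * ((z - p) \<bullet> w)" by (simp add: inner_add_left)
 hence "0 < (z - p) \<bullet> w" using d(1) by (simp add: zero_less_mult_iff)
 hence "0 < (1 - d) * ((z - p) \<bullet> w)" using d1 by simp
 hence lt: "support_function A w < z \<bullet> w" unfolding w(2)[symmetric] by (simp add: inner_add_left inner_diff_left algebra_simps)
 have "(1 / norm w) * support_function A w < (1 / norm w) * (z \<bullet> w)" using lt w(1) by (intro mult_strict_left_mono) auto
 thus ?thesis using w A B support_scale[OF A, of "1 / norm w" w] support_scale[OF B, of "1 / norm w" w]
  by (intro exI[of _ "(1 / norm w) *R w"]) simp
qed

text \<open>\<open>reg\<close> provides some common normal at each frontier point, not every extreme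
  one. If \<open>u\<close> were not common, a direction \<open>d\<close> would separate it strictly
  from the common normals at \<open>y\<close>. The point \<open>y + t d\<close> then lies outside
  \<open>A\<close>, hence beyond a common supporting hyperplane with
  \<open>d \<bullet> w > 0\<close>, and a compactness gap excludes this for small
  \<open>t\<close>.\<close>

lemma extreme_base_common_support:
 assumes y: "y \<in> frontier A" and u: "u extreme_point_of normal_base A y p"
 shows "support_function B u = support_function A u"
proof (rule ccontr)
 assume no: "\<not> ?thesis"
 let ?S = "normal_base A y p" and ?h = "support_function A"
 note S = normal_base_compact_convex[OF A y p]
 define R where "R = ?S \<inter> {w. support_function B w = ?h w}"
 have cl: "closed {w. support_function B w = ?h w}" by (intro closed_Collect_eq support_continuous A B)
 hence R: "compact R" "R \<subseteq> ?S" using S by (auto simp: R_def compact_Int_closed)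
 have uS: "u \<in> ?S" using u by (simp add: extreme_point_of_def)
 have hull: "convex hull R \<subseteq> ?S" using R(2) S(2) by (rule hull_minimal)
 have "u \<notin> convex hull R"
 proof
  assume "u \<in> convex hull R"
  hence "u extreme_point_of (convex hull R)" using u hull unfolding extreme_point_of_def by blast
  hence "u \<in> R" by (rule extreme_point_of_convex_hull)
  thus False using no by (simp add: R_def)
 qed
 then obtain a b where ab: "a \<bullet> u < b" "!!w. w \<in> R ==> b < a \<bullet> w"
  using separating_hyperplane_closed_point[of "convex hull R" u] R(1) compact_convex_hull compact_imp_closed hull_inc by (metis convex_convex_hull)
 \<comment> \<open>On the base \<open>(y - p) \<bullet> w = 1\<close>, so the constant
   \<open>b\<close> is absorbed and the affine separation becomes a linear one, valid on the whole
   cone.\<close>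
 define d where "d = b *R (y - p) - a"
 have "d \<bullet> w = b - a \<bullet> w" if "w \<in> ?S" for w
 proof -
  have "(y - p) \<bullet> w = 1" using that by (simp add: normal_base_def inner_commute)
  moreover have "d \<bullet> w = b * ((y - p) \<bullet> w) - a \<bullet> w" by (simp only: d_def inner_diff_left inner_scaleR_left)
  ultimately show ?thesis by simp
 qed
 hence du: "0 < d \<bullet> u" and dR: "!!w. w \<in> R ==> d \<bullet> w < 0" using ab uS R(2) by auto
 define T where "T = sphere 0 1 \<inter> {w. support_function B w = ?h w} \<inter> {w. 0 <= d \<bullet> w}"
 have "compact T" unfolding T_def by (intro compact_Int_closed compact_sphere cl closed_Collect_le continuous_intros)
 have yA: "y \<in> A" using A y by (rule body_frontier)
 have gpos: "0 < ?h w - y \<bullet> w" if "w \<in> T" for w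
 proof -
  have "w ~= 0" using that by (auto simp: T_def)
  have "y \<bullet> w ~= ?h w"
  proof
   assume "y \<bullet> w = ?h w"
   hence m: "(1 / (w \<bullet> (y - p))) *R w \<in> ?S" "0 < w \<bullet> (y - p)"
    using normals_normalize[OF A y p, of w] normals_pos[OF A y p, of w] \<open>w ~= 0\<close> by auto
   hence "(1 / (w \<bullet> (y - p))) *R w \<in> R" using that A B by (simp add: R_def T_def support_scale)
   from dR[OF this] show False using m(2) that by (simp add: T_def divide_less_0_iff)
  qed
  thus ?thesis using support_upper[of A y w] A yA by (simp add: convex_body_def)
 qed
 have "\<exists>m>0. \<forall>w\<in>T. m <= ?h w - y \<bullet> w"
 proof (cases "T = {}")
  case False
  have "continuous_on T (%w. ?h w - y \<bullet> w)" by (intro continuous_intros support_continuous A)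
  thus ?thesis using continuous_attains_inf[OF \<open>compact T\<close> False] gpos by blast
 qed (auto intro: exI[of _ 1])
 then obtain m where m: "m > 0" "!!w. w \<in> T ==> m <= ?h w - y \<bullet> w" by blast
 define t where "t = m / (norm d + 1)"
 have "0 < norm d + 1" using norm_ge_zero[of d] by linarith
 hence t: "0 < t" "t * norm d < m" using m(1) by (simp_all add: t_def pos_divide_less_eq)
 have "?h u < (y + t *R d) \<bullet> u" using uS du t by (simp add: normal_base_def inner_add_left)
 hence "y + t *R d \<notin> A" using support_upper[of A "y + t *R d" u] A by (auto simp: convex_body_def)
 from common_support_separation[OF this] obtain w where w: "norm w = 1" "support_function B w = ?h w" "?h w < y \<bullet> w + t * (d \<bullet> w)"
  by (auto simp: inner_add_left)
 have "y \<bullet> w <= ?h w" using support_upper[of A y w] A yA by (simp add: convex_body_def)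
 hence "0 < t * (d \<bullet> w)" using w(3) by linarith
 hence "w \<in> T" using w t(1) by (simp add: T_def zero_less_mult_iff)
 moreover have "t * (d \<bullet> w) <= t * norm d" using norm_cauchy_schwarz[of d w] w(1) t(1) by (intro mult_left_mono) auto
 ultimately show False using m(2)[of w] w(3) t(2) by linarith
qed

end

text \<open>An extreme point \<open>u\<close> of the normal base is \<open>(j - 1)\<close>-extreme:
  a representation as a sum of j + 1 \<ge> 2 independent normals would put it inside a segment of
  the base. So the tangential condition applies to \<open>u\<close>.\<close>

lemma tangential_common_support:
 fixes E L :: "'a::euclidean_space set"
 assumes T: "tangential_body (DIM('a) - j) E L" and E: "convex_body E" and j: "0 < j" "j < DIM('a)" and y: "y \<in> frontier L"
 shows "\<exists>w. w ~= 0 & y \<bullet> w = support_function L w & support_function E w = support_function L w"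
proof -
 let ?h = "support_function L"
 have L: "convex_body L" "interior L ~= {}" "E \<subseteq> L" and
  ext: "!!u. extreme_normal (j - 1) L u ==> supporting_hyperplane E {x. x \<bullet> u = ?h u}"
  using T j by (auto simp: tangential_body_def)
 obtain p where p: "p \<in> interior L" using L by blast
 obtain u where u: "u extreme_point_of normal_base L y p"
  using extreme_point_exists_convex normal_base_compact_convex[OF L(1) y p] by metis
 hence uS: "u \<in> normal_base L y p" and ext_u: "!!a b. a \<in> normal_base L y p ==> b \<in> normal_base L y p ==> u \<notin> open_segment a b"
  by (auto simp: extreme_point_of_def)
 have u0: "u ~= 0" and yu: "y \<bullet> u = ?h u" using uS by (auto simp: normal_base_def)
 have up: "u \<bullet> (y - p) = 1" using uS by (simp add: normal_base_def)
 have "extreme_normal (j - 1) L u"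
  unfolding extreme_normal_def
 proof (intro conjI notI)
  assume "\<exists>x\<in>frontier L. \<exists>S. S \<subseteq> outer_normals L x & independent S & card S = j - 1 + 2 & u = \<Sum>S"
  then obtain x S where x: "x \<in> frontier L" and S: "S \<subseteq> outer_normals L x" "independent S" "card S = Suc j" "u = \<Sum>S" using j by auto
  have fin: "finite S" using S(2) by (rule independent_imp_finite)
  have yL: "y \<in> L" "x \<in> L" using y x L by (auto intro: body_frontier)
  have le: "y \<bullet> w <= ?h w" "x \<bullet> w <= ?h w" for w using support_upper[OF bodyD(1)[OF L(1)]] yL by auto
  \<comment> \<open>The representing normals belong to a point \<open>x\<close> that may differ from
    \<open>y\<close>. Since \<open>u\<close> supports at \<open>y\<close>, the nonnegative terms sum
    to at most 0, so all of them are normals at \<open>y\<close> as well.\<close>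
  have "(\<Sum>w\<in>S. ?h w - y \<bullet> w) = x \<bullet> u - y \<bullet> u"
   using S(1) by (simp add: S(4) inner_sum_right sum_subtractf outer_normals_def subset_iff)
  also have "... <= 0" using le(2) yu by simp
  finally have "(\<Sum>w\<in>S. ?h w - y \<bullet> w) = 0" using le(1) by (meson antisym diff_ge_0_iff_ge sum_nonneg)
  hence N: "w \<in> normals L y" if "w \<in> S" for w using that fin le(1) by (simp add: sum_nonneg_eq_0_iff)
  have "S ~= {}" using S(3) by auto
  then obtain a where a: "a \<in> S" by blast
  define b where "b = \<Sum>(S - {a})"
  have ab: "u = a + b" using a fin S(4) by (simp add: b_def sum.remove)
  have bN: "b \<in> normals L y" unfolding b_def
  proof -
   have "finite F ==> F \<subseteq> S ==> \<Sum>F \<in> normals L y" for F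
    by (induction rule: finite_induct) (use L(1) N normals_add[OF L(1) y p] in auto)
   thus "\<Sum>(S - {a}) \<in> normals L y" using fin by blast
  qed
  have asp: "a \<notin> span (S - {a})" using S(2) a by (auto simp: dependent_def)
  have bsp: "b \<in> span (S - {a})" unfolding b_def by (intro span_sum span_base)
  have a0: "a ~= 0" using asp span_zero by metis
  have b0: "b ~= 0"
  proof
   assume "b = 0"
   have "S - {a} ~= {}"
   proof
    assume "S - {a} = {}"
    hence "card S <= 1" using fin by (metis Diff_eq_empty_iff card_mono card_1_singleton_iff finite.emptyI finite_insert One_nat_def)
    thus False using S(3) j by simp
   qed
   then obtain c where c: "c \<in> S - {a}" by blast
   hence "c = - (\<Sum>(S - {a} - {c}))" using \<open>b = 0\<close> fin by (simp add: b_def sum.remove[of "S - {a}" c] eq_neg_iff_add_eq_0)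
   also have "... \<in> span (S - {c})" by (intro span_neg span_sum span_base) auto
   finally show False using S(2) c by (auto simp: dependent_def)
  qed
  let ?q = "a \<bullet> (y - p)" and ?d = "b \<bullet> (y - p)"
  have pos: "0 < ?q" "0 < ?d" using normals_pos[OF L(1) y p] N[OF a] bN a0 b0 by blast+
  have one: "?q + ?d = 1" using up by (simp add: ab inner_add_left)
  have mem: "(1 / ?q) *R a \<in> normal_base L y p" "(1 / ?d) *R b \<in> normal_base L y p"
   using normals_normalize[OF L(1) y p] N[OF a] bN a0 b0 by blast+
  have "(1 / ?q) *R a ~= (1 / ?d) *R b"
  proof
   assume "(1 / ?q) *R a = (1 / ?d) *R b"
   hence "?q *R ((1 / ?q) *R a) = ?q *R ((1 / ?d) *R b)" by simp
   hence "a = (?q / ?d) *R b" using pos by simp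
   thus False using asp span_scale[OF bsp] by metis
  qed
  moreover have "1 - ?d = ?q" using one by simp
  hence "u = (1 - ?d) *R ((1 / ?q) *R a) + ?d *R ((1 / ?d) *R b)" using pos ab by simp
  ultimately have "u \<in> open_segment ((1 / ?q) *R a) ((1 / ?d) *R b)"
   unfolding in_segment using pos one by (intro conjI exI[of _ "?d"]) auto
  thus False using ext_u[OF mem] by blast
 qed (use u0 in blast)
 from ext[OF this] obtain u' where u': "{x. x \<bullet> u = ?h u} = {x. x \<bullet> u' = support_function E u'}" by (auto simp: supporting_hyperplane_def)
 obtain e where e: "e \<in> E" "e \<bullet> u' = support_function E u'" using support_attained[OF E] by blast
 hence "e \<bullet> u = ?h u" using u' by blast
 hence "?h u <= support_function E u" using support_upper[of E e u] E e by (simp add: convex_body_def)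
 moreover have "support_function E u <= ?h u" using E L by (intro support_mono) (auto simp: convex_body_def)
 ultimately show ?thesis using u0 yu by (intro exI[of _ u]) auto
qed

text \<open>The nontrivial inclusion is tested only against normals common to \<open>E\<close> and
  \<open>L\<close>, where \<open>x + s E \<subseteq> L\<close> means exactly the support inequality
  of \<open>(1 - s) L\<close>.\<close>

lemma tangential_erosion:
 fixes E L :: "'a::euclidean_space set"
 assumes T: "tangential_body (DIM('a) - j) E L" and E: "convex_body E" and j: "0 < j" "j < DIM('a)" and s: "0 <= s" "s < 1"
 shows "{x. (%y. x + s *R y) ` E \<subseteq> L} = (1 - s) \<odot> L"
proof (intro equalityI subsetI)
 have L: "convex_body L" "interior L ~= {}" "E \<subseteq> L" using T by (auto simp: tangential_body_def)
 obtain p where p: "p \<in> interior L" using L by blast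
 fix x assume x: "x \<in> {x. (%y. x + s *R y) ` E \<subseteq> L}"
 have "(1 / (1 - s)) *R x \<in> L"
 proof (rule ccontr)
  assume "(1 / (1 - s)) *R x \<notin> L"
  from common_support_separation[OF L(1) E p tangential_common_support[OF T E j] this]
  obtain w where w: "support_function E w = support_function L w" "support_function L w < (1 / (1 - s)) * (x \<bullet> w)" by auto
  obtain e where e: "e \<in> E" "e \<bullet> w = support_function E w" using support_attained[OF E] by blast
  have "(x + s *R e) \<bullet> w <= support_function L w" using x e(1) L by (intro support_upper) (auto simp: convex_body_def)
  hence "x \<bullet> w <= (1 - s) * support_function L w" using e w by (simp add: inner_add_left algebra_simps)
  thus False using w(2) s by (simp add: field_simps)
 qed
 hence "(1 - s) *R ((1 / (1 - s)) *R x) \<in> (1 - s) \<odot> L" by blast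
 thus "x \<in> (1 - s) \<odot> L" using s by simp
next
 fix x assume "x \<in> (1 - s) \<odot> L"
 thus "x \<in> {x. (%y. x + s *R y) ` E \<subseteq> L}" using T s convexD_alt[of L _ _ s] by (auto simp: tangential_body_def convex_body_def)
qed

text \<open>Replacing \<open>E\<close> by \<open>L\<close> in one slot increases the mixed volume by
  an amount that is additive and nonnegative in any other slot and vanishes when that slot holds
  \<open>E\<close>. By smoothness it vanishes for all bodies there, which frees one copy of
  \<open>E\<close> per induction step.\<close>

lemma tangential_mixed_volumes:
 fixes E L :: "'a::euclidean_space set"
 assumes E: "smooth_body E" "convex_body E" "interior E ~= {}" and L: "convex_body L" "E \<subseteq> L"
  and b: "bodies Cs" "bodies Ds" and len: "length Cs + i + 1 = DIM('a)" "length Ds = i"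
  and eq: "mixvol (L # Cs @ replicate i E) = mixvol (E # Cs @ replicate i E)"
 shows "mixvol (L # Cs @ Ds) = mixvol (E # Cs @ Ds)"
 using b len eq
proof (induction i arbitrary: Cs Ds)
 case (Suc i)
 obtain D Ds' where Ds: "Ds = D # Ds'" using Suc.prems by (cases Ds) auto
 define V where "V Z X = mixvol (X # Z # Cs @ replicate i E)" for Z X
 have p: "mixvol (Z # (X # Cs) @ replicate i E) = V Z X" "mixvol (Z # Cs @ replicate (Suc i) E) = V Z E" for Z X
  unfolding V_def by (rule mixvol_perm, simp)+
 note bd = Suc.prems(1,3) E(2) L(1)
 have V: "V Z (X + Y) = V Z X + V Z Y" "0 <= t ==> V Z (t \<odot> X) = t * V Z X" "X \<subseteq> Y ==> V Z X <= V Z Y"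
  if "convex_body X" "convex_body Y" "convex_body Z" for X Y Z t
  unfolding V_def using bd that by (auto intro!: mixvol_add mixvol_dilate mixvol_mono)
 have "V L D - V E D = 0"
 proof (rule smooth_functional_zero[OF E])
  show "V L (X + Y) - V E (X + Y) = (V L X - V E X) + (V L Y - V E Y)" if "convex_body X" "convex_body Y" for X Y using V(1)[OF that] bd by simp
  show "V L (t \<odot> X) - V E (t \<odot> X) = t * (V L X - V E X)" if "convex_body X" "0 <= t" for X t
   using V(2)[OF that(1,1) _ that(2)] bd by (simp add: algebra_simps)
  show "0 <= V L X - V E X" if X: "convex_body X" for X
  proof -
   have "V Z X = mixvol (Z # X # Cs @ replicate i E)" for Z unfolding V_def by (rule mixvol_swap)
   moreover have "mixvol (E # X # Cs @ replicate i E) <= mixvol (L # X # Cs @ replicate i E)"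
    using bd X L by (intro mixvol_mono) auto
   ultimately show ?thesis by simp
  qed
  show "V L X - V E X - V E (cball 0 1) * e <= V L Y - V E Y"
   if "convex_body X" "convex_body Y" "0 <= e" "X \<subseteq> Y" "Y \<subseteq> X + cball 0 e" for X Y e
  proof -
   have "V E Y <= V E (X + e \<odot> cball 0 1)" using that E by (intro V(3)) (auto simp: cball_dilate[symmetric] intro: body_plus)
   hence "V E Y <= V E X + e * V E (cball 0 1)" using V(1)[of X "e \<odot> cball 0 1" E] V(2)[of "cball 0 1" X E e] that E by (simp add: body_dilate)
   thus ?thesis using V(3)[of X Y L] that L by (simp add: mult.commute)
  qed
  show "V L E - V E E = 0" using Suc.prems(5) unfolding p by simp
 qed (use Suc.prems Ds in auto)
 hence "mixvol (L # (D # Cs) @ replicate i E) = mixvol (E # (D # Cs) @ replicate i E)" unfolding p by simp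
 moreover have "bodies (D # Cs)" "bodies Ds'" "length (D # Cs) + i + 1 = DIM('a)" "length Ds' = i" using Suc.prems Ds by auto
 ultimately have fin: "mixvol (L # (D # Cs) @ Ds') = mixvol (E # (D # Cs) @ Ds')" using Suc.IH[of "D # Cs" Ds'] by blast
 have "mixvol (Z # (D # Cs) @ Ds') = mixvol (Z # Cs @ Ds)" for Z unfolding Ds by (rule mixvol_perm) simp
 from fin[unfolded this] show ?case .
qed simp

text \<open>The face of the normal cone at \<open>x\<close> that contains \<open>u\<close> in its relative interior spans a space of dimension at most \<open>j\<close>
  when \<open>u\<close> is \<open>(j - 1)\<close>-extreme.\<close>

lemma extreme_normal_face_dim:
 fixes L :: "'a::euclidean_space set"
 assumes L: "convex_body L" and x: "x \<in> frontier L" and p: "p \<in> interior L" and j: "0 < j"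
  and u: "extreme_normal (j - 1) L u" "u \<in> normals L x"
 shows "dim {v \<in> normals L x. \<exists>e>0. u - e *R v \<in> normals L x} <= j"
proof (rule ccontr)
 define G where "G = {v \<in> normals L x. \<exists>e>0. u - e *R v \<in> normals L x}"
 assume no: "\<not> dim {v \<in> normals L x. \<exists>e>0. u - e *R v \<in> normals L x} <= j"
 have u0: "u ~= 0" using u by (simp add: extreme_normal_def)
 note sc = normals_scale[OF L x p] and ad = normals_add[OF L x p]
 have "u \<in> G" using u(2) L by (auto simp: G_def intro!: exI[of _ 1])
 then obtain B where B: "{u} \<subseteq> B" "B \<subseteq> G" "independent B" "G \<subseteq> span B"
  using maximal_independent_subset_extend[of "{u}" G] u0 by (metis dependent_single empty_subsetI insert_subset)
 have "card B = dim G" using B by (intro basis_card_eq_dim) auto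
 hence "j <= card (B - {u})" using no B(1) by (simp add: G_def card_Diff_singleton)
 then obtain T where T: "T \<subseteq> B - {u}" "card T = j" "finite T" by (rule obtain_subset_with_card_n)
 have "\<forall>v\<in>T. \<exists>e>0. u - e *R v \<in> normals L x" using T B(2) by (auto simp: G_def)
 then obtain e where e: "!!v. v \<in> T ==> 0 < e v & u - e v *R v \<in> normals L x" by metis
 have Tne: "T ~= {}" using T j by auto
 define d where "d = Min (e ` T)"
 have d: "0 < d" "!!v. v \<in> T ==> d <= e v" using T(3) Tne e by (auto simp: d_def)
 define \<delta> where "\<delta> = d / real j"
 have \<delta>: "0 < \<delta>" "real j * \<delta> = d" using d j by (auto simp: \<delta>_def)
 \<comment> \<open>\<open>r\<close> is the average of the normals \<open>u - d v\<close> over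
   \<open>v\<close> in \<open>T\<close>, hence a normal. So \<open>u\<close> is the sum of
   \<open>r\<close> and the \<open>j\<close> vectors \<open>\<delta> v\<close>: j + 1 independent
   normals at \<open>x\<close>, one too many for an extreme \<open>u\<close>.\<close>
 define r where "r = u - \<delta> *R \<Sum>T"
 have step: "u - d *R v \<in> normals L x" if "v \<in> T" for v
 proof -
  have "(1 - d / e v) *R u + (d / e v) *R (u - e v *R v) \<in> normals L x"
   using e[OF that] d that u(2) by (intro ad sc) auto
  moreover have "(1 - d / e v) *R u + (d / e v) *R (u - e v *R v) = u - d *R v" using e[OF that] by (simp add: algebra_simps)
  ultimately show ?thesis by metis
 qed
 have sumN: "finite F ==> (!!v. v \<in> F ==> f v \<in> normals L x) ==> sum f F \<in> normals L x" for F :: "'a set" and f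
  by (induction rule: finite_induct) (use L ad in auto)
 have "(\<Sum>v\<in>T. (1 / real j) *R (u - d *R v)) \<in> normals L x" using T(3) step by (intro sumN sc) auto
 moreover have "(\<Sum>v\<in>T. (1 / real j) *R (u - d *R v)) = r"
  using j by (simp add: r_def scaleR_right.sum[symmetric] sum_subtractf scaleR_right_diff_distrib sum_constant_scaleR T(2) \<delta>_def)
 ultimately have rN: "r \<in> normals L x" by simp
 have iT: "independent T" using B(3) T(1) independent_mono by blast
 have uT: "u \<notin> span T" using B(1,3) T(1) span_mono[of T "B - {u}"] by (auto simp: dependent_def)
 define S where "S = (*R) \<delta> ` T"
 have sp: "span S \<subseteq> span T" unfolding S_def by (intro span_minimal) (auto intro: span_scale span_base)
 have rS: "r \<notin> span S"
 proof
  assume "r \<in> span S"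
  hence "r \<in> span T" using sp by blast
  hence "r + \<delta> *R \<Sum>T \<in> span T" by (rule span_add[OF _ span_scale[OF span_sum[OF span_base]]])
  thus False using uT by (simp add: r_def)
 qed
 have inj: "inj ((*R) \<delta> :: 'a => 'a)" using \<delta> by (simp add: inj_on_def)
 have iS: "independent S" unfolding S_def using iT inj by (intro linear_independent_injective_image) (auto intro: inj_on_subset)
 have finS: "finite S" "card S = j" using T inj by (auto simp: S_def card_image inj_on_subset)
 have sumS: "\<Sum>S = \<delta> *R \<Sum>T" unfolding S_def using inj by (subst sum.reindex) (auto intro: inj_on_subset simp: scaleR_right.sum)
 have "insert r S \<subseteq> outer_normals L x"
 proof -
  have "v \<in> normals L x" if "v \<in> T" for v using that T(1) B(2) by (auto simp: G_def)
  hence "S \<subseteq> normals L x" using sc \<delta> by (auto simp: S_def)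
  moreover have "0 \<notin> insert r S" using iS rS span_zero[of S] dependent_zero by auto
  ultimately show ?thesis using rN by (auto simp: outer_normals_def)
 qed
 moreover have "r \<notin> S" using rS span_base by blast
 hence "card (insert r S) = j - 1 + 2" "u = \<Sum>(insert r S)" using finS j sumS by (auto simp: r_def)
 moreover have "independent (insert r S)" using rS iS by (rule independent_insertI)
 ultimately show False using u(1) x unfolding extreme_normal_def by blast
qed

text \<open>\<open>Q\<close> is the unit ball of a subspace \<open>W\<close> of dimension below
  \<open>j\<close>, orthogonal to \<open>u\<close> and made of directions of the normal face around
  \<open>u\<close>. With \<open>A = L + Q\<close> and \<open>B = E + Q\<close>, mixed volumes with
  \<open>j\<close> or more copies of \<open>Q\<close> vanish and the others agree, so by
  \<open>volume_loss\<close> no frontier point of \<open>A\<close> is strictly indented. Adding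
  \<open>Q\<close> cuts the normal face around \<open>u\<close> down to a ray, so
  \<open>extreme_base_common_support\<close> reaches \<open>u\<close>.\<close>

lemma extreme_normal_common_support:
 fixes E L :: "'a::euclidean_space set"
 assumes E: "smooth_body E" "convex_body E" "interior E ~= {}" and L: "convex_body L" "interior L ~= {}" "E \<subseteq> L"
  and j: "0 < j" "j < DIM('a)" and eq: "qm (j - 1) L E = qm j L E" and u: "extreme_normal (j - 1) L u"
 shows "support_function E u = support_function L u"
proof -
 let ?n = "DIM('a)" and ?h = "support_function"
 obtain p where p: "p \<in> interior L" using L by blast
 obtain x where xL: "x \<in> L" and xu: "x \<bullet> u = ?h L u" using support_attained[OF L(1)] by blast
 have u0: "u ~= 0" using u by (simp add: extreme_normal_def)
 have x: "x \<in> frontier L" using support_hyperplane_frontier[OF bodyD(1)[OF L(1)] xL u0 xu] .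
 define G where "G = {v \<in> normals L x. \<exists>e>0. u - e *R v \<in> normals L x}"
 define W where "W = span G \<inter> {v. v \<bullet> u = 0}"
 note sc = normals_scale[OF L(1) x p]
 have uG: "u \<in> G" using xu L by (auto simp: G_def intro!: exI[of _ 1])
 have W: "subspace W" unfolding W_def by (intro subspace_inter subspace_span subspace_hyperplane2)
 have dW: "dim W < j"
 proof -
  have "span W \<subseteq> span G" "u \<notin> span W" using W u0 by (auto simp: span_eq_iff[THEN iffD2] W_def)
  hence "dim W < dim G" using uG span_base by (intro dim_psubset) blast
  also have "dim G <= j" unfolding G_def using xu by (intro extreme_normal_face_dim[OF L(1) x p j(1) u]) auto
  finally show ?thesis .
 qed
 define Q where "Q = W \<inter> cball 0 1"
 have Q: "convex_body Q" "Q \<subseteq> W \<inter> cball 0 1" "0 \<in> Q"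
  using W subspace_0[OF W] by (auto simp: Q_def convex_body_def closed_Int_compact closed_subspace subspace_imp_convex convex_Int)
 have hQ: "0 <= ?h Q w" for w using support_upper[OF bodyD(1)[OF Q(1)] Q(3), of w] by simp
 have hQ0: "?h Q w = 0 \<longleftrightarrow> (\<forall>g\<in>W. g \<bullet> w = 0)" for w
 proof
  assume w: "?h Q w = 0"
  have le: "g \<bullet> w <= 0" if "g \<in> W" for g
  proof -
   have "(1 / (norm g + 1)) *R g \<in> Q" using W that by (auto simp: Q_def subspace_scale divide_le_eq_1 add_nonneg_pos)
   hence "(1 / (norm g + 1)) * (g \<bullet> w) <= 0" using support_upper[OF bodyD(1)[OF Q(1)], of _ w] w by fastforce
   moreover have "0 < 1 / (norm g + 1)" by (simp add: add_nonneg_pos)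
   ultimately show ?thesis by (simp add: mult_le_0_iff divide_le_0_iff)
  qed
  show "\<forall>g\<in>W. g \<bullet> w = 0"
  proof
   fix g assume "g \<in> W"
   from le[OF this] le[of "- g"] subspace_neg[OF W this] show "g \<bullet> w = 0" by simp
  qed
 next
  assume "\<forall>g\<in>W. g \<bullet> w = 0"
  hence "?h Q w <= 0" by (intro support_le[OF Q(1)]) (auto simp: Q_def)
  thus "?h Q w = 0" using hQ by (metis antisym)
 qed
 define A where "A = L + Q"
 define B where "B = E + Q"
 have A: "convex_body A" and B: "convex_body B" "B \<subseteq> A" unfolding A_def B_def using E(2) L(1) Q(1) set_plus_mono2[OF L(3) order_refl] by (auto intro: body_plus)
 have LA: "L \<subseteq> A" using Q(3) by (force simp: A_def set_plus_def)
 have pA: "p \<in> interior A" using interior_mono[OF LA] p by blast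
 have hA: "?h A w = ?h L w + ?h Q w" and hB: "?h B w = ?h E w + ?h Q w" for w
  using E L Q by (auto simp: A_def B_def convex_body_def intro!: support_plus)
 have "mixvol (replicate (?n - 1) A @ [L]) = mixvol (replicate (?n - 1) A @ [E])"
 proof -
  have "mixvol (replicate (?n - 1 - i) L @ replicate i Q @ [L]) = mixvol (replicate (?n - 1 - i) L @ replicate i Q @ [E])" if i: "i <= ?n - 1" for i
  proof (cases "i <= j - 1")
   case True
   let ?D = "replicate (j - 1 - i) L @ replicate i Q"
   have p: "mixvol (replicate (?n - 1 - i) L @ replicate i Q @ [X]) = mixvol (X # replicate (?n - j) L @ ?D)" for X
   proof (rule mixvol_perm)
    have "?n - 1 - i = (?n - j) + (j - 1 - i)" using True j by simp
    thus "mset (replicate (?n - 1 - i) L @ replicate i Q @ [X]) = mset (X # replicate (?n - j) L @ ?D)" by (simp add: replicate_add)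
   qed
   have "mixvol (L # replicate (?n - j) L @ replicate (j - 1) E) = qm (j - 1) L E"
   proof -
    have "?n - (j - 1) = Suc (?n - j)" using j by simp
    thus ?thesis by (simp add: qm_def)
   qed
   moreover have "mixvol (E # replicate (?n - j) L @ replicate (j - 1) E) = qm j L E"
    unfolding qm_def using j by (intro mixvol_perm) (cases j, auto)
   ultimately have "mixvol (L # replicate (?n - j) L @ replicate (j - 1) E) = mixvol (E # replicate (?n - j) L @ replicate (j - 1) E)" using eq by simp
   thus ?thesis unfolding p using E L Q j True by (subst tangential_mixed_volumes[OF E L(1,3), where i = "j - 1"]) auto
  next
   case False
   obtain R where R: "R > 0" "L \<subseteq> cball 0 R"
    using compact_imp_bounded[OF bodyD(1)[OF L(1)]] unfolding bounded_pos by (auto simp: subset_iff)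
   have "mixvol (replicate (?n - 1 - i) L @ replicate i Q @ [X]) = 0" if X: "X \<subseteq> L" "convex_body X" for X
   proof -
    have "mixvol (replicate (?n - 1 - i) L @ replicate i Q @ [X]) = mixvol ((X # replicate (?n - 1 - i) L) @ replicate i Q)" by (rule mixvol_perm) simp
    also have "... <= mixvol (replicate (Suc (?n - 1 - i)) (cball 0 R) @ replicate i Q)"
    proof (rule mixvol_mono_list)
     have "list_all2 (\<subseteq>) (replicate k L) (replicate k (cball 0 R))" for k using R(2) by (induction k) auto
     thus "list_all2 (\<subseteq>) (X # replicate (?n - 1 - i) L) (replicate (Suc (?n - 1 - i)) (cball 0 R))" using X R by auto
    qed (use X R L Q i j in auto)
    also have "Suc (?n - 1 - i) = ?n - i" using i j by simp
    also have "mixvol (replicate (?n - i) (cball 0 R) @ replicate i Q) = 0" using False dW i by (intro flat_mixvol_zero[OF W _ Q(1,2) _ R(1)]) auto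
    finally have "mixvol (replicate (?n - 1 - i) L @ replicate i Q @ [X]) <= 0" .
    moreover have "0 <= mixvol (replicate (?n - 1 - i) L @ replicate i Q @ [X])" using X L Q i j by (intro mixvol_nonneg) auto
    ultimately show ?thesis by simp
   qed
   thus ?thesis using E L by auto
  qed
  thus ?thesis unfolding A_def using E L Q j mixvol_replicate_add[of L Q "[L]" "?n - 1"] mixvol_replicate_add[of L Q "[E]" "?n - 1"]
   by simp
 qed
 moreover have "mixvol (replicate (?n - 1) A @ [X + Q]) = mixvol (replicate (?n - 1) A @ [X]) + mixvol (replicate (?n - 1) A @ [Q])" if "convex_body X" for X
 proof -
  have "mixvol (replicate (?n - 1) A @ [Z]) = mixvol (Z # replicate (?n - 1) A)" for Z by (rule mixvol_perm) simp
  thus ?thesis using mixvol_add[of X Q "replicate (?n - 1) A"] that A Q j by simp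
 qed
 from this[OF L(1)] this[OF E(2)] calculation have AB: "mixvol (replicate (?n - 1) A @ [B]) = mixvol (replicate (?n - 1) A @ [L + Q])"
  unfolding B_def by simp
 have "mixvol (replicate (?n - 1) A @ [A]) = mixvol (replicate (Suc (?n - 1)) A)" by (rule mixvol_perm) (simp del: Suc_pred Suc_diff_1)
 hence volAB: "mixvol (replicate (?n - 1) A @ [B]) = vol A" using AB mixvol_self[OF A] j unfolding A_def[symmetric] by simp
 have reg: "\<exists>w. w ~= 0 & y \<bullet> w = ?h A w & ?h B w = ?h A w" if y: "y \<in> frontier A" for y
 proof (rule ccontr)
  assume no: "\<not> ?thesis"
  have "?h B w < ?h A w" if "w ~= 0" "y \<bullet> w = ?h A w" for w
   using no that support_mono[OF bodyD(1)[OF B(1)] bodyD(3)[OF B(1)] bodyD(1)[OF A] B(2), of w] by fastforce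
  from volume_loss[OF A _ B y this] show False using volAB pA by blast
 qed
 have QuW: "?h Q u = 0" unfolding hQ0 by (simp add: W_def)
 have xA: "x \<in> frontier A"
  by (rule support_hyperplane_frontier[OF bodyD(1)[OF A] _ u0]) (use xL LA xu QuW hA in auto)
 have base: "x \<bullet> w = ?h L w & ?h Q w = 0" if "w \<in> normals A x" for w
  using that hA[of w] hQ[of w] support_upper[OF bodyD(1)[OF L(1)] xL, of w] by simp
 define c where "c = u \<bullet> (x - p)"
 define u' where "u' = (1 / c) *R u"
 have uA: "u \<in> normals A x" using xu QuW hA by simp
 have c: "0 < c" using normals_pos[OF A xA pA uA u0] by (simp add: c_def)
 have u'S: "u' \<in> normal_base A x p" using normals_normalize[OF A xA pA uA u0] by (simp add: u'_def c_def)
 \<comment> \<open>A normal \<open>a\<close> involved in a convex representation of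
   \<open>u'\<close> lies in \<open>G\<close>. As a normal of \<open>A\<close> it is orthogonal to
   \<open>W\<close>, so its component orthogonal to \<open>u\<close>, which belongs to
   \<open>W\<close>, vanishes.\<close>
 have key: "a = u'" if ab: "a \<in> normal_base A x p" "b \<in> normal_base A x p" "0 < t" "t < 1" "u' = (1 - t) *R a + t *R b" for a b t
 proof -
  have N: "a \<in> normals L x" "b \<in> normals L x" "?h Q a = 0" "a \<bullet> (x - p) = 1" using base ab by (auto simp: normal_base_def)
  have "u - (c * (1 - t)) *R a = (c * t) *R b"
  proof -
   have "u = c *R u'" using c by (simp add: u'_def)
   thus ?thesis by (simp add: ab(5) scaleR_add_right)
  qed
  hence "u - (c * (1 - t)) *R a \<in> normals L x" using sc[OF N(2), of "c * t"] c ab by simp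
  hence "a \<in> G" using N c ab unfolding G_def by (intro CollectI conjI exI[of _ "c * (1 - t)"]) auto
  define a' where "a' = a - (a \<bullet> u / (u \<bullet> u)) *R u"
  have "a' \<in> span G" unfolding a'_def by (rule span_diff[OF span_base[OF \<open>a \<in> G\<close>] span_scale[OF span_base[OF uG]]])
  hence "a' \<in> W" using u0 by (simp add: W_def a'_def inner_diff_left)
  hence "a' \<bullet> a = 0" "a' \<bullet> u = 0" using N(3) hQ0 by (auto simp: W_def)
  hence "a' \<bullet> a' = 0" by (subst (2) a'_def) (simp add: inner_diff_right)
  then obtain k where k: "a = k *R u" by (auto simp: a'_def)
  hence "k = 1 / c" using N(4) c by (simp add: c_def eq_divide_eq)
  thus ?thesis using k by (simp add: u'_def)
 qed
 have "u' extreme_point_of normal_base A x p"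
  unfolding extreme_point_of_def
 proof (intro conjI ballI notI)
  fix a b assume ab: "a \<in> normal_base A x p" "b \<in> normal_base A x p" "u' \<in> open_segment a b"
  then obtain t where t: "0 < t" "t < 1" "u' = (1 - t) *R a + t *R b" "a ~= b" by (auto simp: in_segment)
  have "a = u'" using key[OF ab(1,2) t(1,2,3)] .
  moreover have "b = u'" using key[OF ab(2,1), of "1 - t"] t by (simp add: add.commute)
  ultimately show False using t(4) by simp
 qed (rule u'S)
 from extreme_base_common_support[OF A B(1) pA reg xA this] have "?h E u' = ?h L u'" using hA hB by simp
 thus ?thesis using c E L support_scale[of _ "1 / c" u] by (simp add: u'_def)
qed

lemma tangential_of_quermassintegrals:
 fixes E L :: "'a::euclidean_space set"
 assumes E: "smooth_body E" "convex_body E" "interior E ~= {}" and L: "convex_body L" "interior L ~= {}" "E \<subseteq> L"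
  and j: "0 < j" "j < DIM('a)" and eq: "qm (j - 1) L E = qm j L E"
 shows "tangential_body (DIM('a) - j) E L"
proof -
 have "supporting_hyperplane E {x. x \<bullet> u = support_function L u}" if "extreme_normal (j - 1) L u" for u
  using extreme_normal_common_support[OF E L j eq that] that unfolding supporting_hyperplane_def by (auto simp: extreme_normal_def intro!: exI[of _ u])
 thus ?thesis using L j by (auto simp: tangential_body_def)
qed

section \<open>Quermassintegrals of parallel bodies\<close>

lemma minkowski_cancel:
 assumes B: "convex_body B" and C: "convex_body C" and sub: "A + C \<subseteq> B + C" shows "A \<subseteq> B"
proof
 fix a assume a: "a \<in> A"
 show "a \<in> B"
 proof (rule ccontr)
  assume "a \<notin> B"
  then obtain w where w: "support_function B w < a \<bullet> w" using separating_support[OF B] by blast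
  obtain c where c: "c \<in> C" "c \<bullet> w = support_function C w" using support_attained[OF C] by blast
  have "a + c \<in> B + C" using sub a c by auto
  hence "(a + c) \<bullet> w <= support_function (B + C) w" using B C by (intro support_upper) (auto simp: convex_body_def intro: compact_set_plus)
  also have "... = support_function B w + support_function C w" using B C by (intro support_plus) (auto simp: convex_body_def)
  finally show False using w c by (simp add: inner_add_left)
 qed
qed

lemma minkowski_cancel_iff: "convex_body B ==> convex_body C ==> A + C \<subseteq> B + C \<longleftrightarrow> A \<subseteq> B"
 using minkowski_cancel[of B C A] set_plus_mono2[of A B C C] by blast

lemma qm_affine:
 fixes K E :: "'a::euclidean_space set"
 assumes K: "convex_body K" and E: "convex_body E" and k: "k <= DIM('a)" and a: "0 <= a"
 shows "qm k ((+) x ` (a \<odot> K)) E = a ^ (DIM('a) - k) * qm k K E"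
proof -
 have aK: "convex_body (a \<odot> K)" using K by (rule body_dilate)
 have "(+) x ` (a \<odot> K) + t \<odot> E = (+) x ` (a \<odot> K + t \<odot> E)" for t unfolding translate_eq_plus by (rule add.assoc)
 hence "steiner_coefficients ((+) x ` (a \<odot> K)) E = steiner_coefficients (a \<odot> K) E"
  unfolding steiner_coefficients_def by (simp add: measure_translation)
 hence "quermassintegral k ((+) x ` (a \<odot> K)) E = quermassintegral k (a \<odot> K) E" by (simp add: quermassintegral_def)
 hence "qm k ((+) x ` (a \<odot> K)) E = qm k (a \<odot> K) E"
  unfolding quermassintegral_eq[OF body_affine[OF K] E k] quermassintegral_eq[OF aK E k] .
 thus ?thesis using K E k a by (simp add: qm_def mixvol_replicate_dilate)
qed

lemma qm_self: "convex_body (E :: 'a::euclidean_space set) ==> k <= DIM('a) ==> qm k E E = vol E"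
 using mixvol_self[of E] by (simp add: qm_def flip: replicate_add)

lemma homothetic_interior:
 assumes "convex_body (K :: 'a::euclidean_space set)" "interior K ~= {}" "0 < a" shows "interior ((+) x ` (a \<odot> K)) ~= {}"
 using assms body_affine[of K x a] by (intro interior_of_vol_pos) (auto simp: measure_translation vol_dilate vol_pos_of_interior)

lemma homothetic_sym: "homothetic K L ==> homothetic L K"
proof -
 assume "homothetic K L"
 then obtain a x where a: "a > 0" "L = (%y. a *R y + x) ` K" by (auto simp: homothetic_def)
 hence "K = (%y. (1 / a) *R y + - (1 / a) *R x) ` L" by (simp add: image_image scaleR_add_right)
 thus ?thesis unfolding homothetic_def using a(1) by (metis zero_less_divide_1_iff)
qed

context
 fixes K E :: "'a::euclidean_space set"
 assumes K: "convex_body K" "interior K ~= {}" and E: "convex_body E" "interior E ~= {}"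
begin

abbreviation "P \<equiv> parallel_body K E"

lemma parallel_nonpos: "t <= 0 ==> P t = {x. \<forall>e\<in>E. x + (- t) *R e \<in> K}"
 by (auto simp: parallel_body_def image_subset_iff)

lemma parallel_pos: "0 <= t ==> P t = K + t \<odot> E"
 using bodyD(3)[OF E(1)] by (cases "t = 0") (auto simp: parallel_body_def set_plus_def image_subset_iff)

text \<open>The supremum defining the inradius is finite because
  \<open>x + r E \<subseteq> K\<close> forces \<open>r ^ n * vol E \<le> vol K\<close>.\<close>

lemma inradius_witness:
 assumes "s < inradius K E" shows "\<exists>r>s. \<exists>x. (%y. x + r *R y) ` E \<subseteq> K"
proof -
 let ?S = "{r. 0 <= r & (\<exists>x. (%y. x + r *R y) ` E \<subseteq> K)}"
 obtain k where "k \<in> K" using K by (auto simp: convex_body_def)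
 hence "0 \<in> ?S" by (auto intro!: exI[of _ k])
 moreover have "bdd_above ?S"
 proof (rule bdd_aboveI)
  fix r assume "r \<in> ?S"
  then obtain x where r: "0 <= r" "(%y. x + r *R y) ` E \<subseteq> K" by blast
  have "(+) x ` (r \<odot> E) \<subseteq> K" using r(2) by (simp add: image_image)
  from vol_mono[OF body_lmeasurable[OF body_affine[OF E(1)]] body_lmeasurable[OF K(1)] this]
  have le: "r ^ DIM('a) * vol E <= vol K" using E r by (simp add: measure_translation vol_dilate)
  have v: "0 < vol E" using E by (rule vol_pos_of_interior)
  show "r <= 1 + vol K / vol E"
  proof (cases "r <= 1")
   case False
   have "r <= r ^ DIM('a)" using False by (intro self_le_power) auto
   hence "r * vol E <= r ^ DIM('a) * vol E" using v by (intro mult_right_mono) auto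
   hence "r * vol E <= vol K" using le by linarith
   hence "r <= vol K / vol E" using v by (simp add: le_divide_eq)
   thus ?thesis by simp
  qed (simp add: add_increasing2)
 qed
 ultimately show ?thesis using assms less_cSup_iff[of ?S s] unfolding inradius_def by blast
qed

lemma parallel_body: assumes t: "- inradius K E < t" shows "convex_body (P t)" "interior (P t) ~= {}"
proof -
 have "convex_body (P t) & interior (P t) ~= {}"
 proof (cases "t <= 0")
  case True
  obtain r x where r: "- t < r" "(%y. x + r *R y) ` E \<subseteq> K" using inradius_witness[of "- t"] t by auto
  have "(+) x ` ((r + t) \<odot> E) \<subseteq> P t"
  proof -
   have "x + (r + t) *R e + (- t) *R e' \<in> K" if "e \<in> E" "e' \<in> E" for e e'
   proof -
    have "(r + t) *R e + (- t) *R e' \<in> (r + t) \<odot> E + (- t) \<odot> E" using that by blast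
    also have "(r + t) \<odot> E + (- t) \<odot> E = r \<odot> E" using E r True dilate_add[of E "r + t" "- t"] by (simp add: convex_body_def)
    finally obtain e'' where e'': "e'' \<in> E" "(r + t) *R e + (- t) *R e' = r *R e''" by blast
    have "x + r *R e'' \<in> K" using r(2) e''(1) by blast
    thus ?thesis unfolding add.assoc e''(2) .
   qed
   thus ?thesis using True by (auto simp: parallel_nonpos)
  qed
  moreover have "interior ((+) x ` ((r + t) \<odot> E)) ~= {}" using E r by (intro homothetic_interior) auto
  ultimately have "interior (P t) ~= {}" using interior_mono by blast
  moreover have "P t = erosion K (- t) E" using True by (simp add: parallel_nonpos erosion_def)
  moreover have "E ~= {}" using E by auto
  ultimately show ?thesis using erosion_compact_convex[OF K(1), of E "- t"] interior_subset by (auto simp: convex_body_def)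
 next
  case False
  moreover have "t \<odot> E ~= {}" using bodyD(3)[OF E(1)] by simp
  ultimately show ?thesis using body_plus[OF K(1) body_dilate[OF E(1)], of t] interior_plus_nonempty[OF K(2)] by (simp add: parallel_pos)
 qed
 thus "convex_body (P t)" "interior (P t) ~= {}" by auto
qed

text \<open>Points of the two parallel bodies are combined by convexity of \<open>K\<close>. The
  signs of \<open>s\<close>, \<open>t\<close> and of the intermediate parameter decide how much of
  \<open>E\<close> has to be contributed by each of them.\<close>

lemma parallel_concave:
 assumes st: "s <= t" and l: "0 <= l" "l <= 1" shows "(1 - l) \<odot> P s + l \<odot> P t \<subseteq> P ((1 - l) * s + l * t)"
proof
 let ?m = "(1 - l) * s + l * t"
 have cK: "convex K" "convex E" using K E by (auto simp: convex_body_def)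
 have Kc: "(1 - l) *R a + l *R b \<in> K" if "a \<in> K" "b \<in> K" for a b using that l convexD_alt[OF cK(1)] by blast
 fix z assume "z \<in> (1 - l) \<odot> P s + l \<odot> P t"
 then obtain a b where z: "z = (1 - l) *R a + l *R b" "a \<in> P s" "b \<in> P t" by (auto simp: set_plus_def)
 show "z \<in> P ?m"
 proof (cases "t <= 0")
  case True
  have "(1 - l) * (- s) + l * (- t) \<ge> 0" using True st l by (intro add_nonneg_nonneg mult_nonneg_nonneg) auto
  hence m: "?m <= 0" by (simp add: algebra_simps)
  have "z + (- ?m) *R e \<in> K" if "e \<in> E" for e
  proof -
   have "(1 - l) *R (a + (- s) *R e) + l *R (b + (- t) *R e) \<in> K" using z True st that by (intro Kc) (auto simp: parallel_nonpos)
   thus ?thesis by (simp add: z(1) algebra_simps)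
  qed
  thus ?thesis using m by (simp add: parallel_nonpos)
 next
  case t: False
  then obtain k e where b: "b = k + t *R e" "k \<in> K" "e \<in> E" using z(3) parallel_pos[of t] by (auto simp: set_plus_def)
  show ?thesis
  proof (cases "0 <= s")
   case True
   obtain k' e' where a: "a = k' + s *R e'" "k' \<in> K" "e' \<in> E" using z(2) True parallel_pos[of s] by (auto simp: set_plus_def)
   have m: "0 <= ?m" using True t l by auto
   have "((1 - l) * s) *R e' + (l * t) *R e \<in> ((1 - l) * s) \<odot> E + (l * t) \<odot> E" using a b by blast
   also have "... = ?m \<odot> E" using cK True t l by (intro dilate_add) auto
   finally have "((1 - l) *R k' + l *R k) + (((1 - l) * s) *R e' + (l * t) *R e) \<in> K + ?m \<odot> E" using Kc a b by blast
   thus ?thesis using m by (simp add: parallel_pos z(1) a b algebra_simps)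
  next
   case s: False
   have aK: "a + (- s) *R e' \<in> K" if "e' \<in> E" for e' using z(2) s that by (auto simp: parallel_nonpos)
   show ?thesis
   proof (cases "?m <= 0")
    case True
    have "z + (- ?m) *R e' \<in> K" if e': "e' \<in> E" for e'
    proof (cases "l = 1")
     case False
     \<comment> \<open>The amounts \<open>l * t\<close> and \<open>- ?m\<close> of \<open>E\<close>
       add up to \<open>(1 - l) * (- s)\<close>, exactly what may be added to
       \<open>(1 - l) a\<close> without leaving \<open>(1 - l) K\<close>.\<close>
     have "(l * t) *R e + (- ?m) *R e' \<in> (l * t) \<odot> E + (- ?m) \<odot> E" using b e' by blast
     also have "... = (l * t + (- ?m)) \<odot> E" using cK True t l by (intro dilate_add) auto
     also have "l * t + (- ?m) = (1 - l) * (- s)" by (simp add: algebra_simps)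
     finally obtain e'' where e'': "e'' \<in> E" "(l * t) *R e + (- ?m) *R e' = ((1 - l) * (- s)) *R e''" by auto
     have "(1 - l) *R (a + (- s) *R e'') + l *R k \<in> K" using aK[OF e''(1)] b by (intro Kc)
     also have "(1 - l) *R (a + (- s) *R e'') + l *R k = (1 - l) *R a + l *R k + ((1 - l) * (- s)) *R e''" by (simp add: algebra_simps)
     also have "... = z + (- ?m) *R e'" unfolding e''(2)[symmetric] z(1) b(1) by (simp add: scaleR_add_right)
     finally show ?thesis .
    qed (use True t in auto)
    thus ?thesis using True by (simp add: parallel_nonpos)
   next
    case False
    have "(1 - l) *R (a + (- s) *R e) + l *R k \<in> K" using aK b by (intro Kc) auto
    hence "((1 - l) *R (a + (- s) *R e) + l *R k) + ?m *R e \<in> K + ?m \<odot> E" using b by blast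
    moreover have "((1 - l) *R (a + (- s) *R e) + l *R k) + ?m *R e = z" unfolding z(1) b(1) by (simp add: algebra_simps)
    ultimately show ?thesis using False by (simp add: parallel_pos)
   qed
  qed
 qed
qed

text \<open>Inner parallel bodies can be taken relative to any later member of the family, also
  across parameter 0. For \<open>t > 0\<close> this uses cancellation of Minkowski summands.\<close>

lemma parallel_erosion:
 assumes s: "- inradius K E < s" and st: "s <= t" shows "P s = {x. (%y. x + (t - s) *R y) ` E \<subseteq> P t}"
proof -
 have dE: "a \<odot> E + b \<odot> E = (a + b) \<odot> E" if "0 <= a" "0 <= b" for a b using E that by (intro dilate_add) (auto simp: convex_body_def)
 have im: "(%y. x + a *R y) ` E = {x} + a \<odot> E" for x a by (auto simp: set_plus_def)
 have sub: "x \<in> P u \<longleftrightarrow> {x} + (- u) \<odot> E \<subseteq> K" if "u <= 0" for x u using that by (auto simp: parallel_nonpos set_plus_def)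
 have cE: "convex_body (a \<odot> E)" for a using E by (simp add: body_dilate)
 have "x \<in> P s \<longleftrightarrow> {x} + (t - s) \<odot> E \<subseteq> P t" for x
 proof (cases "t <= 0")
  case True
  have "{x} + (t - s) \<odot> E \<subseteq> P t \<longleftrightarrow> (\<forall>y\<in>{x} + (t - s) \<odot> E. {y} + (- t) \<odot> E \<subseteq> K)" using sub[OF True] by blast
  also have "... \<longleftrightarrow> ({x} + (t - s) \<odot> E) + (- t) \<odot> E \<subseteq> K" by (auto simp: set_plus_def)
  also have "({x} + (t - s) \<odot> E) + (- t) \<odot> E = {x} + (- s) \<odot> E" using dE[of "t - s" "- t"] True st by (simp add: add.assoc)
  finally show ?thesis using sub[of s] True st by simp
 next
  case t: False
  show ?thesis
  proof (cases "s <= 0")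
   case True
   have "{x} + (t - s) \<odot> E = ({x} + (- s) \<odot> E) + t \<odot> E" using dE[of "- s" t] True t by (simp add: add.assoc)
   hence "{x} + (t - s) \<odot> E \<subseteq> P t \<longleftrightarrow> ({x} + (- s) \<odot> E) + t \<odot> E \<subseteq> K + t \<odot> E" using t by (simp add: parallel_pos)
   also have "... \<longleftrightarrow> {x} + (- s) \<odot> E \<subseteq> K" by (rule minkowski_cancel_iff[OF K(1) cE])
   finally show ?thesis using sub[OF True] by simp
  next
   case False
   have "K + t \<odot> E = (K + s \<odot> E) + (t - s) \<odot> E" using dE[of s "t - s"] False st by (simp add: add.assoc)
   hence "{x} + (t - s) \<odot> E \<subseteq> P t \<longleftrightarrow> {x} + (t - s) \<odot> E \<subseteq> (K + s \<odot> E) + (t - s) \<odot> E" using t by (simp add: parallel_pos)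
   also have "... \<longleftrightarrow> {x} \<subseteq> K + s \<odot> E" by (rule minkowski_cancel_iff[OF body_plus[OF K(1) cE] cE])
   finally show ?thesis using False by (simp add: parallel_pos)
  qed
 qed
 thus ?thesis unfolding im by blast
qed

end

lemma qm_pos: "convex_body A ==> interior A ~= {} ==> convex_body E ==> interior E ~= {} ==> k <= DIM('a) ==> 0 < qm k (A :: 'a::euclidean_space set) E"
 unfolding qm_def by (intro mixvol_pos) auto

lemma qm_mono:
 fixes A B E :: "'a::euclidean_space set"
 assumes "convex_body A" "convex_body B" "convex_body E" "A \<subseteq> B" "k <= DIM('a)" shows "qm k A E <= qm k B E"
proof -
 have "list_all2 (\<subseteq>) (replicate m A) (replicate m B)" for m using assms(4) by (induction m) auto
 thus ?thesis unfolding qm_def using assms by (intro mixvol_mono_list) auto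
qed

context
 fixes A B E :: "'a::euclidean_space set" and k :: nat
 assumes A: "convex_body A" "interior A ~= {}" and B: "convex_body B" "interior B ~= {}" and E: "convex_body E" "interior E ~= {}"
  and k: "k < DIM('a)"
begin

lemma qm_brunn_minkowski: "(root (DIM('a) - k) (qm k A E) + root (DIM('a) - k) (qm k B E)) ^ (DIM('a) - k) <= qm k (A + B) E"
 unfolding qm_def[of k "A + B"] using A B E k qm_pos[OF A E, of k] qm_pos[OF B E, of k] by (intro general_brunn_minkowski) (auto simp: qm_def)

lemma qm_brunn_minkowski_equality:
 assumes sm: "smooth_body E" and k2: "k + 2 <= DIM('a)"
  and eq: "qm k (A + B) E = (root (DIM('a) - k) (qm k A E) + root (DIM('a) - k) (qm k B E)) ^ (DIM('a) - k)"
 shows "homothetic A B"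
proof (rule equality_homothetic[OF sm E A B k2])
 let ?m = "DIM('a) - k"
 show p: "0 < root ?m (qm k A E)" "0 < root ?m (qm k B E)" using qm_pos[OF A E] qm_pos[OF B E] k by auto
 show "mixvol (replicate (?m - i) A @ replicate i B @ replicate k E) = root ?m (qm k A E) ^ (?m - i) * root ?m (qm k B E) ^ i" if "i <= ?m" for i
  using A B E k p qm_pos[OF A E, of k] qm_pos[OF B E, of k] that eq by (intro general_brunn_minkowski_equality) (auto simp: qm_def)
qed

end

text \<open>\<open>x\<close> and \<open>y\<close> are the values of a concave function at
  \<open>s\<close> and \<open>t\<close>, and \<open>p\<close> and \<open>q\<close> its tangent
  slopes there; equal slopes make the tangents coincide with the chord.\<close>

lemma tangent_lines:
 fixes x y p q s t :: real
 assumes "y <= x + p * (t - s)" "x <= y + q * (s - t)" "s < t" shows "q <= p" "p = q ==> y - x = q * (t - s)"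
proof -
 have "0 <= (p - q) * (t - s)" using assms by (simp add: algebra_simps)
 thus "q <= p" using assms(3) by (simp add: zero_le_mult_iff)
 show "p = q ==> y - x = q * (t - s)" using assms by (simp add: algebra_simps)
qed

lemma dilate_plus: "t \<odot> (A + B) = t \<odot> A + t \<odot> (B :: 'a::real_vector set)"
proof (intro set_eqI iffI)
 fix z assume "z \<in> t \<odot> A + t \<odot> B"
 then obtain a b where "z = t *R (a + b)" "a \<in> A" "b \<in> B" by (auto simp: set_plus_def scaleR_add_right)
 thus "z \<in> t \<odot> (A + B)" by blast
next
 fix z assume "z \<in> t \<odot> (A + B)"
 then obtain a b where z: "z = t *R a + t *R b" "a \<in> A" "b \<in> B" by (auto simp: set_plus_def scaleR_add_right)
 show "z \<in> t \<odot> A + t \<odot> B" unfolding z(1) using z(2,3) by blast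
qed

section \<open>Monotonicity and equality along the family of parallel bodies\<close>

context
 fixes K E :: "'a::euclidean_space set" and j :: nat
 assumes K: "convex_body K" "interior K ~= {}" and E: "convex_body E" "interior E ~= {}"
  and j: "0 < j" "j < DIM('a)" and R: "class_R (j - 1) E K"
begin

abbreviation (input) "PB \<equiv> parallel_body K E"
abbreviation (input) "W k t \<equiv> qm k (PB t) E"
abbreviation (input) "g k t \<equiv> root (DIM('a) - k) (W k t)"
abbreviation (input) "D k t \<equiv> W (Suc k) t / g k t ^ (DIM('a) - Suc k)"
abbreviation (input) "r \<equiv> inradius K E"

lemma W_pos: "- r < t ==> k <= DIM('a) ==> 0 < W k t"
 using parallel_body[OF K E] E by (intro qm_pos) auto

lemma W_deriv:
 assumes t: "- r < t" and k: "k < j" shows "(W k has_real_derivative real (DIM('a) - k) * W (Suc k) t) (at t)"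
proof -
 let ?f = "%s. quermassintegral k (PB s) E" and ?d = "real (DIM('a) - k) * quermassintegral (k + 1) (PB t) E"
 have "(?f has_real_derivative ?d) (at_right t)" "(?f has_real_derivative ?d) (at_left t)"
  using R t k by (auto simp: class_R_def)
 hence "(?f has_real_derivative ?d) (at t)" unfolding has_field_derivative_iff by (simp add: filterlim_at_split)
 moreover have "quermassintegral (k + 1) (PB t) E = W (Suc k) t" using quermassintegral_eq[OF parallel_body(1)[OF K E t] E(1), of "k + 1"] k j by simp
 ultimately have "(?f has_real_derivative real (DIM('a) - k) * W (Suc k) t) (at t)" by simp
 moreover have "?f s = W k s" if "s \<in> {- r<..}" for s using parallel_body(1)[OF K E, of s] E k j that by (simp add: quermassintegral_eq)
 ultimately show ?thesis using t by (elim has_field_derivative_transform_within_open[where S = "{- r<..}"]) auto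
qed

lemma g_deriv:
 assumes t: "- r < t" and k: "k < j" shows "(g k has_real_derivative D k t) (at t)"
proof -
 have m: "0 < DIM('a) - k" "DIM('a) - k - Suc 0 = DIM('a) - Suc k" using k j by auto
 have "(g k has_real_derivative inverse (real (DIM('a) - k) * g k t ^ (DIM('a) - k - Suc 0)) * (real (DIM('a) - k) * W (Suc k) t)) (at t)"
  using k j by (intro DERIV_chain2[OF DERIV_real_root W_deriv[OF t k]] W_pos[OF t]) auto
 moreover have "inverse (a * x) * (a * y) = y / x" if "a ~= 0" for a x y :: real using that by (simp add: divide_simps)
 ultimately show ?thesis unfolding m(2) using m(1) by simp
qed

lemma g_concave: assumes k: "k < DIM('a)" shows "convex_on {- r<..} (%t. - g k t)"
proof (rule convex_on_linorderI)
 fix l s t :: real assume l: "0 < l" "l < 1" and st: "s \<in> {- r<..}" "t \<in> {- r<..}" "s < t"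
 let ?m = "DIM('a) - k" and ?u = "(1 - l) * s + l * t"
 note bs = parallel_body[OF K E, of s] and bt = parallel_body[OF K E, of t]
 have "(1 - l) * (- r) + l * (- r) < ?u" using l st by (intro add_strict_mono mult_strict_left_mono) auto
 hence u: "- r < ?u" by (simp add: algebra_simps)
 have dil: "root ?m (qm k (a \<odot> C) E) = a * root ?m (qm k C E)" if "0 <= a" "convex_body C" for a and C :: "'a set"
  using qm_affine[OF that(2) E(1) _ that(1), of k 0] k that by (simp add: real_root_mult real_root_power_cancel)
 have int: "interior (a \<odot> C) ~= {}" if "0 < a" "convex_body C" "interior C ~= {}" for a and C :: "'a set"
  using homothetic_interior[OF that(2,3,1), of 0] by simp
 have c: "convex_body ((1 - l) \<odot> PB s)" "convex_body (l \<odot> PB t)" using bs bt st by (simp_all add: body_dilate)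
 have "((1 - l) * g k s + l * g k t) ^ ?m = (root ?m (qm k ((1 - l) \<odot> PB s) E) + root ?m (qm k (l \<odot> PB t) E)) ^ ?m"
  using l bs bt st by (simp add: dil)
 also have "... <= qm k ((1 - l) \<odot> PB s + l \<odot> PB t) E" using c int bs bt st l E k by (intro qm_brunn_minkowski) auto
 also have "... <= W k ?u" using parallel_concave[OF K E, of s t l] c l st E k parallel_body[OF K E u] by (intro qm_mono body_plus) auto
 finally have le: "((1 - l) * g k s + l * g k t) ^ ?m <= W k ?u" .
 have "0 <= (1 - l) * g k s + l * g k t" using k l W_pos[of s k] W_pos[of t k] st by simp
 hence "(1 - l) * g k s + l * g k t <= g k ?u" using real_root_le_mono[OF _ le, of ?m] k by (simp add: real_root_power_cancel)
 thus "- g k ((1 - l) *R s + l *R t) <= (1 - l) * - g k s + l * - g k t" by simp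
qed simp

lemma g_tangent: assumes s: "- r < s" and t: "- r < t" and k: "k < j" shows "g k t <= g k s + D k s * (t - s)"
proof -
 have "- g k t - - g k s \<ge> - D k s * (t - s)"
  using s t k j by (intro convex_on_imp_above_tangent[OF g_concave]) (auto simp: interior_open intro!: DERIV_minus[OF g_deriv, THEN DERIV_subset])
 thus ?thesis by simp
qed

lemma D_antimono: assumes s: "- r < s" and st: "s < t" and k: "k < j" shows "D k t <= D k s"
 using tangent_lines(1)[OF g_tangent[of s t k] g_tangent[of t s k] st] assms by simp

text \<open>A concave function with equal slopes at both ends is affine in between. The midpoint
  bound, a tangent estimate, is the converse of concavity and produces equality in
  Brunn-Minkowski.\<close>

lemma D_equal_chord:
 assumes s: "- r < s" and st: "s < t" and k: "k < j" and eq: "D k s = D k t"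
 shows "g k t - g k s = D k t * (t - s)" "g k ((s + t) / 2) <= (g k s + g k t) / 2"
proof -
 show 1: "g k t - g k s = D k t * (t - s)" using tangent_lines(2)[OF g_tangent[of s t k] g_tangent[of t s k] st eq] s st k by simp
 have "g k ((s + t) / 2) <= g k s + D k s * ((s + t) / 2 - s)" using s st k by (intro g_tangent) auto
 also have "(s + t) / 2 - s = (t - s) / 2" by (simp add: field_simps)
 also have "D k s * ((t - s) / 2) = (g k t - g k s) / 2" unfolding 1 eq by simp
 also have "x + (y - x) / 2 = (x + y) / 2" for x y :: real by (simp add: field_simps)
 finally show "g k ((s + t) / 2) <= (g k s + g k t) / 2" .
qed

text \<open>The logarithm of \<open>g k t\<close>. The increment of \<open>lg\<close> from
  \<open>k\<close> to \<open>Suc k\<close> is \<open>ln (D k t)\<close> up to a positive factor, and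
  these increments telescope to the logarithm of \<open>I_quot\<close>, so its monotonicity and
  equality reduce to single steps.\<close>

definition "lg k t = ln (W k t) / real (DIM('a) - k)"

lemma D_pos: "- r < t ==> k < j ==> 0 < D k t"
 using W_pos[of t k] W_pos[of t "Suc k"] j by auto

lemma ln_D: assumes "- r < t" "k < j" shows "ln (D k t) = real (DIM('a) - Suc k) * (lg (Suc k) t - lg k t)"
proof -
 have "real (DIM('a) - Suc k) ~= 0" using assms j by simp
 thus ?thesis using assms W_pos[of t k] W_pos[of t "Suc k"] j
  by (simp add: ln_div ln_realpow ln_root lg_def right_diff_distrib del: of_nat_diff)
qed

lemma I_quot_exp:
 assumes "- r < t" "i < j" shows "I_quot i j K E t = exp (real (DIM('a) - i) * real (DIM('a) - j) * (\<Sum>k=i..<j. lg (Suc k) t - lg k t))"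
proof -
 let ?n = "DIM('a)"
 have "I_quot i j K E t = W j t ^ (?n - i) / W i t ^ (?n - j)"
  using parallel_body(1)[OF K E assms(1)] E j assms by (simp add: I_quot_def quermassintegral_eq)
 also have "... = exp (ln (W j t)) ^ (?n - i) / exp (ln (W i t)) ^ (?n - j)" using W_pos[OF assms(1)] j assms by simp
 also have "... = exp (real (?n - i) * ln (W j t) - real (?n - j) * ln (W i t))" by (simp add: exp_of_nat_mult exp_diff)
 also have "real (?n - i) * ln (W j t) - real (?n - j) * ln (W i t) = real (?n - i) * real (?n - j) * (lg j t - lg i t)"
 proof -
  have "real (?n - i) ~= 0" "real (?n - j) ~= 0" using j assms by auto
  thus ?thesis by (simp add: lg_def field_simps del: of_nat_diff of_nat_eq_0_iff)
 qed
 also have "lg j t - lg i t = (\<Sum>k=i..<j. lg (Suc k) t - lg k t)" using sum_Suc_diff'[of i j "%k. lg k t"] assms by simp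
 finally show ?thesis .
qed

lemma lg_step_antimono: assumes "- r < s" "s < t" "k < j" shows "lg (Suc k) t - lg k t <= lg (Suc k) s - lg k s"
proof -
 have "ln (D k t) <= ln (D k s)" using D_antimono[OF assms] D_pos[of s k] D_pos[of t k] assms by (subst ln_le_cancel_iff) auto
 thus ?thesis using ln_D[of s k] ln_D[of t k] assms j by (simp add: mult_le_cancel_left)
qed

lemma I_quot_antimono: "i < j ==> - r < s ==> s < t ==> I_quot i j K E t <= I_quot i j K E s"
 using lg_step_antimono[of s t] by (simp add: I_quot_exp) (intro mult_left_mono sum_mono; simp)

lemma I_quot_equal_D:
 assumes i: "i < j" and s: "- r < s" "s < t" and eq: "I_quot i j K E s = I_quot i j K E t" and k: "i <= k" "k < j"
 shows "D k s = D k t"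
proof -
 let ?d = "%k. (lg (Suc k) s - lg k s) - (lg (Suc k) t - lg k t)"
 have "(\<Sum>k=i..<j. ?d k) = 0" using eq s i j by (simp add: I_quot_exp sum_subtractf)
 moreover have "!!k. k \<in> {i..<j} ==> 0 <= ?d k" using lg_step_antimono[OF s] by simp
 ultimately have "?d k = 0" using k by (subst (asm) sum_nonneg_eq_0_iff) auto
 hence "ln (D k s) = ln (D k t)" using s k by (simp add: ln_D)
 thus ?thesis using D_pos[of s k] D_pos[of t k] s k by (subst (asm) ln_inj_iff) auto
qed

text \<open>Equality makes \<open>g i\<close> affine between \<open>s\<close> and \<open>t\<close>.
  Half the sum of the two bodies lies in the parallel body at the midpoint, whose quermassintegral
  is then too small for strict Brunn-Minkowski.\<close>

lemma equal_homothetic: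
 assumes sm: "smooth_body E" and i: "i < j" and s: "- r < s" "s < t" and eq: "I_quot i j K E s = I_quot i j K E t"
 shows "homothetic (PB s) (PB t)"
proof (rule qm_brunn_minkowski_equality[where k = i])
 let ?m = "DIM('a) - i" and ?S = "PB s + PB t" and ?u = "(s + t) / 2"
 show b: "convex_body (PB s)" "interior (PB s) ~= {}" "convex_body (PB t)" "interior (PB t) ~= {}" using s parallel_body[OF K E] by auto
 have S: "convex_body ?S" using b by (intro body_plus)
 have bm: "(g i s + g i t) ^ ?m <= qm i ?S E" using b E i j by (intro qm_brunn_minkowski) auto
 have "(1/2) \<odot> ?S = (1 - 1/2) \<odot> PB s + (1/2) \<odot> PB t" by (simp add: dilate_plus)
 also have "... \<subseteq> PB ((1 - 1/2) * s + (1/2) * t)" using s by (intro parallel_concave[OF K E]) auto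
 also have "(1 - 1/2) * s + (1/2) * t = ?u" by (simp add: field_simps)
 finally have "qm i ((1/2) \<odot> ?S) E <= W i ?u" using S E i j s parallel_body(1)[OF K E, of ?u] by (intro qm_mono body_dilate) auto
 moreover have "qm i ((1/2) \<odot> ?S) E = (1/2) ^ ?m * qm i ?S E" using qm_affine[OF S E(1), of i "1/2" 0] i j by simp
 moreover have "W i ?u = g i ?u ^ ?m" using W_pos[of ?u i] s i j by simp
 moreover have "g i ?u ^ ?m <= ((g i s + g i t) / 2) ^ ?m"
  using D_equal_chord(2)[OF s i I_quot_equal_D[OF i s eq order_refl i]] W_pos[of ?u i] s i j by (intro power_mono) auto
 moreover have "((g i s + g i t) / 2) ^ ?m = (1/2) ^ ?m * (g i s + g i t) ^ ?m" by (simp add: power_divide)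
 ultimately have "(1/2) ^ ?m * qm i ?S E <= (1/2) ^ ?m * (g i s + g i t) ^ ?m" by linarith
 hence "qm i ?S E <= (g i s + g i t) ^ ?m" by (subst (asm) mult_le_cancel_left_pos) auto
 thus "qm i ?S E = (g i s + g i t) ^ ?m" using bm by simp
qed (use sm E i j in auto)

lemma homothetic_I_quot:
 assumes i: "i < j" and s: "- r < s" and t: "- r < t" and C: "convex_body C" and hs: "homothetic C (PB s)" and ht: "homothetic C (PB t)"
 shows "I_quot i j K E s = I_quot i j K E t"
proof -
 let ?n = "DIM('a)"
 have "I_quot i j K E u = qm j C E ^ (?n - i) / qm i C E ^ (?n - j)" if u: "- r < u" "homothetic C (PB u)" for u
 proof -
  obtain a x where a: "0 < a" "PB u = (+) x ` (a \<odot> C)" using u(2) unfolding homothetic_def affine_image by blast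
  have "I_quot i j K E u = W j u ^ (?n - i) / W i u ^ (?n - j)" using parallel_body(1)[OF K E u(1)] E i j by (simp add: I_quot_def quermassintegral_eq)
  also have "W j u = a ^ (?n - j) * qm j C E" using a qm_affine[OF C E(1)] j by simp
  also have "W i u = a ^ (?n - i) * qm i C E" using a qm_affine[OF C E(1)] i j by simp
  finally show ?thesis using a(1) by (simp add: power_mult_distrib mult.commute flip: power_mult)
 qed
 thus ?thesis using assms by simp
qed

text \<open>\<open>L\<close> is the larger body with the centre \<open>c\<close> of the homothety
  moved to the origin, scaled by \<open>1 / b\<close>. That \<open>P s + (t - s) E\<close> lies in
  \<open>P t\<close> yields \<open>E \<subseteq> L\<close>, and the affine growth of
  \<open>g (j - 1)\<close> yields equality of the two quermassintegrals that characterize tangential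
  bodies.\<close>

lemma homothetic_tangential:
 assumes sm: "smooth_body E" and i: "i < j" and s: "- r < s" "s < t" and hom: "homothetic (PB s) (PB t)"
 shows "\<exists>L. tangential_body (DIM('a) - j) E L & homothetic (PB t) L"
proof -
 let ?n = "DIM('a)" and ?k = "j - 1" and ?h = "support_function"
 have t: "- r < t" using s by simp
 note bs = parallel_body[OF K E s(1)] and bt = parallel_body[OF K E t]
 have refl: "homothetic (PB s) (PB s)" unfolding homothetic_def by (intro exI[of _ 1] conjI exI[of _ 0]) auto
 have eq: "I_quot i j K E s = I_quot i j K E t" using homothetic_I_quot[OF i s(1) t bs(1) refl hom] .
 obtain a x where a: "0 < a" "PB t = (+) x ` (a \<odot> PB s)" using hom unfolding homothetic_def affine_image by blast
 have kj: "?k < j" "Suc ?k = j" "i <= ?k" using i j by auto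
 have Wa: "W k t = a ^ (?n - k) * W k s" if "k <= ?n" for k using a qm_affine[OF bs(1) E(1) that, of a x] by simp
 have ga: "g ?k t = a * g ?k s" using Wa[of ?k] a(1) j by (simp add: real_root_mult real_root_power_cancel)
 have gpos: "0 < g ?k s" "0 < g ?k t" using W_pos[OF s(1), of ?k] W_pos[OF t, of ?k] j by auto
 have chord: "g ?k t - g ?k s = D ?k t * (t - s)" using D_equal_chord(1)[OF s kj(1) I_quot_equal_D[OF i s eq kj(3,1)]] .
 have "0 < D ?k t * (t - s)" by (rule mult_pos_pos[OF D_pos[OF t kj(1)]]) (use s in simp)
 hence "0 < (a - 1) * g ?k s" using chord ga by (simp add: algebra_simps)
 hence a1: "1 < a" using gpos by (simp add: zero_less_mult_iff)
 \<comment> \<open>With the origin at \<open>c\<close> the smaller body is \<open>1 / a\<close>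
   times the larger, so the larger exceeds it by the fraction \<open>(a - 1) / a\<close> of itself,
   which must accommodate \<open>(t - s) E\<close>. Hence this scale; \<open>a > 1\<close> because
   \<open>g\<close> grows.\<close>
 define b where "b = a * (t - s) / (a - 1)"
 define c where "c = (1 / (1 - a)) *R x"
 have b: "0 < b" using a1 s by (simp add: b_def)
 define L where "L = (+) ((- (1 / b)) *R c) ` ((1 / b) \<odot> PB t)"
 have L: "convex_body L" "interior L ~= {}" unfolding L_def by (intro body_affine bt, intro homothetic_interior bt) (use b in simp)
 have hom': "homothetic (PB t) L" unfolding homothetic_def affine_image L_def using b by (intro exI[of _ "1 / b"] conjI exI[of _ "(- (1 / b)) *R c"]) auto
 have hL0: "?h L w = ((- (1 / b)) *R c) \<bullet> w + (1 / b) * ?h (PB t) w" for w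
  unfolding L_def by (rule support_affine[OF bt(1)]) (use b in simp)
 have hL: "b * ?h L w = ?h (PB t) w - c \<bullet> w" for w unfolding hL0 using b by (simp add: field_simps)
 have xc: "x = (1 - a) *R c" using a1 by (simp add: c_def)
 have EL: "E \<subseteq> L"
 proof
  fix e assume e: "e \<in> E"
  show "e \<in> L"
  proof (rule ccontr)
   assume "e \<notin> L"
   then obtain w where w: "?h L w < e \<bullet> w" using separating_support[OF L(1)] by blast
   obtain y where y: "y \<in> PB s" "y \<bullet> w = ?h (PB s) w" using support_attained[OF bs(1)] by blast
   have "y + (t - s) *R e \<in> PB t" using y(1) e parallel_erosion[OF K E s(1), of t] s(2) by auto
   hence "(y + (t - s) *R e) \<bullet> w <= ?h (PB t) w" using bt by (intro support_upper) (auto simp: convex_body_def)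
   hence "?h (PB s) w + (t - s) * (e \<bullet> w) <= ?h (PB t) w" using y by (simp add: inner_add_left)
   moreover have "?h (PB t) w = (1 - a) * (c \<bullet> w) + a * ?h (PB s) w" using a support_affine[OF bs(1), of a x w] by (simp add: xc)
   ultimately have "a * ((t - s) * (e \<bullet> w)) <= (a - 1) * (?h (PB t) w - c \<bullet> w)"
    using a1 mult_left_mono[of "?h (PB s) w + (t - s) * (e \<bullet> w)" "?h (PB t) w" a] by (simp add: algebra_simps)
   also have "... = (a - 1) * (b * ?h L w)" by (simp add: hL)
   also have "... = a * ((t - s) * ?h L w)" using a1 by (simp add: b_def)
   finally have "e \<bullet> w <= ?h L w" using a1 s by simp
   thus False using w by simp
  qed
 qed
 have "y = b * d" if "y = a * x" "y - x = d * (t - s)" for x y d :: real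
 proof -
  have "a * (t - s) * d = a * (y - x)" using that(2) by simp
  hence "a * (t - s) * d = (a - 1) * y" using that(1) by (simp add: algebra_simps)
  thus ?thesis using a1 by (simp add: b_def)
 qed
 from this[OF ga chord] have gD: "g ?k t = b * D ?k t" .
 have nk: "?n - ?k = Suc (?n - j)" using j by simp
 have "0 < W ?k t" by (rule W_pos[OF t]) (use j in simp)
 hence "W ?k t = g ?k t ^ (?n - ?k)" using real_root_pow_pos[of "?n - ?k" "W ?k t"] j by simp
 also have "... = b * D ?k t * g ?k t ^ (?n - j)" unfolding nk power_Suc using gD unfolding nk by simp
 also have "... = b * W j t" using gpos kj(2) by simp
 finally have "W ?k t = b * W j t" .
 moreover have "qm k L E = (1 / b) ^ (?n - k) * W k t" if "k <= ?n" for k unfolding L_def by (rule qm_affine[OF bt(1) E(1) that]) (use b in simp)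
 moreover have "(1 / b) ^ (?n - ?k) * (b * W j t) = (1 / b) ^ (?n - j) * W j t" unfolding nk power_Suc using b by simp
 ultimately have "qm ?k L E = qm j L E" using j by simp
 hence "tangential_body (?n - j) E L" by (rule tangential_of_quermassintegrals[OF sm E L EL j])
 thus ?thesis using hom' by blast
qed

text \<open>In the scale of \<open>L\<close> the parallel body at \<open>u\<close> is the erosion of
  \<open>L\<close> by \<open>p E\<close>, which for a tangential body is the dilate
  \<open>(1 - p) L\<close>. All earlier parallel bodies are thus homothetic to the one at
  \<open>t\<close>.\<close>

lemma tangential_constant:
 assumes T: "tangential_body (DIM('a) - j) E L" and hom: "homothetic (PB t) L" and i: "i < j" and t: "- r < t" and u: "- r < u" "u <= t"
 shows "I_quot i j K E u = I_quot i j K E t"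
proof -
 let ?n = "DIM('a)"
 have L: "convex_body L" using T by (simp add: tangential_body_def)
 obtain a x where a: "0 < a" "L = (+) x ` (a \<odot> PB t)" using hom unfolding homothetic_def affine_image by blast
 define p where "p = a * (t - u)"
 have p: "0 <= p" using a u by (simp add: p_def)
 have mem: "z \<in> L \<longleftrightarrow> (1 / a) *R (z - x) \<in> PB t" for z
 proof
  assume "z \<in> L" thus "(1 / a) *R (z - x) \<in> PB t" using a by auto
 next
  assume "(1 / a) *R (z - x) \<in> PB t"
  hence "x + a *R ((1 / a) *R (z - x)) \<in> L" unfolding a(2) by blast
  thus "z \<in> L" using a(1) by simp
 qed
 have er: "{z. (%y. z + p *R y) ` E \<subseteq> L} = (+) x ` (a \<odot> PB u)"
 proof -
  have "(1 / a) *R (z + p *R y - x) = (1 / a) *R (z - x) + (t - u) *R y" for z y using a(1) by (simp add: p_def algebra_simps)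
  hence "z \<in> {z. (%y. z + p *R y) ` E \<subseteq> L} \<longleftrightarrow> (1 / a) *R (z - x) \<in> PB u" for z
   using parallel_erosion[OF K E u] by (auto simp: mem image_subset_iff)
  moreover have "(1 / a) *R (z - x) \<in> PB u \<longleftrightarrow> z \<in> (+) x ` (a \<odot> PB u)" for z
  proof
   assume "(1 / a) *R (z - x) \<in> PB u"
   hence "x + a *R ((1 / a) *R (z - x)) \<in> (+) x ` (a \<odot> PB u)" by blast
   thus "z \<in> (+) x ` (a \<odot> PB u)" using a(1) by simp
  qed (use a in auto)
  ultimately show ?thesis by blast
 qed
 note bu = parallel_body[OF K E u(1)]
 let ?U = "(+) x ` (a \<odot> PB u)"
 have U: "convex_body ?U" "0 < vol ?U" using bu a(1) body_affine[OF bu(1)] homothetic_interior[OF bu a(1)] vol_pos_of_interior by blast+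
 \<comment> \<open>Otherwise the copy \<open>?U\<close> of the parallel body at \<open>u\<close>
   would have a translate inside \<open>d L\<close> for every small \<open>d > 0\<close>, and so
   volume 0, although it has interior points.\<close>
 have p1: "p < 1"
 proof (rule ccontr)
  assume no: "\<not> p < 1"
  obtain e0 where e0: "e0 \<in> E" using E by (auto simp: convex_body_def)
  have le: "vol ?U <= d * vol L" if d: "0 < d" "d <= 1" for d
  proof -
   define s where "s = 1 - d"
   have s: "0 <= s" "s < 1" "s <= p" "1 - s = d" using d no by (auto simp: s_def)
   have "(+) ((p - s) *R e0) ` ?U \<subseteq> {z. (%y. z + s *R y) ` E \<subseteq> L}"
   proof -
    have "(p - s) *R e0 + z + s *R y \<in> L" if z: "z \<in> ?U" and y: "y \<in> E" for z y
    proof -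
     have "(p - s) *R e0 + s *R y \<in> (p - s) \<odot> E + s \<odot> E" using e0 y by blast
     also have "... = p \<odot> E" using E s dilate_add[of E "p - s" s] by (simp add: convex_body_def)
     finally obtain y' where y': "y' \<in> E" "(p - s) *R e0 + s *R y = p *R y'" by blast
     have "z + p *R y' \<in> L" using z y'(1) unfolding er[symmetric] by blast
     thus ?thesis by (simp add: y'(2)[symmetric] algebra_simps)
    qed
    thus ?thesis by auto
   qed
   also have "... = d \<odot> L" using tangential_erosion[OF T E(1) j s(1,2)] s(4) by simp
   finally have "vol ((+) ((p - s) *R e0) ` ?U) <= vol (d \<odot> L)"
    by (rule vol_mono[OF measurable_translation[OF body_lmeasurable[OF U(1)]] body_lmeasurable[OF body_dilate[OF L]]])
   also have "... = d ^ ?n * vol L" using L d by (simp add: vol_dilate)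
   also have "d ^ ?n <= d ^ 1" using d by (intro power_decreasing) (auto simp: Suc_leI)
   finally show ?thesis using d by (simp add: measure_translation mult_right_mono)
  qed
  have "0 <= - vol ?U + d * vol L" if "0 < d" for d
  proof (cases "d <= 1")
   case False
   hence "1 * vol L <= d * vol L" by (intro mult_right_mono) auto
   thus ?thesis using le[of 1] by simp
  qed (use le[of d] that in simp)
  hence "0 <= - vol ?U" by (rule closed_limit_nonneg)
  thus False using U by simp
 qed
 have dL: "(1 - p) \<odot> L = ?U" using tangential_erosion[OF T E(1) j p p1] er by simp
 have "homothetic L ?U" unfolding homothetic_def dL[symmetric] using p1 by (intro exI[of _ "1 - p"] conjI exI[of _ 0]) auto
 then obtain b z where b: "0 < b" "?U = (%y. b *R y + z) ` L" by (auto simp: homothetic_def)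
 have "PB u = (%v. (1 / a) *R (v - x)) ` ?U" using a(1) by (simp add: image_image)
 also have "... = (%v. (1 / a) *R (v - x)) ` (%y. b *R y + z) ` L" using b(2) by (rule arg_cong)
 also have "... = (%y. (b / a) *R y + (1 / a) *R (z - x)) ` L" unfolding image_image by (rule image_cong[OF refl]) (simp add: algebra_simps)
 finally have "homothetic L (PB u)" unfolding homothetic_def using a b by (metis divide_pos_pos)
 thus ?thesis using homothetic_I_quot[OF i u(1) t L] homothetic_sym[OF hom] by blast
qed

text \<open>For \<open>t > 0\<close> the body \<open>L\<close> has a dilate of \<open>E\<close> as a
  summand, so its normals at a frontier point are normals of \<open>E\<close> at one point, and
  smoothness leaves a single ray. The common normal of the tangential condition is then every
  normal, so \<open>E\<close> and \<open>L\<close> have the same support function, and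
  \<open>K\<close> is recovered from it.\<close>

lemma tangential_positive_homothetic:
 assumes sm: "smooth_body E" and T: "tangential_body (DIM('a) - j) E L" and hom: "homothetic (PB t) L" and t: "0 < t"
 shows "homothetic K E"
proof -
 let ?h = "support_function"
 have L: "convex_body L" "E \<subseteq> L" using T by (auto simp: tangential_body_def)
 have Pt: "PB t = K + t \<odot> E" using t by (intro parallel_pos[OF K E]) simp
 have bt: "convex_body (PB t)" unfolding Pt using K E by (intro body_plus body_dilate)
 obtain a x where a: "0 < a" "L = (+) x ` (a \<odot> PB t)" using hom unfolding homothetic_def affine_image by blast
 have hE: "?h ((+) 0 ` (t \<odot> E)) w = t * ?h E w" for w using support_affine[OF E(1), of t 0 w] t by simp
 have hL: "?h L w = x \<bullet> w + a * (?h K w + t * ?h E w)" for w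
  using a support_affine[OF bt, of a x w] hE[of w] support_plus[of K "t \<odot> E" w] K E body_dilate[OF E(1), of t]
  by (simp add: Pt convex_body_def)
 have "?h E w = ?h L w" for w
 proof (cases "w = 0")
  case False
  define v where "v = (1 / norm w) *R w"
  obtain y where y: "y \<in> L" "y \<bullet> w = ?h L w" using support_attained[OF L(1)] by blast
  have "y \<in> frontier L" using support_hyperplane_frontier[OF bodyD(1)[OF L(1)] y(1) False y(2)] .
  from tangential_common_support[OF T E(1) j this] obtain w' where w': "w' ~= 0" "y \<bullet> w' = ?h L w'" "?h E w' = ?h L w'" by blast
  obtain k e where ke: "k \<in> K" "e \<in> E" "y = x + a *R (k + t *R e)" using y(1) unfolding a(2) Pt by (auto simp: set_plus_def)
  have en: "e \<bullet> q = ?h E q" if q: "y \<bullet> q = ?h L q" for q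
  proof -
   have le: "k \<bullet> q <= ?h K q" "e \<bullet> q <= ?h E q" using ke K E by (auto intro!: support_upper simp: convex_body_def)
   have "a * (k \<bullet> q + t * (e \<bullet> q)) = a * (?h K q + t * ?h E q)" using q hL[of q] by (simp add: ke(3) inner_add_left)
   hence "k \<bullet> q + t * (e \<bullet> q) = ?h K q + t * ?h E q" using a(1) by simp
   hence "t * ?h E q <= t * (e \<bullet> q)" using le(1) by simp
   thus ?thesis using le(2) t by simp
  qed
  have "norm v = 1" "e \<bullet> v = ?h E v" using False en[OF y(2)] by (simp_all add: v_def support_scale[OF E(1)])
  from smooth_unique_normal[OF sm E ke(2) this w'(1) en[OF w'(2)]] obtain c where c: "0 < c" "w' = c *R v" by blast
  have w'w: "w' = (c / norm w) *R w" and p: "0 < c / norm w" using c False by (auto simp: v_def)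
  have "(c / norm w) * ?h E w = (c / norm w) * ?h L w" using w'(3) p unfolding w'w by (simp add: support_scale[OF E(1)] support_scale[OF L(1)])
  thus ?thesis using c(1) False by simp
 qed (use E L in simp)
 hence hEK: "(1 - a * t) * ?h E w = x \<bullet> w + a * ?h K w" for w using hL[of w] by (simp add: algebra_simps)
 \<comment> \<open>The factor \<open>1 - a * t\<close> multiplies the support function of
   \<open>E\<close>; comparing the widths of \<open>E\<close> and \<open>K\<close> in one direction,
   where translations cancel, shows that it is positive.\<close>
 have width: "0 < ?h C w + ?h C (- w)" if C: "convex_body C" "interior C ~= {}" and w: "w ~= 0" for C :: "'a set" and w
 proof -
  obtain p where p: "p \<in> interior C" using C by blast
  show ?thesis using support_gt_interior[OF C(1) p w] support_gt_interior[OF C(1) p, of "- w"] w by simp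
 qed
 obtain w :: 'a where w: "w ~= 0" using nonzero_Basis SOME_Basis by blast
 have "(1 - a * t) * (?h E w + ?h E (- w)) = a * (?h K w + ?h K (- w))" using hEK[of w] hEK[of "- w"] by (simp add: algebra_simps)
 moreover have "0 < a * (?h K w + ?h K (- w))" using a width[OF K w] by simp
 ultimately have b: "0 < 1 - a * t" using width[OF E w] by (metis zero_less_mult_pos2)
 define b where "b = 1 - a * t"
 have b0: "0 < b" using \<open>0 < 1 - a * t\<close> by (simp add: b_def)
 have "E = (+) ((1 / b) *R x) ` ((a / b) \<odot> K)"
 proof (rule body_eqI[OF E(1) body_affine[OF K(1)]])
  fix w
  have "b * ?h E w = x \<bullet> w + a * ?h K w" using hEK[of w] by (simp add: b_def)
  hence "?h E w = (x \<bullet> w + a * ?h K w) / b" using b0 by (simp add: eq_divide_eq mult.commute)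
  also have "... = ?h ((+) ((1 / b) *R x) ` ((a / b) \<odot> K)) w" using support_affine[OF K(1), of "a / b"] a b0 by (simp add: add_divide_distrib)
  finally show "?h E w = ?h ((+) ((1 / b) *R x) ` ((a / b) \<odot> K)) w" .
 qed
 thus ?thesis unfolding homothetic_def affine_image using a b0 by (metis divide_pos_pos)
qed

lemma homothetic_positive:
 assumes hom: "homothetic K E" and t: "0 < t"
 shows "tangential_body (DIM('a) - j) E E" "homothetic (PB t) E"
proof -
 show "tangential_body (DIM('a) - j) E E" using E j by (auto simp: tangential_body_def extreme_normal_def supporting_hyperplane_def)
 obtain a x where a: "0 < a" "K = (%y. a *R y + x) ` E" using homothetic_sym[OF hom] by (auto simp: homothetic_def)
 have "PB t = K + t \<odot> E" using t by (simp add: parallel_pos[OF K E])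
 also have "... = {x} + (a \<odot> E + t \<odot> E)" by (simp add: a(2) affine_image translate_eq_plus add.assoc)
 also have "a \<odot> E + t \<odot> E = (a + t) \<odot> E" using E a t by (intro dilate_add) (auto simp: convex_body_def)
 finally have "PB t = (%y. (a + t) *R y + x) ` E" by (simp add: affine_image translate_eq_plus)
 hence "homothetic E (PB t)" unfolding homothetic_def using a t by (metis add_pos_pos)
 thus "homothetic (PB t) E" by (rule homothetic_sym)
qed

end

theorem proposition5p7:
  fixes K E :: "'a::euclidean_space set" and i j :: nat
  assumes "convex_body K" "interior K \<noteq> {}"
    and "convex_body E" "interior E \<noteq> {}"
    and "i < j" "j < DIM('a)"
    and "class_R (j - 1) E K"
  shows "antimono_on {- inradius K E<..} (I_quot i j K E) \<and>
    (smooth_body E \<longrightarrow>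
      (\<forall>t\<^sub>0 t\<^sub>1. - inradius K E < t\<^sub>0 \<longrightarrow> t\<^sub>0 < t\<^sub>1 \<longrightarrow>
        (let c1 = (I_quot i j K E t\<^sub>0 = I_quot i j K E t\<^sub>1);
             c2 = homothetic (parallel_body K E t\<^sub>0) (parallel_body K E t\<^sub>1);
             c3 = (\<exists>L. tangential_body (DIM('a) - j) E L \<and> homothetic (parallel_body K E t\<^sub>1) L);
             c4 = (I_quot i j K E constant_on {- inradius K E<..t\<^sub>1})
         in (c1 \<longleftrightarrow> c2) \<and> (c2 \<longleftrightarrow> c3) \<and> (c3 \<longleftrightarrow> c4) \<and>
            (0 < t\<^sub>1 \<longrightarrow>
              (c1 \<and> c2 \<and> c3 \<and> c4 \<longleftrightarrow> homothetic K E) \<and>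
              (c1 \<and> c2 \<and> c3 \<and> c4 \<longleftrightarrow>
                (\<forall>t\<in>{- inradius K E<..}.
                   I_quot i j K E t = measure lebesgue E ^ (j - i)))))))"
proof (intro conjI impI allI)
 have j: "0 < j" "j < DIM('a)" using assms(5,6) by auto
 note K = assms(1,2) and E = assms(3,4) and i = assms(5)
 note cx = K E j assms(7)
 let ?I = "I_quot i j K E" and ?r = "inradius K E" and ?P = "parallel_body K E"
 show "antimono_on {- ?r<..} ?I"
 proof (rule monotone_onI)
  fix s t assume st: "s \<in> {- ?r<..}" "t \<in> {- ?r<..}" "s <= t"
  thus "?I t <= ?I s" using I_quot_antimono[OF cx i, of s t] by (cases "s = t") auto
 qed
 fix t\<^sub>0 t\<^sub>1 assume sm: "smooth_body E" and s: "- ?r < t\<^sub>0" "t\<^sub>0 < t\<^sub>1"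
 have t: "- ?r < t\<^sub>1" using s by simp
 define c3 where "c3 \<longleftrightarrow> (\<exists>L. tangential_body (DIM('a) - j) E L & homothetic (?P t\<^sub>1) L)"
 have 12: "?I t\<^sub>0 = ?I t\<^sub>1 ==> homothetic (?P t\<^sub>0) (?P t\<^sub>1)" using equal_homothetic[OF cx sm i s] .
 have 23: "homothetic (?P t\<^sub>0) (?P t\<^sub>1) ==> c3" using homothetic_tangential[OF cx sm i s] by (simp add: c3_def)
 have 34: "c3 ==> ?I constant_on {- ?r<..t\<^sub>1}"
 proof -
  assume c3
  then obtain L where L: "tangential_body (DIM('a) - j) E L" "homothetic (?P t\<^sub>1) L" by (auto simp: c3_def)
  have "?I u = ?I t\<^sub>1" if "u \<in> {- ?r<..t\<^sub>1}" for u by (rule tangential_constant[OF cx L i t]) (use that in simp_all)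
  thus "?I constant_on {- ?r<..t\<^sub>1}" unfolding constant_on_def by blast
 qed
 have 41: "?I constant_on {- ?r<..t\<^sub>1} ==> ?I t\<^sub>0 = ?I t\<^sub>1" using s t unfolding constant_on_def by force
 have pos: "(c3 \<longleftrightarrow> homothetic K E) & (c3 \<longleftrightarrow> (\<forall>t\<in>{- ?r<..}. ?I t = vol E ^ (j - i)))" if t1: "0 < t\<^sub>1"
 proof -
  have h: "c3 \<longleftrightarrow> homothetic K E"
   using tangential_positive_homothetic[OF cx sm _ _ t1] homothetic_positive[OF cx _ t1] unfolding c3_def by blast
  have "?I t = vol E ^ (j - i)" if hom: "homothetic K E" and t: "- ?r < t" for t
  proof -
   let ?n = "DIM('a)"
   \<comment> \<open>Any positive parameter beyond \<open>t\<close> serves: there the parallel body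
     is homothetic to \<open>E\<close>, a tangential body of itself, and constancy below
     \<open>u\<close> carries the value back to \<open>t\<close>.\<close>
   define u where "u = max t 1"
   have u: "0 < u" "t <= u" "- ?r < u" using t by (auto simp: u_def)
   have "?I t = ?I u" using tangential_constant[OF cx homothetic_positive[OF cx hom u(1)] i u(3) t u(2)] .
   also have "... = vol E ^ (j - i)"
   proof -
    obtain a x where a: "0 < a" "?P u = (+) x ` (a \<odot> E)" using homothetic_sym[OF homothetic_positive(2)[OF cx hom u(1)]] unfolding homothetic_def affine_image by blast
    have "?I u = qm j (?P u) E ^ (?n - i) / qm i (?P u) E ^ (?n - j)"
     using parallel_body(1)[OF K E u(3)] E i j by (simp add: I_quot_def quermassintegral_eq)
    also have "... = (a ^ (?n - j) * vol E) ^ (?n - i) / (a ^ (?n - i) * vol E) ^ (?n - j)"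
     using a qm_affine[OF E(1,1)] i j by (simp add: qm_self[OF E(1)])
    also have "... = vol E ^ (?n - i) / vol E ^ (?n - j)" using a(1) by (simp add: power_mult_distrib mult.commute flip: power_mult)
    also have "... = vol E ^ (j - i)" using vol_pos_of_interior[OF E] i j by (simp add: power_diff[symmetric])
    finally show ?thesis .
   qed
   finally show ?thesis .
  qed
  moreover have "c3" if "\<forall>t\<in>{- ?r<..}. ?I t = vol E ^ (j - i)" using that s t 12 23 by simp
  ultimately show ?thesis using h by auto
 qed
 show "let c1 = (?I t\<^sub>0 = ?I t\<^sub>1); c2 = homothetic (?P t\<^sub>0) (?P t\<^sub>1);
       c3 = (\<exists>L. tangential_body (DIM('a) - j) E L & homothetic (?P t\<^sub>1) L);
       c4 = (?I constant_on {- ?r<..t\<^sub>1})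
     in (c1 \<longleftrightarrow> c2) & (c2 \<longleftrightarrow> c3) & (c3 \<longleftrightarrow> c4) &
      (0 < t\<^sub>1 -->
       (c1 & c2 & c3 & c4 \<longleftrightarrow> homothetic K E) &
       (c1 & c2 & c3 & c4 \<longleftrightarrow> (\<forall>t\<in>{- ?r<..}. ?I t = vol E ^ (j - i))))"
  unfolding Let_def c3_def[symmetric] using 12 23 34 41 pos by blast
qed

end
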